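(* Let $T\in\mathcal T_h^b$ and let $e\in\mathcal E_h^b$ be an edge of $T$. Let $\tilde u_h\in H^1(T)$ be the harmonic extension of $u_h^*$, i.e. the weak solution of $\Delta\tilde u_h=0$ in $T$, $\tilde u_h=u_h^*$ on $\partial T$ (with $u_h^*$ as defined in the context). If $g|_e\in H^1(e)$, then $$\|\tilde u_h-u_h\|_{H^1(T)}\le C\,h_T^{1/2}\,|g-g_h|_{H^1(e)}$$ with a constant $C>0$ independent of $T$, and furthermore $$\min_{z\in T}\tilde u_h(z)=\min_{z\in\partial T}u_h^*(z).$$
   Context: $\Omega\subset\mathbb R^2$ is a bounded polygonal domain (without slits); $(\cdot,\cdot)$ is the $L^2(\Omega)$ inner product; $f\in L^2(\Omega)$; $g\in C(\partial\Omega)$ is the trace of some $H^1(\Omega)$ function; $\chi\in C(\bar\Omega)\cap H^1(\Omega)$ satisfies $\chi|_{\partial\Omega}\le g$; $a(v,w)=(\nabla v,\nabla w)$. Mesh. $\mathcal T_h$ is a conforming (no hanging nodes), shape-regular triangulation of $\Omega$ into closed triangles (all angles bounded below by a fixed positive angle; constants may depend on this bound and on $\Omega$). $h_T$ is the diameter of $T$; $\mathcal V_h^i,\mathcal V_h^b$ are the sets of vertices in $\Omega$ and on $\partial\Omega$; $\mathcal E_h^b$ is the set of boundary edges. $\mathcal T_h^b$ is the set of triangles having an edge in $\mathcal E_h^b$; each $T\in\mathcal T_h^b$ is assumed to have at most one edge on $\partial\Omega$. Discrete problem. $V_h=\{v\in H^1(\Omega):v|_T\in\mathbb P_1(T)\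 \forall T\in\mathcal T_h\}$. $g_h\in C(\partial\Omega)$ is the piecewise affine (on each $e\in\mathcal E_h^b$) nodal interpolant of $g$ at $\mathcal V_h^b$. $\mathcal K_h=\{v_h\in V_h: v_h(z)\ge\chi(z)\ \forall z\in\mathcal V_h^i,\ v_h=g_h\text{ on }\partial\Omega\}$. $u_h\in\mathcal K_h$ is the unique solution of $a(u_h,v_h-u_h)\ge(f,v_h-u_h)$ for all $v_h\in\mathcal K_h$. For $T\in\mathcal T_h^b$, $u_h^*\in C(\partial T)$ is defined by $u_h^*=g$ on $\partial T\cap\partial\Omega$ and $u_h^*=u_h$ on $\partial T\setminus\partial\Omega$. $|\cdot|_{H^1(e)}$ is the $L^2(e)$ norm of the tangential derivative along $e$. *)

theory Defs
  imports "HOL-Analysis.Analysis"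
begin

type_synonym plane = "real ^ 2"


section \<open>Square integrable functions, weak gradients and $H^1$\<close>

definition L2_on :: "'a::euclidean_space set \<Rightarrow> ('a \<Rightarrow> 'b::euclidean_space) \<Rightarrow> bool" where
  "L2_on D v \<longleftrightarrow>
     v \<in> borel_measurable (lebesgue_on D) \<and> integrable (lebesgue_on D) (\<lambda>x. (norm (v x))\<^sup>2)"

definition L2_inner :: "'a::euclidean_space set \<Rightarrow> ('a \<Rightarrow> 'b::euclidean_space) \<Rightarrow> ('a \<Rightarrow> 'b) \<Rightarrow> real" where
  "L2_inner D v w = (\<integral>x. v x \<bullet> w x \<partial>lebesgue_on D)"

fun Ck :: "nat \<Rightarrow> ('a::euclidean_space \<Rightarrow> real) \<Rightarrow> bool" where
  "Ck 0 \<phi> \<longleftrightarrow> continuous_on UNIV \<phi>"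
| "Ck (Suc k) \<phi> \<longleftrightarrow>
     \<phi> differentiable_on UNIV \<and> (\<forall>i\<in>Basis. Ck k (\<lambda>x. frechet_derivative \<phi> (at x) i))"

text \<open>The space $C_c^\infty(D)$, its members being extended by zero to the whole space.\<close>

definition test_fun :: "'a::euclidean_space set \<Rightarrow> ('a \<Rightarrow> real) \<Rightarrow> bool" where
  "test_fun D \<phi> \<longleftrightarrow>
     (\<forall>k. Ck k \<phi>) \<and> compact (closure {x. \<phi> x \<noteq> 0}) \<and> closure {x. \<phi> x \<noteq> 0} \<subseteq> D"

definition has_weak_gradient :: "'a::euclidean_space set \<Rightarrow> ('a \<Rightarrow> real) \<Rightarrow> ('a \<Rightarrow> 'a) \<Rightarrow> bool" where
  "has_weak_gradient D v G \<longleftrightarrow>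
     (\<forall>K. compact K \<and> K \<subseteq> D \<longrightarrow> v absolutely_integrable_on K \<and> G absolutely_integrable_on K) \<and>
     (\<forall>\<phi>. test_fun D \<phi> \<longrightarrow> (\<forall>i\<in>Basis.
        (\<integral>x. v x * frechet_derivative \<phi> (at x) i \<partial>lebesgue_on D)
          = - (\<integral>x. (G x \<bullet> i) * \<phi> x \<partial>lebesgue_on D)))"

text \<open>On an open set the weak gradient is unique up to null sets, so it does not matter which
  representative is chosen.\<close>

definition weak_gradient :: "'a::euclidean_space set \<Rightarrow> ('a \<Rightarrow> real) \<Rightarrow> 'a \<Rightarrow> 'a" where
  "weak_gradient D v = (SOME G. has_weak_gradient D v G)"

definition H1 :: "'a::euclidean_space set \<Rightarrow> ('a \<Rightarrow> real) \<Rightarrow> bool" where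
  "H1 D v \<longleftrightarrow> L2_on D v \<and> (\<exists>G. has_weak_gradient D v G \<and> L2_on D G)"

definition dirichlet_form :: "'a::euclidean_space set \<Rightarrow> ('a \<Rightarrow> real) \<Rightarrow> ('a \<Rightarrow> real) \<Rightarrow> real" where
  "dirichlet_form D v w = L2_inner D (weak_gradient D v) (weak_gradient D w)"

definition H1_seminorm :: "'a::euclidean_space set \<Rightarrow> ('a \<Rightarrow> real) \<Rightarrow> real" where
  "H1_seminorm D v = sqrt (dirichlet_form D v v)"

definition H1_norm :: "'a::euclidean_space set \<Rightarrow> ('a \<Rightarrow> real) \<Rightarrow> real" where
  "H1_norm D v = sqrt (L2_inner D v v + dirichlet_form D v v)"


section \<open>Functions on segments, traces, harmonic extensions\<close>

definition arclength_param :: "plane \<Rightarrow> plane \<Rightarrow> real \<Rightarrow> plane" where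
  "arclength_param a b s = a + (s / dist a b) *\<^sub>R (b - a)"

text \<open>The restriction of \<open>v\<close> to the segment from \<open>a\<close> to \<open>b\<close> is identified with the function
  \<open>v \<circ> arclength_param a b\<close> on the interval \<open>{0<..<dist a b}\<close>; the derivative of the
  latter is the tangential derivative of \<open>v\<close>.\<close>

definition H1_segment :: "plane \<Rightarrow> plane \<Rightarrow> (plane \<Rightarrow> real) \<Rightarrow> bool" where
  "H1_segment a b v \<longleftrightarrow> H1 {0<..<dist a b} (v \<circ> arclength_param a b)"

definition H1_segment_seminorm :: "plane \<Rightarrow> plane \<Rightarrow> (plane \<Rightarrow> real) \<Rightarrow> real" where
  "H1_segment_seminorm a b v = H1_seminorm {0<..<dist a b} (v \<circ> arclength_param a b)"

definition L2_segment :: "plane \<Rightarrow> plane \<Rightarrow> (plane \<Rightarrow> real) \<Rightarrow> bool" where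
  "L2_segment a b v \<longleftrightarrow> L2_on {0<..<dist a b} (v \<circ> arclength_param a b)"

definition L2_segment_norm :: "plane \<Rightarrow> plane \<Rightarrow> (plane \<Rightarrow> real) \<Rightarrow> real" where
  "L2_segment_norm a b v =
     sqrt (L2_inner {0<..<dist a b} (v \<circ> arclength_param a b) (v \<circ> arclength_param a b))"

text \<open>The trace operator is the continuous extension, from $H^1(D)$ to $L^2(\partial D)$, of the
  restriction map $w \mapsto w|_{\partial D}$ on $H^1(D) \cap C(\overline D)$. The boundary of
  a polygonal domain \<open>D\<close> is a finite union of segments, so convergence in $L^2(\partial D)$ is
  convergence in $L^2$ of every segment contained in $\partial D$.\<close>

definition has_trace :: "plane set \<Rightarrow> (plane \<Rightarrow> real) \<Rightarrow> (plane \<Rightarrow> real) \<Rightarrow> bool" where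
  "has_trace D v \<phi> \<longleftrightarrow>
     H1 D v \<and>
     (\<forall>a b. closed_segment a b \<subseteq> frontier D \<longrightarrow> L2_segment a b \<phi>) \<and>
     (\<exists>w :: nat \<Rightarrow> plane \<Rightarrow> real.
        (\<forall>n. H1 D (w n) \<and> continuous_on (closure D) (w n)) \<and>
        (\<lambda>n. H1_norm D (\<lambda>x. w n x - v x)) \<longlonglongrightarrow> 0 \<and>
        (\<forall>a b. closed_segment a b \<subseteq> frontier D \<longrightarrow>
           (\<lambda>n. L2_segment_norm a b (\<lambda>x. w n x - \<phi> x)) \<longlonglongrightarrow> 0))"

definition H1_zero :: "plane set \<Rightarrow> (plane \<Rightarrow> real) \<Rightarrow> bool" where
  "H1_zero D v \<longleftrightarrow> has_trace D v (\<lambda>x. 0)"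

definition harmonic_extension :: "plane set \<Rightarrow> (plane \<Rightarrow> real) \<Rightarrow> (plane \<Rightarrow> real) \<Rightarrow> bool" where
  "harmonic_extension D \<phi> v \<longleftrightarrow>
     has_trace D v \<phi> \<and> (\<forall>w. H1_zero D w \<longrightarrow> dirichlet_form D v w = 0)"

definition has_min_on :: "'a set \<Rightarrow> ('a \<Rightarrow> real) \<Rightarrow> real \<Rightarrow> bool" where
  "has_min_on S v m \<longleftrightarrow> m \<in> v ` S \<and> (\<forall>x\<in>S. m \<le> v x)"


section \<open>Polygonal domains and triangulations\<close>

text \<open>The condition \<open>interior (closure \<Omega>) = \<Omega>\<close> excludes slits.\<close>

definition polygonal_domain :: "plane set \<Rightarrow> bool" where
  "polygonal_domain \<Omega> \<longleftrightarrow>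
     open \<Omega> \<and> connected \<Omega> \<and> \<Omega> \<noteq> {} \<and> bounded \<Omega> \<and>
     interior (closure \<Omega>) = \<Omega> \<and>
     (\<exists>S. finite S \<and> frontier \<Omega> = (\<Union>(a, b)\<in>S. closed_segment a b))"

definition angle_at :: "plane \<Rightarrow> plane \<Rightarrow> plane \<Rightarrow> real" where
  "angle_at a b c = arccos (((b - a) \<bullet> (c - a)) / (norm (b - a) * norm (c - a)))"

definition vertices :: "plane set set \<Rightarrow> plane set" where
  "vertices \<T> = {z. \<exists>T\<in>\<T>. z extreme_point_of T}"

definition boundary_edges :: "plane set \<Rightarrow> plane set set \<Rightarrow> plane set set" where
  "boundary_edges \<Omega> \<T> = {e. (\<exists>T\<in>\<T>. e edge_of T) \<and> e \<subseteq> frontier \<Omega>}"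

definition boundary_triangles :: "plane set \<Rightarrow> plane set set \<Rightarrow> plane set set" where
  "boundary_triangles \<Omega> \<T> = {T\<in>\<T>. \<exists>e\<in>boundary_edges \<Omega> \<T>. e edge_of T}"

text \<open>The library notion \<open>triangulation\<close> requires any two cells to meet in a common face, which
  excludes hanging nodes. In the third clause \<open>a\<close>, \<open>b\<close>, \<open>c\<close> are the vertices of \<open>T\<close> in any
  order, so that all three angles are bounded below by \<open>\<theta>\<close>.\<close>

definition admissible_mesh :: "plane set \<Rightarrow> real \<Rightarrow> plane set set \<Rightarrow> bool" where
  "admissible_mesh \<Omega> \<theta> \<T> \<longleftrightarrow>
     triangulation \<T> \<and> (\<forall>T\<in>\<T>. 2 simplex T) \<and> \<Union>\<T> = closure \<Omega> \<and>
     (\<forall>T\<in>\<T>. \<forall>a b c. T = convex hull {a, b, c} \<longrightarrow> \<theta> \<le> angle_at a b c) \<and>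
     (\<forall>T\<in>\<T>. \<forall>e\<in>boundary_edges \<Omega> \<T>. \<forall>e'\<in>boundary_edges \<Omega> \<T>.
        e edge_of T \<and> e' edge_of T \<longrightarrow> e = e')"


section \<open>The discrete obstacle problem\<close>

text \<open>The obstacle is called \<open>\<psi>\<close>, since $\chi$ is reserved for the vector binder.\<close>

definition affine_fun_on :: "plane set \<Rightarrow> (plane \<Rightarrow> real) \<Rightarrow> bool" where
  "affine_fun_on S v \<longleftrightarrow> (\<exists>p c. \<forall>x\<in>S. v x = p \<bullet> x + c)"

definition fe_space :: "plane set \<Rightarrow> plane set set \<Rightarrow> (plane \<Rightarrow> real) set" where
  "fe_space \<Omega> \<T> = {v. H1 \<Omega> v \<and> (\<forall>T\<in>\<T>. affine_fun_on T v)}"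

definition nodal_boundary_interpolant ::
    "plane set \<Rightarrow> plane set set \<Rightarrow> (plane \<Rightarrow> real) \<Rightarrow> (plane \<Rightarrow> real) \<Rightarrow> bool" where
  "nodal_boundary_interpolant \<Omega> \<T> g g\<^sub>h \<longleftrightarrow>
     continuous_on (frontier \<Omega>) g\<^sub>h \<and>
     (\<forall>e\<in>boundary_edges \<Omega> \<T>. affine_fun_on e g\<^sub>h) \<and>
     (\<forall>z\<in>vertices \<T> \<inter> frontier \<Omega>. g\<^sub>h z = g z)"

definition discrete_convex_set ::
    "plane set \<Rightarrow> plane set set \<Rightarrow> (plane \<Rightarrow> real) \<Rightarrow> (plane \<Rightarrow> real) \<Rightarrow> (plane \<Rightarrow> real) set" where
  "discrete_convex_set \<Omega> \<T> \<psi> g\<^sub>h =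
     {v \<in> fe_space \<Omega> \<T>.
        (\<forall>z\<in>vertices \<T> \<inter> \<Omega>. \<psi> z \<le> v z) \<and> (\<forall>x\<in>frontier \<Omega>. v x = g\<^sub>h x)}"

definition discrete_solution ::
    "plane set \<Rightarrow> plane set set \<Rightarrow> (plane \<Rightarrow> real) \<Rightarrow> (plane \<Rightarrow> real) \<Rightarrow> (plane \<Rightarrow> real)
       \<Rightarrow> (plane \<Rightarrow> real) \<Rightarrow> bool" where
  "discrete_solution \<Omega> \<T> f \<psi> g\<^sub>h u \<longleftrightarrow>
     u \<in> discrete_convex_set \<Omega> \<T> \<psi> g\<^sub>h \<and>
     (\<forall>v\<in>discrete_convex_set \<Omega> \<T> \<psi> g\<^sub>h.
        dirichlet_form \<Omega> u (\<lambda>x. v x - u x) \<ge> L2_inner \<Omega> f (\<lambda>x. v x - u x))"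

definition u_star :: "plane set \<Rightarrow> (plane \<Rightarrow> real) \<Rightarrow> (plane \<Rightarrow> real) \<Rightarrow> plane \<Rightarrow> real" where
  "u_star \<Omega> g u x = (if x \<in> frontier \<Omega> then g x else u x)"

end

theory Submission
  imports Defs "HOL-Computational_Algebra.Polynomial"
begin

text \<open>Let \<open>\<phi>\<close> be the difference of the modified boundary values and the discrete
  solution on the boundary of \<open>T\<close>. On the boundary edge \<open>e\<close> it equals
  \<open>g - g\<^sub>h\<close>, which vanishes at the endpoints of \<open>e\<close>. It vanishes on
  the other two edges as well: they are not boundary edges, so another triangle lies across each of
  them, and since the domain has no slits their relative interiors lie inside the domain
  (\<open>interior_edge\<close>, \<open>discrete_boundary_values\<close>).

  Energy estimate. The discrete solution is affine on \<open>T\<close>, so \<open>u\<^sub>t -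
  u\<^sub>h\<close> is the harmonic extension of \<open>\<phi>\<close> and its gradient is bounded by
  the gradient of any other extension (\<open>energy_comparison\<close>). The extension used here is
  conical. Let \<open>c\<close> be the vertex opposite to \<open>e\<close>, and describe a point of
  \<open>T\<close> by the position \<open>\<tau>\<close> in \<open>[0,1]\<close> at which its ray from
  \<open>c\<close> hits \<open>e\<close> and by the fraction \<open>s\<close> of that ray. If
  \<open>f\<close> is \<open>\<phi>\<close> as a function of \<open>\<tau>\<close>, the extension is
  \<open>s f(\<tau>)\<close>. Its gradient is a combination of \<open>f'(\<tau>)\<close> and
  \<open>f(\<tau>)\<close> with coefficients of size \<open>1/h\<close>, so the integral of its square
  over \<open>T\<close> is bounded by that of \<open>f'^2\<close> and \<open>f^2\<close>
  (\<open>cone_ext_parts\<close>, \<open>cone_ext_bounds\<close>). The term with \<open>f\<close> is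
  absorbed by the fundamental theorem of calculus on \<open>e\<close>
  (\<open>weak_derivative_bound\<close>), and the scaling of \<open>e\<close> to unit length
  contributes the factor \<open>h\<close> of the squared estimate. The size of the coefficients is
  where the lower bound on the angles enters: it bounds the area of \<open>T\<close> below by a
  multiple of \<open>h^2\<close> (\<open>shape_regular\<close>). The zero order part follows from the
  Poincare inequality, and \<open>h\<close> is at most the diameter of the domain.

  Minimum. The weak maximum principle (\<open>weak_maximum\<close>) tests with a smooth truncation of
  \<open>u - \<psi>\<close> for harmonic \<open>\<psi>\<close>. Quadratic harmonic barriers, which
  exist at every boundary point because \<open>T\<close> is convex, turn it into uniform continuity of
  \<open>u\<close> at the boundary (\<open>boundary_estimate\<close>). In the interior the
  mollifications of \<open>u\<close> are harmonic; by the classical maximum principle they form a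
  Cauchy sequence, uniformly away from the boundary, and their limit together with the boundary values
  is the continuous representative (\<open>continuous_representative\<close>). Constant comparison
  functions then show that its minimum is attained on the boundary (\<open>minimum_principle\<close>).

  Traces are defined by approximation with functions that are continuous up to the boundary. For such
  functions Green's formula holds up to an error that is controlled by the boundary values
  (\<open>green_inequality\<close>), and passing to the limit gives Green's formula and the Poincare
  inequality for functions with zero trace.\<close>

abbreviation (input) sequence_limit :: "(nat => 'a::topological_space) => 'a => bool"  (infixr "---->" 60) where
  "X ----> L \<equiv> LIMSEQ X L"

section \<open>Smooth functions and bump functions\<close>

abbreviation partial :: "'a::euclidean_space => ('a => real) => 'a => real" where
  "partial i \<phi> x \<equiv> frechet_derivative \<phi> (at x) i"

abbreviation laplacian :: "('a::euclidean_space => real) => 'a => real" where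
  "laplacian f x \<equiv> (\<Sum>i\<in>Basis. partial i (partial i f) x)"

definition smooth :: "('a::euclidean_space => real) => bool" where
  "smooth \<phi> \<longleftrightarrow> (\<forall>k. Ck k \<phi>)"

text \<open>The recursive definition of \<open>Ck\<close> refers to the chosen derivative; this rule accepts any
  derivative.\<close>

lemma Ck_SucI:
  assumes "!!x. (\<phi> has_derivative \<phi>' x) (at x)" "!!i. i \<in> Basis ==> Ck k (%x. \<phi>' x i)"
  shows "Ck (Suc k) \<phi>"
proof -
  have "frechet_derivative \<phi> (at x) = \<phi>' x" for x
    using frechet_derivative_at[OF assms(1)] by simp
  moreover have "\<phi> differentiable_on UNIV"
    unfolding differentiable_on_def differentiable_def using assms(1) by blast
  ultimately show ?thesis using assms(2) by simp
qed

lemma Ck_Suc_derivative: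
  assumes "Ck (Suc k) \<phi>"
  shows "(\<phi> has_derivative frechet_derivative \<phi> (at x)) (at x)"
  using assms by (auto simp: differentiable_on_def frechet_derivative_works[symmetric])

lemma Ck_SucD: "Ck (Suc k) \<phi> ==> Ck k \<phi>"
proof (induction k arbitrary: \<phi>)
  case 0
  then show ?case by (auto intro: differentiable_imp_continuous_on)
next
  case (Suc k)
  then show ?case by (auto simp del: Ck.simps(1))
qed

lemma Ck_const: "Ck k (%x. c)"
proof (induction k arbitrary: c)
  case (Suc k)
  show ?case by (rule Ck_SucI[where \<phi>' = "%x h. 0"]) (use Suc in auto)
qed simp

lemma Ck_add: "Ck k \<phi> ==> Ck k \<psi> ==> Ck k (%x. \<phi> x + \<psi> x)"
proof (induction k arbitrary: \<phi> \<psi>)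
  case 0 then show ?case by (auto intro: continuous_intros)
next
  case (Suc k)
  note d = Ck_Suc_derivative[OF Suc.prems(1)] Ck_Suc_derivative[OF Suc.prems(2)]
  show ?case
    by (rule Ck_SucI[OF has_derivative_add[OF d]], rule Suc.IH) (use Suc.prems in auto)
qed

lemma Ck_mult: "Ck k \<phi> ==> Ck k \<psi> ==> Ck k (%x. \<phi> x * \<psi> x)"
proof (induction k arbitrary: \<phi> \<psi>)
  case 0 then show ?case by (auto intro: continuous_intros)
next
  case (Suc k)
  note d = Ck_Suc_derivative[OF Suc.prems(1)] Ck_Suc_derivative[OF Suc.prems(2)]
  show ?case
    by (rule Ck_SucI[OF has_derivative_mult[OF d]], rule Ck_add; rule Suc.IH)
      (use Suc.prems Ck_SucD in auto)
qed

lemma Ck_inner: "Ck k (%x. x \<bullet> v)"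
proof (cases k)
  case (Suc n)
  show ?thesis unfolding Suc
    by (rule Ck_SucI[where \<phi>' = "%x h. h \<bullet> v"]) (auto intro!: derivative_eq_intros Ck_const)
qed (auto intro: continuous_intros)

lemma Ck_sum: "(!!j. j \<in> J ==> Ck k (\<phi> j)) ==> Ck k (%x. \<Sum>j\<in>J. \<phi> j x)"
  by (induction J rule: infinite_finite_induct) (auto intro: Ck_const Ck_add)

lemma Ck_affine:
  fixes A :: "'b::euclidean_space => 'a::euclidean_space"
  assumes "linear A"
  shows "Ck k \<phi> ==> Ck k (%x. \<phi> (p + A x))"
proof (induction k arbitrary: \<phi>)
  case 0
  have "continuous_on UNIV (%x. p + A x)"
    by (intro continuous_intros linear_continuous_on linear_conv_bounded_linear[THEN iffD1] assms)
  then show ?case using 0 continuous_on_compose2[of UNIV \<phi> UNIV "%x. p + A x"] by auto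
next
  case (Suc k)
  have A: "bounded_linear A" using assms linear_conv_bounded_linear by blast
  have L: "((%x. p + A x) has_derivative A) (at x)" for x
    by (auto intro!: derivative_eq_intros bounded_linear_imp_has_derivative[OF A])
  have D: "((%x. \<phi> (p + A x)) has_derivative (%h. frechet_derivative \<phi> (at (p + A x)) (A h))) (at x)" for x
    using has_derivative_compose[OF L Ck_Suc_derivative[OF Suc.prems]] .
  have e: "frechet_derivative \<phi> (at y) (A h) = (\<Sum>i\<in>Basis. (A h \<bullet> i) * partial i \<phi> y)" for y h
  proof -
    have l: "linear (frechet_derivative \<phi> (at y))"
      using Ck_Suc_derivative[OF Suc.prems] has_derivative_linear by blast
    have "frechet_derivative \<phi> (at y) (A h) = frechet_derivative \<phi> (at y) (\<Sum>i\<in>Basis. (A h \<bullet> i) *\<^sub>R i)"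
      by (simp add: euclidean_representation)
    then show ?thesis by (simp add: linear_sum[OF l] linear_cmul[OF l])
  qed
  show ?case
    by (rule Ck_SucI[OF D], unfold e, intro Ck_sum Ck_mult Ck_const Suc.IH) (use Suc.prems in auto)
qed

text \<open>A family of functions of one real variable that is closed under differentiation may be
  composed with a smooth function.\<close>

lemma Ck_compose_family:
  assumes F: "!!f. f \<in> F ==> \<exists>f'\<in>F. \<forall>t. (f has_real_derivative f' t) (at t)"
    and q: "Ck k q"
  shows "f \<in> F ==> Ck k (%x. f (q x))"
  using q
proof (induction k arbitrary: f)
  case 0
  obtain f' where "\<forall>t. (f has_real_derivative f' t) (at t)" using F 0 by blast
  then have "continuous_on UNIV f" by (meson DERIV_isCont continuous_at_imp_continuous_on)
  then show ?case using 0 continuous_on_compose2[of UNIV f UNIV q] by auto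
next
  case (Suc k)
  obtain f' where f': "f' \<in> F" "!!t. (f has_real_derivative f' t) (at t)" using F Suc by blast
  have D: "((%x. f (q x)) has_derivative (%h. frechet_derivative q (at x) h * f' (q x))) (at x)" for x
    using has_derivative_compose[OF Ck_Suc_derivative[OF Suc.prems(2)] f'(2)[of "q x", unfolded has_field_derivative_def]]
    by (simp add: mult.commute)
  show ?case
    by (rule Ck_SucI[OF D], rule Ck_mult)
      (use Suc.prems in simp, rule Suc.IH[OF f'(1) Ck_SucD[OF Suc.prems(2)]])
qed

lemma smooth_intros:
  "smooth (%x. c)"
  "smooth (%x. x \<bullet> v)"
  "smooth \<phi> ==> smooth \<psi> ==> smooth (%x. \<phi> x + \<psi> x)"
  "smooth \<phi> ==> smooth \<psi> ==> smooth (%x. \<phi> x * \<psi> x)"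
  "(!!j. j \<in> J ==> smooth (f j)) ==> smooth (%x. \<Sum>j\<in>J. f j x)"
  by (auto simp: smooth_def Ck_const Ck_inner Ck_add Ck_mult Ck_sum)

lemma smooth_diff: "smooth \<phi> ==> smooth \<psi> ==> smooth (%x. \<phi> x - \<psi> x)"
  using smooth_intros(3)[of \<phi> "%x. (-1) * \<psi> x"] smooth_intros(4)[OF smooth_intros(1)[of "-1"], of \<psi>] by simp

lemma smooth_prod: "(!!j. j \<in> J ==> smooth (f j)) ==> smooth (%x. \<Prod>j\<in>J. f j x)"
  by (induction J rule: infinite_finite_induct) (auto intro: smooth_intros)

lemma smooth_affine:
  "linear A ==> smooth \<phi> ==> smooth (%x. \<phi> (p + A x))"
  by (simp add: smooth_def Ck_affine)

lemma smooth_partial: "smooth \<phi> ==> i \<in> Basis ==> smooth (partial i \<phi>)"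
  unfolding smooth_def by (metis Ck.simps(2))

lemma smooth_has_derivative: "smooth \<phi> ==> (\<phi> has_derivative frechet_derivative \<phi> (at x)) (at x)"
  unfolding smooth_def using Ck_Suc_derivative by blast

lemma smooth_continuous: "smooth \<phi> ==> continuous_on S \<phi>"
  unfolding smooth_def using Ck.simps(1) continuous_on_subset by blast

lemma partial_eqI: "(\<phi> has_derivative D) (at x) ==> partial i \<phi> x = D i"
  using frechet_derivative_at by metis

lemma smooth_partial_mult:
  assumes "smooth \<phi>" "smooth \<psi>"
  shows "partial i (%x. \<phi> x * \<psi> x) x = \<phi> x * partial i \<psi> x + partial i \<phi> x * \<psi> x"
  using partial_eqI[OF has_derivative_mult[OF smooth_has_derivative[OF assms(1)] smooth_has_derivative[OF assms(2)]]] .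

text \<open>The functions that vanish for \<open>t \<le> 0\<close> and are a polynomial in \<open>1/t\<close>
  times \<open>exp (- 1/t)\<close> for \<open>t > 0\<close>. The family is closed under
  differentiation, which makes its members smooth.\<close>

definition flat :: "real poly => real => real" where
  "flat p t = (if t \<le> 0 then 0 else poly p (1 / t) * exp (- (1 / t)))"

lemma poly_exp_neg_tendsto_0: "((%r::real. poly p r * exp (- r)) \<longlongrightarrow> 0) at_top"
proof -
  have "((%r. \<Sum>i\<le>degree p. coeff p i * (r ^ i / exp r)) \<longlongrightarrow> (\<Sum>i\<le>degree p. coeff p i * 0)) at_top"
    by (intro tendsto_intros tendsto_power_div_exp_0)
  then show ?thesis
    by (simp add: poly_altdef sum_distrib_right exp_minus divide_inverse mult.assoc)
qed

lemma flat_has_derivative: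
  "(flat p has_real_derivative flat (monom 1 2 * (p - pderiv p)) t) (at t)"
proof -
  consider "t < 0" | "t > 0" | "t = 0" by linarith
  then show ?thesis
  proof cases
    case 1
    have "(flat p has_real_derivative 0) (at t)"
      by (rule DERIV_cong_ev[THEN iffD2, OF refl _ refl DERIV_const])
        (use 1 in \<open>auto simp: flat_def eventually_nhds intro!: exI[of _ "{..<0}"]\<close>)
    then show ?thesis using 1 by (simp add: flat_def)
  next
    case 2
    have "((%s. poly p (1 / s) * exp (- (1 / s))) has_real_derivative
       poly (pderiv p) (1 / t) * (- (1 / t^2)) * exp (- (1 / t)) + poly p (1 / t) * (exp (- (1 / t)) * (1 / t^2))) (at t)"
    proof -
      have i: "((%s. 1 / s) has_real_derivative - (1 / t^2)) (at t)"
        using 2 by (auto intro!: derivative_eq_intros simp: power2_eq_square)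
      have "((%s. poly p (1 / s)) has_real_derivative poly (pderiv p) (1 / t) * (- (1 / t^2))) (at t)"
        using DERIV_chain2[OF poly_DERIV i] .
      moreover have "((%s. exp (- (1 / s))) has_real_derivative exp (- (1 / t)) * (1 / t^2)) (at t)"
        using DERIV_chain2[OF DERIV_exp DERIV_minus[OF i]] by simp
      ultimately show ?thesis
        by (rule DERIV_mult[THEN DERIV_cong]) (simp add: algebra_simps)
    qed
    moreover have "\<forall>\<^sub>F s in nhds t. flat p s = poly p (1 / s) * exp (- (1 / s))"
      using 2 by (auto simp: flat_def eventually_nhds intro!: exI[of _ "{0<..}"])
    ultimately have "(flat p has_real_derivative (poly (pderiv p) (1 / t) * (- (1 / t^2)) * exp (- (1 / t)) + poly p (1 / t) * (exp (- (1 / t)) * (1 / t^2)))) (at t)"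
      by (subst DERIV_cong_ev[OF refl _ refl])
    then show ?thesis using 2 by (simp add: flat_def poly_monom algebra_simps power_divide)
  next
    case 3
    have r: "((%h. flat p h / h) \<longlongrightarrow> 0) (at_right 0)"
    proof -
      have "((%h. poly (pCons 0 p) (inverse h) * exp (- inverse h)) \<longlongrightarrow> 0) (at_right (0::real))"
        using filterlim_compose[OF poly_exp_neg_tendsto_0 filterlim_inverse_at_top_right] .
      then show ?thesis
        by (rule Lim_transform_eventually)
          (auto simp: flat_def eventually_at_filter divide_simps)
    qed
    have l: "((%h. flat p h / h) \<longlongrightarrow> 0) (at_left 0)"
      by (rule Lim_transform_eventually[OF tendsto_const])
        (auto simp: flat_def eventually_at_filter)
    have "((%h. flat p h / h) \<longlongrightarrow> 0) (at 0)" using l r filterlim_at_split by blast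
    then show ?thesis using 3 by (simp add: DERIV_def flat_def)
  qed
qed

definition kappa :: "real => real" where "kappa = flat 1"
definition kappa' :: "real => real" where "kappa' = flat (monom 1 2)"

lemma kappa_eq: "kappa t = (if t \<le> 0 then 0 else exp (- (1 / t)))"
  by (simp add: kappa_def flat_def)

lemma kappa'_eq: "kappa' t = (if t \<le> 0 then 0 else exp (- (1 / t)) / t^2)"
  by (simp add: kappa'_def flat_def poly_monom power_divide)

lemma kappa_deriv: "(kappa has_real_derivative kappa' t) (at t)"
  using flat_has_derivative[of 1 t] by (simp add: kappa_def kappa'_def pderiv_1)

lemma kappa'_isCont: "isCont kappa' t"
  unfolding kappa'_def using flat_has_derivative DERIV_isCont by blast

lemma kappa_bounds: "0 \<le> kappa t" "kappa t \<le> 1" and kappa_pos: "0 < t ==> 0 < kappa t"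
  by (auto simp: kappa_eq)

lemma kappa_nonpos: "t \<le> 0 ==> kappa t = 0" "t \<le> 0 ==> kappa' t = 0"
  by (auto simp: kappa_eq kappa'_eq)

lemma kappa'_bounds: "0 \<le> kappa' t" "kappa' t \<le> 1"
proof -
  show "0 \<le> kappa' t" by (auto simp: kappa'_eq)
  have "exp (- (1 / t)) / t^2 \<le> 1" if t: "t > 0"
  proof -
    define r where "r = 1 / (2 * t)"
    have r: "r > 0" using t by (simp add: r_def)
    have "2 * r \<le> 1 + r + r^2 / 2"
      using zero_le_power2[of "r - 1"] by (simp add: power2_eq_square algebra_simps)
    also have "... \<le> exp r" using exp_lower_Taylor_quadratic[of r] r by simp
    finally have "(2 * r)^2 \<le> (exp r)^2" using r by (intro power_mono) auto
    moreover have "(exp r)^2 = exp (1 / t)" by (simp add: power2_eq_square exp_add[symmetric] r_def)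
    moreover have "(2 * r)^2 = 1 / t^2" by (simp add: r_def power_divide)
    ultimately have "1 / t^2 \<le> exp (1 / t)" by linarith
    then have "exp (- (1 / t)) * (1 / t^2) \<le> exp (- (1 / t)) * exp (1 / t)"
      by (intro mult_left_mono) auto
    then show ?thesis by (simp add: exp_add[symmetric])
  qed
  then show "kappa' t \<le> 1" by (auto simp: kappa'_eq)
qed

lemma kappa_at_top: "(kappa \<longlongrightarrow> 1) at_top"
proof -
  have "((%t::real. exp (- inverse t)) \<longlongrightarrow> exp (- 0)) at_top"
    by (intro tendsto_intros tendsto_inverse_0_at_top filterlim_ident)
  then have "((%t::real. exp (- inverse t)) \<longlongrightarrow> 1) at_top" by simp
  then show ?thesis
    by (rule Lim_transform_eventually)
      (auto simp: kappa_eq eventually_at_top_linorder inverse_eq_divide intro!: exI[of _ 1])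
qed

lemma smooth_kappa: "smooth q ==> smooth (%x. kappa (q x))"
  unfolding smooth_def kappa_def
  by (rule allI, rule Ck_compose_family[where F = "range flat"]) (use flat_has_derivative in fastforce)+

section \<open>Integration by parts and mollification\<close>

lemmas lintegral_cong = Bochner_Integration.integral_cong[OF refl]
  and lintegral_add = Bochner_Integration.integral_add
  and lintegral_diff = Bochner_Integration.integral_diff
  and lintegrable_bound = Bochner_Integration.integrable_bound

lemma lebesgue_on_eq_lborel:
  fixes f :: "'a::euclidean_space => 'b::euclidean_space"
  assumes f: "f \<in> borel_measurable borel" and D: "D \<in> sets borel"
    and 0: "!!x. x \<notin> D ==> f x = 0"
  shows "integral\<^sup>L (lebesgue_on D) f = integral\<^sup>L lborel f"
    "integrable (lebesgue_on D) f \<longleftrightarrow> integrable lborel f"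
proof -
  have *: "(%x. indicator D x *\<^sub>R f x) = f" using 0 by (auto simp: indicator_def)
  show "integral\<^sup>L (lebesgue_on D) f = integral\<^sup>L lborel f"
    using D f by (simp add: integral_restrict_space * integral_completion)
  show "integrable (lebesgue_on D) f \<longleftrightarrow> integrable lborel f"
    using D f by (simp add: integrable_restrict_space * integrable_completion)
qed

lemma continuous_integrable_lborel:
  fixes f :: "'a::euclidean_space => real"
  assumes f: "continuous_on UNIV f" and 0: "!!x. x \<notin> cball 0 R ==> f x = 0"
  shows "integrable lborel f"
proof -
  have "integrable lborel (%x. indicator (cball 0 R) x *\<^sub>R f x)"
    by (rule borel_integrable_compact) (use f continuous_on_subset in auto)
  moreover have "(%x. indicator (cball 0 R) x *\<^sub>R f x) = f"
    using 0 by (force simp: indicator_def)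
  ultimately show ?thesis by simp
qed

lemma derivative_zero_outside:
  assumes "(f has_derivative D) (at x)" "x \<in> S" "open S" "!!y. y \<in> S ==> f y = (0::real)"
  shows "D h = 0"
proof -
  have "(f has_derivative (%h. 0)) (at x)"
    by (rule has_derivative_transform_within_open[OF has_derivative_const assms(3,2)])
      (use assms(4) in auto)
  then show ?thesis using has_derivative_unique[OF assms(1)] by metis
qed

lemma continuous_bounded_support:
  fixes f :: "'a::euclidean_space => real"
  assumes f: "continuous_on UNIV f" and 0: "!!x. x \<notin> cball 0 R ==> f x = 0"
  obtains B where "B \<ge> 0" "!!x. \<bar>f x\<bar> \<le> B"
proof -
  have "bounded (f ` cball 0 R)"
    by (intro compact_imp_bounded compact_continuous_image compact_cball continuous_on_subset[OF f]) auto
  then obtain B where B: "!!x. x \<in> cball 0 R ==> \<bar>f x\<bar> \<le> B"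
    unfolding bounded_iff real_norm_def by blast
  have "\<bar>f x\<bar> \<le> max 0 B" for x
  proof (cases "x \<in> cball 0 R")
    case True then show ?thesis using B[of x] by simp
  next
    case False then show ?thesis using 0[of x] by simp
  qed
  then show ?thesis using that[of "max 0 B"] by auto
qed

text \<open>The integral is invariant under translations, so all difference quotients of \<open>f\<close> have
  integral zero.\<close>

lemma integral_directional_derivative_eq_0:
  fixes f :: "'a::euclidean_space => real"
  assumes f: "!!x. (f has_derivative f' x) (at x)"
    and c: "continuous_on UNIV (%x. f' x i)"
    and 0: "!!x. x \<notin> cball 0 R ==> f x = 0"
  shows "integral\<^sup>L lborel (%x. f' x i) = 0"
proof -
  have z0: "f' x i = 0" if "x \<notin> cball 0 R" for x
    by (rule derivative_zero_outside[OF f[of x], of "- cball 0 R"]) (use that 0 in auto)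
  have fc: "continuous_on UNIV f"
    using f has_derivative_continuous continuous_at_imp_continuous_on by blast
  obtain B where B: "B \<ge> 0" "!!x. \<bar>f' x i\<bar> \<le> B"
    using continuous_bounded_support[OF c z0] by metis
  define h where "h n = 1 / (real n + 1)" for n
  have h: "0 < h n" "h n \<le> 1" for n by (auto simp: h_def)
  have h0: "h ----> 0" unfolding h_def using LIMSEQ_inverse_real_of_nat by (simp add: inverse_eq_divide add.commute)
  define q where "q n x = (f (x + h n *\<^sub>R i) - f x) / h n" for n x
  define R' where "R' = R + norm i"
  have der: "((%t. f (x + t *\<^sub>R i)) has_real_derivative f' (x + t *\<^sub>R i) i) (at t)" for x t
  proof -
    have "((%t. f (x + t *\<^sub>R i)) has_derivative (%s. f' (x + t *\<^sub>R i) (s *\<^sub>R i))) (at t)"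
      by (rule has_derivative_compose[of "%t. x + t *\<^sub>R i", OF _ f]) (auto intro!: derivative_eq_intros)
    moreover have "(%s. f' (x + t *\<^sub>R i) (s *\<^sub>R i)) = (*) (f' (x + t *\<^sub>R i) i)"
      using linear_cmul[OF has_derivative_linear[OF f]] by (auto simp: mult.commute)
    ultimately show ?thesis by (simp add: has_field_derivative_def)
  qed
  have qB: "\<bar>q n x\<bar> \<le> B * indicator (cball 0 R') x" for n x
  proof (cases "x \<in> cball 0 R'")
    case True
    obtain t where "f (x + h n *\<^sub>R i) - f (x + 0 *\<^sub>R i) = (h n - 0) * f' (x + t *\<^sub>R i) i"
      using MVT2[of 0 "h n" "%t. f (x + t *\<^sub>R i)" "%t. f' (x + t *\<^sub>R i) i"] der h[of n] by metis
    then have "q n x = f' (x + t *\<^sub>R i) i" using h[of n] by (simp add: q_def)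
    then show ?thesis using B True by auto
  next
    case False
    have "norm (h n *\<^sub>R i) \<le> norm i" using h[of n] by (simp add: mult_left_le_one_le)
    then have "norm (x + h n *\<^sub>R i) > R"
      using False norm_triangle_ineq2[of x "- (h n *\<^sub>R i)"] by (simp add: R'_def)
    moreover have "norm x > R" using False norm_ge_zero[of i] by (simp add: R'_def del: norm_ge_zero)
    ultimately show ?thesis using 0 False by (simp add: q_def)
  qed
  have qlim: "(%n. q n x) ----> f' x i" for x
  proof -
    have "((%t. (f (x + t *\<^sub>R i) - f x) / t) \<longlongrightarrow> f' x i) (at 0)"
      using der[of x 0] by (simp add: DERIV_def)
    moreover have "filterlim h (at 0) sequentially"
      using h h0 by (auto simp: filterlim_at intro!: always_eventually) (metis less_irrefl)
    ultimately show ?thesis unfolding q_def using filterlim_compose by blast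
  qed
  have fi: "integrable lborel f" by (rule continuous_integrable_lborel[OF fc 0])
  have tr: "integrable lborel (%x. f (x + a))" "integral\<^sup>L lborel (%x. f (x + a)) = integral\<^sup>L lborel f" for a
  proof -
    have m: "(%x. x + a) \<in> lborel \<rightarrow>\<^sub>M borel" by simp
    have d: "distr lborel borel (%x. x + a) = lborel" unfolding add.commute[of _ a] by (rule lborel_distr_plus)
    show "integrable lborel (%x. f (x + a))"
      using integrable_distr[OF m, of f] fi by (simp add: d)
    show "integral\<^sup>L lborel (%x. f (x + a)) = integral\<^sup>L lborel f"
      using integral_distr[OF m borel_measurable_continuous_onI[OF fc]] by (simp add: d)
  qed
  have "(%n. integral\<^sup>L lborel (q n)) ----> integral\<^sup>L lborel (%x. f' x i)"
  proof (rule integral_dominated_convergence[where w = "%x. B * indicator (cball 0 R') x"])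
    show "(%x. f' x i) \<in> borel_measurable lborel" using borel_measurable_continuous_onI[OF c] by simp
    show "q n \<in> borel_measurable lborel" for n
      unfolding q_def using tr(1) fi by (auto intro!: borel_measurable_divide borel_measurable_diff)
    show "integrable lborel (%x::'a. B * indicator (cball 0 R') x)"
      by (intro integrable_mult_right integrable_real_indicator) (simp_all add: emeasure_bounded_finite[unfolded infinity_ennreal_def])
  qed (use qB qlim in auto)
  moreover have "integral\<^sup>L lborel (q n) = 0" for n
    unfolding q_def using tr fi by simp
  ultimately have "(%n. 0) ----> integral\<^sup>L lborel (%x. f' x i)" by simp
  then show ?thesis by (rule LIMSEQ_unique[OF _ tendsto_const])
qed

subsection \<open>The mollifier\<close>

text \<open>The mollifier: a multiple, with integral one, of a bump supported in the ball of radius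
  \<open>d\<close>.\<close>

definition eta :: "real => 'a::euclidean_space => real" where
  "eta d z = kappa (d^2 - z \<bullet> z) / (LINT z|lborel. kappa (d^2 - (z::'a) \<bullet> z))"

lemma smooth_cmult: "smooth \<phi> ==> smooth (%x. c * \<phi> x)"
  by (rule smooth_intros(4)[OF smooth_intros(1)])

lemma smooth_norm_square: "smooth (%z. z \<bullet> z)"
proof -
  have "smooth (%z::'a. \<Sum>b\<in>Basis. (z \<bullet> b) * (z \<bullet> b))"
    by (rule smooth_intros(5), rule smooth_intros(4)) (rule smooth_intros(2))+
  then show ?thesis by (simp only: euclidean_inner[symmetric])
qed

lemma norm_square_less_iff: "d > 0 ==> (z::'a::real_inner) \<bullet> z < d^2 \<longleftrightarrow> norm z < d"
  by (metis abs_of_pos less_imp_le power2_norm_eq_inner norm_ge_zero power2_less_imp_less power_strict_mono zero_less_numeral)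

lemma
  fixes z :: "'a::euclidean_space"
  assumes d: "d > 0"
  shows smooth_eta: "smooth (eta d :: 'a => real)"
    and eta_nonneg: "eta d z \<ge> 0"
    and eta_minus: "eta d (- z) = eta d z"
    and eta_outside: "norm z \<ge> d ==> eta d z = 0"
    and eta_integrable: "integrable lborel (eta d :: 'a => real)"
    and eta_integral: "integral\<^sup>L lborel (eta d :: 'a => real) = 1"
proof -
  let ?k = "%z::'a. kappa (d^2 - z \<bullet> z)"
  have sm: "smooth ?k" by (intro smooth_kappa smooth_diff smooth_intros smooth_norm_square)
  have 0: "?k z = 0" if "norm z \<ge> d" for z
    using norm_square_less_iff[OF d, of z] that by (intro kappa_nonpos) auto
  have int: "integrable lborel ?k"
    by (rule continuous_integrable_lborel[OF smooth_continuous[OF sm], of d]) (use 0 in auto)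
  have "integral\<^sup>L lborel ?k \<noteq> 0"
  proof
    assume "integral\<^sup>L lborel ?k = 0"
    then have "AE z in lborel. ?k z = 0"
      using integral_nonneg_eq_0_iff_AE[OF int] kappa_bounds by auto
    then have "AE z in lborel. z \<notin> ball (0::'a) d"
    proof eventually_elim
      case (elim z)
      then show ?case using norm_square_less_iff[OF d, of z] kappa_pos[of "d^2 - z \<bullet> z"] by auto
    qed
    then have "emeasure lborel (ball (0::'a) d) = 0"
      by (subst (asm) AE_iff_measurable[OF _ refl]) (auto simp: ball_def)
    then have "negligible (ball (0::'a) d)"
      by (simp add: negligible_iff_null_sets null_sets_def)
    then show False using d open_not_negligible[of "ball (0::'a) d"] by auto
  qed
  then have pos: "integral\<^sup>L lborel ?k > 0"
    using integral_nonneg_AE[of ?k lborel] kappa_bounds by (simp add: less_le)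
  show "smooth (eta d :: 'a => real)"
    using smooth_cmult[OF sm, of "inverse (integral\<^sup>L lborel ?k)"]
    by (simp add: eta_def[abs_def] divide_inverse mult.commute)
  show "eta d z \<ge> 0" using pos kappa_bounds by (simp add: eta_def)
  show "eta d (- z) = eta d z" by (simp add: eta_def)
  show "norm z \<ge> d ==> eta d z = 0" using 0 by (simp add: eta_def)
  show "integrable lborel (eta d :: 'a => real)"
    using int by (simp add: eta_def[abs_def])
  show "integral\<^sup>L lborel (eta d :: 'a => real) = 1"
    using pos by (simp add: eta_def[abs_def])
qed

lemma
  fixes x :: "'a::euclidean_space"
  assumes d: "d > 0"
  shows eta_shift_integrable: "integrable lborel (%y. eta d (x - y))"
    and eta_shift_integral: "integral\<^sup>L lborel (%y. eta d (x - y)) = 1"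
proof -
  have m: "(%y. y + (- x)) \<in> lborel \<rightarrow>\<^sub>M borel" by simp
  have dd: "distr lborel borel (%y. y + (- x)) = lborel" unfolding add.commute[of _ "- x"] by (rule lborel_distr_plus)
  have e: "(%y. eta d (x - y)) = (%y. eta d (y + (- x)))"
    using eta_minus[OF d] by (metis minus_diff_eq diff_conv_add_uminus)
  show "integrable lborel (%y. eta d (x - y))"
    unfolding e using integrable_distr[OF m, of "eta d"] eta_integrable[OF d] by (simp only: dd)
  show "integral\<^sup>L lborel (%y. eta d (x - y)) = 1"
    unfolding e using integral_distr[OF m borel_measurable_continuous_onI[OF smooth_continuous[OF smooth_eta[OF d]]]]
      eta_integral[OF d, where 'a = 'a] by (simp only: dd)
qed

definition conv :: "'a::euclidean_space set => ('a => real) => ('a => real) => 'a => real" where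
  "conv D u k x = (LINT y|lebesgue_on D. u y * k (x - y))"

lemma measurable_lebesgue_on_continuous:
  "continuous_on UNIV f ==> f \<in> borel_measurable (lebesgue_on D)"
  by (intro measurable_restrict_space1 measurable_completion) (simp add: borel_measurable_continuous_onI)

lemma conv_integrand_integrable:
  fixes u k :: "'a::euclidean_space => real"
  assumes u: "integrable (lebesgue_on D) u" and k: "continuous_on UNIV k" "!!z. \<bar>k z\<bar> \<le> B"
  shows "integrable (lebesgue_on D) (%y. u y * k (x - y))"
proof (rule lintegrable_bound)
  show "integrable (lebesgue_on D) (%y. B * u y)" using u by simp
  have "continuous_on UNIV (%y. k (x - y))"
    by (intro continuous_on_compose2[OF k(1)] continuous_intros) auto
  then show "(%y. u y * k (x - y)) \<in> borel_measurable (lebesgue_on D)"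
    by (intro borel_measurable_times measurable_lebesgue_on_continuous borel_measurable_integrable[OF u])
  show "AE y in lebesgue_on D. norm (u y * k (x - y)) \<le> norm (B * u y)"
  proof (rule AE_I2)
    fix y
    have "\<bar>k (x - y)\<bar> \<le> \<bar>B\<bar>" using k(2)[of "x - y"] by linarith
    then show "norm (u y * k (x - y)) \<le> norm (B * u y)"
      by (simp add: abs_mult mult.commute[of "\<bar>B\<bar>"] mult_left_mono)
  qed
qed

text \<open>The derivative falls on the smooth kernel. The difference quotients of the kernel are bounded
  uniformly, so dominated convergence applies.\<close>

lemma conv_has_derivative:
  assumes u: "integrable (lebesgue_on D) u" and k: "smooth k" and 0: "!!z. z \<notin> cball 0 R ==> k z = 0"
  shows "(conv D u k has_derivative (%h. \<Sum>i\<in>Basis. (h \<bullet> i) * conv D u (partial i k) x)) (at x)"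
proof -
  let ?k' = "%z. frechet_derivative k (at z)"
  have kd: "(k has_derivative ?k' z) (at z)" for z by (rule smooth_has_derivative[OF k])
  have pc: "continuous_on UNIV (partial i k)" if "i \<in> Basis" for i
    by (intro smooth_continuous smooth_partial k that)
  have p0: "partial i k z = 0" if "z \<notin> cball 0 R" for z i
    by (rule derivative_zero_outside[OF kd, of z "- cball 0 R"]) (use that 0 in auto)
  have "\<exists>B\<ge>0. \<forall>z. \<bar>partial i k z\<bar> \<le> B" if "i \<in> Basis" for i
    using continuous_bounded_support[OF pc[OF that] p0] by metis
  then obtain Bi where Bi: "!!i z. i \<in> Basis ==> \<bar>partial i k z\<bar> \<le> Bi i" by metis
  define B where "B = (\<Sum>i\<in>(Basis::'a set). Bi i)"
  have ex: "?k' z h = (\<Sum>i\<in>Basis. (h \<bullet> i) * partial i k z)" for z h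
  proof -
    have l: "linear (?k' z)" using kd has_derivative_linear by blast
    have "?k' z h = ?k' z (\<Sum>i\<in>Basis. (h \<bullet> i) *\<^sub>R i)" by (simp add: euclidean_representation)
    then show ?thesis by (simp add: linear_sum[OF l] linear_cmul[OF l])
  qed
  have k'B: "\<bar>?k' z h\<bar> \<le> B * norm h" for z h
  proof -
    have "\<bar>?k' z h\<bar> \<le> (\<Sum>i\<in>Basis. \<bar>(h \<bullet> i) * partial i k z\<bar>)" by (subst ex) (rule sum_abs)
    also have "... \<le> (\<Sum>i\<in>Basis. norm h * Bi i)"
      by (intro sum_mono, subst abs_mult, intro mult_mono Basis_le_norm Bi) auto
    finally show ?thesis by (simp add: B_def sum_distrib_left mult.commute)
  qed
  have kL: "\<bar>k (z + h) - k z\<bar> \<le> B * norm h" for z h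
  proof -
    have "norm (k (z + h) - k z) \<le> B * norm (z + h - z)"
      by (rule differentiable_bound[of UNIV k ?k'])
        (use kd k'B in "auto intro!: onorm_le")
    then show ?thesis by simp
  qed
  obtain Bk where Bk: "!!z. \<bar>k z\<bar> \<le> Bk"
    using continuous_bounded_support[OF smooth_continuous[OF k] 0] by metis
  note ik = conv_integrand_integrable[OF u smooth_continuous[OF k] Bk]
  note ip = conv_integrand_integrable[OF u pc Bi]
  define L where "L h = (\<Sum>i\<in>Basis. (h \<bullet> i) * conv D u (partial i k) x)" for h
  have L: "L h = (LINT y|lebesgue_on D. u y * ?k' (x - y) h)" for h
  proof -
    have "(LINT y|lebesgue_on D. u y * ?k' (x - y) h) =
       (LINT y|lebesgue_on D. (\<Sum>i\<in>Basis. (h \<bullet> i) * (u y * partial i k (x - y))))"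
      by (simp add: ex[of _ h] sum_distrib_left algebra_simps)
    also have "... = L h" unfolding L_def conv_def by (subst Bochner_Integration.integral_sum) (use ip in auto)
    finally show ?thesis by simp
  qed
  have ik': "integrable (lebesgue_on D) (%y. u y * ?k' (x - y) h)" for h
  proof -
    have "integrable (lebesgue_on D) (%y. (\<Sum>i\<in>Basis. (h \<bullet> i) * (u y * partial i k (x - y))))"
      using ip by (intro Bochner_Integration.integrable_sum integrable_mult_right) auto
    then show ?thesis by (simp add: ex[of _ h] sum_distrib_left algebra_simps)
  qed
  have "(conv D u k has_derivative L) (at x)"
    unfolding has_derivative_iff_norm
  proof
    show "bounded_linear L" unfolding L_def
      by (intro bounded_linear_sum bounded_linear_mult_const bounded_linear_inner_left)
    show "((%y. norm (conv D u k y - conv D u k x - L (y - x)) / norm (y - x)) \<longlongrightarrow> 0) (at x)"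
      unfolding tendsto_at_iff_sequentially
    proof (intro allI impI)
      fix X assume X: "\<forall>i. X i \<in> UNIV - {x}" "X ----> x"
      define q where "q n y = u y * ((k (X n - y) - k (x - y) - ?k' (x - y) (X n - x)) / norm (X n - x))" for n y
      have qe: "q n y = (u y * k (X n - y) - u y * k (x - y) - u y * ?k' (x - y) (X n - x)) / norm (X n - x)" for n y
        by (simp add: q_def algebra_simps)
      have qi: "integrable (lebesgue_on D) (q n)" for n
        unfolding qe using ik ik' by (intro integrable_divide Bochner_Integration.integrable_diff) auto
      have qI: "integral\<^sup>L (lebesgue_on D) (q n) = (conv D u k (X n) - conv D u k x - L (X n - x)) / norm (X n - x)" for n
        unfolding qe using ik ik' by (simp add: L conv_def)
      have "(%n. integral\<^sup>L (lebesgue_on D) (q n)) ----> integral\<^sup>L (lebesgue_on D) (%y. 0)"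
      proof (rule integral_dominated_convergence[where w = "%y. 2 * B * \<bar>u y\<bar>"])
        show "AE y in lebesgue_on D. (%n. q n y) ----> 0"
        proof (rule AE_I2)
          fix y
          have "((%w. norm (k w - k (x - y) - ?k' (x - y) (w - (x - y))) / norm (w - (x - y))) \<longlongrightarrow> 0) (at (x - y))"
            using kd[of "x - y"] unfolding has_derivative_iff_norm by auto
          moreover have "filterlim (%n. X n - y) (at (x - y)) sequentially"
            using X by (auto simp: filterlim_at intro!: tendsto_intros)
          ultimately have "(%n. norm (k (X n - y) - k (x - y) - ?k' (x - y) (X n - y - (x - y))) / norm (X n - y - (x - y))) ----> 0"
            using filterlim_compose by blast
          then have "(%n. norm ((k (X n - y) - k (x - y) - ?k' (x - y) (X n - x)) / norm (X n - x))) ----> 0"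
            by (simp add: abs_div)
          then have "(%n. (k (X n - y) - k (x - y) - ?k' (x - y) (X n - x)) / norm (X n - x)) ----> 0"
            by (rule tendsto_norm_zero_cancel)
          then show "(%n. q n y) ----> 0" unfolding q_def by (rule tendsto_mult_right_zero)
        qed
        show "AE y in lebesgue_on D. norm (q n y) \<le> 2 * B * \<bar>u y\<bar>" for n
        proof (rule AE_I2)
          fix y
          have "\<bar>k (X n - y) - k (x - y) - ?k' (x - y) (X n - x)\<bar> \<le> 2 * B * norm (X n - x)"
            using kL[of "x - y" "X n - x"] k'B[of "x - y" "X n - x"] by (simp add: algebra_simps) 
          then have "\<bar>(k (X n - y) - k (x - y) - ?k' (x - y) (X n - x)) / norm (X n - x)\<bar> \<le> 2 * B"
            using X(1) by (auto simp: abs_div divide_simps)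
          then show "norm (q n y) \<le> 2 * B * \<bar>u y\<bar>"
            unfolding q_def by (simp only: real_norm_def abs_mult mult.commute[of "2 * B"]) (intro mult_left_mono, auto)
        qed
      qed (use qi u in "auto intro: borel_measurable_integrable")
      then have "(%n. norm (integral\<^sup>L (lebesgue_on D) (q n))) ----> 0"
        using tendsto_norm_zero by fastforce
      then show "((%y. norm (conv D u k y - conv D u k x - L (y - x)) / norm (y - x)) \<circ> X) ----> 0"
        unfolding qI o_def by (simp add: abs_div)
    qed
  qed
  then show ?thesis unfolding L_def .
qed

lemma
  assumes u: "integrable (lebesgue_on D) u" and k: "smooth k" and 0: "!!z. z \<notin> cball 0 R ==> k z = 0"
  shows conv_partial: "i \<in> Basis ==> partial i (conv D u k) x = conv D u (partial i k) x"
    and conv_continuous: "continuous_on UNIV (conv D u k)"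
    and partial_support: "z \<notin> cball 0 R ==> partial i k z = 0"
proof -
  note d = conv_has_derivative[OF assms]
  show "partial i (conv D u k) x = conv D u (partial i k) x" if "i \<in> Basis"
  proof -
    have "partial i (conv D u k) x = (\<Sum>j\<in>Basis. (i \<bullet> j) * conv D u (partial j k) x)"
      by (rule partial_eqI[OF d])
    also have "... = (\<Sum>j\<in>Basis. if j = i then conv D u (partial j k) x else 0)"
      by (intro sum.cong) (auto simp: inner_Basis that)
    finally show ?thesis using that by simp
  qed
  show "continuous_on UNIV (conv D u k)"
    by (intro continuous_at_imp_continuous_on ballI has_derivative_continuous[OF d])
  show "z \<notin> cball 0 R ==> partial i k z = 0"
    by (rule derivative_zero_outside[OF smooth_has_derivative[OF k], of z "- cball 0 R"]) (use 0 in auto)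
qed

lemma eta_continuous: "d > 0 ==> continuous_on S (eta d)"
  by (rule smooth_continuous[OF smooth_eta])

lemma eta_bounded:
  assumes "d > 0" obtains B where "!!z::'a::euclidean_space. \<bar>eta d z\<bar> \<le> B"
proof -
  have "eta d z = 0" if "z \<notin> cball 0 d" for z::'a using eta_outside[OF assms, of z] that by auto
  then show ?thesis using continuous_bounded_support[OF eta_continuous[OF assms]] that by metis
qed

lemma eta_borel:
  assumes "d > 0" shows "(%y. eta d (x - y)) \<in> borel_measurable borel"
  by (intro borel_measurable_continuous_onI continuous_on_compose2[OF eta_continuous[OF assms, of UNIV]]
     continuous_intros) auto

lemma eta_lebesgue_on:
  fixes x :: "'a::euclidean_space"
  assumes d: "d > 0" and D: "open D"
  shows "integrable (lebesgue_on D) (%y. eta d (x - y))"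
    and "integral\<^sup>L (lebesgue_on D) (%y. eta d (x - y)) \<le> 1"
    and "cball x d \<subseteq> D ==> integral\<^sup>L (lebesgue_on D) (%y. eta d (x - y)) = 1"
proof -
  note [measurable] = eta_borel[OF d, of x]
  have Db: "D \<in> sets borel" using D by simp
  let ?f = "%y. indicator D y * eta d (x - y)"
  have i: "integrable lborel ?f"
    using integrable_mult_indicator[OF _ eta_shift_integrable[OF d, of x], of D] Db by simp
  have e: "integral\<^sup>L (lebesgue_on D) (%y. eta d (x - y)) = integral\<^sup>L lborel ?f"
    using Db by (simp add: integral_restrict_space integral_completion)
  show "integrable (lebesgue_on D) (%y. eta d (x - y))"
    using Db i by (simp add: integrable_restrict_space integrable_completion)
  show "integral\<^sup>L (lebesgue_on D) (%y. eta d (x - y)) \<le> 1"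
    unfolding e eta_shift_integral[OF d, of x, symmetric]
    by (rule integral_mono[OF i eta_shift_integrable[OF d]]) (auto simp: indicator_def eta_nonneg[OF d])
  assume c: "cball x d \<subseteq> D"
  have "?f y = eta d (x - y)" for y
    using c eta_outside[OF d, of "x - y"] by (force simp: indicator_def dist_norm)
  then show "integral\<^sup>L (lebesgue_on D) (%y. eta d (x - y)) = 1"
    unfolding e by (simp only: eta_shift_integral[OF d])
qed

lemma conv_eta_integrable:
  assumes "integrable (lebesgue_on D) u" "d > 0"
  shows "integrable (lebesgue_on D) (%y. u y * eta d (x - y))"
  using eta_bounded[OF assms(2)] conv_integrand_integrable[OF assms(1) eta_continuous[OF assms(2)]] by metis

text \<open>The kernel is nonnegative with integral one, so a bound on the ball around \<open>y\<close> survives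
  the averaging.\<close>

lemma conv_close:
  assumes D: "open D" and d: "d > 0" and A: "integrable (lebesgue_on D) A" and c: "cball y d \<subseteq> D"
    and e: "AE x in lebesgue_on D. dist y x < d --> \<bar>A x - c\<bar> \<le> e"
  shows "\<bar>conv D A (eta d) y - c\<bar> \<le> e"
proof -
  let ?M = "lebesgue_on D" and ?k = "%x. eta d (y - x)"
  note k = eta_lebesgue_on(1,3)[OF d D, of y]
  note i = conv_eta_integrable[OF A d, of y]
  have "conv D A (eta d) y - c = (LINT x|?M. A x * ?k x) - (LINT x|?M. c * ?k x)"
    using k c by (simp add: conv_def)
  also have "... = (LINT x|?M. A x * ?k x - c * ?k x)"
    using k(1) i by simp
  finally have "\<bar>conv D A (eta d) y - c\<bar> \<le> (LINT x|?M. \<bar>A x * ?k x - c * ?k x\<bar>)"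
    using integral_abs_bound by metis
  also have "... \<le> (LINT x|?M. e * ?k x)"
  proof (rule integral_mono_AE)
    show "AE x in ?M. \<bar>A x * ?k x - c * ?k x\<bar> \<le> e * ?k x"
      using e
    proof eventually_elim
      case (elim x)
      show ?case
      proof (cases "dist y x < d")
        case True
        then show ?thesis using elim eta_nonneg[OF d, of "y - x"]
          by (simp add: left_diff_distrib[symmetric] abs_mult mult_right_mono)
      next
        case False
        then show ?thesis using eta_outside[OF d, of "y - x"] by (simp add: dist_norm)
      qed
    qed
  qed (use k(1) i in auto)
  also have "... = e" using k c by simp
  finally show ?thesis .
qed

lemma conv_bound:
  assumes D: "open D" and d: "d > 0" and A: "integrable (lebesgue_on D) A"
    and B: "!!x. x \<in> D ==> \<bar>A x\<bar> \<le> B" "B \<ge> 0"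
  shows "\<bar>conv D A (eta d) y\<bar> \<le> B"
proof -
  let ?M = "lebesgue_on D" and ?k = "%x. eta d (y - x)"
  note i = conv_eta_integrable[OF A d, of y]
  have "\<bar>conv D A (eta d) y\<bar> \<le> (LINT x|?M. \<bar>A x * ?k x\<bar>)"
    unfolding conv_def by (rule integral_abs_bound)
  also have "... \<le> (LINT x|?M. B * ?k x)"
  proof (rule integral_mono)
    show "integrable ?M (%x. \<bar>A x * ?k x\<bar>)" using i by (rule integrable_abs)
    show "integrable ?M (%x. B * ?k x)" using eta_lebesgue_on(1)[OF d D, of y] by simp
    show "\<bar>A x * ?k x\<bar> \<le> B * ?k x" if "x \<in> space ?M" for x
      using that B(1)[of x] eta_nonneg[OF d, of "y - x"] by (auto simp: abs_mult intro!: mult_right_mono)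
  qed
  also have "... \<le> B" using eta_lebesgue_on(1,2)[OF d D, of y] B(2) by (simp add: mult_left_le)
  finally show ?thesis .
qed

lemma conv_Fubini:
  fixes A G k :: "'a::euclidean_space => real"
  assumes D: "open D" "bounded D" and A: "integrable (lebesgue_on D) A" and G: "integrable (lebesgue_on D) G"
    and k: "continuous_on UNIV k" "!!z. \<bar>k z\<bar> \<le> B" "!!z. k (- z) = k z"
  shows "(LINT x|lebesgue_on D. A x * conv D G k x) = (LINT y|lebesgue_on D. G y * conv D A k y)"
proof -
  let ?M = "lebesgue_on D"
  interpret finite_measure ?M
    by (intro finite_measure_lebesgue_on lmeasurable_open D)
  interpret P: pair_sigma_finite ?M ?M ..
  have [measurable]: "A \<in> borel_measurable ?M" "G \<in> borel_measurable ?M" using A G by auto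
  have id[measurable]: "(%x. x) \<in> borel_measurable ?M"
    by (rule measurable_lebesgue_on_continuous) (rule continuous_on_id)
  have [measurable]: "k \<in> borel_measurable borel" using k(1) borel_measurable_continuous_onI by blast
  have m: "(%(x, y). k (x - y)) \<in> borel_measurable (?M \<Otimes>\<^sub>M ?M)" by measurable
  have int: "integrable (?M \<Otimes>\<^sub>M ?M) (%(x, y). A x * G y)"
  proof (rule P.Fubini_integrable)
    show "integrable ?M (%x. LINT y|?M. norm (case (x, y) of (x, y) => A x * G y))"
      using A by (simp add: abs_mult)
  qed (use A G in auto)
  have "integrable (?M \<Otimes>\<^sub>M ?M) (%(x, y). A x * (G y * k (x - y)))"
  proof (rule lintegrable_bound)
    show "integrable (?M \<Otimes>\<^sub>M ?M) (%z. B * (case z of (x, y) => A x * G y))" using int by simp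
    show "(%(x, y). A x * (G y * k (x - y))) \<in> borel_measurable (?M \<Otimes>\<^sub>M ?M)" by measurable
    have "\<bar>k (x - y)\<bar> \<le> \<bar>B\<bar>" for x y using k(2)[of "x - y"] by linarith
    then show "AE z in ?M \<Otimes>\<^sub>M ?M. norm (case z of (x, y) => A x * (G y * k (x - y)))
        \<le> norm (B * (case z of (x, y) => A x * G y))"
      by (intro AE_I2) (auto simp: abs_mult mult.assoc[symmetric] mult.commute[of "\<bar>B\<bar>"] intro!: mult_left_mono)
  qed
  then have "(LINT y|?M. (LINT x|?M. A x * (G y * k (x - y)))) = (LINT x|?M. (LINT y|?M. A x * (G y * k (x - y))))"
    by (rule P.Fubini_integral)
  moreover have "A x * (G y * k (x - y)) = G y * (A x * k (y - x))" for x y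
    using k(3)[of "x - y"] by simp
  then have "(LINT y|?M. (LINT x|?M. A x * (G y * k (x - y)))) = (LINT y|?M. (LINT x|?M. G y * (A x * k (y - x))))"
    by presburger
  ultimately show ?thesis by (simp add: conv_def)
qed

lemma bounded_integrable_lebesgue_on:
  fixes f :: "'a::euclidean_space => real"
  assumes D: "open D" "bounded D" and f: "f \<in> borel_measurable (lebesgue_on D)" and B: "!!x. x \<in> D ==> \<bar>f x\<bar> \<le> B"
  shows "integrable (lebesgue_on D) f"
proof -
  interpret finite_measure "lebesgue_on D"
    by (intro finite_measure_lebesgue_on lmeasurable_open D)
  show ?thesis by (rule integrable_const_bound[of _ B]) (use f B in auto)
qed

text \<open>The mollifier is even, so by Fubini's theorem it may be moved from \<open>G\<close> to the test
  functions. These converge locally uniformly at every point, so their mollifications converge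
  pointwise and boundedly.\<close>

lemma mollification_weak_limit:
  fixes A :: "nat => 'a::euclidean_space => real"
  assumes D: "open D" "bounded D" and G: "integrable (lebesgue_on D) G"
    and d: "!!n. d n > 0" "d ----> 0"
    and A: "!!n. A n \<in> borel_measurable (lebesgue_on D)" "!!n x. x \<in> D ==> \<bar>A n x\<bar> \<le> B"
    and lim: "!!y e. y \<in> D ==> e > 0 ==> \<exists>r>0. \<forall>\<^sub>F n in sequentially. \<forall>x\<in>D. dist y x < r --> \<bar>A n x - A' y\<bar> \<le> e"
  shows "(%n. LINT x|lebesgue_on D. A n x * conv D G (eta (d n)) x) ----> (LINT y|lebesgue_on D. G y * A' y)"
proof (cases "D = {}")
  case True
  then have "space (lebesgue_on D) = {}" by simp
  then show ?thesis by (simp add: integral_empty)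
next
  case False
  then have B: "B \<ge> 0" using A(2) by (meson abs_ge_zero all_not_in_conv order_trans)
  let ?M = "lebesgue_on D"
  have Ai: "integrable ?M (A n)" for n by (rule bounded_integrable_lebesgue_on[OF D A])
  have Gm[measurable]: "G \<in> borel_measurable ?M" using G by auto
  have e: "(LINT x|?M. A n x * conv D G (eta (d n)) x) = (LINT y|?M. G y * conv D (A n) (eta (d n)) y)" for n
  proof -
    obtain K where "!!z::'a. \<bar>eta (d n) z\<bar> \<le> K" using eta_bounded[OF d(1)] by metis
    then show ?thesis by (rule conv_Fubini[OF D Ai G eta_continuous[OF d(1)] _ eta_minus[OF d(1)]])
  qed
  have p: "(%n. conv D (A n) (eta (d n)) y) ----> A' y" if y: "y \<in> D" for y
  proof (rule LIMSEQ_I)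
    fix \<epsilon> :: real assume \<epsilon>: "\<epsilon> > 0"
    obtain r where r: "r > 0" "\<forall>\<^sub>F n in sequentially. \<forall>x\<in>D. dist y x < r --> \<bar>A n x - A' y\<bar> \<le> \<epsilon> / 2"
      using lim[OF y, of "\<epsilon> / 2"] \<epsilon> by auto
    obtain s where s: "s > 0" "cball y s \<subseteq> D" using D(1) y open_contains_cball by blast
    have "\<forall>\<^sub>F n in sequentially. d n < min r s"
      by (rule order_tendstoD(2)[OF d(2)]) (use r s in simp)
    with r(2) have "\<forall>\<^sub>F n in sequentially. norm (conv D (A n) (eta (d n)) y - A' y) < \<epsilon>"
    proof eventually_elim
      case (elim n)
      have "\<bar>conv D (A n) (eta (d n)) y - A' y\<bar> \<le> \<epsilon> / 2"
        by (rule conv_close[OF D(1) d(1) Ai]) (use s elim in "auto intro!: AE_I2")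
      then show ?case using \<epsilon> by simp
    qed
    then show "\<exists>N. \<forall>n\<ge>N. norm (conv D (A n) (eta (d n)) y - A' y) < \<epsilon>"
      by (simp add: eventually_sequentially)
  qed
  have cm: "(%y. conv D (A n) (eta (d n)) y) \<in> borel_measurable ?M" for n
    by (rule measurable_lebesgue_on_continuous,
        rule conv_continuous[OF Ai smooth_eta[OF d(1)], of "d n"]) (auto intro: eta_outside[OF d(1)])
  have A'm: "A' \<in> borel_measurable ?M"
    by (rule borel_measurable_LIMSEQ_real[OF _ cm]) (use p in simp)
  show ?thesis unfolding e
  proof (rule integral_dominated_convergence[where w = "%y. B * \<bar>G y\<bar>"])
    show "(%y. G y * A' y) \<in> borel_measurable ?M" using A'm by simp
    show "(%y. G y * conv D (A n) (eta (d n)) y) \<in> borel_measurable ?M" for n using cm by simp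
    show "integrable ?M (%y. B * \<bar>G y\<bar>)" using G by simp
    show "AE y in ?M. (%n. G y * conv D (A n) (eta (d n)) y) ----> G y * A' y"
      by (rule AE_I2) (use p in "auto intro: tendsto_mult_left")
    show "AE y in ?M. norm (G y * conv D (A n) (eta (d n)) y) \<le> B * \<bar>G y\<bar>" for n
      by (rule AE_I2) (use conv_bound[OF D(1) d(1)[of n] Ai A(2) B] in
        \<open>auto simp: abs_mult mult.commute[of B] intro!: mult_left_mono\<close>)
  qed
qed

section \<open>Weak gradients\<close>

lemma integrable_lebesgue_on_iff:
  "D \<in> sets lebesgue ==> integrable (lebesgue_on D) f \<longleftrightarrow> f absolutely_integrable_on D"
  by (simp add: integrable_restrict_space set_integrable_def)

definition locally_integrable :: "'a::euclidean_space set => ('a => 'b::euclidean_space) => bool" where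
  "locally_integrable D v \<longleftrightarrow> (\<forall>K. compact K \<and> K \<subseteq> D --> v absolutely_integrable_on K)"

lemma integrable_imp_locally_integrable:
  assumes "D \<in> sets lebesgue" "integrable (lebesgue_on D) v"
  shows "locally_integrable D v"
  unfolding locally_integrable_def
proof safe
  fix K assume K: "compact K" "K \<subseteq> D"
  have "v absolutely_integrable_on D" using assms by (simp add: integrable_lebesgue_on_iff)
  then show "v absolutely_integrable_on K"
    by (rule set_integrable_subset) (use K lmeasurable_compact fmeasurableD in auto)
qed

lemma continuous_imp_locally_integrable:
  fixes v :: "'a::euclidean_space => 'b::euclidean_space"
  assumes "continuous_on D v" shows "locally_integrable D v"
  unfolding locally_integrable_def set_integrable_def
proof safe
  fix K assume K: "compact K" "K \<subseteq> D"
  have "integrable lborel (%x. indicator K x *\<^sub>R v x)"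
    by (rule borel_integrable_compact) (use assms K continuous_on_subset in auto)
  then show "integrable lebesgue (%x. indicator K x *\<^sub>R v x)"
    using integrable_completion[of "%x. indicator K x *\<^sub>R v x" lborel] by auto
qed

lemma test_funD:
  assumes "test_fun D \<phi>"
  shows "smooth \<phi>" and "continuous_on UNIV \<phi>"
    and "!!x. x \<notin> D ==> \<phi> x = 0"
    and "\<exists>R. \<forall>x. x \<notin> cball 0 R --> \<phi> x = 0"
    and "!!x. x \<notin> closure {x. \<phi> x \<noteq> 0} ==> \<phi> x = 0"
proof -
  show "smooth \<phi>" using assms by (simp add: test_fun_def smooth_def)
  then show "continuous_on UNIV \<phi>" by (rule smooth_continuous)
  show *: "!!x. x \<notin> closure {x. \<phi> x \<noteq> 0} ==> \<phi> x = 0"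
    using closure_subset[of "{x. \<phi> x \<noteq> 0}"] by auto
  have K: "closure {x. \<phi> x \<noteq> 0} \<subseteq> D" "compact (closure {x. \<phi> x \<noteq> 0})"
    using assms unfolding test_fun_def by (rule conjunct2[OF conjunct2], rule conjunct1[OF conjunct2])
  show "\<phi> x = 0" if "x \<notin> D" for x
    by (rule *) (use K(1) that in blast)
  have "bounded (closure {x. \<phi> x \<noteq> 0})" using K(2) by (rule compact_imp_bounded)
  then obtain R where "\<forall>x\<in>closure {x. \<phi> x \<noteq> 0}. norm x \<le> R" by (auto simp only: bounded_iff)
  then have R: "closure {x. \<phi> x \<noteq> 0} \<subseteq> cball 0 R" by (intro subsetI) (simp only: mem_cball_0)
  show "\<exists>R. \<forall>x. x \<notin> cball 0 R --> \<phi> x = 0"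
    by (rule exI[of _ R], intro allI impI, rule *, rule contra_subsetD[OF R])
qed

lemma test_funI:
  assumes "smooth \<phi>" "compact K" "K \<subseteq> D" "!!x. x \<notin> K ==> \<phi> x = 0"
  shows "test_fun D \<phi>"
proof -
  have c: "closure {x. \<phi> x \<noteq> 0} \<subseteq> K"
    using assms by (intro closure_minimal compact_imp_closed) auto
  then have "compact (closure {x. \<phi> x \<noteq> 0})"
    using assms(2) by (metis closed_closure compact_Int_closed inf.absorb_iff2)
  with c assms show ?thesis by (auto simp: test_fun_def smooth_def)
qed

lemma test_fun_partial:
  assumes "test_fun D \<phi>" "i \<in> Basis" shows "test_fun D (partial i \<phi>)"
proof (rule test_funI)
  show "smooth (partial i \<phi>)" by (intro smooth_partial test_funD[OF assms(1)] assms)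
  show "compact (closure {x. \<phi> x \<noteq> 0})" "closure {x. \<phi> x \<noteq> 0} \<subseteq> D" using assms by (auto simp: test_fun_def)
  show "partial i \<phi> x = 0" if x: "x \<notin> closure {x. \<phi> x \<noteq> 0}" for x
  proof (rule derivative_zero_outside[OF smooth_has_derivative[OF test_funD(1)[OF assms(1)]]])
    show "x \<in> - closure {x. \<phi> x \<noteq> 0}" using x by simp
    show "open (- closure {x. \<phi> x \<noteq> 0})" by (intro open_Compl closed_closure)
    show "\<phi> y = 0" if "y \<in> - closure {x. \<phi> x \<noteq> 0}" for y
      by (rule test_funD(5)[OF assms(1)]) (use that in blast)
  qed
qed

lemma locally_integrable_mult_test:
  fixes v :: "'a::euclidean_space => real"
  assumes D: "open D" and v: "locally_integrable D v" and \<phi>: "test_fun D \<phi>"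
  shows "integrable (lebesgue_on D) (%x. v x * \<phi> x)"
proof -
  define K where "K = closure {x. \<phi> x \<noteq> 0}"
  have K: "compact K" "K \<subseteq> D" 
    using \<phi> unfolding K_def test_fun_def by metis+
  have 0: "\<phi> x = 0" if "x \<notin> K" for x
    by (rule test_funD(5)[OF \<phi>]) (use that in "unfold K_def")
  obtain R where "!!x. x \<notin> cball 0 R ==> \<phi> x = 0" using test_funD(4)[OF \<phi>] by metis
  then obtain B where B: "!!x. \<bar>\<phi> x\<bar> \<le> B" using continuous_bounded_support[OF test_funD(2)[OF \<phi>]] by metis
  have i: "integrable lebesgue (%x. indicator K x * v x)"
    using v K by (auto simp: locally_integrable_def set_integrable_def)
  have "integrable lebesgue (%x. (indicator K x * v x) * \<phi> x)"
  proof (rule lintegrable_bound)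
    show "integrable lebesgue (%x. B * (indicator K x * v x))" using i by simp
    show "(%x. indicator K x * v x * \<phi> x) \<in> borel_measurable lebesgue"
      by (intro borel_measurable_times borel_measurable_integrable[OF i] measurable_completion)
        (simp add: borel_measurable_continuous_onI[OF test_funD(2)[OF \<phi>]])
    have "\<bar>\<phi> x\<bar> \<le> \<bar>B\<bar>" for x using B[of x] by linarith
    then show "AE x in lebesgue. norm (indicator K x * v x * \<phi> x) \<le> norm (B * (indicator K x * v x))"
      by (intro AE_I2) (auto simp: abs_mult mult.commute[of "\<bar>B\<bar>"] intro!: mult_left_mono)
  qed
  moreover have "indicator K x * v x * \<phi> x = indicator D x *\<^sub>R (v x * \<phi> x)" for x
    using K 0[of x] by (cases "x \<in> K") auto
  ultimately show ?thesis using D by (simp add: integrable_restrict_space)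
qed

lemma lebesgue_integral_Borel_box_zero:
  fixes g :: "'a::euclidean_space => real"
  assumes g: "integrable lebesgue g" and box: "!!l u. (LINT x:box l u|lebesgue. g x) = 0" 
    and all: "integral\<^sup>L lebesgue g = 0" and A: "A \<in> sets borel"
  shows "(LINT x:A|lebesgue. g x) = 0"
proof -
  have "Int_stable (range (%(a, b). box (a::'a) b))"
    by (auto simp: Int_stable_def box_Int_box)
  moreover have "range (%(a, b). box (a::'a) b) \<subseteq> Pow UNIV" by auto
  moreover have "A \<in> sigma_sets UNIV (range (%(a, b). box a b))"
    using A unfolding borel_eq_box by simp
  ultimately show ?thesis
  proof (induction rule: sigma_sets_induct_disjoint)
    case (compl A)
    then have [measurable]: "A \<in> sets borel" by (simp add: borel_eq_box)
    have "(LINT x:UNIV - A|lebesgue. g x) = (LINT x|lebesgue. g x - indicator A x * g x)"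
      unfolding set_lebesgue_integral_def by (intro Bochner_Integration.integral_cong) (auto simp: indicator_def)
    also have "... = integral\<^sup>L lebesgue g - (LINT x:A|lebesgue. g x)"
      using g integrable_mult_indicator[of A lebesgue g] by (simp add: set_lebesgue_integral_def)
    finally show ?case using compl all by simp
  next
    case (union F)
    then have [measurable]: "!!i. F i \<in> sets borel" by (auto simp: borel_eq_box subset_eq)
    have "(LINT x:(\<Union>i. F i)|lebesgue. g x) = (\<Sum>i. LINT x:F i|lebesgue. g x)"
    proof (rule lebesgue_integral_countable_add)
      show "set_integrable lebesgue (\<Union>i. F i) g"
        unfolding set_integrable_def by (rule integrable_mult_indicator[OF _ g]) auto
    qed (use union in "auto simp: disjoint_family_on_def")
    then show ?case using union by simp
  next
    case (basic A)
    then obtain l u where "A = box l u" by auto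
    then show ?case using box by simp
  next
    case empty
    then show ?case by (simp add: set_lebesgue_integral_def)
  qed
qed

lemma sigma_finite_lebesgue: "sigma_finite_measure (lebesgue :: 'a::euclidean_space measure)"
proof
  show "\<exists>A::'a set set. countable A \<and> A \<subseteq> sets lebesgue \<and> \<Union> A = space lebesgue \<and> (\<forall>a\<in>A. emeasure lebesgue a \<noteq> \<infinity>)"
    by (rule exI[of _ "range (%n::nat. cball 0 (real n))"])
      (auto simp: less_imp_neq[OF emeasure_lborel_cball_finite[unfolded infinity_ennreal_def]] real_arch_simple)
qed

text \<open>The indicator function of the box is the pointwise limit of products of the cutoffs
  \<open>kappa\<close> in the coordinate directions, which are test functions.\<close>

lemma locally_integrable_box_zero:
  fixes g :: "'a::euclidean_space => real"
  assumes D: "open D" and g: "locally_integrable D g"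
    and 0: "!!\<phi>. test_fun D \<phi> ==> (LINT x|lebesgue_on D. g x * \<phi> x) = 0"
    and c: "cbox l u \<subseteq> D"
  shows "(LINT x:box l u|lebesgue. g x) = 0"
proof -
  define \<theta> where "\<theta> n x = (\<Prod>b\<in>Basis. kappa (real n * ((x - l) \<bullet> b)) * kappa (real n * ((u - x) \<bullet> b)))" for n x
  have sm: "smooth (\<theta> n)" for n
    unfolding \<theta>_def inner_diff_left
    by (rule smooth_prod, rule smooth_intros(4); rule smooth_kappa, rule smooth_cmult, rule smooth_diff)
      (rule smooth_intros(1,2))+
  have z: "\<theta> n x = 0" if b: "b \<in> Basis" "(x - l) \<bullet> b \<le> 0 \<or> (u - x) \<bullet> b \<le> 0" for n x b
  proof -
    have "real n * ((x - l) \<bullet> b) \<le> 0 \<or> real n * ((u - x) \<bullet> b) \<le> 0"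
      using b(2) by (meson mult_nonneg_nonpos of_nat_0_le_iff)
    then have "kappa (real n * ((x - l) \<bullet> b)) * kappa (real n * ((u - x) \<bullet> b)) = 0"
      using kappa_nonpos(1) by auto
    then show ?thesis unfolding \<theta>_def using b(1) by (intro prod_zero bexI[of _ b]) auto
  qed
  have zc: "\<theta> n x = 0" if "x \<notin> cbox l u" for n x
  proof -
    obtain b where "b \<in> Basis" "\<not> (l \<bullet> b \<le> x \<bullet> b \<and> x \<bullet> b \<le> u \<bullet> b)" using \<open>x \<notin> cbox l u\<close> unfolding mem_box by blast
    then show ?thesis by (intro z[of b]) (auto simp: inner_diff_left)
  qed
  have zb: "\<theta> n x = 0" if "x \<notin> box l u" for n x
  proof -
    obtain b where "b \<in> Basis" "\<not> (l \<bullet> b < x \<bullet> b \<and> x \<bullet> b < u \<bullet> b)" using \<open>x \<notin> box l u\<close> unfolding mem_box by blast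
    then show ?thesis by (intro z[of b]) (auto simp: inner_diff_left)
  qed
  have bd: "\<bar>\<theta> n x\<bar> \<le> 1" for n x
    unfolding \<theta>_def abs_prod
    by (rule prod_le_1) (auto simp: abs_mult kappa_bounds intro!: mult_le_one)
  have lim: "(%n. \<theta> n x) ----> indicator (box l u) x" for x
  proof (cases "x \<in> box l u")
    case True
    have k: "(%n. kappa (real n * t)) ----> 1" if "t > 0" for t
      by (rule filterlim_compose[OF kappa_at_top])
        (use that filterlim_real_sequentially in "auto intro: filterlim_at_top_mult_tendsto_pos filterlim_tendsto_pos_mult_at_top")
    have "(%n. \<theta> n x) ----> (\<Prod>b\<in>(Basis::'a set). 1 * 1)" unfolding \<theta>_def
      by (intro tendsto_prod tendsto_mult k) (use True in "auto simp: mem_box inner_diff_left")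
    then show ?thesis using True by simp
  qed (simp add: zb)
  have tf: "test_fun D (\<theta> n)" for n by (rule test_funI[OF sm compact_cbox c zc])
  have i: "integrable lebesgue (%x. indicator (cbox l u) x * g x)"
    using g c compact_cbox by (auto simp: locally_integrable_def set_integrable_def)
  have e0: "(LINT x|lebesgue. indicator (cbox l u) x * g x * \<theta> n x) = 0" for n
  proof -
    have "indicator (cbox l u) x * g x * \<theta> n x = indicator D x *\<^sub>R (g x * \<theta> n x)" for x
      using c zc[of x n] by (cases "x \<in> cbox l u") auto
    then have "(LINT x|lebesgue. indicator (cbox l u) x * g x * \<theta> n x) = (LINT x|lebesgue. indicator D x *\<^sub>R (g x * \<theta> n x))"
      by presburger
    also have "... = (LINT x|lebesgue_on D. g x * \<theta> n x)"
      using D by (subst integral_restrict_space) auto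
    finally show ?thesis using 0[OF tf] by simp
  qed
  have m: "\<theta> n \<in> borel_measurable lebesgue" for n
    by (intro measurable_completion) (simp add: borel_measurable_continuous_onI smooth_continuous[OF sm])
  have mi: "(indicator (box l u) :: 'a => real) \<in> borel_measurable lebesgue"
    by (rule borel_measurable_indicator) simp
  have "(%n. LINT x|lebesgue. indicator (cbox l u) x * g x * \<theta> n x)
     ----> (LINT x|lebesgue. indicator (cbox l u) x * g x * indicator (box l u) x)"
  proof (rule integral_dominated_convergence[where w = "%x. \<bar>indicator (cbox l u) x * g x\<bar>"])
    show "AE x in lebesgue. (%n. indicator (cbox l u) x * g x * \<theta> n x) ----> indicator (cbox l u) x * g x * indicator (box l u) x"
      by (rule AE_I2) (rule tendsto_mult_left[OF lim])
    show "AE x in lebesgue. norm (indicator (cbox l u) x * g x * \<theta> n x) \<le> \<bar>indicator (cbox l u) x * g x\<bar>" for n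
    proof (rule AE_I2)
      fix x show "norm (indicator (cbox l u) x * g x * \<theta> n x) \<le> \<bar>indicator (cbox l u) x * g x\<bar>"
        unfolding real_norm_def abs_mult[of _ "\<theta> n x"] by (rule mult_right_le_one_le) (use bd in auto)
    qed
    show "integrable lebesgue (%x. \<bar>indicator (cbox l u) x * g x\<bar>)" using i by (rule integrable_abs)
    show "(%x. indicator (cbox l u) x * g x * \<theta> n x) \<in> borel_measurable lebesgue" for n
      by (rule borel_measurable_times[OF borel_measurable_integrable[OF i] m])
    show "(%x. indicator (cbox l u) x * g x * indicator (box l u) x) \<in> borel_measurable lebesgue"
      by (rule borel_measurable_times[OF borel_measurable_integrable[OF i] mi])
  qed
  then have "(%n. 0) ----> (LINT x|lebesgue. indicator (cbox l u) x * g x * indicator (box l u) x)"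
    unfolding e0 .
  then have "(LINT x|lebesgue. indicator (cbox l u) x * g x * indicator (box l u) x) = 0"
    by (rule LIMSEQ_unique[OF _ tendsto_const])
  moreover have "indicator (cbox l u) x * g x * indicator (box l u) x = indicator (box l u) x *\<^sub>R g x" for x
    using box_subset_cbox[of l u] by (auto simp: indicator_def)
  ultimately show ?thesis by (simp add: set_lebesgue_integral_def)
qed

text \<open>The fundamental lemma of the calculus of variations. The boxes generate the Borel sets, so
  \<open>g\<close> has integral zero over every Borel set inside a compact part of \<open>D\<close>.\<close>

lemma fundamental_lemma:
  fixes g :: "'a::euclidean_space => real"
  assumes D: "open D" and g: "locally_integrable D g"
    and 0: "!!\<phi>. test_fun D \<phi> ==> (LINT x|lebesgue_on D. g x * \<phi> x) = 0"
  shows "AE x in lebesgue_on D. g x = 0"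
proof -
  have cb: "AE x in lebesgue. x \<in> cbox l u --> g x = 0" if c: "cbox l u \<subseteq> D" for l u
  proof -
    let ?f = "%x. indicator (box l u) x *\<^sub>R g x"
    have i: "integrable lebesgue ?f"
    proof -
      have "integrable lebesgue (%x. indicator (cbox l u) x *\<^sub>R g x)"
        using g c compact_cbox by (auto simp: locally_integrable_def set_integrable_def)
      then have "integrable lebesgue (%x. indicator (box l u) x *\<^sub>R indicator (cbox l u) x *\<^sub>R g x)"
        by (rule integrable_mult_indicator[rotated]) auto
      moreover have "indicator (box l u) x *\<^sub>R indicator (cbox l u) x *\<^sub>R g x = ?f x" for x
        using box_subset_cbox[of l u] by (auto simp: indicator_def)
      ultimately show ?thesis by (simp only:)
    qed
    have bx: "(LINT x:box a b|lebesgue. ?f x) = 0" for a b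
    proof -
      obtain a' b' where ab: "box l u \<inter> box a b = box a' b'" by (rule that[OF box_Int_box])
      have "(LINT x:box a b|lebesgue. ?f x) = (LINT x:box a' b'|lebesgue. g x)"
        unfolding set_lebesgue_integral_def ab[symmetric]
        by (intro Bochner_Integration.integral_cong) (auto simp: indicator_def)
      also have "... = 0"
      proof (cases "box a' b' = {}")
        case False
        then have "cbox a' b' = closure (box a' b')" by simp
        also have "... \<subseteq> cbox l u"
          using ab box_subset_cbox[of l u] by (intro closure_minimal) auto
        finally have "cbox a' b' \<subseteq> D" using c by blast
        from locally_integrable_box_zero[OF D g 0 this] show ?thesis by simp
      qed (simp add: set_lebesgue_integral_def)
      finally show ?thesis .
    qed
    have all: "integral\<^sup>L lebesgue ?f = 0"
      using locally_integrable_box_zero[OF D g 0 c] by (simp add: set_lebesgue_integral_def)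
    have "AE x in lebesgue. ?f x = 0"
    proof (rule sigma_finite_measure.density_zero[OF sigma_finite_lebesgue i])
      fix A :: "'a set" assume "A \<in> sets lebesgue"
      then obtain C T where CT: "fsigma C" "T \<in> null_sets lebesgue" "C \<union> T = A"
        by (rule lebesgue_set_almost_fsigma)
      have C: "C \<in> sets borel" 
        using CT(1) by cases (auto intro!: borel_closed)
      have T: "AE x in lebesgue. x \<notin> T" 
        using CT(2) by (rule AE_not_in)
      have "(LINT x:A|lebesgue. ?f x) = (LINT x:C|lebesgue. ?f x)"
        unfolding set_lebesgue_integral_def
      proof (rule integral_cong_AE)
        show "AE x in lebesgue. indicator A x *\<^sub>R ?f x = indicator C x *\<^sub>R ?f x"
          using T by eventually_elim (use CT(3) in "auto simp: indicator_def")
        show "(%x. indicator A x *\<^sub>R ?f x) \<in> borel_measurable lebesgue"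
          by (intro borel_measurable_integrable integrable_mult_indicator[OF _ i]) fact
        show "(%x. indicator C x *\<^sub>R ?f x) \<in> borel_measurable lebesgue"
          by (intro borel_measurable_integrable integrable_mult_indicator[OF _ i]) (use C in auto)
      qed
      also have "... = 0" by (rule lebesgue_integral_Borel_box_zero[OF i bx all C])
      finally show "(LINT x:A|lebesgue. ?f x) = 0" .
    qed
    moreover have "AE x in lebesgue. x \<notin> cbox l u - box l u"
      by (intro AE_not_in negligible_frontier_interval[unfolded negligible_iff_null_sets])
    ultimately show ?thesis by eventually_elim (auto simp: indicator_def)
  qed
  obtain \<D> where \<D>: "countable \<D>" "\<D> \<subseteq> Pow D" "!!X. X \<in> \<D> ==> \<exists>a b. X = cbox a b" "\<Union>\<D> = D"
    by (rule open_countable_Union_open_cbox[OF D]) blast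
  have "AE x in lebesgue. \<forall>X\<in>\<D>. x \<in> X --> g x = 0"
    by (subst AE_ball_countable[OF \<D>(1)]) (use cb \<D>(2,3) in blast)
  then have "AE x in lebesgue. x \<in> D --> g x = 0"
    by eventually_elim (use \<D>(4) in auto)
  then show ?thesis using D by (subst AE_restrict_space_iff) auto
qed

lemma borel_measurable_lebesgue_on_AE:
  fixes f g :: "'a::euclidean_space => 'b::euclidean_space"
  assumes D: "D \<in> sets lebesgue" and g: "g \<in> borel_measurable (lebesgue_on D)"
    and ae: "AE x in lebesgue_on D. g x = f x"
  shows "f \<in> borel_measurable (lebesgue_on D)"
proof -
  have "AE x in lebesgue. x \<in> D --> g x = f x"
    using ae D by (subst (asm) AE_restrict_space_iff) auto
  then have "AE x in lebesgue. indicator D x *\<^sub>R g x = indicator D x *\<^sub>R f x"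
    by eventually_elim (auto simp: indicator_def)
  then show ?thesis
    using D g borel_measurable_AE[of "%x. indicator D x *\<^sub>R g x" "%x. indicator D x *\<^sub>R f x"]
    by (simp add: borel_measurable_restrict_space_iff)
qed

lemma has_weak_gradient_iff:
  "has_weak_gradient D v G \<longleftrightarrow> locally_integrable D v \<and> locally_integrable D G \<and>
     (\<forall>\<phi>. test_fun D \<phi> --> (\<forall>i\<in>Basis.
        (LINT x|lebesgue_on D. v x * partial i \<phi> x) = - (LINT x|lebesgue_on D. (G x \<bullet> i) * \<phi> x)))"
  unfolding has_weak_gradient_def locally_integrable_def by blast

lemma locally_integrable_inner: "locally_integrable D G ==> locally_integrable D (%x. G x \<bullet> i)"
  unfolding locally_integrable_def set_integrable_def
  by (auto dest!: spec intro!: integrable_inner_left simp flip: inner_scaleR_left)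

lemma locally_integrable_add_scale:
  "locally_integrable D v ==> locally_integrable D w ==> locally_integrable D (%x. v x + c *\<^sub>R w x)"
  unfolding locally_integrable_def by (auto intro!: set_integral_add set_integrable_scaleR_right)

lemma has_weak_gradient_add_scale:
  fixes v w :: "'a::euclidean_space => real"
  assumes D: "open D" and v: "has_weak_gradient D v G" and w: "has_weak_gradient D w H"
  shows "has_weak_gradient D (%x. v x + c * w x) (%x. G x + c *\<^sub>R H x)"
  unfolding has_weak_gradient_iff
proof (intro conjI allI impI ballI)
  have l: "locally_integrable D v" "locally_integrable D G" "locally_integrable D w" "locally_integrable D H"
    using v w by (auto simp: has_weak_gradient_iff)
  show "locally_integrable D (%x. v x + c * w x)"
    using locally_integrable_add_scale[OF l(1,3), of c] by simp
  show "locally_integrable D (%x. G x + c *\<^sub>R H x)"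
    using locally_integrable_add_scale[OF l(2,4)] .
  fix \<phi> :: "'a => real" and i :: 'a assume t: "test_fun D \<phi>" and i: "i \<in> Basis"
  note a = locally_integrable_mult_test[OF D l(1) test_fun_partial[OF t i]]
    locally_integrable_mult_test[OF D l(3) test_fun_partial[OF t i]]
    locally_integrable_mult_test[OF D locally_integrable_inner[OF l(2)] t, of i]
    locally_integrable_mult_test[OF D locally_integrable_inner[OF l(4)] t, of i]
  have e: "(LINT x|lebesgue_on D. v x * partial i \<phi> x) = - (LINT x|lebesgue_on D. (G x \<bullet> i) * \<phi> x)"
    "(LINT x|lebesgue_on D. w x * partial i \<phi> x) = - (LINT x|lebesgue_on D. (H x \<bullet> i) * \<phi> x)"
    using v w t i by (auto simp: has_weak_gradient_iff)
  have "(LINT x|lebesgue_on D. (v x + c * w x) * partial i \<phi> x)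
     = (LINT x|lebesgue_on D. v x * partial i \<phi> x + c * (w x * partial i \<phi> x))"
    by (simp add: algebra_simps)
  also have "... = - ((LINT x|lebesgue_on D. (G x \<bullet> i) * \<phi> x) + c * (LINT x|lebesgue_on D. (H x \<bullet> i) * \<phi> x))"
    using a by (simp add: e)
  also have "... = - (LINT x|lebesgue_on D. (G x \<bullet> i) * \<phi> x + c * ((H x \<bullet> i) * \<phi> x))"
    using a by simp
  also have "... = - (LINT x|lebesgue_on D. ((G x + c *\<^sub>R H x) \<bullet> i) * \<phi> x)"
    by (simp add: algebra_simps)
  finally show "(LINT x|lebesgue_on D. (v x + c * w x) * partial i \<phi> x)
     = - (LINT x|lebesgue_on D. ((G x + c *\<^sub>R H x) \<bullet> i) * \<phi> x)" .
qed

text \<open>The difference of two weak gradients is orthogonal to all test functions.\<close>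

lemma weak_gradient_unique:
  fixes v :: "'a::euclidean_space => real"
  assumes D: "open D" and G: "has_weak_gradient D v G" and H: "has_weak_gradient D v H"
  shows "AE x in lebesgue_on D. G x = H x"
proof -
  have "has_weak_gradient D (%x. v x + (-1) * v x) (%x. G x + (-1) *\<^sub>R H x)"
    by (rule has_weak_gradient_add_scale[OF D G H])
  then have Z: "has_weak_gradient D (%x. 0) (%x. G x - H x)" by simp
  have "AE x in lebesgue_on D. (G x - H x) \<bullet> i = 0" if "i \<in> Basis" for i
  proof (rule fundamental_lemma[OF D])
    show "locally_integrable D (%x. (G x - H x) \<bullet> i)"
      using Z locally_integrable_inner unfolding has_weak_gradient_iff by blast
    show "(LINT x|lebesgue_on D. ((G x - H x) \<bullet> i) * \<phi> x) = 0" if "test_fun D \<phi>" for \<phi>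
      using Z that \<open>i \<in> Basis\<close> unfolding has_weak_gradient_iff by fastforce
  qed
  then have "AE x in lebesgue_on D. \<forall>i\<in>Basis. (G x - H x) \<bullet> i = 0"
    by (subst AE_finite_all) auto
  then show ?thesis
  proof eventually_elim
    case (elim x)
    show ?case by (rule euclidean_eqI) (use elim in "simp add: inner_diff_left")
  qed
qed

lemma has_weak_gradient_cong:
  assumes "D \<in> sets lebesgue" "!!x. x \<in> D ==> v x = v' x" "!!x. x \<in> D ==> G x = G' x" "has_weak_gradient D v G"
  shows "has_weak_gradient D v' G'"
proof -
  have c: "(LINT x|lebesgue_on D. v' x * k x) = (LINT x|lebesgue_on D. v x * k x)"
     "(LINT x|lebesgue_on D. (G' x \<bullet> i) * k x) = (LINT x|lebesgue_on D. (G x \<bullet> i) * k x)" for k i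
    by (intro Bochner_Integration.integral_cong; use assms(2,3) in simp)+
  have "v' absolutely_integrable_on K \<longleftrightarrow> v absolutely_integrable_on K"
    "G' absolutely_integrable_on K \<longleftrightarrow> G absolutely_integrable_on K" if "K \<subseteq> D" for K
    by (intro set_integrable_cong; use assms(2,3) that in auto)+
  then have "locally_integrable D v' = locally_integrable D v" "locally_integrable D G' = locally_integrable D G"
    unfolding locally_integrable_def by metis+
  then show ?thesis using assms(4) unfolding has_weak_gradient_iff by (simp add: c)
qed

lemma has_weak_gradient_C1:
  fixes v :: "'a::euclidean_space => real"
  assumes D: "open D" and v: "!!x. (v has_derivative v' x) (at x)"
    and c: "!!i. i \<in> Basis ==> continuous_on UNIV (%x. v' x i)"
  shows "has_weak_gradient D v (%x. \<Sum>i\<in>Basis. v' x i *\<^sub>R i)"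
  unfolding has_weak_gradient_iff
proof (intro conjI allI impI ballI)
  have vc: "continuous_on S v" for S
    using v has_derivative_continuous continuous_at_imp_continuous_on by metis
  show "locally_integrable D v" by (rule continuous_imp_locally_integrable[OF vc])
  have c': "continuous_on D (%x. v' x i)" if "i \<in> Basis" for i
    using c[OF that] continuous_on_subset by blast
  show "locally_integrable D (%x. \<Sum>i\<in>Basis. v' x i *\<^sub>R i)"
    by (rule continuous_imp_locally_integrable) (intro continuous_intros c')
  fix \<phi> :: "'a => real" and i :: 'a assume t: "test_fun D \<phi>" and i: "i \<in> Basis"
  note a = locally_integrable_mult_test[OF D continuous_imp_locally_integrable[OF vc] test_fun_partial[OF t i]]
    locally_integrable_mult_test[OF D continuous_imp_locally_integrable[OF c'[OF i]] t]
  have \<phi>: "(\<phi> has_derivative frechet_derivative \<phi> (at x)) (at x)" for x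
    by (rule smooth_has_derivative[OF test_funD(1)[OF t]])
  obtain R where R: "\<forall>x. x \<notin> cball 0 R --> \<phi> x = 0" using test_funD(4)[OF t] by metis
  let ?F = "%x. v x * partial i \<phi> x + v' x i * \<phi> x"
  have F: "continuous_on UNIV ?F"
    by (intro continuous_intros vc c i smooth_continuous[OF smooth_partial[OF test_funD(1)[OF t] i]] test_funD(2)[OF t])
  have "integral\<^sup>L lborel ?F = 0"
    by (rule integral_directional_derivative_eq_0[OF has_derivative_mult[OF v \<phi>] F, of R]) (use R in simp)
  moreover have "integral\<^sup>L (lebesgue_on D) ?F = integral\<^sup>L lborel ?F"
  proof (rule lebesgue_on_eq_lborel(1))
    show "?F \<in> borel_measurable borel" by (rule borel_measurable_continuous_onI[OF F])
    show "D \<in> sets borel" using D by simp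
    show "?F x = 0" if "x \<notin> D" for x
      using test_funD(3)[OF t that] test_funD(3)[OF test_fun_partial[OF t i] that] by simp
  qed
  ultimately have "(LINT x|lebesgue_on D. v x * partial i \<phi> x) = - (LINT x|lebesgue_on D. v' x i * \<phi> x)"
    using a by simp
  then show "(LINT x|lebesgue_on D. v x * partial i \<phi> x) = - (LINT x|lebesgue_on D. ((\<Sum>i\<in>Basis. v' x i *\<^sub>R i) \<bullet> i) * \<phi> x)"
    using i by (simp add: inner_sum_left_Basis)
qed

definition grad :: "('a::euclidean_space => real) => 'a => 'a" where
  "grad \<phi> x = (\<Sum>i\<in>Basis. partial i \<phi> x *\<^sub>R i)"

lemma grad_inner_Basis: "i \<in> Basis ==> grad \<phi> x \<bullet> i = partial i \<phi> x"
  by (simp add: grad_def inner_sum_left_Basis)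

lemma has_weak_gradient_smooth:
  assumes "open D" "smooth \<phi>"
  shows "has_weak_gradient D \<phi> (grad \<phi>)"
proof -
  have "has_weak_gradient D \<phi> (%x. \<Sum>i\<in>Basis. partial i \<phi> x *\<^sub>R i)"
  proof (rule has_weak_gradient_C1[OF assms(1)])
    show "(\<phi> has_derivative frechet_derivative \<phi> (at x)) (at x)" for x
      by (rule smooth_has_derivative[OF assms(2)])
    show "continuous_on UNIV (partial i \<phi>)" if "i \<in> Basis" for i
      by (rule smooth_continuous[OF smooth_partial[OF assms(2) that]])
  qed
  then show ?thesis by (simp only: grad_def[abs_def])
qed

lemma continuous_grad: "smooth \<phi> ==> continuous_on S (grad \<phi>)"
  unfolding grad_def[abs_def]
  by (rule continuous_on_sum, rule continuous_on_scaleR, rule smooth_continuous, rule smooth_partial)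
    (simp_all add: continuous_on_const)

section \<open>Square integrable functions\<close>

lemma L2_on_measurable: "L2_on D v ==> v \<in> borel_measurable (lebesgue_on D)"
  by (simp add: L2_on_def)

lemma L2_on_square: "L2_on D v ==> integrable (lebesgue_on D) (%x. (norm (v x))^2)"
  by (simp add: L2_on_def)

lemma L2_onI_bound:
  assumes "v \<in> borel_measurable (lebesgue_on D)" "integrable (lebesgue_on D) f"
    "AE x in lebesgue_on D. (norm (v x))^2 \<le> f x"
  shows "L2_on D v"
  unfolding L2_on_def
proof
  show "v \<in> borel_measurable (lebesgue_on D)" by fact
  show "integrable (lebesgue_on D) (%x. (norm (v x))^2)"
  proof (rule lintegrable_bound[OF assms(2)])
    show "(%x. (norm (v x))^2) \<in> borel_measurable (lebesgue_on D)" using assms(1) by measurable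
    show "AE x in lebesgue_on D. norm ((norm (v x))^2) \<le> norm (f x)"
      using assms(3)
    proof eventually_elim
      case (elim x)
      then have "(norm (v x))^2 \<le> \<bar>f x\<bar>" by linarith
      then show ?case by simp
    qed
  qed
qed

lemma norm_add_scale_square:
  fixes a b :: "'b::real_inner"
  shows "(norm (a + c *\<^sub>R b))^2 \<le> 2 * (norm a)^2 + 2 * c^2 * (norm b)^2"
proof -
  have "(norm (a + c *\<^sub>R b))^2 + (norm (a - c *\<^sub>R b))^2 = 2 * (norm a)^2 + 2 * c^2 * (norm b)^2"
    unfolding power2_norm_eq_inner
    by (simp add: inner_add_left inner_add_right inner_diff_left inner_diff_right
      algebra_simps power2_eq_square inner_commute)
  moreover have "0 \<le> (norm (a - c *\<^sub>R b))^2" by simp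
  ultimately show ?thesis by linarith
qed

lemma L2_on_add_scale:
  assumes "L2_on D v" "L2_on D w"
  shows "L2_on D (%x. v x + c *\<^sub>R w x)"
proof (rule L2_onI_bound)
  show "(%x. v x + c *\<^sub>R w x) \<in> borel_measurable (lebesgue_on D)"
    using assms[THEN L2_on_measurable] by measurable
  show "integrable (lebesgue_on D) (%x. 2 * (norm (v x))^2 + 2 * c^2 * (norm (w x))^2)"
    using assms[THEN L2_on_square] by simp
qed (simp add: norm_add_scale_square)

lemma L2_on_AE_cong:
  assumes D: "D \<in> sets lebesgue" and v: "L2_on D v" and ae: "AE x in lebesgue_on D. v x = w x"
  shows "L2_on D w"
proof (rule L2_onI_bound)
  show "w \<in> borel_measurable (lebesgue_on D)"
    by (rule borel_measurable_lebesgue_on_AE[OF D L2_on_measurable[OF v] ae])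
  show "integrable (lebesgue_on D) (%x. (norm (v x))^2)" by (rule L2_on_square[OF v])
  show "AE x in lebesgue_on D. (norm (w x))^2 \<le> (norm (v x))^2" using ae by eventually_elim simp
qed

lemma L2_inner_integrable:
  assumes "L2_on D v" "L2_on D w"
  shows "integrable (lebesgue_on D) (%x. v x \<bullet> w x)"
proof (rule lintegrable_bound)
  show "integrable (lebesgue_on D) (%x. (norm (v x))^2 + (norm (w x))^2)"
    using assms[THEN L2_on_square] by simp
  show "(%x. v x \<bullet> w x) \<in> borel_measurable (lebesgue_on D)"
    using assms[THEN L2_on_measurable] by measurable
  show "AE x in lebesgue_on D. norm (v x \<bullet> w x) \<le> norm ((norm (v x))^2 + (norm (w x))^2)"
  proof (rule AE_I2)
    fix x
    have "\<bar>v x \<bullet> w x\<bar> \<le> norm (v x) * norm (w x)" by (rule Cauchy_Schwarz_ineq2)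
    also have "... \<le> (norm (v x))^2 + (norm (w x))^2"
    proof -
      have "0 \<le> norm (v x) * norm (w x)" by simp
      then show ?thesis using sum_squares_bound[of "norm (v x)" "norm (w x)"] by linarith
    qed
    finally show "norm (v x \<bullet> w x) \<le> norm ((norm (v x))^2 + (norm (w x))^2)" by simp
  qed
qed

lemma L2_inner_commute: "L2_inner D v w = L2_inner D w v"
  by (simp add: L2_inner_def inner_commute)

lemma L2_inner_nonneg: "0 \<le> L2_inner D v v"
  by (simp add: L2_inner_def)

lemma L2_inner_add_scale:
  assumes "L2_on D v" "L2_on D w" "L2_on D z"
  shows "L2_inner D (%x. v x + c *\<^sub>R w x) z = L2_inner D v z + c * L2_inner D w z"
  using L2_inner_integrable[OF assms(1,3)] L2_inner_integrable[OF assms(2,3)]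
  by (simp add: L2_inner_def inner_add_left)

lemma L2_inner_cong_AE:
  assumes "L2_on D v" "L2_on D v'" "L2_on D w" "L2_on D w'"
    "AE x in lebesgue_on D. v x = v' x" "AE x in lebesgue_on D. w x = w' x"
  shows "L2_inner D v w = L2_inner D v' w'"
  unfolding L2_inner_def
proof (rule integral_cong_AE)
  show "AE x in lebesgue_on D. v x \<bullet> w x = v' x \<bullet> w' x" using assms(5,6) by eventually_elim simp
qed (use assms(1-4)[THEN L2_on_measurable] in measurable)

definition L2_norm :: "'a::euclidean_space set => ('a => 'b::euclidean_space) => real" where
  "L2_norm D v = sqrt (L2_inner D v v)"

abbreviation L2_lim :: "'a::euclidean_space set => (nat => 'a => 'b::euclidean_space) => ('a => 'b) => bool" where
  "L2_lim D w v \<equiv> (%n. L2_norm D (%x. w n x - v x)) ----> 0"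

lemma L2_norm_nonneg: "0 \<le> L2_norm D v" by (simp add: L2_norm_def L2_inner_nonneg)

lemma L2_norm_square: "(L2_norm D v)^2 = L2_inner D v v"
  by (simp add: L2_norm_def L2_inner_nonneg)

lemma L2_norm_square_integral: "(L2_norm D v)^2 = (LINT x|lebesgue_on D. (norm (v x))^2)"
  by (simp add: L2_norm_square L2_inner_def power2_norm_eq_inner)

lemma L2_Cauchy_Schwarz:
  assumes "L2_on D v" "L2_on D w"
  shows "\<bar>L2_inner D v w\<bar> \<le> L2_norm D v * L2_norm D w"
proof -
  let ?a = "L2_inner D v v" and ?b = "L2_inner D v w" and ?c = "L2_inner D w w"
  have q: "0 \<le> ?a + 2 * t * ?b + t^2 * ?c" for t
  proof -
    let ?z = "%x. v x + t *\<^sub>R w x"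
    have z: "L2_on D ?z" by (rule L2_on_add_scale[OF assms])
    have "L2_inner D ?z ?z = L2_inner D v ?z + t * L2_inner D w ?z"
      by (rule L2_inner_add_scale[OF assms z])
    also have "... = ?a + 2 * t * ?b + t^2 * ?c"
      using L2_inner_add_scale[OF assms assms(1), of t] L2_inner_add_scale[OF assms assms(2), of t]
      by (simp add: L2_inner_commute[of D v ?z] L2_inner_commute[of D w ?z] L2_inner_commute[of D w v]
        power2_eq_square algebra_simps)
    finally show ?thesis using L2_inner_nonneg[of D ?z] by simp
  qed
  have "?b^2 \<le> ?a * ?c"
  proof (cases "?c = 0")
    case True
    have "?b = 0"
    proof (rule ccontr)
      assume b: "?b \<noteq> 0"
      have "2 * (- (?a + 1) / (2 * ?b)) * ?b = - (?a + 1)" using b by (simp add: field_simps)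
      then show False using q[of "- (?a + 1) / (2 * ?b)"] True by simp
    qed
    then show ?thesis using True by simp
  next
    case False
    then have c: "?c > 0" using L2_inner_nonneg[of D w] by linarith
    have "?a + 2 * (- ?b / ?c) * ?b + (- ?b / ?c)^2 * ?c = ?a - ?b^2 / ?c"
      using c by (simp add: power2_eq_square field_simps)
    then have "?b^2 / ?c \<le> ?a" using q[of "- ?b / ?c"] by simp
    then show ?thesis using c by (simp add: field_simps)
  qed
  then have "\<bar>?b\<bar>^2 \<le> (L2_norm D v * L2_norm D w)^2" by (simp add: power_mult_distrib L2_norm_square)
  then show ?thesis by (rule power2_le_imp_le) (simp add: L2_norm_nonneg)
qed

lemma L2_norm_triangle:
  assumes "L2_on D v" "L2_on D w"
  shows "L2_norm D (%x. v x + c *\<^sub>R w x) \<le> L2_norm D v + \<bar>c\<bar> * L2_norm D w"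
proof -
  let ?z = "%x. v x + c *\<^sub>R w x"
  have z: "L2_on D ?z" by (rule L2_on_add_scale[OF assms])
  have "(L2_norm D ?z)^2 = L2_inner D v ?z + c * L2_inner D w ?z"
    unfolding L2_norm_square by (rule L2_inner_add_scale[OF assms z])
  also have "... \<le> L2_norm D v * L2_norm D ?z + \<bar>c\<bar> * (L2_norm D w * L2_norm D ?z)"
  proof (rule add_mono)
    show "L2_inner D v ?z \<le> L2_norm D v * L2_norm D ?z" using L2_Cauchy_Schwarz[OF assms(1) z] by linarith
    have "c * L2_inner D w ?z \<le> \<bar>c\<bar> * \<bar>L2_inner D w ?z\<bar>" by (metis abs_ge_self abs_mult)
    also have "... \<le> \<bar>c\<bar> * (L2_norm D w * L2_norm D ?z)"
      by (intro mult_left_mono L2_Cauchy_Schwarz[OF assms(2) z]) simp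
    finally show "c * L2_inner D w ?z \<le> \<bar>c\<bar> * (L2_norm D w * L2_norm D ?z)" .
  qed
  finally have "L2_norm D ?z * L2_norm D ?z \<le> (L2_norm D v + \<bar>c\<bar> * L2_norm D w) * L2_norm D ?z"
    by (simp add: power2_eq_square algebra_simps)
  then show ?thesis
    using L2_norm_nonneg[of D ?z] L2_norm_nonneg[of D v] L2_norm_nonneg[of D w]
    by (cases "L2_norm D ?z = 0") (auto simp: mult_le_cancel_right)
qed

lemma L2_norm_diff:
  assumes "L2_on D v" "L2_on D w"
  shows "L2_on D (%x. v x - w x)" "L2_norm D (%x. v x - w x) \<le> L2_norm D v + L2_norm D w"
  using L2_on_add_scale[OF assms, of "-1"] L2_norm_triangle[OF assms, of "-1"] by simp_all

lemma L2_norm_zero_AE: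
  assumes "L2_on D v" "L2_norm D v = 0" shows "AE x in lebesgue_on D. v x = 0"
proof -
  have "(LINT x|lebesgue_on D. (norm (v x))^2) = 0" using assms(2) L2_norm_square_integral[of D v] by simp
  then have "AE x in lebesgue_on D. (norm (v x))^2 = 0"
    by (subst (asm) integral_nonneg_eq_0_iff_AE[OF L2_on_square[OF assms(1)]]) auto
  then show ?thesis by eventually_elim simp
qed

lemma L2_norm_mono:
  assumes "L2_on D w" "v \<in> borel_measurable (lebesgue_on D)"
    "AE x in lebesgue_on D. norm (v x) \<le> norm (w x)"
  shows "L2_on D v" "L2_norm D v \<le> L2_norm D w"
proof -
  have ae: "AE x in lebesgue_on D. (norm (v x))^2 \<le> (norm (w x))^2"
    using assms(3) by eventually_elim (simp add: power_mono)
  show v: "L2_on D v" by (rule L2_onI_bound[OF assms(2) L2_on_square[OF assms(1)] ae])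
  have "(L2_norm D v)^2 \<le> (L2_norm D w)^2"
    unfolding L2_norm_square_integral
    by (rule integral_mono_AE[OF L2_on_square[OF v] L2_on_square[OF assms(1)] ae])
  then show "L2_norm D v \<le> L2_norm D w" by (rule power2_le_imp_le) (rule L2_norm_nonneg)
qed

lemma L2_norm_cong_AE:
  assumes "L2_on D v" "L2_on D w" "AE x in lebesgue_on D. v x = w x"
  shows "L2_norm D v = L2_norm D w"
  unfolding L2_norm_def by (simp add: L2_inner_cong_AE[OF assms(1,2,1,2,3,3)])

lemma L2_norm_scale: "L2_norm D (%x. c *\<^sub>R v x) = \<bar>c\<bar> * L2_norm D v"
proof -
  have "L2_inner D (%x. c *\<^sub>R v x) (%x. c *\<^sub>R v x) = c^2 * L2_inner D v v"
    by (simp add: L2_inner_def power2_eq_square mult.assoc)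
  then show ?thesis by (simp add: L2_norm_def real_sqrt_mult)
qed

lemma L2_norm_tendsto:
  assumes "!!n. L2_on D (w n)" "L2_on D v" "L2_lim D w v" "L2_on D z"
  shows "(%n. L2_inner D (w n) z) ----> L2_inner D v z"
proof (rule Lim_null[THEN iffD2], rule Lim_null_comparison)
  have "\<bar>L2_inner D (w n) z - L2_inner D v z\<bar> \<le> L2_norm D (%x. w n x - v x) * L2_norm D z" for n
    using L2_inner_add_scale[OF assms(1)[of n] assms(2) assms(4), of "-1"]
      L2_Cauchy_Schwarz[OF L2_norm_diff(1)[OF assms(1)[of n] assms(2)] assms(4)] by simp
  then show "\<forall>\<^sub>F n in sequentially. norm (L2_inner D (w n) z - L2_inner D v z) \<le> L2_norm D (%x. w n x - v x) * L2_norm D z"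
    by simp
  show "(%n. L2_norm D (%x. w n x - v x) * L2_norm D z) ----> 0"
    using tendsto_mult_right[OF assms(3), of "L2_norm D z"] by simp
qed

lemma L2_norm_abs_diff:
  assumes "L2_on D v" "L2_on D w"
  shows "\<bar>L2_norm D v - L2_norm D w\<bar> \<le> L2_norm D (%x. v x - w x)"
proof -
  note d = L2_norm_diff(1)[OF assms]
  have "L2_norm D v \<le> L2_norm D w + L2_norm D (%x. v x - w x)"
    using L2_norm_triangle[OF assms(2) d, of 1] by simp
  moreover have "L2_norm D w \<le> L2_norm D v + L2_norm D (%x. v x - w x)"
    using L2_norm_triangle[OF assms(1) d, of "-1"] by simp
  ultimately show ?thesis by linarith
qed

lemma L2_norm_tendsto_norm:
  assumes "!!n. L2_on D (w n)" "L2_on D v" "L2_lim D w v"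
  shows "(%n. L2_norm D (w n)) ----> L2_norm D v"
  by (rule Lim_null[THEN iffD2], rule Lim_null_comparison[OF _ assms(3)])
    (simp add: L2_norm_abs_diff[OF assms(1,2)])

text \<open>Convergence in \<open>L\<^sup>2\<close> gives convergence of the integrals of the squares, hence
  almost everywhere convergence along a subsequence.\<close>

lemma L2_subseq_AE:
  assumes "!!n. L2_on D (w n)" "L2_on D v" "L2_lim D w v"
  shows "\<exists>r::nat => nat. strict_mono r \<and> (AE x in lebesgue_on D. (%n. w (r n) x) ----> v x)"
proof -
  let ?u = "%n x. (norm (w n x - v x))^2"
  have i: "integrable (lebesgue_on D) (?u n)" for n by (rule L2_on_square[OF L2_norm_diff(1)[OF assms(1,2)]])
  have e: "(LINT x|lebesgue_on D. norm (?u n x)) = (L2_norm D (%x. w n x - v x))^2" for n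
    by (simp add: L2_norm_square_integral)
  have "(%n. (LINT x|lebesgue_on D. norm (?u n x))) ----> 0"
    unfolding e using tendsto_power[OF assms(3), of 2] by simp
  from tendsto_L1_AE_subseq[OF i this] obtain r where r: "strict_mono r"
    "AE x in lebesgue_on D. (%n. ?u (r n) x) ----> 0" by blast
  have "AE x in lebesgue_on D. (%n. w (r n) x) ----> v x"
    using r(2)
  proof eventually_elim
    case (elim x)
    then have "(%n. sqrt (?u (r n) x)) ----> sqrt 0" by (rule tendsto_real_sqrt)
    then have "(%n. norm (w (r n) x - v x)) ----> 0" by simp
    then show ?case by (simp add: LIM_zero_iff tendsto_norm_zero_iff)
  qed
  then show ?thesis using r(1) by blast
qed

lemma L2_bounded_integrable:
  assumes D: "open D" "bounded D" and v: "L2_on D v"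
  shows "integrable (lebesgue_on D) v"
proof (rule lintegrable_bound)
  interpret finite_measure "lebesgue_on D"
    by (intro finite_measure_lebesgue_on lmeasurable_open D)
  show "integrable (lebesgue_on D) (%x. 1 + (norm (v x))^2)" using L2_on_square[OF v] by simp
  show "v \<in> borel_measurable (lebesgue_on D)" by (rule L2_on_measurable[OF v])
  show "AE x in lebesgue_on D. norm (v x) \<le> norm (1 + (norm (v x))^2)"
  proof (rule AE_I2)
    fix x
    have "2 * norm (v x) * 1 \<le> (norm (v x))^2 + 1^2" by (rule sum_squares_bound)
    then have "norm (v x) \<le> 1 + (norm (v x))^2" using norm_ge_zero[of "v x"] by (simp del: norm_ge_zero)
    also have "... \<le> norm (1 + (norm (v x))^2)" by simp
    finally show "norm (v x) \<le> norm (1 + (norm (v x))^2)" .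
  qed
qed

lemma bounded_L2_on:
  fixes v :: "'a::euclidean_space => 'b::euclidean_space"
  assumes D: "open D" "bounded D" and v: "v \<in> borel_measurable (lebesgue_on D)" "!!x. x \<in> D ==> norm (v x) \<le> B"
  shows "L2_on D v"
proof (rule L2_onI_bound[OF v(1)])
  interpret finite_measure "lebesgue_on D"
    by (intro finite_measure_lebesgue_on lmeasurable_open D)
  show "integrable (lebesgue_on D) (%x. B^2)" by simp
  show "AE x in lebesgue_on D. (norm (v x))^2 \<le> B^2"
    by (rule AE_I2) (use v(2) in "auto intro!: power_mono")
qed

lemma continuous_L2_on:
  fixes v :: "'a::euclidean_space => 'b::euclidean_space"
  assumes D: "open D" "bounded D" and v: "continuous_on (closure D) v"
  shows "L2_on D v"
proof -
  have "compact (v ` closure D)"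
    using D(2) v by (intro compact_continuous_image) (simp_all add: compact_closure)
  then obtain B where "\<forall>y\<in>v ` closure D. norm y \<le> B" using compact_imp_bounded bounded_iff by metis
  moreover have "v \<in> borel_measurable (lebesgue_on D)"
    by (rule continuous_imp_measurable_on_sets_lebesgue)
      (use D(1) continuous_on_subset[OF v closure_subset] in auto)
  ultimately show ?thesis using bounded_L2_on[OF D] closure_subset[of D] by (metis image_eqI subsetD)
qed

section \<open>The Sobolev space\<close>

lemma H1_weak_gradient:
  assumes D: "open D" and v: "H1 D v"
  shows "has_weak_gradient D v (weak_gradient D v)" "L2_on D (weak_gradient D v)" "L2_on D v"
proof -
  obtain G where G: "has_weak_gradient D v G" "L2_on D G" using v by (auto simp: H1_def)
  show w: "has_weak_gradient D v (weak_gradient D v)"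
    unfolding weak_gradient_def by (rule someI[of _ G]) (rule G(1))
  show "L2_on D (weak_gradient D v)"
    by (rule L2_on_AE_cong[OF _ G(2) weak_gradient_unique[OF D G(1) w]]) (use D in auto)
  show "L2_on D v" using v by (simp add: H1_def)
qed

text \<open>A pair of a square integrable function and its square integrable weak gradient. Carrying
  the gradient along avoids the choice that is hidden in the gradient operator.\<close>

definition H1_pair :: "'a::euclidean_space set => ('a => real) => ('a => 'a) => bool" where
  "H1_pair D v G \<longleftrightarrow> L2_on D v \<and> has_weak_gradient D v G \<and> L2_on D G"

lemma H1_pair_imp_H1: "H1_pair D v G ==> H1 D v"
  by (auto simp: H1_pair_def H1_def)

lemma H1_imp_pair: "open D ==> H1 D v ==> H1_pair D v (weak_gradient D v)"
  using H1_weak_gradient by (auto simp: H1_pair_def)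

lemma H1_pair_add_scale:
  assumes "open D" "H1_pair D v G" "H1_pair D w H"
  shows "H1_pair D (%x. v x + c * w x) (%x. G x + c *\<^sub>R H x)"
  using assms has_weak_gradient_add_scale[of D v G w H c] L2_on_add_scale[of D v w c] L2_on_add_scale[of D G H c]
  by (simp add: H1_pair_def)

lemma H1_pair_diff:
  assumes "open D" "H1_pair D v G" "H1_pair D w H"
  shows "H1_pair D (%x. v x - w x) (%x. G x - H x)"
  using H1_pair_add_scale[OF assms, of "-1"] by simp

lemma H1_pair_unique:
  assumes "open D" "H1_pair D v G" "H1_pair D v H"
  shows "AE x in lebesgue_on D. G x = H x"
  by (rule weak_gradient_unique[OF assms(1), where v = v]) (use assms(2,3) in "simp_all add: H1_pair_def")

lemma dirichlet_form_eq:
  assumes D: "open D" and v: "H1_pair D v G" and w: "H1_pair D w H"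
  shows "dirichlet_form D v w = L2_inner D G H"
proof -
  note v' = H1_imp_pair[OF D H1_pair_imp_H1[OF v]] and w' = H1_imp_pair[OF D H1_pair_imp_H1[OF w]]
  show ?thesis unfolding dirichlet_form_def
    by (rule L2_inner_cong_AE[OF _ _ _ _ H1_pair_unique[OF D v' v] H1_pair_unique[OF D w' w]])
      (use v w v' w' in "simp_all add: H1_pair_def")
qed

lemma H1_norm_eq:
  assumes "open D" "H1_pair D v G"
  shows "H1_norm D v = sqrt ((L2_norm D v)^2 + (L2_norm D G)^2)"
  by (simp add: H1_norm_def dirichlet_form_eq[OF assms assms(2)] L2_norm_square)

lemma H1_norm_bounds:
  assumes "open D" "H1_pair D v G"
  shows "L2_norm D v \<le> H1_norm D v" "L2_norm D G \<le> H1_norm D v" "H1_norm D v \<le> L2_norm D v + L2_norm D G"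
proof -
  show "L2_norm D v \<le> H1_norm D v" "L2_norm D G \<le> H1_norm D v"
    by (auto simp: H1_norm_eq[OF assms] intro!: real_le_rsqrt)
  show "H1_norm D v \<le> L2_norm D v + L2_norm D G"
    unfolding H1_norm_eq[OF assms]
    by (rule sqrt_sum_squares_le_sum) (auto simp: L2_norm_nonneg)
qed

lemma H1_pair_cong:
  assumes D: "open D" and e: "!!x. x \<in> D ==> v x = v' x" "!!x. x \<in> D ==> G x = G' x" and v: "H1_pair D v G"
  shows "H1_pair D v' G'"
proof -
  have Ds: "D \<in> sets lebesgue" using D by auto
  have ae: "AE x in lebesgue_on D. v x = v' x" "AE x in lebesgue_on D. G x = G' x"
    by (rule AE_I2, use e in simp)+
  from v have "L2_on D v'" "L2_on D G'"
    unfolding H1_pair_def using L2_on_AE_cong[OF Ds _ ae(1)] L2_on_AE_cong[OF Ds _ ae(2)] by simp_all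
  moreover have "has_weak_gradient D v' G'"
    by (rule has_weak_gradient_cong[OF Ds e]) (use v in "simp_all add: H1_pair_def")
  ultimately show ?thesis by (simp add: H1_pair_def)
qed

lemma H1_pair_smooth:
  assumes D: "open D" "bounded D" and \<phi>: "smooth \<phi>"
  shows "H1_pair D \<phi> (grad \<phi>)"
  unfolding H1_pair_def
proof (intro conjI)
  show "L2_on D \<phi>" by (rule continuous_L2_on[OF D smooth_continuous[OF \<phi>]])
  show "has_weak_gradient D \<phi> (grad \<phi>)" by (rule has_weak_gradient_smooth[OF D(1) \<phi>])
  show "L2_on D (grad \<phi>)" by (rule continuous_L2_on[OF D continuous_grad[OF \<phi>]])
qed

subsection \<open>The chain rule\<close>

lemma has_derivative_affine_reflect:
  assumes "smooth k"
  shows "partial i (%y. k (x - y)) y = - partial i k (x - y)"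
proof -
  have "((%y. k (x - y)) has_derivative (%h. frechet_derivative k (at (x - y)) (- h))) (at y)"
    by (rule has_derivative_compose[OF _ smooth_has_derivative[OF assms]]) (auto intro!: derivative_eq_intros)
  then have "partial i (%y. k (x - y)) y = frechet_derivative k (at (x - y)) (- i)"
    by (rule partial_eqI)
  also have "... = - partial i k (x - y)"
    using linear_neg[OF has_derivative_linear[OF smooth_has_derivative[OF assms]]] .
  finally show ?thesis .
qed

lemma smooth_reflect: "smooth k ==> smooth (%y. k (x - y))"
  using smooth_affine[of "%y. - y" k x] by (simp add: linear_iff)

lemma test_fun_eta:
  assumes "cball x d \<subseteq> D" "d > 0" shows "test_fun D (%y. eta d (x - y))"
proof (rule test_funI[OF _ compact_cball assms(1)])
  show "smooth (%y. eta d (x - y))" by (rule smooth_reflect[OF smooth_eta[OF assms(2)]])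
  show "eta d (x - y) = 0" if "y \<notin> cball x d" for y
    by (rule eta_outside[OF assms(2)]) (use that in "simp add: dist_norm")
qed

lemma eta_support: "d > 0 ==> z \<notin> cball 0 d ==> eta d z = 0"
  by (rule eta_outside) auto

text \<open>The kernel, as a function of the integration variable, is a test function as long as its support
  stays inside \<open>D\<close>.\<close>

lemma conv_weak_gradient:
  fixes w :: "'a::euclidean_space => real"
  assumes w: "has_weak_gradient D w G" "integrable (lebesgue_on D) w" and d: "d > 0" and c: "cball x d \<subseteq> D" and i: "i \<in> Basis"
  shows "partial i (conv D w (eta d)) x = conv D (%y. G y \<bullet> i) (eta d) x"
proof -
  have "partial i (conv D w (eta d)) x = conv D w (partial i (eta d)) x"
    by (rule conv_partial[OF w(2) smooth_eta[OF d] eta_support[OF d] i])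
  also have "... = - (LINT y|lebesgue_on D. w y * partial i (%y. eta d (x - y)) y)"
    by (simp add: conv_def has_derivative_affine_reflect[OF smooth_eta[OF d]])
  also have "... = conv D (%y. G y \<bullet> i) (eta d) x"
    using w(1) test_fun_eta[OF c d] i by (simp add: has_weak_gradient_iff conv_def)
  finally show ?thesis .
qed

lemma continuous_near:
  fixes w :: "'a::euclidean_space => real"
  assumes D: "open D" and w: "continuous_on D w" "integrable (lebesgue_on D) w"
    and d: "!!n. d n > 0" "d ----> 0" and y: "y \<in> D" and e: "e > 0"
  shows "\<exists>r>0. \<forall>\<^sub>F n in sequentially. \<forall>x. dist y x < r --> \<bar>conv D w (eta (d n)) x - w y\<bar> \<le> e"
proof -
  obtain s where s: "s > 0" "!!x. x \<in> D ==> dist x y < s ==> dist (w x) (w y) < e"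
    using w(1) y e unfolding continuous_on_iff by metis
  obtain t where t: "t > 0" "ball y t \<subseteq> D" using D y openE by blast
  define r where "r = min s t / 2"
  have r: "r > 0" "2 * r \<le> s" "2 * r \<le> t" using s t by (auto simp: r_def)
  have "\<forall>\<^sub>F n in sequentially. d n < r" by (rule order_tendstoD(2)[OF d(2) r(1)])
  then have "\<forall>\<^sub>F n in sequentially. \<forall>x. dist y x < r --> \<bar>conv D w (eta (d n)) x - w y\<bar> \<le> e"
  proof eventually_elim
    case (elim n)
    show ?case
    proof (intro allI impI)
      fix x assume x: "dist y x < r"
      have near: "dist z y < 2 * r" if "dist x z \<le> d n" for z
        using dist_triangle[of z y x] x that elim by (simp add: dist_commute)
      show "\<bar>conv D w (eta (d n)) x - w y\<bar> \<le> e"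
      proof (rule conv_close[OF D d(1) w(2)])
        show "cball x (d n) \<subseteq> D"
        proof
          fix z assume "z \<in> cball x (d n)"
          then have "z \<in> ball y t" using near[of z] r by (simp add: dist_commute)
          then show "z \<in> D" using t by blast
        qed
        show "AE z in lebesgue_on D. dist x z < d n --> \<bar>w z - w y\<bar> \<le> e"
        proof (rule AE_I2, rule impI)
          fix z assume "z \<in> space (lebesgue_on D)" "dist x z < d n"
          then show "\<bar>w z - w y\<bar> \<le> e" using near[of z] s(2)[of z] r by (simp add: dist_real_def)
        qed
      qed
    qed
  qed
  with r(1) show ?thesis by blast
qed

text \<open>The mollifications of \<open>w\<close> converge locally uniformly, hence so do the factors
  \<open>b'(w)\<close>, while their gradients converge weakly. The products converge by
  \<open>mollification_weak_limit\<close>.\<close>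

lemma weak_gradient_chain_continuous:
  fixes w :: "'a::euclidean_space => real"
  assumes D: "open D" "bounded D" and w: "continuous_on (closure D) w"
    and G: "has_weak_gradient D w G" "integrable (lebesgue_on D) G"
    and b: "!!t. (b has_real_derivative b' t) (at t)" "!!t. isCont b' t"
  shows "has_weak_gradient D (%x. b (w x)) (%x. b' (w x) *\<^sub>R G x)"
proof -
  let ?M = "lebesgue_on D"
  have bc: "continuous_on UNIV b" and b'c: "continuous_on UNIV b'"
    by (rule continuous_at_imp_continuous_on, use b(1) DERIV_isCont in blast)
      (rule continuous_at_imp_continuous_on, use b(2) in blast)
  have wD: "continuous_on D w" by (rule continuous_on_subset[OF w closure_subset])
  have "compact (w ` closure D)"
    using D(2) w by (intro compact_continuous_image) (simp_all add: compact_closure)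
  then obtain M0 where M0: "\<forall>y\<in>w ` closure D. norm y \<le> M0" using compact_imp_bounded bounded_iff by metis
  define M where "M = max M0 0"
  have M: "M \<ge> 0" "\<bar>w x\<bar> \<le> M" if "x \<in> D" for x
    using M0 that closure_subset[of D] by (auto simp: M_def le_max_iff_disj)
  have M_nn: "M \<ge> 0" by (simp add: M_def)
  have wi: "integrable ?M w"
    by (rule L2_bounded_integrable[OF D continuous_L2_on[OF D w]])
  have bdd: "\<exists>B\<ge>0. \<forall>t. \<bar>t\<bar> \<le> M --> \<bar>f t\<bar> \<le> B" if "continuous_on UNIV f" for f :: "real => real"
  proof -
    have "compact (f ` {-M..M})" by (intro compact_continuous_image continuous_on_subset[OF that]) auto
    then obtain B where B: "\<forall>y\<in>f ` {-M..M}. norm y \<le> B" using compact_imp_bounded bounded_iff by metis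
    have "\<bar>f t\<bar> \<le> max B 0" if "\<bar>t\<bar> \<le> M" for t
    proof -
      have "t \<in> {-M..M}" using that by auto
      then have "norm (f t) \<le> B" using B by blast
      then show ?thesis by simp
    qed
    then show ?thesis by (intro exI[of _ "max B 0"]) auto
  qed
  obtain B where B: "B \<ge> 0" "!!t. \<bar>t\<bar> \<le> M ==> \<bar>b t\<bar> \<le> B" using bdd[OF bc] by blast
  obtain B' where B': "B' \<ge> 0" "!!t. \<bar>t\<bar> \<le> M ==> \<bar>b' t\<bar> \<le> B'" using bdd[OF b'c] by blast
  have Gm: "G \<in> borel_measurable ?M" using G(2) by (rule borel_measurable_integrable)
  have b'wm: "(%x. b' (w x)) \<in> borel_measurable ?M"
    by (rule continuous_imp_measurable_on_sets_lebesgue)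
      (use D(1) in "auto intro!: continuous_on_compose2[OF b'c wD]")
  show ?thesis unfolding has_weak_gradient_iff
  proof (intro conjI allI impI ballI)
    show "locally_integrable D (%x. b (w x))"
      by (rule continuous_imp_locally_integrable) (rule continuous_on_compose2[OF bc wD], simp)
    have "integrable ?M (%x. b' (w x) *\<^sub>R G x)"
    proof (rule lintegrable_bound)
      show "integrable ?M (%x. B' *\<^sub>R G x)" using G(2) by simp
      show "(%x. b' (w x) *\<^sub>R G x) \<in> borel_measurable ?M" using b'wm Gm by measurable
      show "AE x in ?M. norm (b' (w x) *\<^sub>R G x) \<le> norm (B' *\<^sub>R G x)"
        by (rule AE_I2) (use B' M in "auto intro!: mult_right_mono")
    qed
    then show "locally_integrable D (%x. b' (w x) *\<^sub>R G x)"
      by (rule integrable_imp_locally_integrable[rotated]) (use D in auto)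
    fix z :: "'a => real" and i :: 'a assume t: "test_fun D z" and i: "i \<in> Basis"
    define S where "S = closure {x. z x \<noteq> 0}"
    have S: "compact S" "S \<subseteq> D" using t unfolding S_def test_fun_def by simp_all
    have zS: "z x = 0" if "x \<notin> S" for x using test_funD(5)[OF t] that unfolding S_def by metis
    obtain \<epsilon> where \<epsilon>: "\<epsilon> > 0" "(\<Union>x\<in>S. ball x \<epsilon>) \<subseteq> D"
      using compact_subset_open_imp_ball_epsilon_subset[OF S(1) D(1) S(2)] by metis
    define d where "d n = \<epsilon> * inverse (real (Suc (Suc n)))" for n
    have d: "d n > 0" "d n < \<epsilon>" for n
    proof -
      show "d n > 0" using \<epsilon>(1) by (simp add: d_def)
      have "inverse (real (Suc (Suc n))) < 1" by (rule inverse_less_1_iff[THEN iffD2]) simp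
      then have "\<epsilon> * inverse (real (Suc (Suc n))) < \<epsilon> * 1" by (rule mult_strict_left_mono[OF _ \<epsilon>(1)])
      then show "d n < \<epsilon>" by (simp only: d_def mult_1_right)
    qed
    have d0: "d ----> 0"
      unfolding d_def using tendsto_mult_right_zero[OF LIMSEQ_Suc[OF LIMSEQ_inverse_real_of_nat], of \<epsilon>] by simp
    define W where "W n = conv D w (eta (d n))" for n
    note cs = wi smooth_eta[OF d(1)] eta_support[OF d(1)]
    have Wd: "(W n has_derivative frechet_derivative (W n) (at x)) (at x)" for n x
    proof -
      have "W n differentiable (at x)" using conv_has_derivative[OF cs] unfolding W_def differentiable_def by blast
      then show ?thesis by (rule frechet_derivative_works[THEN iffD1])
    qed
    have Wc: "continuous_on A (W n)" for A n
      unfolding W_def by (rule continuous_on_subset[OF conv_continuous[OF cs]]) simp_all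
    have Wpc: "continuous_on UNIV (partial i (W n))" for n
    proof -
      have e: "partial i (W n) = conv D w (partial i (eta (d n)))"
        unfolding W_def using conv_partial[OF cs i] by (intro ext) simp
      show ?thesis unfolding e
        by (rule conv_continuous[OF wi smooth_partial[OF smooth_eta[OF d(1)] i]])
           (rule partial_support[OF cs])
    qed
    have WM: "\<bar>W n x\<bar> \<le> M" for n x
      unfolding W_def by (rule conv_bound[OF D(1) d(1) wi M(2) M_nn])
    have Wlim: "(%n. W n x) ----> w x" if x: "x \<in> D" for x
    proof (rule LIMSEQ_I)
      fix e :: real assume e: "e > 0"
      obtain r where "r > 0" "\<forall>\<^sub>F n in sequentially. \<forall>x'. dist x x' < r --> \<bar>W n x' - w x\<bar> \<le> e / 2"
        using continuous_near[OF D(1) wD wi d(1) d0 x, of "e / 2"] e unfolding W_def by auto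
      then have "\<forall>\<^sub>F n in sequentially. norm (W n x - w x) < e"
        using e by (auto elim!: eventually_mono dest!: spec[of _ x])
      then show "\<exists>N. \<forall>n\<ge>N. norm (W n x - w x) < e" by (simp add: eventually_sequentially)
    qed
    have zd: "(z has_derivative frechet_derivative z (at x)) (at x)" for x
      by (rule smooth_has_derivative[OF test_funD(1)[OF t]])
    note zc = test_funD(2)[OF t] and zpc = test_funD(2)[OF test_fun_partial[OF t i]]
    obtain R where R: "\<forall>x. x \<notin> cball 0 R --> z x = 0" using test_funD(4)[OF t] by metis
    obtain Z where Z: "!!x. \<bar>z x\<bar> \<le> Z" using continuous_bounded_support[OF zc, of R] R by metis
    obtain Z' where Z': "!!x. \<bar>partial i z x\<bar> \<le> Z'"
      using test_funD(2,4)[OF test_fun_partial[OF t i]] continuous_bounded_support[of "partial i z"] by metis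
    define A where "A n x = b' (W n x) * z x" for n x
    have Am: "A n \<in> borel_measurable ?M" for n
      unfolding A_def
      by (rule measurable_lebesgue_on_continuous) (intro continuous_on_mult zc continuous_on_compose2[OF b'c Wc], simp)
    have AB: "\<bar>A n x\<bar> \<le> B' * Z" for n x
      unfolding A_def abs_mult by (intro mult_mono B' WM Z) auto
    have parts: "(LINT x|?M. b (W n x) * partial i z x) = - (LINT x|?M. A n x * conv D (%y. G y \<bullet> i) (eta (d n)) x)" for n
    proof -
      let ?F = "%x. b (W n x) * partial i z x + (b' (W n x) * partial i (W n) x) * z x"
      have bW: "((%x. b (W n x)) has_derivative (%h. b' (W n x) * frechet_derivative (W n) (at x) h)) (at x)" for x
        using has_derivative_compose[OF Wd b(1)[unfolded has_field_derivative_def]] .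
      have F1: "continuous_on UNIV (%x. b (W n x) * partial i z x)"
        by (intro continuous_on_mult zpc continuous_on_compose2[OF bc Wc]) simp
      have F2: "continuous_on UNIV (%x. (b' (W n x) * partial i (W n) x) * z x)"
        by (intro continuous_on_mult zc Wpc continuous_on_compose2[OF b'c Wc]) simp
      have F: "continuous_on UNIV ?F" by (rule continuous_on_add[OF F1 F2])
      have "integral\<^sup>L lborel ?F = 0"
        by (rule integral_directional_derivative_eq_0[OF has_derivative_mult[OF bW zd] F, of R]) (use R in simp)
      moreover have "integral\<^sup>L lborel ?F = integral\<^sup>L ?M ?F"
      proof (rule lebesgue_on_eq_lborel(1)[symmetric])
        show "?F \<in> borel_measurable borel" by (rule borel_measurable_continuous_onI[OF F])
        show "D \<in> sets borel" using D by simp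
        show "?F x = 0" if "x \<notin> D" for x
          using test_funD(3)[OF t that] test_funD(3)[OF test_fun_partial[OF t i] that] by simp
      qed
      moreover have "integral\<^sup>L ?M ?F = (LINT x|?M. b (W n x) * partial i z x) + (LINT x|?M. (b' (W n x) * partial i (W n) x) * z x)"
      proof (rule lintegral_add)
        have c1: "locally_integrable D (%x. b (W n x))"
          by (rule continuous_imp_locally_integrable) (rule continuous_on_compose2[OF bc Wc], simp)
        have c2: "locally_integrable D (%x. b' (W n x) * partial i (W n) x)"
          by (rule continuous_imp_locally_integrable)
            (intro continuous_on_mult continuous_on_compose2[OF b'c Wc] continuous_on_subset[OF Wpc], simp_all)
        show "integrable ?M (%x. b (W n x) * partial i z x)"
          by (rule locally_integrable_mult_test[OF D(1) c1 test_fun_partial[OF t i]])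
        show "integrable ?M (%x. (b' (W n x) * partial i (W n) x) * z x)"
          by (rule locally_integrable_mult_test[OF D(1) c2 t])
      qed
      moreover have "(LINT x|?M. (b' (W n x) * partial i (W n) x) * z x) = (LINT x|?M. A n x * conv D (%y. G y \<bullet> i) (eta (d n)) x)"
      proof (rule lintegral_cong)
        fix x
        show "(b' (W n x) * partial i (W n) x) * z x = A n x * conv D (%y. G y \<bullet> i) (eta (d n)) x"
        proof (cases "x \<in> S")
          case True
          then have "cball x (d n) \<subseteq> ball x \<epsilon>" using d(2)[of n] by auto
          then have "cball x (d n) \<subseteq> D" using True \<epsilon>(2) by blast
          then show ?thesis using conv_weak_gradient[OF G(1) wi d(1) _ i] by (simp add: A_def W_def)
        next
          case False
          then show ?thesis by (simp add: A_def zS)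
        qed
      qed
      ultimately show ?thesis by linarith
    qed
    have L1: "(%n. LINT x|?M. b (W n x) * partial i z x) ----> (LINT x|?M. b (w x) * partial i z x)"
    proof (rule integral_dominated_convergence[where w = "%x. B * Z'"])
      show "(%x. b (W n x) * partial i z x) \<in> borel_measurable ?M" for n
        by (rule measurable_lebesgue_on_continuous)
          (intro continuous_on_mult zpc continuous_on_compose2[OF bc Wc], simp)
      show "(%x. b (w x) * partial i z x) \<in> borel_measurable ?M"
        by (rule continuous_imp_measurable_on_sets_lebesgue)
          (use D(1) in "auto intro!: continuous_on_mult continuous_on_compose2[OF bc wD] continuous_on_subset[OF zpc]")
      interpret finite_measure ?M by (intro finite_measure_lebesgue_on lmeasurable_open D)
      show "integrable ?M (%x. B * Z')" by simp
      show "AE x in ?M. (%n. b (W n x) * partial i z x) ----> b (w x) * partial i z x"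
      proof (rule AE_I2)
        fix x assume "x \<in> space ?M"
        then have "(%n. W n x) ----> w x" using Wlim by simp
        then have "(%n. b (W n x)) ----> b (w x)" by (rule isCont_tendsto_compose[OF DERIV_isCont[OF b(1)]])
        then show "(%n. b (W n x) * partial i z x) ----> b (w x) * partial i z x" by (rule tendsto_mult_right)
      qed
      show "AE x in ?M. norm (b (W n x) * partial i z x) \<le> B * Z'" for n
        unfolding real_norm_def abs_mult by (rule AE_I2) (intro mult_mono B WM Z' abs_ge_zero)
    qed
    have L2: "(%n. LINT x|?M. A n x * conv D (%y. G y \<bullet> i) (eta (d n)) x) ----> (LINT y|?M. (G y \<bullet> i) * (b' (w y) * z y))"
    proof (rule mollification_weak_limit[OF D _ d(1) d0 Am AB])
      show "integrable ?M (%y. G y \<bullet> i)" using G(2) by (rule integrable_inner_left)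
      fix y and e :: real assume y: "y \<in> D" and e: "e > 0"
      have "continuous_on UNIV (%p::real \<times> real. b' (fst p) * snd p)"
        by (intro continuous_on_mult continuous_on_compose2[OF b'c] continuous_intros) simp
      then have "\<exists>\<delta>>0. \<forall>p. dist p (w y, z y) < \<delta> --> dist (b' (fst p) * snd p) (b' (w y) * z y) < e"
        using e by (auto simp: continuous_on_iff)
      then obtain \<delta> where \<delta>: "\<delta> > 0" "!!p. dist p (w y, z y) < \<delta> ==> dist (b' (fst p) * snd p) (b' (w y) * z y) < e"
        by blast
      obtain r1 where r1: "r1 > 0" "\<forall>\<^sub>F n in sequentially. \<forall>x. dist y x < r1 --> \<bar>W n x - w y\<bar> \<le> \<delta> / 3"
        using continuous_near[OF D(1) wD wi d(1) d0 y, of "\<delta> / 3"] \<delta>(1) unfolding W_def by auto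
      obtain r2 where r2: "r2 > 0" "!!x. dist x y < r2 ==> dist (z x) (z y) < \<delta> / 3"
        using zc \<delta>(1) unfolding continuous_on_iff by (metis UNIV_I divide_pos_pos zero_less_numeral)
      show "\<exists>r>0. \<forall>\<^sub>F n in sequentially. \<forall>x\<in>D. dist y x < r --> \<bar>A n x - b' (w y) * z y\<bar> \<le> e"
      proof (intro exI conjI)
        show "min r1 r2 > 0" using r1 r2 by simp
        show "\<forall>\<^sub>F n in sequentially. \<forall>x\<in>D. dist y x < min r1 r2 --> \<bar>A n x - b' (w y) * z y\<bar> \<le> e"
          using r1(2)
        proof eventually_elim
          case (elim n)
          show ?case
          proof (intro ballI impI)
            fix x assume x: "dist y x < min r1 r2"
            have 1: "\<bar>W n x - w y\<bar> \<le> \<delta> / 3" using elim x by simp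
            have 2: "\<bar>z x - z y\<bar> < \<delta> / 3" using r2(2)[of x] x by (simp add: dist_commute dist_real_def)
            have "dist (W n x, z x) (w y, z y) \<le> \<bar>W n x - w y\<bar> + \<bar>z x - z y\<bar>"
              by (simp add: dist_Pair_Pair dist_real_def sqrt_sum_squares_le_sum_abs[of "W n x - w y" "z x - z y", simplified])
            then have "dist (W n x, z x) (w y, z y) < \<delta>" using 1 2 \<delta>(1) by linarith
            from \<delta>(2)[OF this] show "\<bar>A n x - b' (w y) * z y\<bar> \<le> e" by (simp add: A_def dist_real_def)
          qed
        qed
      qed
    qed
    have "(LINT x|?M. b (w x) * partial i z x) = - (LINT y|?M. (G y \<bullet> i) * (b' (w y) * z y))"
      using L1 tendsto_minus[OF L2] unfolding parts by (rule LIMSEQ_unique)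
    then show "(LINT x|?M. b (w x) * partial i z x) = - (LINT x|?M. ((b' (w x) *\<^sub>R G x) \<bullet> i) * z x)"
      by (simp add: ac_simps)
  qed
qed

lemma H1_pair_chain_continuous:
  fixes w :: "'a::euclidean_space => real"
  assumes D: "open D" "bounded D" and w: "continuous_on (closure D) w" "H1_pair D w G"
    and b: "!!t. (b has_real_derivative b' t) (at t)" "!!t. isCont b' t"
  shows "H1_pair D (%x. b (w x)) (%x. b' (w x) *\<^sub>R G x)"
proof -
  have bc: "continuous_on UNIV b" and b'c: "continuous_on UNIV b'"
    by (rule continuous_at_imp_continuous_on, use b(1) DERIV_isCont in blast)
      (rule continuous_at_imp_continuous_on, use b(2) in blast)
  have G: "has_weak_gradient D w G" "L2_on D G" using w(2) by (simp_all add: H1_pair_def)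
  have c: "continuous_on (closure D) (%x. b' (w x))" by (rule continuous_on_compose2[OF b'c w(1)]) simp
  have "compact ((%x. b' (w x)) ` closure D)"
    using D(2) c by (intro compact_continuous_image) (simp_all add: compact_closure)
  then obtain B where B: "\<forall>y\<in>(%x. b' (w x)) ` closure D. norm y \<le> B" using compact_imp_bounded bounded_iff by metis
  have "L2_on D (%x. b' (w x) *\<^sub>R G x)"
  proof (rule L2_norm_mono(1))
    show "L2_on D (%x. 0 + B *\<^sub>R G x)"
      using L2_norm_mono(1)[OF G(2), of "%x. 0"] by (intro L2_on_add_scale G(2)) simp
    show "(%x. b' (w x) *\<^sub>R G x) \<in> borel_measurable (lebesgue_on D)"
      using L2_on_measurable[OF continuous_L2_on[OF D c]] L2_on_measurable[OF G(2)] by measurable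
    show "AE x in lebesgue_on D. norm (b' (w x) *\<^sub>R G x) \<le> norm (0 + B *\<^sub>R G x)"
    proof (rule AE_I2)
      fix x assume "x \<in> space (lebesgue_on D)"
      then have "x \<in> closure D" using closure_subset[of D] by auto
      then have "\<bar>b' (w x)\<bar> \<le> B" using B by auto
      then show "norm (b' (w x) *\<^sub>R G x) \<le> norm (0 + B *\<^sub>R G x)" by (auto intro!: mult_right_mono)
    qed
  qed
  moreover have "L2_on D (%x. b (w x))"
    by (rule continuous_L2_on[OF D]) (rule continuous_on_compose2[OF bc w(1)], simp)
  ultimately show ?thesis
    using weak_gradient_chain_continuous[OF D w(1) G(1) L2_bounded_integrable[OF D G(2)] b]
    by (simp add: H1_pair_def)
qed

lemma test_fun_L2:
  assumes D: "open D" "bounded D" and t: "test_fun D \<phi>"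
  shows "L2_on D \<phi>" "L2_on D (%x. \<phi> x *\<^sub>R i)"
  by (rule continuous_L2_on[OF D continuous_on_subset[OF test_funD(2)[OF t]]], simp)
    (rule continuous_L2_on[OF D], intro continuous_on_scaleR continuous_on_const
      continuous_on_subset[OF test_funD(2)[OF t]], simp)

text \<open>Both sides of the integration by parts formula are continuous in \<open>L\<^sup>2\<close>.\<close>

lemma H1_pair_limit:
  fixes v :: "'a::euclidean_space => real"
  assumes D: "open D" "bounded D" and u: "!!n. H1_pair D (u n) (U n)" and v: "L2_on D v" "L2_on D V"
    and lim: "L2_lim D u v" "L2_lim D U V"
  shows "H1_pair D v V"
  unfolding H1_pair_def has_weak_gradient_iff
proof (intro conjI v allI impI ballI)
  have Ds: "D \<in> sets lebesgue" using D(1) by auto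
  show "locally_integrable D v" "locally_integrable D V"
    by (rule integrable_imp_locally_integrable[OF Ds L2_bounded_integrable[OF D]], rule v)+
  have u': "L2_on D (u n)" "L2_on D (U n)" "has_weak_gradient D (u n) (U n)" for n
    using u[of n] by (simp_all add: H1_pair_def)
  fix \<phi> :: "'a => real" and i :: 'a assume t: "test_fun D \<phi>" and i: "i \<in> Basis"
  have 1: "(%n. L2_inner D (u n) (partial i \<phi>)) ----> L2_inner D v (partial i \<phi>)"
    by (rule L2_norm_tendsto[OF u'(1) v(1) lim(1) test_fun_L2(1)[OF D test_fun_partial[OF t i]]])
  have 2: "(%n. L2_inner D (U n) (%x. \<phi> x *\<^sub>R i)) ----> L2_inner D V (%x. \<phi> x *\<^sub>R i)"
    by (rule L2_norm_tendsto[OF u'(2) v(2) lim(2) test_fun_L2(2)[OF D t]])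
  have "L2_inner D (u n) (partial i \<phi>) = - L2_inner D (U n) (%x. \<phi> x *\<^sub>R i)" for n
    using u'(3)[of n] t i by (simp add: has_weak_gradient_iff L2_inner_def mult.commute)
  then have "L2_inner D v (partial i \<phi>) = - L2_inner D V (%x. \<phi> x *\<^sub>R i)"
    using LIMSEQ_unique[OF 1] tendsto_minus[OF 2] by simp
  then show "(LINT x|lebesgue_on D. v x * partial i \<phi> x) = - (LINT x|lebesgue_on D. (V x \<bullet> i) * \<phi> x)"
    by (simp add: L2_inner_def mult.commute)
qed

lemma L2_on_const:
  fixes c :: "'b::euclidean_space"
  assumes D: "open D" "bounded D" shows "L2_on D (%x. c)"
  by (rule continuous_L2_on[OF D continuous_on_const])

text \<open>Along a subsequence \<open>w n\<close> converges almost everywhere, so dominated convergence applies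
  to \<open>(b'(w n) - b'(v)) G\<close>; the remaining part is controlled by the bound for
  \<open>b'\<close>.\<close>

lemma H1_chain_limit:
  fixes v :: "'a::euclidean_space => real"
  assumes D: "open D" "bounded D"
    and w: "!!n. continuous_on (closure D) (w n)" "!!n. H1_pair D (w n) (W n)"
    and v: "H1_pair D v G"
    and lim: "L2_lim D w v" "L2_lim D W G"
    and b: "!!t. (b has_real_derivative b' t) (at t)" "!!t. isCont b' t" "!!t. \<bar>b' t\<bar> \<le> B"
  obtains r :: "nat => nat" where "strict_mono r" "H1_pair D (%x. b (v x)) (%x. b' (v x) *\<^sub>R G x)"
    "!!n. H1_pair D (%x. b (w n x)) (%x. b' (w n x) *\<^sub>R W n x)"
    "(%n. L2_norm D (%x. b (w (r n) x) - b (v x))) ----> 0"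
    "(%n. L2_norm D (%x. b' (w (r n) x) *\<^sub>R W (r n) x - b' (v x) *\<^sub>R G x)) ----> 0"
proof -
  let ?M = "lebesgue_on D"
  have B: "B \<ge> 0" using b(3)[of 0] by linarith
  have w2: "L2_on D (w n)" "L2_on D (W n)" for n using w(2)[of n] by (simp_all add: H1_pair_def)
  have v2: "L2_on D v" "L2_on D G" using v by (simp_all add: H1_pair_def)
  have bw: "H1_pair D (%x. b (w n x)) (%x. b' (w n x) *\<^sub>R W n x)" for n
    by (rule H1_pair_chain_continuous[OF D w b(1,2)])
  have bc: "continuous_on UNIV b" 
    by (rule continuous_at_imp_continuous_on, use b(1) DERIV_isCont in blast)
  have b'c: "continuous_on UNIV b'"
    by (rule continuous_at_imp_continuous_on, use b(2) in blast)
  have [measurable]: "b \<in> borel_measurable borel" "b' \<in> borel_measurable borel"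
    by (simp_all add: bc b'c borel_measurable_continuous_onI)
  have [measurable]: "v \<in> borel_measurable ?M" "G \<in> borel_measurable ?M" "!!n. w n \<in> borel_measurable ?M" "!!n. W n \<in> borel_measurable ?M"
    using v2 w2 L2_on_measurable by auto
  have lip: "\<bar>b s - b t\<bar> \<le> B * \<bar>s - t\<bar>" for s t
  proof -
    have "norm (b s - b t) \<le> B * norm (s - t)"
      by (rule differentiable_bound[of UNIV b "%t. (*) (b' t)"])
        (use b(1,3) in "auto simp: has_field_derivative_def abs_mult intro!: onorm_le mult_right_mono")
    then show ?thesis by simp
  qed
  obtain r where r: "strict_mono r" "AE x in ?M. (%n. w (r n) x) ----> v x"
    using L2_subseq_AE[OF w2(1) v2(1) lim(1)] by blast
  have bv: "L2_on D (%x. b (v x))"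
  proof (rule L2_norm_mono(1))
    have "L2_on D (%x. \<bar>v x\<bar>)" by (rule L2_norm_mono(1)[OF v2(1)]) auto
    then show "L2_on D (%x. \<bar>b 0\<bar> + B *\<^sub>R \<bar>v x\<bar>)" by (rule L2_on_add_scale[OF L2_on_const[OF D]])
    show "(%x. b (v x)) \<in> borel_measurable ?M" by measurable
    show "AE x in ?M. norm (b (v x)) \<le> norm (\<bar>b 0\<bar> + B *\<^sub>R \<bar>v x\<bar>)"
    proof (rule AE_I2)
      fix x
      have "\<bar>b (v x)\<bar> \<le> \<bar>b 0\<bar> + B * \<bar>v x\<bar>" using lip[of "v x" 0] by simp
      then show "norm (b (v x)) \<le> norm (\<bar>b 0\<bar> + B *\<^sub>R \<bar>v x\<bar>)" by simp
    qed
  qed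
  have scaled: "L2_on D (%x. c x *\<^sub>R H x)" "L2_norm D (%x. c x *\<^sub>R H x) \<le> K * L2_norm D H"
    if H: "L2_on D H" and c: "c \<in> borel_measurable ?M" "!!x. \<bar>c x\<bar> \<le> K" for c and H :: "'a => 'a" and K
  proof -
    have K: "K \<ge> 0" using c(2) abs_ge_zero order_trans by blast
    have KH: "L2_on D (%x. K *\<^sub>R H x)" using L2_on_add_scale[OF L2_on_const[OF D] H, of 0 K] by simp
    have m: "(%x. c x *\<^sub>R H x) \<in> borel_measurable ?M" using c(1) L2_on_measurable[OF H] by measurable
    have ae: "AE x in ?M. norm (c x *\<^sub>R H x) \<le> norm (K *\<^sub>R H x)"
      by (rule AE_I2) (use c(2) K in "auto intro!: mult_right_mono")
    show "L2_on D (%x. c x *\<^sub>R H x)" by (rule L2_norm_mono(1)[OF KH m ae])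
    show "L2_norm D (%x. c x *\<^sub>R H x) \<le> K * L2_norm D H"
      using L2_norm_mono(2)[OF KH m ae] K by (simp add: L2_norm_scale)
  qed
  have b'v: "L2_on D (%x. b' (v x) *\<^sub>R G x)" by (rule scaled(1)[OF v2(2)]) (use b(3) in auto)
  have l1: "(%n. L2_norm D (%x. b (w (r n) x) - b (v x))) ----> 0"
  proof (rule Lim_null_comparison)
    have "L2_norm D (%x. b (w (r n) x) - b (v x)) \<le> B * L2_norm D (%x. w (r n) x - v x)" for n
    proof -
      have d: "L2_on D (%x. w (r n) x - v x)" by (rule L2_norm_diff(1)[OF w2(1) v2(1)])
      have Bd: "L2_on D (%x. B *\<^sub>R (w (r n) x - v x))" using L2_on_add_scale[OF L2_on_const[OF D] d, of 0 B] by simp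
      have "L2_norm D (%x. b (w (r n) x) - b (v x)) \<le> L2_norm D (%x. B *\<^sub>R (w (r n) x - v x))"
        by (rule L2_norm_mono(2)[OF Bd]) (measurable, rule AE_I2, use lip B in "simp add: abs_mult")
      then show ?thesis using B by (simp only: L2_norm_scale abs_of_nonneg)
    qed
    then show "\<forall>\<^sub>F n in sequentially. norm (L2_norm D (%x. b (w (r n) x) - b (v x))) \<le> B * L2_norm D (%x. w (r n) x - v x)"
      by (simp add: L2_norm_nonneg)
    show "(%n. B * L2_norm D (%x. w (r n) x - v x)) ----> 0"
      using tendsto_mult_left[OF LIMSEQ_subseq_LIMSEQ[OF lim(1) r(1)], of B] by (simp add: o_def)
  qed
  have l2: "(%n. L2_norm D (%x. b' (w (r n) x) *\<^sub>R W (r n) x - b' (v x) *\<^sub>R G x)) ----> 0"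
  proof -
    let ?e = "%n x. (b' (w (r n) x) - b' (v x)) *\<^sub>R G x"
    have e2: "L2_on D (?e n)" for n
    proof (rule scaled(1)[OF v2(2)])
      show "\<bar>b' (w (r n) x) - b' (v x)\<bar> \<le> 2 * B" for x using b(3)[of "w (r n) x"] b(3)[of "v x"] by linarith
    qed measurable
    have "(%n. LINT x|?M. (norm (?e n x))^2) ----> (LINT x|?M. 0)"
    proof (rule integral_dominated_convergence[where w = "%x. (2 * B)^2 * (norm (G x))^2"])
      show "integrable ?M (%x. (2 * B)^2 * (norm (G x))^2)" using L2_on_square[OF v2(2)] by simp
      show "AE x in ?M. (%n. (norm (?e n x))^2) ----> 0" using r(2)
      proof eventually_elim
        case (elim x)
        have "(%n. b' (w (r n) x)) ----> b' (v x)" by (rule isCont_tendsto_compose[OF b(2) elim])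
        then have "(%n. b' (w (r n) x) - b' (v x)) ----> 0" by (rule LIM_zero)
        then have "(%n. (norm ((b' (w (r n) x) - b' (v x)) *\<^sub>R G x))^2) ----> (norm (0 *\<^sub>R G x))^2"
          by (intro tendsto_intros)
        then show ?case by simp
      qed
      show "AE x in ?M. norm ((norm (?e n x))^2) \<le> (2 * B)^2 * (norm (G x))^2" for n
      proof (rule AE_I2)
        fix x
        have "\<bar>b' (w (r n) x) - b' (v x)\<bar> \<le> 2 * B" using b(3)[of "w (r n) x"] b(3)[of "v x"] by linarith
        then have "\<bar>b' (w (r n) x) - b' (v x)\<bar>^2 \<le> (2 * B)^2" by (intro power_mono) auto
        then have "\<bar>b' (w (r n) x) - b' (v x)\<bar>^2 * (norm (G x))^2 \<le> (2 * B)^2 * (norm (G x))^2"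
          by (rule mult_right_mono) simp
        then show "norm ((norm (?e n x))^2) \<le> (2 * B)^2 * (norm (G x))^2"
          by (simp only: norm_scaleR power_mult_distrib real_norm_def abs_mult abs_power2 power2_abs)
      qed
    qed measurable
    then have "(%n. sqrt ((L2_norm D (?e n))^2)) ----> sqrt 0"
      by (intro tendsto_real_sqrt) (simp add: L2_norm_square_integral)
    then have le: "(%n. L2_norm D (?e n)) ----> 0" by (simp add: L2_norm_nonneg)
    show ?thesis
    proof (rule Lim_null_comparison)
      have "L2_norm D (%x. b' (w (r n) x) *\<^sub>R W (r n) x - b' (v x) *\<^sub>R G x)
         \<le> B * L2_norm D (%x. W (r n) x - G x) + L2_norm D (?e n)" for n
      proof -
        let ?f = "%x. b' (w (r n) x) *\<^sub>R (W (r n) x - G x)"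
        have d: "L2_on D (%x. W (r n) x - G x)" by (rule L2_norm_diff(1)[OF w2(2) v2(2)])
        have f: "L2_on D ?f" "L2_norm D ?f \<le> B * L2_norm D (%x. W (r n) x - G x)"
          by (rule scaled[OF d _ b(3)], measurable)+
        have "L2_norm D (%x. ?f x + 1 *\<^sub>R ?e n x) \<le> L2_norm D ?f + \<bar>1\<bar> * L2_norm D (?e n)"
          by (rule L2_norm_triangle[OF f(1) e2])
        moreover have "?f x + 1 *\<^sub>R ?e n x = b' (w (r n) x) *\<^sub>R W (r n) x - b' (v x) *\<^sub>R G x" for x
          by (simp add: algebra_simps)
        ultimately show ?thesis using f(2) by simp
      qed
      then show "\<forall>\<^sub>F n in sequentially. norm (L2_norm D (%x. b' (w (r n) x) *\<^sub>R W (r n) x - b' (v x) *\<^sub>R G x))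
         \<le> B * L2_norm D (%x. W (r n) x - G x) + L2_norm D (?e n)"
        by (simp add: L2_norm_nonneg)
      show "(%n. B * L2_norm D (%x. W (r n) x - G x) + L2_norm D (?e n)) ----> 0"
        using tendsto_add[OF tendsto_mult_left[OF LIMSEQ_subseq_LIMSEQ[OF lim(2) r(1)], of B] le] by (simp add: o_def)
    qed
  qed
  have "H1_pair D (%x. b (v x)) (%x. b' (v x) *\<^sub>R G x)"
    by (rule H1_pair_limit[OF D bw bv b'v l1 l2])
  from that[OF r(1) this bw l1 l2] show ?thesis .
qed

section \<open>Triangles in the plane\<close>

text \<open>Twice the signed area of the triangle spanned by \<open>u\<close> and \<open>v\<close>.\<close>

definition cr :: "plane => plane => real" where
  "cr u v = u$1 * v$2 - u$2 * v$1"

text \<open>The barycentric coordinate that equals one at \<open>r\<close> and vanishes on the line through \<open>p\<close> and \<open>q\<close>.\<close>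

definition bary :: "plane => plane => plane => plane => real" where
  "bary p q r x = cr (q - p) (x - p) / cr (q - p) (r - p)"

definition bary_grad :: "plane => plane => plane => plane" where
  "bary_grad p q r = (1 / cr (q - p) (r - p)) *\<^sub>R vector [- (q - p)$2, (q - p)$1]"

lemma plane_inner: "(u::plane) \<bullet> v = u$1 * v$1 + u$2 * v$2"
  by (simp add: inner_vec_def sum_2)

lemma plane_eqI: "u$1 = v$1 ==> u$2 = v$2 ==> u = (v::plane)"
  by (simp add: vec_eq_iff forall_2)

lemma bary_affine: "bary p q r x = x \<bullet> bary_grad p q r - p \<bullet> bary_grad p q r"
  by (simp add: bary_def bary_grad_def plane_inner cr_def diff_divide_distrib add_divide_distrib algebra_simps)

lemma smooth_bary: "smooth (bary p q r)"
proof -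
  have "smooth (%x. x \<bullet> bary_grad p q r - p \<bullet> bary_grad p q r)"
    by (rule smooth_diff) (rule smooth_intros(1,2))+
  then show ?thesis by (simp add: bary_affine[abs_def])
qed

lemma bary_add: "bary p q r (x + h) = bary p q r x + h \<bullet> bary_grad p q r"
  by (simp add: bary_affine inner_add_left)

text \<open>Everything is formulated for one distinguished edge, from \<open>a\<close> to \<open>b\<close>; the
  other edges are reached by the instances of the locale in which the vertices are permuted
  cyclically.\<close>

locale triangle =
  fixes a b c :: plane
  assumes nondegenerate: "cr (a - c) (b - c) \<noteq> 0"
begin

definition J :: real where "J = cr (a - c) (b - c)"

lemma J_nonzero: "J \<noteq> 0" using nondegenerate by (simp add: J_def)

lemma J_rotate: "cr (b - a) (c - a) = J" "cr (c - b) (a - b) = J"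
  by (simp_all add: J_def cr_def algebra_simps)

lemma rotate: "triangle b c a"
  by unfold_locales (use J_rotate(1) J_nonzero in simp)

lemma bary_J: "bary a b c x = cr (b - a) (x - a) / J" "bary b c a x = cr (c - b) (x - b) / J"
  "bary c a b x = cr (a - c) (x - c) / J"
  by (simp_all add: bary_def J_rotate J_def)

lemma bary_sum: "bary b c a x + bary c a b x + bary a b c x = 1"
proof -
  have "cr (c - b) (x - b) + cr (a - c) (x - c) + cr (b - a) (x - a) = J"
    by (simp add: J_def cr_def algebra_simps)
  then show ?thesis using J_nonzero by (simp add: bary_J add_divide_distrib[symmetric])
qed

lemma bary_representation:
  "x = bary b c a x *\<^sub>R a + bary c a b x *\<^sub>R b + bary a b c x *\<^sub>R c"
proof (rule plane_eqI)
  have "J * x$1 = cr (c - b) (x - b) * a$1 + cr (a - c) (x - c) * b$1 + cr (b - a) (x - a) * c$1"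
    by (simp add: J_def cr_def algebra_simps)
  then have "x$1 = (cr (c - b) (x - b) * a$1 + cr (a - c) (x - c) * b$1 + cr (b - a) (x - a) * c$1) / J"
    using J_nonzero by (metis nonzero_mult_div_cancel_left)
  then show "x$1 = (bary b c a x *\<^sub>R a + bary c a b x *\<^sub>R b + bary a b c x *\<^sub>R c)$1"
    by (simp add: bary_J add_divide_distrib)
  have "J * x$2 = cr (c - b) (x - b) * a$2 + cr (a - c) (x - c) * b$2 + cr (b - a) (x - a) * c$2"
    by (simp add: J_def cr_def algebra_simps)
  then have "x$2 = (cr (c - b) (x - b) * a$2 + cr (a - c) (x - c) * b$2 + cr (b - a) (x - a) * c$2) / J"
    using J_nonzero by (metis nonzero_mult_div_cancel_left)
  then show "x$2 = (bary b c a x *\<^sub>R a + bary c a b x *\<^sub>R b + bary a b c x *\<^sub>R c)$2"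
    by (simp add: bary_J add_divide_distrib)
qed

lemma bary_combination:
  assumes "u + v + w = 1"
  shows "bary a b c (u *\<^sub>R a + v *\<^sub>R b + w *\<^sub>R c) = w"
proof -
  have u: "u = 1 - v - w" using assms by simp
  have "cr (b - a) (u *\<^sub>R a + v *\<^sub>R b + w *\<^sub>R c - a) = w * J"
    unfolding u by (simp add: J_def cr_def algebra_simps)
  then show ?thesis using J_nonzero by (simp add: bary_J)
qed

definition T :: "plane set" where "T = convex hull {a, b, c}"
definition D :: "plane set" where "D = interior T"

lemma T_rotate: "triangle.T b c a = T"
  unfolding triangle.T_def[OF rotate] T_def by (rule arg_cong[of _ _ "%X. convex hull X"]) auto

lemma D_rotate: "triangle.D b c a = D"
  unfolding triangle.D_def[OF rotate] D_def T_rotate ..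

lemma T_compact: "compact T" unfolding T_def by (intro finite_imp_compact_convex_hull) simp
lemma T_convex: "convex T" unfolding T_def by (rule convex_convex_hull)

lemma T_subset_bary: "x \<in> T ==> 0 \<le> bary a b c x"
  unfolding T_def convex_hull_3 using bary_combination by force

lemma mem_T: "x \<in> T \<longleftrightarrow> 0 \<le> bary a b c x \<and> 0 \<le> bary b c a x \<and> 0 \<le> bary c a b x"
proof
  interpret r1: triangle b c a by (rule rotate)
  interpret r2: triangle c a b by (rule r1.rotate)
  assume "x \<in> T"
  then show "0 \<le> bary a b c x \<and> 0 \<le> bary b c a x \<and> 0 \<le> bary c a b x"
    using T_subset_bary r1.T_subset_bary r2.T_subset_bary by (simp add: r1.T_rotate T_rotate)
next
  assume *: "0 \<le> bary a b c x \<and> 0 \<le> bary b c a x \<and> 0 \<le> bary c a b x"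
  show "x \<in> T" unfolding T_def convex_hull_3
    using bary_representation[of x] bary_sum[of x] * by blast
qed

lemma continuous_bary: "continuous_on S (bary p q r)"
  by (rule smooth_continuous[OF smooth_bary])

lemma interior_bary_pos:
  assumes "x \<in> D" shows "0 < bary a b c x"
proof -
  obtain e where e: "e > 0" "ball x e \<subseteq> T" using assms unfolding D_def mem_interior by blast
  have g: "(c - a) \<bullet> bary_grad a b c = 1"
    using bary_affine[of a b c c] bary_combination[of 0 0 1] by (simp add: inner_diff_left)
  define t where "t = e / (2 * (norm (c - a) + 1))"
  have n: "norm (c - a) \<ge> 0" by (rule norm_ge_zero)
  have t: "t > 0" using e n unfolding t_def by (intro divide_pos_pos) (auto simp del: norm_ge_zero)
  have "t * (norm (c - a) + 1) = e / 2" using n unfolding t_def by (simp add: field_simps del: norm_ge_zero)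
  then have "t * norm (c - a) < e" using t e by (simp add: algebra_simps)
  then have "x + (- t) *\<^sub>R (c - a) \<in> T" using e t by (intro subsetD[OF e(2)]) (simp add: dist_norm)
  then have "0 \<le> bary a b c (x + (- t) *\<^sub>R (c - a))" using mem_T by blast
  also have "... = bary a b c x - t"
    using bary_add[of a b c x "(- t) *\<^sub>R (c - a)"] by (simp only: inner_scaleR_left g)
  finally show ?thesis using t by linarith
qed

lemma mem_D: "x \<in> D \<longleftrightarrow> 0 < bary a b c x \<and> 0 < bary b c a x \<and> 0 < bary c a b x"
proof
  interpret r1: triangle b c a by (rule rotate)
  interpret r2: triangle c a b by (rule r1.rotate)
  assume "x \<in> D"
  then show "0 < bary a b c x \<and> 0 < bary b c a x \<and> 0 < bary c a b x"
    using interior_bary_pos r1.interior_bary_pos r2.interior_bary_pos by (simp add: r1.D_rotate D_rotate)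
next
  let ?U = "{x. 0 < bary a b c x} \<inter> {x. 0 < bary b c a x} \<inter> {x. 0 < bary c a b x}"
  assume "0 < bary a b c x \<and> 0 < bary b c a x \<and> 0 < bary c a b x"
  then have "x \<in> ?U" by simp
  moreover have "open ?U"
    by (intro open_Int open_Collect_less continuous_bary continuous_on_const)
  moreover have "?U \<subseteq> T" by (auto simp: mem_T)
  ultimately show "x \<in> D" unfolding D_def by (meson interiorI)
qed

lemma D_open: "open D" by (simp add: D_def)
lemma D_subset: "D \<subseteq> T" by (simp add: D_def interior_subset)
lemma D_bounded: "bounded D" by (rule bounded_subset[OF compact_imp_bounded[OF T_compact] D_subset])

lemma centroid_in_D: "(1/3) *\<^sub>R a + (1/3) *\<^sub>R b + (1/3) *\<^sub>R c \<in> D"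
proof -
  interpret r1: triangle b c a by (rule rotate)
  interpret r2: triangle c a b by (rule r1.rotate)
  show ?thesis
    using bary_combination[of "1/3" "1/3" "1/3"] r1.bary_combination[of "1/3" "1/3" "1/3"]
      r2.bary_combination[of "1/3" "1/3" "1/3"] by (simp add: mem_D add_ac)
qed

lemma closure_D: "closure D = T"
  using convex_closure_interior[OF T_convex] centroid_in_D closure_closed[OF compact_imp_closed[OF T_compact]]
  unfolding D_def by auto

lemma frontier_D: "frontier D = T - D"
  unfolding frontier_def closure_D using D_open by (simp add: interior_open)

lemma frontier_T: "frontier T = T - D"
  unfolding frontier_def D_def using closure_closed[OF compact_imp_closed[OF T_compact]] by simp

subsection \<open>Cone coordinates\<close>

text \<open>The point on the ray from \<open>c\<close> through \<open>(1 - \<tau>) a + \<tau> b\<close>, at the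
  fraction \<open>s\<close> of the way, for \<open>p = (s, \<tau>)\<close>. The Jacobian of this map
  is \<open>J s\<close>.\<close>

definition cone :: "real \<times> real => plane" where
  "cone p = c + fst p *\<^sub>R ((1 - snd p) *\<^sub>R a + snd p *\<^sub>R b - c)"

lemma cone_combination: "cone p = (fst p * (1 - snd p)) *\<^sub>R a + (fst p * snd p) *\<^sub>R b + (1 - fst p) *\<^sub>R c"
  by (simp add: cone_def algebra_simps)

lemma bary_cone: "bary a b c (cone p) = 1 - fst p" "bary b c a (cone p) = fst p * (1 - snd p)"
  "bary c a b (cone p) = fst p * snd p"
proof -
  interpret r1: triangle b c a by (rule rotate)
  interpret r2: triangle c a b by (rule r1.rotate)
  show "bary a b c (cone p) = 1 - fst p"
    unfolding cone_combination by (rule bary_combination) (simp add: algebra_simps)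
  have "cone p = (fst p * snd p) *\<^sub>R b + (1 - fst p) *\<^sub>R c + (fst p * (1 - snd p)) *\<^sub>R a"
    unfolding cone_combination by (simp add: add_ac)
  then show "bary b c a (cone p) = fst p * (1 - snd p)"
    by (simp only:) (rule r1.bary_combination, simp add: algebra_simps)
  have "cone p = (1 - fst p) *\<^sub>R c + (fst p * (1 - snd p)) *\<^sub>R a + (fst p * snd p) *\<^sub>R b"
    unfolding cone_combination by (simp add: add_ac)
  then show "bary c a b (cone p) = fst p * snd p"
    by (simp only:) (rule r2.bary_combination, simp add: algebra_simps)
qed

lemma cone_inverse:
  assumes "bary a b c x \<noteq> 1"
  shows "cone (1 - bary a b c x, bary c a b x / (1 - bary a b c x)) = x"
proof -
  have "1 - bary a b c x \<noteq> 0" using assms by simp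
  moreover have "bary b c a x = (1 - bary a b c x) - bary c a b x" using bary_sum[of x] by simp
  ultimately show ?thesis
    using bary_representation[of x] by (simp add: cone_combination right_diff_distrib)
qed

definition Q :: "(real \<times> real) set" where "Q = {0<..<1} \<times> {0<..<1}"

lemma cone_image: "cone ` Q = D"
proof
  show "cone ` Q \<subseteq> D" by (auto simp: mem_D bary_cone Q_def)
  show "D \<subseteq> cone ` Q"
  proof
    fix x assume x: "x \<in> D"
    then have p: "0 < bary a b c x" "0 < bary b c a x" "0 < bary c a b x" by (simp_all add: mem_D)
    then have "bary a b c x < 1" "bary c a b x < 1 - bary a b c x" using bary_sum[of x] by linarith+
    then have "(1 - bary a b c x, bary c a b x / (1 - bary a b c x)) \<in> Q" using p by (simp add: Q_def field_simps)
    then show "x \<in> cone ` Q" using cone_inverse[of x] \<open>bary a b c x < 1\<close> by (metis image_eqI less_irrefl)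
  qed
qed

lemma cone_inj: "inj_on cone Q"
proof (rule inj_onI)
  fix p q assume p: "p \<in> Q" "q \<in> Q" "cone p = cone q"
  then have "fst p = fst q" using bary_cone(1)[of p] bary_cone(1)[of q] by simp
  moreover have "fst p * snd p = fst q * snd q" using bary_cone(3)[of p] bary_cone(3)[of q] p(3) by simp
  ultimately show "p = q" using p(1) by (auto simp: Q_def prod_eq_iff)
qed

end

text \<open>Iterated integrals live on the product of the real line with itself, the change of variables theorem
  on vectors; this map mediates between the two.\<close>

definition plane_of :: "real \<times> real => plane" where "plane_of p = vector [fst p, snd p]"

lemma plane_of_nth: "plane_of p $ 1 = fst p" "plane_of p $ 2 = snd p"
  by (simp_all add: plane_of_def)

lemma continuous_plane_of: "continuous_on S plane_of"
proof -
  have "plane_of p = fst p *\<^sub>R axis 1 1 + snd p *\<^sub>R axis 2 1" for p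
    by (rule plane_eqI) (simp_all add: plane_of_nth axis_def)
  then have e: "plane_of = (%p. fst p *\<^sub>R axis 1 1 + snd p *\<^sub>R axis 2 1)" by auto
  show ?thesis unfolding e by (intro continuous_intros)
qed

lemma plane_of_measurable[measurable]: "plane_of \<in> borel \<rightarrow>\<^sub>M borel"
  by (rule borel_measurable_continuous_onI[OF continuous_plane_of])

lemma Basis_plane: "(Basis :: plane set) = {axis 1 1, axis 2 1}"
  by (auto simp: Basis_vec_def) (metis exhaust_2)

lemma distr_plane_of: "distr lborel borel plane_of = lborel"
proof (rule lborel_eqI[symmetric])
  fix l u :: plane
  assume lu: "!!b. b \<in> Basis ==> l \<bullet> b \<le> u \<bullet> b"
  have ne: "axis 1 1 \<noteq> (axis 2 1 :: plane)" by (simp add: axis_eq_axis)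
  have le: "l$1 \<le> u$1" "l$2 \<le> u$2" using lu[of "axis 1 1"] lu[of "axis 2 1"] by (auto simp: Basis_plane inner_axis)
  have v: "plane_of -` box l u = {l$1<..<u$1} \<times> {l$2<..<u$2}"
    by (auto simp: mem_box Basis_plane inner_axis plane_of_nth)
  have "emeasure (distr lborel borel plane_of) (box l u) = emeasure lborel ({l$1<..<u$1} \<times> {l$2<..<u$2})"
    by (subst emeasure_distr) (simp_all add: v)
  also have "... = emeasure lborel {l$1<..<u$1} * emeasure lborel {l$2<..<u$2}"
    unfolding lborel_prod[symmetric] by (rule lborel.emeasure_pair_measure_Times) auto
  also have "... = (\<Prod>b\<in>Basis. (u - l) \<bullet> b)"
    using le ne by (simp add: Basis_plane inner_axis ennreal_mult)
  finally show "emeasure (distr lborel borel plane_of) (box l u) = (\<Prod>b\<in>Basis. (u - l) \<bullet> b)" .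
qed simp

context triangle
begin

text \<open>The cone coordinates as a map of the plane into itself.\<close>

definition cone_v :: "plane => plane" where
  "cone_v v = c + (v$1) *\<^sub>R ((1 - v$2) *\<^sub>R a + (v$2) *\<^sub>R b - c)"

lemma cone_v_plane_of: "cone_v (plane_of p) = cone p"
  by (simp add: cone_v_def cone_def plane_of_nth)

definition cone_v' :: "plane => plane => plane" where
  "cone_v' v h = (h$1) *\<^sub>R ((1 - v$2) *\<^sub>R a + (v$2) *\<^sub>R b - c) + (v$1 * h$2) *\<^sub>R (b - a)"

lemma cone_v_derivative: "(cone_v has_derivative cone_v' v) (at v within S)"
proof -
  have n: "((%v::plane. v$i) has_derivative (%h. h$i)) (at v within S)" for i
    by (rule bounded_linear_imp_has_derivative[OF bounded_linear_vec_nth])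
  have m: "((%v. (1 - v$2) *\<^sub>R a + (v$2) *\<^sub>R b - c) has_derivative (%h. (0 - h$2) *\<^sub>R a + (h$2) *\<^sub>R b - 0)) (at v within S)"
    by (intro has_derivative_diff has_derivative_add has_derivative_scaleR_left n has_derivative_const)
  have "(cone_v has_derivative (%h. 0 + ((v$1) *\<^sub>R ((0 - h$2) *\<^sub>R a + (h$2) *\<^sub>R b - 0)
      + (h$1) *\<^sub>R ((1 - v$2) *\<^sub>R a + (v$2) *\<^sub>R b - c)))) (at v within S)"
    unfolding cone_v_def[abs_def]
    by (intro has_derivative_add has_derivative_const has_derivative_scaleR n m)
  moreover have "(%h. 0 + ((v$1) *\<^sub>R ((0 - h$2) *\<^sub>R a + (h$2) *\<^sub>R b - 0)
      + (h$1) *\<^sub>R ((1 - v$2) *\<^sub>R a + (v$2) *\<^sub>R b - c))) = cone_v' v"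
    by (rule ext) (simp add: cone_v'_def algebra_simps)
  ultimately show ?thesis by simp
qed

lemma det_cone_v': "det (matrix (cone_v' v)) = v$1 * J"
proof -
  have m: "matrix (cone_v' v) $ i $ j = cone_v' v (axis j 1) $ i" for i j by (simp add: matrix_def)
  show ?thesis
    unfolding det_2 m by (simp add: cone_v'_def axis_def J_def cr_def algebra_simps)
qed

lemma borel_measurable_cone[measurable]: "cone \<in> borel \<rightarrow>\<^sub>M borel"
  unfolding cone_def[abs_def] by (intro borel_measurable_continuous_onI continuous_intros)

text \<open>The change of variables formula for cone coordinates, as an identity of measures. In this
  form it transports every integral of a Borel function.\<close>

lemma cone_measure:
  "density lborel (indicator D) = distr (density lborel (%p. ennreal (\<bar>J\<bar> * fst p) * indicator Q p)) borel cone"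
  (is "?L = ?R")
proof (rule measure_eqI)
  show "sets ?L = sets ?R" by simp
  fix B assume "B \<in> sets ?L"
  then have B[measurable]: "B \<in> sets borel" by simp
  have D[measurable]: "D \<in> sets borel" using D_open by simp
  have Q[measurable]: "Q \<in> sets borel" unfolding Q_def by (intro borel_open open_Times) auto
  define S where "S = {v. plane_of (v$1, v$2) = v \<and> 0 < v$1 \<and> v$1 < 1 \<and> 0 < v$2 \<and> v$2 < 1 \<and> cone_v v \<in> B}"
  have S_eq: "S = {v. 0 < v$1 \<and> v$1 < 1 \<and> 0 < v$2 \<and> v$2 < 1} \<inter> (cone_v -` B)"
    unfolding S_def by (auto simp: plane_of_nth intro: plane_eqI)
  have cv: "cone_v \<in> borel \<rightarrow>\<^sub>M borel"
    by (rule borel_measurable_continuous_onI) (meson cone_v_derivative has_derivative_continuous continuous_at_imp_continuous_on)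
  have S[measurable]: "S \<in> sets borel"
  proof -
    have "{v::plane. 0 < v$1 \<and> v$1 < 1 \<and> 0 < v$2 \<and> v$2 < 1} \<in> sets borel"
      by (intro borel_open open_Collect_conj open_Collect_less continuous_intros)
    moreover have "cone_v -` B \<in> sets borel" using measurable_sets[OF cv B] by simp
    ultimately show ?thesis unfolding S_eq by (rule sets.Int)
  qed
  have inj: "inj_on cone_v S"
  proof (rule inj_onI)
    fix v w assume vw: "v \<in> S" "w \<in> S" "cone_v v = cone_v w"
    then have "cone (v$1, v$2) = cone (w$1, w$2)" unfolding S_def
      by (metis (mono_tags, lifting) cone_v_plane_of mem_Collect_eq)
    then have "(v$1, v$2) = (w$1, w$2)" using cone_inj vw by (auto simp: inj_on_def S_def Q_def)
    then show "v = w" by (auto intro: plane_eqI)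
  qed
  have im: "cone_v ` S = B \<inter> D"
  proof
    show "cone_v ` S \<subseteq> B \<inter> D"
    proof
      fix x assume "x \<in> cone_v ` S"
      then obtain v where v: "v \<in> S" "x = cone_v v" by blast
      then have "x = cone (v$1, v$2)" "(v$1, v$2) \<in> Q" by (auto simp: S_def Q_def cone_v_plane_of[symmetric])
      then show "x \<in> B \<inter> D" using v cone_image by (auto simp: S_def)
    qed
    show "B \<inter> D \<subseteq> cone_v ` S"
    proof
      fix x assume x: "x \<in> B \<inter> D"
      then obtain p where p: "p \<in> Q" "x = cone p" using cone_image by blast
      then have "plane_of p \<in> S" using x by (auto simp: S_def Q_def plane_of_nth cone_v_plane_of)
      moreover have "x = cone_v (plane_of p)" using p by (simp add: cone_v_plane_of)
      ultimately show "x \<in> cone_v ` S" by blast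
    qed
  qed
  have fin: "B \<inter> D \<in> lmeasurable"
    by (rule bounded_set_imp_lmeasurable) (use D_bounded bounded_subset in auto)
  have SL: "S \<in> sets lebesgue" using S by auto
  let ?j = "%v::plane. \<bar>det (matrix (cone_v' v))\<bar>"
  have int: "?j integrable_on S"
    using measurable_differentiable_image_eq[OF SL cone_v_derivative inj] fin by (simp add: im)
  have m: "measure lebesgue (B \<inter> D) = integral S ?j"
    using measure_differentiable_image_eq[OF SL cone_v_derivative inj int] by (simp add: im)
  have je: "?j v = \<bar>J\<bar> * v$1" if "v \<in> S" for v
    using that by (simp add: det_cone_v' abs_mult S_def)
  have "(?j has_integral measure lebesgue (B \<inter> D)) S" using int m by (simp add: has_integral_iff)
  then have "((%v. \<bar>J\<bar> * v$1) has_integral measure lebesgue (B \<inter> D)) S"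
    by (rule has_integral_cong[THEN iffD1, rotated]) (rule je)
  then have h: "((%v. indicator S v * (\<bar>J\<bar> * v$1)) has_integral measure lebesgue (B \<inter> D)) UNIV"
  proof -
    have e: "(%v. indicator S v * (\<bar>J\<bar> * v$1)) = (%v. if v \<in> S then \<bar>J\<bar> * v$1 else 0)" by (auto simp: indicator_def)
    assume "((%v. \<bar>J\<bar> * v$1) has_integral measure lebesgue (B \<inter> D)) S"
    then show ?thesis unfolding e by (simp only: has_integral_restrict_UNIV)
  qed
  have nth: "(%v::plane. v$1) \<in> borel_measurable borel"
    by (intro borel_measurable_continuous_onI continuous_intros)
  have "(\<integral>\<^sup>+v. ennreal (indicator S v * (\<bar>J\<bar> * v$1)) \<partial>lborel) = measure lebesgue (B \<inter> D)"
  proof (rule nn_integral_has_integral_lborel[OF _ _ h])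
    show "(%v. indicator S v * (\<bar>J\<bar> * v$1)) \<in> borel_measurable borel"
      using S nth by measurable
    show "0 \<le> indicator S v * (\<bar>J\<bar> * v$1)" for v by (auto simp: indicator_def S_def)
  qed
  also have "(\<integral>\<^sup>+v. ennreal (indicator S v * (\<bar>J\<bar> * v$1)) \<partial>lborel)
     = (\<integral>\<^sup>+p. ennreal (indicator S (plane_of p) * (\<bar>J\<bar> * plane_of p$1)) \<partial>lborel)"
    by (subst distr_plane_of[symmetric], rule nn_integral_distr) (use S nth in measurable)
  also have "... = (\<integral>\<^sup>+p. ennreal (\<bar>J\<bar> * fst p) * indicator Q p * indicator (cone -` B) p \<partial>lborel)"
  proof (rule nn_integral_cong)
    fix p :: "real \<times> real"
    have "plane_of p \<in> S \<longleftrightarrow> p \<in> Q \<and> cone p \<in> B"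
      by (cases p) (auto simp: S_def Q_def plane_of_nth cone_v_plane_of)
    then show "ennreal (indicator S (plane_of p) * (\<bar>J\<bar> * plane_of p$1)) = ennreal (\<bar>J\<bar> * fst p) * indicator Q p * indicator (cone -` B) p"
      by (simp add: indicator_def plane_of_nth)
  qed
  also have "... = emeasure ?R B"
  proof -
    have "cone -` B \<in> sets borel" using measurable_sets[OF borel_measurable_cone B] by simp
    moreover have "(%p. ennreal (\<bar>J\<bar> * fst p) * indicator Q p) \<in> borel_measurable borel"
    proof (intro borel_measurable_times_ennreal borel_measurable_indicator Q)
      show "(%p::real\<times>real. ennreal (\<bar>J\<bar> * fst p)) \<in> borel_measurable borel"
        by (intro measurable_compose[OF _ measurable_ennreal] borel_measurable_continuous_onI continuous_intros)
    qed
    ultimately show ?thesis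
      by (subst emeasure_distr) (auto simp: emeasure_density)
  qed
  finally have R: "emeasure ?R B = ennreal (measure lebesgue (B \<inter> D))" by simp
  have "emeasure ?L B = emeasure lborel (B \<inter> D)"
    by (subst emeasure_density) (auto simp: indicator_inter_arith[symmetric] Int_commute
      intro!: arg_cong2[of _ _ _ _ "%x y. integral\<^sup>N x y"] simp flip: nn_integral_indicator)
  also have "... = emeasure lebesgue (B \<inter> D)" by (simp add: emeasure_completion)
  also have "... = ennreal (measure lebesgue (B \<inter> D))"
    using fin by (simp add: emeasure_eq_measure2)
  finally show "emeasure ?L B = emeasure ?R B" using R by simp
qed

end

subsection \<open>Integration by parts on a triangle up to the boundary\<close>

lemma lborel_product_integral:
  fixes A B :: "real => real"
  assumes "integrable lborel A" "integrable lborel B"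
  shows "integrable lborel (%p. A (fst p) * B (snd p))"
    "integral\<^sup>L lborel (%p. A (fst p) * B (snd p)) = integral\<^sup>L lborel A * integral\<^sup>L lborel B"
proof -
  have [measurable]: "A \<in> borel_measurable borel" "B \<in> borel_measurable borel" using assms by auto
  have i: "integrable (lborel \<Otimes>\<^sub>M lborel) (%(s, t). A s * B t)"
  proof (rule lborel_pair.Fubini_integrable)
    show "(%(s, t). A s * B t) \<in> borel_measurable (lborel \<Otimes>\<^sub>M lborel)" by measurable
    show "integrable lborel (%x. LINT y|lborel. norm (case (x, y) of (s, t) => A s * B t))"
      using assms by (simp add: abs_mult)
  qed (use assms in auto)
  have e: "(%(s, t). A s * B t) = (%p. A (fst p) * B (snd p))" by auto
  from i show "integrable lborel (%p. A (fst p) * B (snd p))" by (simp only: lborel_prod e)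
  have "integral\<^sup>L (lborel \<Otimes>\<^sub>M lborel) (%(s, t). A s * B t) = (LINT s|lborel. (LINT t|lborel. A s * B t))"
    by (rule lborel_pair.integral_fst[OF i, symmetric])
  then show "integral\<^sup>L lborel (%p. A (fst p) * B (snd p)) = integral\<^sup>L lborel A * integral\<^sup>L lborel B"
    by (simp add: lborel_prod e)
qed

definition edge_integral :: "plane => plane => (plane => real) => real" where
  "edge_integral p q w = (LINT t|lborel. indicator {0..1} t *\<^sub>R \<bar>w ((1 - t) *\<^sub>R p + t *\<^sub>R q)\<bar>)"

text \<open>The derivative of the cutoff \<open>kappa (n r - 1)\<close> with respect to \<open>r\<close>. Its
  mass concentrates at \<open>r = 0\<close>.\<close>

definition layer :: "nat => real => real" where
  "layer n r = real n * kappa' (real n * r - 1)"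

lemma layer_nonneg: "0 \<le> layer n r" by (simp add: layer_def kappa'_bounds)

lemma continuous_kappa': "continuous_on S kappa'"
  by (rule continuous_at_imp_continuous_on) (simp add: kappa'_isCont)

lemma layer_continuous: "continuous_on S (%s. layer n (1 - s))"
  unfolding layer_def
  by (intro continuous_on_mult continuous_on_const continuous_on_compose2[OF continuous_kappa'[of UNIV]] continuous_on_diff continuous_on_id) simp

lemma layer_integral:
  assumes "0 \<le> u"
  shows "integrable lborel (%s. indicator {0..u} s * layer n (1 - s))"
    "(LINT s|lborel. indicator {0..u} s * layer n (1 - s)) = kappa (real n - 1) - kappa (real n * (1 - u) - 1)"
proof -
  show "integrable lborel (%s. indicator {0..u} s * layer n (1 - s))"
    using borel_integrable_compact[of "{0..u}" "%s. layer n (1 - s)"] layer_continuous by simp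
  have d: "((%s. - kappa (real n * (1 - s) - 1)) has_real_derivative layer n (1 - s)) (at s)" for s
  proof -
    have "((%s. real n * (1 - s) - 1) has_real_derivative - real n) (at s)"
      by (auto intro!: derivative_eq_intros)
    from DERIV_minus[OF DERIV_chain2[OF kappa_deriv this]]
    show ?thesis by (simp add: layer_def mult.commute)
  qed
  have "(LINT s|lborel. indicator {0..u} s *\<^sub>R layer n (1 - s)) = - kappa (real n * (1 - u) - 1) - - kappa (real n * (1 - 0) - 1)"
    by (rule integral_FTC_atLeastAtMost[OF assms _ layer_continuous])
      (simp only: has_real_derivative_iff_has_vector_derivative[symmetric], rule has_field_derivative_at_within[OF d])
  then show "(LINT s|lborel. indicator {0..u} s * layer n (1 - s)) = kappa (real n - 1) - kappa (real n * (1 - u) - 1)"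
    by simp
qed

context triangle
begin

text \<open>The density of the area of the triangle in cone coordinates.\<close>

definition wt :: "real \<times> real => real" where "wt p = \<bar>J\<bar> * fst p * indicator Q p"

lemma Q_measurable[measurable]: "Q \<in> sets borel"
  unfolding Q_def by (intro borel_open open_Times) auto

lemma wt_measurable[measurable]: "wt \<in> borel_measurable borel"
proof -
  have "(%p::real\<times>real. \<bar>J\<bar> * fst p) \<in> borel_measurable borel"
    by (intro borel_measurable_continuous_onI continuous_intros)
  then show ?thesis unfolding wt_def[abs_def]
    by (rule borel_measurable_times[OF _ borel_measurable_indicator[OF Q_measurable]])
qed

lemma wt_nonneg: "0 \<le> wt p" and wt_le: "wt p \<le> \<bar>J\<bar> * indicator Q p"
  by (auto simp: wt_def indicator_def Q_def intro!: mult_left_le)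

lemma cone_integral:
  fixes f :: "plane => real"
  assumes f[measurable]: "f \<in> borel_measurable borel"
  shows "integral\<^sup>L (lebesgue_on D) f = (LINT p|lborel. wt p * f (cone p))"
    "integrable (lebesgue_on D) f \<longleftrightarrow> integrable lborel (%p. wt p * f (cone p))"
proof -
  have D[measurable]: "D \<in> sets borel" using D_open by simp
  have m: "density lborel (indicator D) = density lborel (%x. ennreal (indicator D x))"
    by (simp add: ennreal_indicator)
  have w: "density lborel (%p. ennreal (\<bar>J\<bar> * fst p) * indicator Q p) = density lborel (%p. ennreal (wt p))"
    by (rule arg_cong2[of _ _ _ _ density, OF refl])
      (auto simp: fun_eq_iff wt_def indicator_def)
  have eq: "density lborel (%x. ennreal (indicator D x)) = distr (density lborel (%p. ennreal (wt p))) borel cone"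
    using cone_measure by (simp only: m w)
  have cm: "cone \<in> density lborel (%p. ennreal (wt p)) \<rightarrow>\<^sub>M borel" by simp
  have fc: "(%p. f (cone p)) \<in> borel_measurable lborel" by simp
  have fl: "f \<in> borel_measurable lborel" by simp
  have iD: "(indicator D :: plane => real) \<in> borel_measurable lborel" by (rule borel_measurable_indicator) simp
  have wl: "wt \<in> borel_measurable lborel" by simp
  have "integral\<^sup>L (lebesgue_on D) f = (LINT x|lborel. indicator D x *\<^sub>R f x)"
    using D by (simp add: integral_restrict_space integral_completion)
  also have "... = integral\<^sup>L (density lborel (%x. ennreal (indicator D x))) f"
    by (rule integral_density[OF fl iD, symmetric]) simp
  also have "... = (\<integral>p. f (cone p) \<partial>density lborel (%p. ennreal (wt p)))"
    unfolding eq by (rule integral_distr[OF cm f])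
  also have "... = (LINT p|lborel. wt p *\<^sub>R f (cone p))"
    by (rule integral_density[OF fc wl]) (simp add: wt_nonneg)
  finally show "integral\<^sup>L (lebesgue_on D) f = (LINT p|lborel. wt p * f (cone p))" by simp
  have "integrable (lebesgue_on D) f \<longleftrightarrow> integrable lborel (%x. indicator D x *\<^sub>R f x)"
    using D by (simp add: integrable_restrict_space integrable_completion)
  also have "... \<longleftrightarrow> integrable (density lborel (%x. ennreal (indicator D x))) f"
    by (rule integrable_density[OF fl iD, symmetric]) simp
  also have "... \<longleftrightarrow> integrable (density lborel (%p. ennreal (wt p))) (%p. f (cone p))"
    unfolding eq by (rule integrable_distr_eq[OF cm f])
  also have "... \<longleftrightarrow> integrable lborel (%p. wt p *\<^sub>R f (cone p))"
    by (rule integrable_density[OF fc wl]) (simp add: wt_nonneg)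
  finally show "integrable (lebesgue_on D) f \<longleftrightarrow> integrable lborel (%p. wt p * f (cone p))" by simp
qed

lemma cone_in_T: "0 \<le> s ==> s \<le> 1 ==> 0 \<le> t ==> t \<le> 1 ==> cone (s, t) \<in> T"
  by (simp add: mem_T bary_cone)

lemma cone_1: "cone (1, t) = (1 - t) *\<^sub>R a + t *\<^sub>R b"
  by (simp add: cone_def)

lemma dist_cone_1:
  assumes "0 \<le> s" "s \<le> 1" "0 \<le> t" "t \<le> 1"
  shows "dist (cone (s, t)) (cone (1, t)) \<le> (1 - s) * (norm (a - c) + norm (b - c))"
proof -
  have "cone (s, t) - cone (1, t) = (s - 1) *\<^sub>R ((1 - t) *\<^sub>R (a - c) + t *\<^sub>R (b - c))"
    by (simp add: cone_def algebra_simps)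
  then have "dist (cone (s, t)) (cone (1, t)) = (1 - s) * norm ((1 - t) *\<^sub>R (a - c) + t *\<^sub>R (b - c))"
    using assms by (simp add: dist_norm)
  also have "norm ((1 - t) *\<^sub>R (a - c) + t *\<^sub>R (b - c)) \<le> norm ((1 - t) *\<^sub>R (a - c)) + norm (t *\<^sub>R (b - c))"
    by (rule norm_triangle_ineq)
  also have "... \<le> norm (a - c) + norm (b - c)"
    using assms by (intro add_mono) (auto intro: mult_left_le_one_le)
  finally show ?thesis using assms by (simp add: mult_left_mono)
qed

text \<open>In cone coordinates based at \<open>c\<close> the edge is \<open>s = 1\<close> and the layer
  function depends on \<open>s\<close> only. It has mass at most one, so in the limit only the values
  of \<open>w\<close> on the edge remain.\<close>

lemma boundary_layer:
  assumes w: "continuous_on T w" and e: "e > 0"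
  shows "\<forall>\<^sub>F n in sequentially. (LINT x|lebesgue_on D. \<bar>w x\<bar> * layer n (bary a b c x)) \<le> \<bar>J\<bar> * edge_integral a b w + e"
proof -
  (* uniform continuity is used within distance \<delta> of the edge; the rest of the layer has
     small mass *)
  define e' where "e' = e / (2 * (\<bar>J\<bar> + 1))"
  have e': "e' > 0" "\<bar>J\<bar> * e' \<le> e / 2" using e by (auto simp: e'_def field_simps)
  obtain M0 where M0: "\<forall>y\<in>w ` T. norm y \<le> M0"
    using compact_imp_bounded[OF compact_continuous_image[OF w T_compact]] bounded_iff by metis
  define M where "M = max M0 0"
  have M: "M \<ge> 0" "x \<in> T ==> \<bar>w x\<bar> \<le> M" for x using M0 by (auto simp: M_def le_max_iff_disj)
  define K where "K = norm (a - c) + norm (b - c) + 1"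
  have K: "K > 0" unfolding K_def using norm_ge_zero[of "a - c"] norm_ge_zero[of "b - c"] by linarith
  obtain \<delta>0 where \<delta>0: "\<delta>0 > 0" "!!x y. x \<in> T ==> y \<in> T ==> dist y x < \<delta>0 ==> dist (w y) (w x) < e'"
    using compact_uniformly_continuous[OF w T_compact] e'(1) unfolding uniformly_continuous_on_def by metis
  define \<delta> where "\<delta> = min (\<delta>0 / K) (1/2)"
  have \<delta>: "\<delta> > 0" "\<delta> < 1" "\<delta> * K \<le> \<delta>0"
  proof -
    show "\<delta> > 0" "\<delta> < 1" using \<delta>0 K by (auto simp: \<delta>_def)
    have "\<delta> * K \<le> \<delta>0 / K * K" using K by (intro mult_right_mono) (auto simp: \<delta>_def)
    then show "\<delta> * K \<le> \<delta>0" using K by simp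
  qed
  define W where "W t = \<bar>w (cone (1, t))\<bar>" for t
  have Wc: "continuous_on {0..1} W" unfolding W_def cone_1
    by (intro continuous_on_rabs continuous_on_compose2[OF w] continuous_intros)
      (use cone_in_T[of 1] in "auto simp: cone_1")
  have Wi: "integrable lborel (%t. indicator {0..1} t * W t)"
    using borel_integrable_compact[OF compact_Icc Wc] by simp
  have Ei: "(LINT t|lborel. indicator {0..1} t * W t) = edge_integral a b w"
    by (simp add: edge_integral_def W_def cone_1)
  let ?I = "%t::real. indicator {0..1} t :: real"
  have Ii: "integrable lborel ?I" "integral\<^sup>L lborel ?I = 1" by simp_all
  define wT where "wT x = (if x \<in> T then \<bar>w x\<bar> else 0)" for x
  have [measurable]: "wT \<in> borel_measurable borel" unfolding wT_def
    by (rule borel_measurable_continuous_on_if)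
      (use borel_closed[OF compact_imp_closed[OF T_compact]] w in "auto intro!: continuous_intros")
  have [measurable]: "bary a b c \<in> borel_measurable borel"
    by (rule borel_measurable_continuous_onI[OF continuous_bary])
  have [measurable]: "kappa' \<in> borel_measurable borel"
    by (rule borel_measurable_continuous_onI[OF continuous_kappa'])
  have bound: "(LINT x|lebesgue_on D. \<bar>w x\<bar> * layer n (bary a b c x))
      \<le> \<bar>J\<bar> * (edge_integral a b w + e') + \<bar>J\<bar> * M * (1 - kappa (real n * \<delta> - 1))" for n
  proof -
    define A1 where "A1 s = indicator {0..1} s * layer n (1 - s)" for s :: real
    define A2 where "A2 s = indicator {0..1 - \<delta>} s * layer n (1 - s)" for s :: real
    define B where "B t = ?I t * W t + e' * ?I t" for t
    have A1: "integrable lborel A1" "integral\<^sup>L lborel A1 \<le> 1" "0 \<le> integral\<^sup>L lborel A1"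
      using layer_integral[of 1 n] kappa_bounds[of "real n - 1"] kappa_nonpos(1)[of "-1"] unfolding A1_def[abs_def] by auto
    have A2: "integrable lborel A2" "integral\<^sup>L lborel A2 \<le> 1 - kappa (real n * \<delta> - 1)"
      using layer_integral[of "1 - \<delta>" n] \<delta> kappa_bounds[of "real n - 1"] unfolding A2_def[abs_def] by auto
    have B: "integrable lborel B" "integral\<^sup>L lborel B = edge_integral a b w + e'"
      unfolding B_def[abs_def] using Wi Ii Ei by simp_all
    have En: "0 \<le> edge_integral a b w"
      unfolding edge_integral_def by (rule integral_nonneg_AE) (simp add: indicator_def)
    let ?h = "%p. \<bar>J\<bar> * (A1 (fst p) * B (snd p)) + \<bar>J\<bar> * M * (A2 (fst p) * ?I (snd p))"
    have hi: "integrable lborel ?h"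
      using lborel_product_integral(1)[OF A1(1) B(1)] lborel_product_integral(1)[OF A2(1) Ii(1)] by simp
    have hI: "integral\<^sup>L lborel ?h = \<bar>J\<bar> * (integral\<^sup>L lborel A1 * integral\<^sup>L lborel B) + \<bar>J\<bar> * M * (integral\<^sup>L lborel A2 * 1)"
      using lborel_product_integral[OF A1(1) B(1)] lborel_product_integral[OF A2(1) Ii(1)] Ii(2) by simp
    have pw: "wt p * (wT (cone p) * layer n (bary a b c (cone p))) \<le> ?h p" for p
    proof (cases "p \<in> Q")
      case False
      have "0 \<le> ?h p" using e'(1) M(1)
        by (auto simp: A1_def A2_def B_def W_def layer_nonneg indicator_def intro!: add_nonneg_nonneg mult_nonneg_nonneg)
      then show ?thesis using False by (simp add: wt_def)
    next
      case True
      obtain s t where p: "p = (s, t)" by (cases p)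
      have st: "0 < s" "s < 1" "0 < t" "t < 1" using True by (auto simp: p Q_def)
      have inT: "cone (s, t) \<in> T" "cone (1, t) \<in> T" using st by (auto intro!: cone_in_T)
      have i1: "indicator {0..1} s = (1::real)" "indicator {0..1} t = (1::real)" using st by auto
      have key: "\<bar>w (cone (s, t))\<bar> \<le> W t + e' + M * indicator {0..1 - \<delta>} s"
      proof (cases "s \<le> 1 - \<delta>")
        case True
        then have "indicator {0..1 - \<delta>} s = (1::real)" using st by auto
        moreover have "0 \<le> W t" by (simp add: W_def)
        ultimately show ?thesis using M(2)[OF inT(1)] e'(1) by simp
      next
        case False
        have "dist (cone (s, t)) (cone (1, t)) \<le> (1 - s) * (norm (a - c) + norm (b - c))"
          using st by (intro dist_cone_1) auto
        also have "... \<le> (1 - s) * K" using st by (intro mult_left_mono) (auto simp: K_def)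
        also have "... < \<delta> * K" using False K by (intro mult_strict_right_mono) auto
        finally have "dist (cone (s, t)) (cone (1, t)) < \<delta>0" using \<delta>(3) by linarith
        then have "dist (w (cone (s, t))) (w (cone (1, t))) < e'" by (rule \<delta>0(2)[OF inT(2,1)])
        then have "\<bar>w (cone (s, t))\<bar> \<le> W t + e'" unfolding W_def dist_real_def by linarith
        then show ?thesis using M(1) by (simp add: indicator_def)
      qed
      have "wt p * (wT (cone p) * layer n (bary a b c (cone p))) \<le> \<bar>J\<bar> * ((W t + e' + M * indicator {0..1 - \<delta>} s) * layer n (1 - s))"
      proof (intro mult_mono)
        show "wt p \<le> \<bar>J\<bar>" using wt_le[of p] True by simp
        show "wT (cone p) \<le> W t + e' + M * indicator {0..1 - \<delta>} s" using key inT(1) by (simp add: wT_def p)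
        show "layer n (bary a b c (cone p)) \<le> layer n (1 - s)" by (simp add: bary_cone p)
        show "0 \<le> W t + e' + M * indicator {0..1 - \<delta>} s" using key abs_ge_zero order_trans by blast
        show "0 \<le> wT (cone p) * layer n (bary a b c (cone p))" by (simp add: wT_def layer_nonneg)
      qed (simp_all add: layer_nonneg)
      also have "... = ?h p" using i1 by (simp add: p A1_def A2_def B_def algebra_simps)
      finally show ?thesis .
    qed
    have "(LINT x|lebesgue_on D. \<bar>w x\<bar> * layer n (bary a b c x)) = (LINT x|lebesgue_on D. wT x * layer n (bary a b c x))"
      by (rule Bochner_Integration.integral_cong) (use D_subset in "auto simp: wT_def")
    also have "... = (LINT p|lborel. wt p * (wT (cone p) * layer n (bary a b c (cone p))))"
      by (rule cone_integral(1)) (unfold layer_def, measurable)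
    also have "... \<le> integral\<^sup>L lborel ?h"
      by (rule Bochner_Integration.integral_mono'[OF hi pw])
        (use e'(1) M(1) in "auto simp: A1_def A2_def B_def W_def layer_nonneg indicator_def intro!: add_nonneg_nonneg mult_nonneg_nonneg")
    also have "... \<le> \<bar>J\<bar> * (1 * (edge_integral a b w + e')) + \<bar>J\<bar> * M * (1 - kappa (real n * \<delta> - 1))"
      unfolding hI B(2) using A1 A2 M(1) En e'(1)
      by (intro add_mono mult_left_mono mult_right_mono) auto
    finally show ?thesis by simp
  qed
  have "(%n. real n * \<delta> - 1) = (%n. - 1 + real n * \<delta>)" by auto
  moreover have "filterlim (%n. - 1 + real n * \<delta>) at_top sequentially"
    by (intro filterlim_tendsto_add_at_top[OF tendsto_const] filterlim_at_top_mult_tendsto_pos[OF tendsto_const \<delta>(1)] filterlim_real_sequentially)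
  ultimately have "(%n. kappa (real n * \<delta> - 1)) ----> 1"
    using filterlim_compose[OF kappa_at_top] by simp
  then have "(%n. \<bar>J\<bar> * M * (1 - kappa (real n * \<delta> - 1))) ----> \<bar>J\<bar> * M * (1 - 1)"
    by (intro tendsto_intros)
  then have "\<forall>\<^sub>F n in sequentially. \<bar>J\<bar> * M * (1 - kappa (real n * \<delta> - 1)) < e / 2"
    by (rule order_tendstoD(2)) (use e in simp)
  then show ?thesis
  proof eventually_elim
    case (elim n)
    then show ?case using bound[of n] e'(2) by (simp add: distrib_left)
  qed
qed

end

lemma L2_inner_real: "L2_inner D (v::'a::euclidean_space => real) w = (LINT x|lebesgue_on D. v x * w x)"
  by (simp add: L2_inner_def)

lemma smooth_cut: "smooth (%x. kappa (real n * bary p q r x - 1))"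
  by (rule smooth_kappa, rule smooth_diff, rule smooth_cmult, rule smooth_bary, rule smooth_intros(1))

lemma partial_cut:
  "partial i (%x. kappa (real n * bary p q r x - 1)) x = layer n (bary p q r x) * (i \<bullet> bary_grad p q r)"
proof -
  have b: "((%x. real n * bary p q r x - 1) has_derivative (%h. real n * (h \<bullet> bary_grad p q r))) (at x)"
    unfolding bary_affine by (auto intro!: derivative_eq_intros)
  have "((%x. kappa (real n * bary p q r x - 1)) has_derivative
     (%h. kappa' (real n * bary p q r x - 1) * (real n * (h \<bullet> bary_grad p q r)))) (at x)"
    using has_derivative_compose[OF b kappa_deriv[unfolded has_field_derivative_def]] .
  from partial_eqI[OF this] show ?thesis by (simp add: layer_def)
qed

context triangle
begin

definition boundary_integral :: "(plane => real) => real" where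
  "boundary_integral w = edge_integral a b w + edge_integral b c w + edge_integral c a w"

definition green_const :: real where
  "green_const = \<bar>J\<bar> * (norm (bary_grad a b c) + norm (bary_grad b c a) + norm (bary_grad c a b))"

lemma edge_integral_nonneg: "0 \<le> edge_integral p q w"
  unfolding edge_integral_def by (rule integral_nonneg_AE) (simp add: indicator_def)

lemma continuous_T_integrable:
  fixes f :: "plane => real"
  assumes "continuous_on T f" shows "integrable (lebesgue_on D) f"
  by (rule L2_bounded_integrable[OF D_open D_bounded continuous_L2_on[OF D_open D_bounded]])
    (simp add: closure_D assms)

text \<open>The product of three smooth cutoffs vanishes near the boundary of the triangle and tends to one
  inside.\<close>

definition cutoff :: "nat => plane => real" where
  "cutoff n x = kappa (real n * bary a b c x - 1) * (kappa (real n * bary b c a x - 1) * kappa (real n * bary c a b x - 1))"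

lemma cutoff_smooth: "smooth (cutoff n)"
  unfolding cutoff_def[abs_def] by (intro smooth_intros(4) smooth_cut)

lemma cutoff_bounds: "0 \<le> cutoff n x" "cutoff n x \<le> 1"
  unfolding cutoff_def by (auto simp: kappa_bounds intro!: mult_le_one mult_nonneg_nonneg)

lemma cutoff_partial:
  assumes i: "i \<in> Basis"
  shows "\<bar>partial i (cutoff n) x\<bar> \<le> layer n (bary a b c x) * norm (bary_grad a b c)
     + layer n (bary b c a x) * norm (bary_grad b c a) + layer n (bary c a b x) * norm (bary_grad c a b)"
proof -
  let ?c = "%x. kappa (real n * bary a b c x - 1)" and ?a = "%x. kappa (real n * bary b c a x - 1)"
    and ?b = "%x. kappa (real n * bary c a b x - 1)"
  have e: "partial i (cutoff n) x = ?c x * (?a x * partial i ?b x + partial i ?a x * ?b x) + partial i ?c x * (?a x * ?b x)"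
    unfolding cutoff_def[abs_def]
    by (subst smooth_partial_mult[OF smooth_cut smooth_intros(4)[OF smooth_cut smooth_cut]],
        subst smooth_partial_mult[OF smooth_cut smooth_cut]) (rule refl)
  have "\<bar>partial i (cutoff n) x\<bar> \<le> \<bar>?c x * (?a x * partial i ?b x)\<bar> + \<bar>?c x * (partial i ?a x * ?b x)\<bar> + \<bar>partial i ?c x * (?a x * ?b x)\<bar>"
    unfolding e distrib_left by linarith
  also have "... \<le> \<bar>partial i ?b x\<bar> + \<bar>partial i ?a x\<bar> + \<bar>partial i ?c x\<bar>"
  proof (intro add_mono)
    have 1: "\<bar>u * v * z\<bar> \<le> \<bar>z\<bar>" if "0 \<le> u" "u \<le> 1" "0 \<le> v" "v \<le> 1" for u v z :: real
    proof -
      have "u * v \<le> 1" by (rule mult_le_one[OF that(2,3,4)])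
      moreover have "0 \<le> u * v" by (rule mult_nonneg_nonneg[OF that(1,3)])
      ultimately show ?thesis unfolding abs_mult[of "u * v"] by (simp only: abs_of_nonneg mult_left_le_one_le abs_ge_zero)
    qed
    note k = kappa_bounds
    show "\<bar>?c x * (?a x * partial i ?b x)\<bar> \<le> \<bar>partial i ?b x\<bar>"
      using 1[OF k k, of "real n * bary a b c x - 1" "real n * bary b c a x - 1" "partial i ?b x"] by (simp only: mult.assoc)
    show "\<bar>?c x * (partial i ?a x * ?b x)\<bar> \<le> \<bar>partial i ?a x\<bar>"
      using 1[OF k k, of "real n * bary a b c x - 1" "real n * bary c a b x - 1" "partial i ?a x"] by (simp only: ac_simps)
    show "\<bar>partial i ?c x * (?a x * ?b x)\<bar> \<le> \<bar>partial i ?c x\<bar>"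
      using 1[OF k k, of "real n * bary b c a x - 1" "real n * bary c a b x - 1" "partial i ?c x"] by (simp only: ac_simps)
  qed
  also have "... \<le> layer n (bary c a b x) * norm (bary_grad c a b) + layer n (bary b c a x) * norm (bary_grad b c a)
      + layer n (bary a b c x) * norm (bary_grad a b c)"
  proof -
    have 2: "\<bar>layer n u * (i \<bullet> g)\<bar> \<le> layer n u * norm g" for u and g :: plane
    proof -
      have "\<bar>i \<bullet> g\<bar> \<le> norm g" using Basis_le_norm[OF i, of g] by (simp add: inner_commute)
      then show ?thesis using layer_nonneg[of n u] by (simp add: abs_mult mult_left_mono)
    qed
    show ?thesis unfolding partial_cut by (intro add_mono 2)
  qed
  finally show ?thesis by linarith
qed

lemma cutoff_test_fun:
  assumes z: "smooth \<zeta>" and n: "n > 0" shows "test_fun D (%x. \<zeta> x * cutoff n x)"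
proof (rule test_funI)
  let ?K = "T \<inter> ({x. 1 / real n \<le> bary a b c x} \<inter> {x. 1 / real n \<le> bary b c a x} \<inter> {x. 1 / real n \<le> bary c a b x})"
  show "smooth (%x. \<zeta> x * cutoff n x)" by (rule smooth_intros(4)[OF z cutoff_smooth])
  show "compact ?K"
    by (intro compact_Int_closed T_compact closed_Int closed_Collect_le continuous_on_const continuous_bary)
  have "1 / real n > 0" using n by simp
  then show "?K \<subseteq> D" 
    unfolding subset_iff mem_D Int_iff mem_Collect_eq by linarith
  show "\<zeta> x * cutoff n x = 0" if "x \<notin> ?K" for x
  proof -
    have "real n * bary a b c x - 1 \<le> 0 \<or> real n * bary b c a x - 1 \<le> 0 \<or> real n * bary c a b x - 1 \<le> 0"
    proof (rule ccontr)
      assume "\<not> ?thesis"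
      then have "1 / real n \<le> bary a b c x" "1 / real n \<le> bary b c a x" "1 / real n \<le> bary c a b x"
        using n by (auto simp: field_simps)
      moreover from this have "x \<in> T" using \<open>1 / real n > 0\<close> unfolding mem_T by linarith
      ultimately show False using that by simp
    qed
    then show ?thesis unfolding cutoff_def using kappa_nonpos(1) by auto
  qed
qed

lemma cutoff_limit: "x \<in> D ==> (%n. cutoff n x) ----> 1"
proof -
  assume "x \<in> D"
  then have p: "0 < bary a b c x" "0 < bary b c a x" "0 < bary c a b x" by (simp_all add: mem_D)
  have k: "(%n. kappa (real n * t - 1)) ----> 1" if "t > 0" for t
  proof -
    have "filterlim (%n. - 1 + real n * t) at_top sequentially"
      by (intro filterlim_tendsto_add_at_top[OF tendsto_const] filterlim_at_top_mult_tendsto_pos[OF tendsto_const that] filterlim_real_sequentially)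
    then have "filterlim (%n. real n * t - 1) at_top sequentially" by (simp add: algebra_simps)
    from filterlim_compose[OF kappa_at_top this] show ?thesis .
  qed
  have "(%n. cutoff n x) ----> 1 * (1 * 1)" unfolding cutoff_def by (intro tendsto_mult k p)
  then show ?thesis by simp
qed

text \<open>The smooth function \<open>\<zeta>\<close> is multiplied by a cutoff to obtain a test function. The
  derivatives of the cutoff produce boundary layers, which \<open>boundary_layer\<close> estimates by
  the boundary values of \<open>w\<close>.\<close>

lemma green_inequality:
  fixes w \<zeta> :: "plane => real"
  assumes w: "continuous_on T w" and G: "has_weak_gradient D w G" "integrable (lebesgue_on D) G"
    and z: "smooth \<zeta>" "!!x. x \<in> T ==> \<bar>\<zeta> x\<bar> \<le> Z" and i: "i \<in> Basis"
  shows "\<bar>(LINT x|lebesgue_on D. w x * partial i \<zeta> x) + (LINT x|lebesgue_on D. (G x \<bullet> i) * \<zeta> x)\<bar>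
     \<le> Z * green_const * boundary_integral w"
proof -
  interpret r1: triangle b c a by (rule rotate)
  interpret r2: triangle c a b by (rule r1.rotate)
  let ?M = "lebesgue_on D"
  have Js: "r1.J = J" "r2.J = J" unfolding r1.J_def r2.J_def using J_rotate by simp_all
  have TD: "r1.T = T" "r1.D = D" "r2.T = T" "r2.D = D"
    by (simp_all add: r1.T_rotate r1.D_rotate T_rotate D_rotate)
  have "(1/3) *\<^sub>R a + (1/3) *\<^sub>R b + (1/3) *\<^sub>R c \<in> T" using centroid_in_D D_subset by blast
  then have Z: "Z \<ge> 0" using z(2) abs_ge_zero order_trans by blast
  have Gi: "integrable ?M (%x. G x \<bullet> i)" using G(2) by (rule integrable_inner_left)
  have zc: "continuous_on S \<zeta>" and zpc: "continuous_on S (partial i \<zeta>)" for S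
    by (rule smooth_continuous[OF z(1)], rule smooth_continuous[OF smooth_partial[OF z(1) i]])
  have cc: "continuous_on S (cutoff n)" and cpc: "continuous_on S (partial i (cutoff n))" for S n
    by (rule smooth_continuous[OF cutoff_smooth], rule smooth_continuous[OF smooth_partial[OF cutoff_smooth i]])
  have Gz: "integrable ?M (%x. (G x \<bullet> i) * \<zeta> x)"
  proof (rule lintegrable_bound)
    show "integrable ?M (%x. Z * (G x \<bullet> i))" using Gi by simp
    show "(%x. G x \<bullet> i * \<zeta> x) \<in> borel_measurable ?M"
      by (rule borel_measurable_times[OF borel_measurable_integrable[OF Gi] measurable_lebesgue_on_continuous[OF zc]])
    show "AE x in ?M. norm (G x \<bullet> i * \<zeta> x) \<le> norm (Z * (G x \<bullet> i))"
      by (rule AE_I2) (use z(2) D_subset Z in "auto simp: abs_mult mult.commute[of Z] intro!: mult_left_mono")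
  qed
  have wz: "integrable ?M (%x. w x * partial i \<zeta> x)"
    by (rule continuous_T_integrable) (intro continuous_on_mult w zpc)
  define L where "L n = (LINT x|?M. w x * partial i \<zeta> x * cutoff n x) + (LINT x|?M. (G x \<bullet> i) * \<zeta> x * cutoff n x)" for n
  have dom: "(%n. LINT x|?M. f x * cutoff n x) ----> integral\<^sup>L ?M f" if f: "integrable ?M f" for f
  proof (rule integral_dominated_convergence[where w = "%x. \<bar>f x\<bar>"])
    show "AE x in ?M. (%n. f x * cutoff n x) ----> f x"
    proof (rule AE_I2)
      fix x assume "x \<in> space ?M"
      then have "(%n. cutoff n x) ----> 1" by (intro cutoff_limit) simp
      from tendsto_mult_left[OF this, of "f x"] show "(%n. f x * cutoff n x) ----> f x" by simp
    qed
    show "AE x in ?M. norm (f x * cutoff n x) \<le> \<bar>f x\<bar>" for n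
      by (rule AE_I2) (use cutoff_bounds[of n] in "auto simp: abs_mult intro!: mult_left_le")
    show "(%x. f x * cutoff n x) \<in> borel_measurable ?M" for n
      by (rule borel_measurable_times[OF borel_measurable_integrable[OF f] measurable_lebesgue_on_continuous[OF cc]])
  qed (use f in auto)
  have Llim: "L ----> (LINT x|?M. w x * partial i \<zeta> x) + (LINT x|?M. (G x \<bullet> i) * \<zeta> x)"
    unfolding L_def by (rule tendsto_add[OF dom[OF wz] dom[OF Gz]])
  define Y where "Y n = (LINT x|?M. \<bar>w x\<bar> * layer n (bary a b c x)) * norm (bary_grad a b c)
     + (LINT x|?M. \<bar>w x\<bar> * layer n (bary b c a x)) * norm (bary_grad b c a)
     + (LINT x|?M. \<bar>w x\<bar> * layer n (bary c a b x)) * norm (bary_grad c a b)" for n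
  have LY: "\<bar>L n\<bar> \<le> Z * Y n" if n: "n > 0" for n
  proof -
    have t: "test_fun D (%x. \<zeta> x * cutoff n x)" by (rule cutoff_test_fun[OF z(1) n])
    have p: "partial i (%x. \<zeta> x * cutoff n x) x = \<zeta> x * partial i (cutoff n) x + partial i \<zeta> x * cutoff n x" for x
      by (rule smooth_partial_mult[OF z(1) cutoff_smooth])
    have i1: "integrable ?M (%x. w x * \<zeta> x * partial i (cutoff n) x)"
      by (rule continuous_T_integrable) (intro continuous_on_mult w zc cpc)
    have i2: "integrable ?M (%x. w x * partial i \<zeta> x * cutoff n x)"
      by (rule continuous_T_integrable) (intro continuous_on_mult w zpc cc)
    have "(LINT x|?M. w x * partial i (%x. \<zeta> x * cutoff n x) x) = - (LINT x|?M. (G x \<bullet> i) * (\<zeta> x * cutoff n x))"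
      using G(1) t i unfolding has_weak_gradient_iff by blast
    moreover have "(LINT x|?M. w x * partial i (%x. \<zeta> x * cutoff n x) x)
       = (LINT x|?M. w x * \<zeta> x * partial i (cutoff n) x) + (LINT x|?M. w x * partial i \<zeta> x * cutoff n x)"
      unfolding p by (subst lintegral_add[OF i1 i2, symmetric]) (simp add: algebra_simps)
    ultimately have "L n = - (LINT x|?M. w x * \<zeta> x * partial i (cutoff n) x)"
      unfolding L_def by (simp add: mult.assoc)
    then have "\<bar>L n\<bar> \<le> (LINT x|?M. \<bar>w x * \<zeta> x * partial i (cutoff n) x\<bar>)"
      using integral_abs_bound[of ?M "%x. w x * \<zeta> x * partial i (cutoff n) x"] by simp
    also have "... \<le> (LINT x|?M. Z * (\<bar>w x\<bar> * layer n (bary a b c x) * norm (bary_grad a b c)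
         + \<bar>w x\<bar> * layer n (bary b c a x) * norm (bary_grad b c a)
         + \<bar>w x\<bar> * layer n (bary c a b x) * norm (bary_grad c a b)))"
    proof (rule integral_mono)
      have lc: "continuous_on T (%x. layer n (bary p q r x))" for p q r
        unfolding layer_def by (intro continuous_on_mult continuous_on_const
            continuous_on_compose2[OF continuous_kappa'[of UNIV]] continuous_on_diff continuous_bary) simp
      show "integrable ?M (%x. Z * (\<bar>w x\<bar> * layer n (bary a b c x) * norm (bary_grad a b c)
         + \<bar>w x\<bar> * layer n (bary b c a x) * norm (bary_grad b c a)
         + \<bar>w x\<bar> * layer n (bary c a b x) * norm (bary_grad c a b)))"
        by (rule continuous_T_integrable)
          (intro continuous_on_mult continuous_on_add continuous_on_const continuous_on_rabs w lc)
      show "integrable ?M (%x. \<bar>w x * \<zeta> x * partial i (cutoff n) x\<bar>)" using i1 by (rule integrable_abs)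
      fix x assume "x \<in> space ?M"
      then have "x \<in> T" using D_subset by auto
      then have "\<bar>\<zeta> x\<bar> * (\<bar>w x\<bar> * \<bar>partial i (cutoff n) x\<bar>) \<le> Z * (\<bar>w x\<bar> * (layer n (bary a b c x) * norm (bary_grad a b c)
     + layer n (bary b c a x) * norm (bary_grad b c a) + layer n (bary c a b x) * norm (bary_grad c a b)))"
        using Z by (intro mult_mono mult_left_mono z(2) cutoff_partial i) auto
      then show "\<bar>w x * \<zeta> x * partial i (cutoff n) x\<bar> \<le> Z * (\<bar>w x\<bar> * layer n (bary a b c x) * norm (bary_grad a b c)
         + \<bar>w x\<bar> * layer n (bary b c a x) * norm (bary_grad b c a)
         + \<bar>w x\<bar> * layer n (bary c a b x) * norm (bary_grad c a b))"
        by (simp add: abs_mult algebra_simps)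
    qed
    also have "... = Z * Y n"
    proof -
      have lc: "continuous_on T (%x. layer n (bary p q r x))" for p q r
        unfolding layer_def by (intro continuous_on_mult continuous_on_const
            continuous_on_compose2[OF continuous_kappa'[of UNIV]] continuous_on_diff continuous_bary) simp
      have "integrable ?M (%x. \<bar>w x\<bar> * layer n (bary p q r x))" for p q r
        by (rule continuous_T_integrable) (intro continuous_on_mult continuous_on_rabs w lc)
      then show ?thesis unfolding Y_def by simp
    qed
    finally show ?thesis .
  qed
  have bnd: "\<bar>(LINT x|?M. w x * partial i \<zeta> x) + (LINT x|?M. (G x \<bullet> i) * \<zeta> x)\<bar>
     \<le> Z * ((\<bar>J\<bar> * edge_integral a b w + e) * norm (bary_grad a b c) + (\<bar>J\<bar> * edge_integral b c w + e) * norm (bary_grad b c a)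
       + (\<bar>J\<bar> * edge_integral c a w + e) * norm (bary_grad c a b))" if e: "e > 0" for e
  proof (rule tendsto_upperbound[OF tendsto_rabs[OF Llim]])
    show "\<forall>\<^sub>F n in sequentially. \<bar>L n\<bar> \<le> Z * ((\<bar>J\<bar> * edge_integral a b w + e) * norm (bary_grad a b c) + (\<bar>J\<bar> * edge_integral b c w + e) * norm (bary_grad b c a)
       + (\<bar>J\<bar> * edge_integral c a w + e) * norm (bary_grad c a b))"
      using boundary_layer[OF w e] r1.boundary_layer[unfolded TD Js, OF w e] r2.boundary_layer[unfolded TD Js, OF w e] eventually_gt_at_top[of 0]
    proof eventually_elim
      case (elim n)
      have "Y n \<le> (\<bar>J\<bar> * edge_integral a b w + e) * norm (bary_grad a b c) + (\<bar>J\<bar> * edge_integral b c w + e) * norm (bary_grad b c a)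
       + (\<bar>J\<bar> * edge_integral c a w + e) * norm (bary_grad c a b)"
        unfolding Y_def using elim(1-3) by (intro add_mono mult_right_mono) auto
      from mult_left_mono[OF this Z] show ?case using LY[OF elim(4)] by linarith
    qed
  qed simp
  let ?c = "Z * ((\<bar>J\<bar> * edge_integral a b w) * norm (bary_grad a b c) + (\<bar>J\<bar> * edge_integral b c w) * norm (bary_grad b c a)
       + (\<bar>J\<bar> * edge_integral c a w) * norm (bary_grad c a b))"
  let ?N = "Z * (norm (bary_grad a b c) + norm (bary_grad b c a) + norm (bary_grad c a b))"
  have N: "0 \<le> ?N" using Z by (intro mult_nonneg_nonneg add_nonneg_nonneg) auto
  have "\<bar>(LINT x|?M. w x * partial i \<zeta> x) + (LINT x|?M. (G x \<bullet> i) * \<zeta> x)\<bar> \<le> ?c"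
  proof (rule field_le_epsilon)
    fix e :: real assume e: "e > 0"
    have "e / (?N + 1) > 0" using e N by (intro divide_pos_pos) linarith+
    from bnd[OF this] have "\<bar>(LINT x|?M. w x * partial i \<zeta> x) + (LINT x|?M. (G x \<bullet> i) * \<zeta> x)\<bar> \<le> ?c + e / (?N + 1) * ?N"
      by (simp only: distrib_left distrib_right ac_simps)
    also have "e / (?N + 1) * ?N \<le> e" using N e by (simp add: divide_le_eq mult_left_mono)
    finally show "\<bar>(LINT x|?M. w x * partial i \<zeta> x) + (LINT x|?M. (G x \<bullet> i) * \<zeta> x)\<bar> \<le> ?c + e" by simp
  qed
  also have "?c \<le> Z * green_const * boundary_integral w"
  proof -
    have "edge_integral p q w \<le> boundary_integral w" if "(p, q) \<in> {(a, b), (b, c), (c, a)}" for p q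
      using that edge_integral_nonneg[of a b w] edge_integral_nonneg[of b c w] edge_integral_nonneg[of c a w]
      by (auto simp: boundary_integral_def)
    then have "?c \<le> Z * ((\<bar>J\<bar> * boundary_integral w) * norm (bary_grad a b c) + (\<bar>J\<bar> * boundary_integral w) * norm (bary_grad b c a)
       + (\<bar>J\<bar> * boundary_integral w) * norm (bary_grad c a b))"
      using Z by (intro mult_left_mono add_mono mult_right_mono) auto
    also have "... = Z * green_const * boundary_integral w" by (simp add: green_const_def algebra_simps)
    finally show ?thesis .
  qed
  finally show ?thesis .
qed

end

section \<open>Functions with zero trace on a triangle\<close>

lemma arclength_param_eq: "arclength_param p q s = (1 - s / dist p q) *\<^sub>R p + (s / dist p q) *\<^sub>R q"
  by (simp add: arclength_param_def algebra_simps)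

lemma arclength_param_segment:
  assumes "p \<noteq> q" "0 \<le> s" "s \<le> dist p q"
  shows "arclength_param p q s \<in> closed_segment p q"
  unfolding arclength_param_eq in_segment using assms by (intro exI[of _ "s / dist p q"]) auto

lemma continuous_arclength: "continuous_on S (arclength_param p q)"
  unfolding arclength_param_def[abs_def] divide_inverse by (intro continuous_intros)

lemma continuous_on_arclength:
  assumes "p \<noteq> q" "continuous_on (closed_segment p q) w"
  shows "continuous_on {0..dist p q} (w \<circ> arclength_param p q)"
  unfolding o_def
  by (rule continuous_on_compose2[OF assms(2) continuous_arclength])
    (use arclength_param_segment[OF assms(1)] in auto)

lemma segment_L2:
  assumes "p \<noteq> q" "continuous_on (closed_segment p q) w"
  shows "L2_on {0<..<dist p q} (w \<circ> arclength_param p q)"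
  by (rule continuous_L2_on) (use continuous_on_arclength[OF assms] assms(1) in "auto simp: closure_greaterThanLessThan")

lemma L2_segment_norm_eq: "L2_segment_norm p q w = L2_norm {0<..<dist p q} (w \<circ> arclength_param p q)"
  by (simp add: L2_segment_norm_def L2_norm_def)

lemma edge_integral_arclength:
  assumes pq: "p \<noteq> q" and w: "continuous_on (closed_segment p q) w"
  shows "edge_integral p q w = (LINT s|lebesgue_on {0<..<dist p q}. \<bar>w (arclength_param p q s)\<bar>) / dist p q"
proof -
  define L where "L = dist p q"
  have L: "L > 0" using pq by (simp add: L_def)
  define F where "F s = indicator {0..L} s *\<^sub>R \<bar>w (arclength_param p q s)\<bar>" for s
  have c: "continuous_on {0..L} (%s. \<bar>w (arclength_param p q s)\<bar>)"
    using continuous_on_rabs[OF continuous_on_arclength[OF pq w]] by (simp add: o_def L_def)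
  have Fm: "F \<in> borel_measurable borel"
    unfolding F_def[abs_def] by (rule borel_measurable_continuous_on_indicator[OF _ c]) simp
  have Fe: "F (0 + L * t) = indicator {0..1} t *\<^sub>R \<bar>w ((1 - t) *\<^sub>R p + t *\<^sub>R q)\<bar>" for t
    using L by (auto simp: F_def arclength_param_eq L_def[symmetric] indicator_def zero_le_mult_iff mult_le_cancel_left1)
  have "integral\<^sup>L lborel F = \<bar>L\<bar> *\<^sub>R (LINT t|lborel. F (0 + L * t))"
    by (rule lborel_integral_real_affine) (use L in simp)
  then have 1: "integral\<^sup>L lborel F = L * edge_integral p q w"
    using L Fe by (simp add: edge_integral_def)
  have "(LINT s|lebesgue_on {0<..<L}. \<bar>w (arclength_param p q s)\<bar>) = (LINT s|lebesgue. indicator {0<..<L} s *\<^sub>R \<bar>w (arclength_param p q s)\<bar>)"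
    by (subst integral_restrict_space) auto
  also have "... = (LINT s|lebesgue. indicator {0<..<L} s *\<^sub>R F s)"
    by (rule Bochner_Integration.integral_cong) (auto simp: F_def indicator_def)
  also have "... = (LINT s|lebesgue. F s)"
  proof (rule integral_cong_AE)
    have FL: "F \<in> borel_measurable lebesgue" using Fm by (intro measurable_completion) simp
    then show "F \<in> borel_measurable lebesgue" .
    show "(%s. indicator {0<..<L} s *\<^sub>R F s) \<in> borel_measurable lebesgue"
      by (intro borel_measurable_scaleR borel_measurable_indicator FL) simp
    have "AE s in lebesgue. s \<notin> {0, L}"
      by (rule AE_not_in) (simp add: negligible_iff_null_sets[symmetric])
    then show "AE s in lebesgue. indicator {0<..<L} s *\<^sub>R F s = F s"
      by eventually_elim (auto simp: F_def indicator_def)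
  qed
  also have "... = integral\<^sup>L lborel F" by (rule integral_completion) (use Fm in simp)
  finally show ?thesis using 1 L by (simp add: L_def[symmetric])
qed

text \<open>Boundary integrals are compared with the norms on segments that define the trace.\<close>

lemma edge_integral_L2:
  assumes pq: "p \<noteq> q" and w: "continuous_on (closed_segment p q) w"
  shows "edge_integral p q w \<le> L2_segment_norm p q w / sqrt (dist p q)"
    "edge_integral p q (%x. (w x)^2) = (L2_segment_norm p q w)^2 / dist p q"
proof -
  let ?I = "{0<..<dist p q}"
  let ?f = "w \<circ> arclength_param p q"
  have L: "dist p q > 0" using pq by simp
  have I: "open ?I" "bounded ?I" by auto
  note f = segment_L2[OF pq w]
  have af: "L2_on ?I (%s. \<bar>?f s\<bar>)" "L2_norm ?I (%s. \<bar>?f s\<bar>) \<le> L2_norm ?I ?f"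
  proof -
    have m: "(%s. \<bar>?f s\<bar>) \<in> borel_measurable (lebesgue_on ?I)" using L2_on_measurable[OF f] by measurable
    have ae: "AE s in lebesgue_on ?I. norm \<bar>?f s\<bar> \<le> norm (?f s)" by simp
    show "L2_on ?I (%s. \<bar>?f s\<bar>)" "L2_norm ?I (%s. \<bar>?f s\<bar>) \<le> L2_norm ?I ?f"
      by (rule L2_norm_mono(1)[OF f m ae], rule L2_norm_mono(2)[OF f m ae])
  qed
  have one: "L2_on ?I (%s. 1::real)" by (rule L2_on_const[OF I])
  have "(L2_norm ?I (%s. 1::real))^2 = dist p q"
    unfolding L2_norm_square_integral using L by (simp add: measure_restrict_space)
  then have n1: "L2_norm ?I (%s. 1::real) = sqrt (dist p q)"
    using L2_norm_nonneg[of ?I "%s. 1::real"] by (metis real_sqrt_unique)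
  have "(LINT s|lebesgue_on ?I. \<bar>?f s\<bar>) = L2_inner ?I (%s. \<bar>?f s\<bar>) (%s. 1)" by (simp add: L2_inner_def)
  also have "... \<le> L2_norm ?I (%s. \<bar>?f s\<bar>) * L2_norm ?I (%s. 1::real)"
    using L2_Cauchy_Schwarz[OF af(1) one] by linarith
  also have "... \<le> L2_norm ?I ?f * sqrt (dist p q)"
    unfolding n1 by (intro mult_right_mono af(2)) simp
  finally have "edge_integral p q w \<le> L2_norm ?I ?f * sqrt (dist p q) / dist p q"
    unfolding edge_integral_arclength[OF pq w] using L by (simp add: divide_right_mono)
  also have "... = L2_norm ?I ?f / sqrt (dist p q)"
    using L by (simp add: field_simps)
  finally show "edge_integral p q w \<le> L2_segment_norm p q w / sqrt (dist p q)"
    by (simp add: L2_segment_norm_eq)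
  have w2: "continuous_on (closed_segment p q) (%x. (w x)^2)" by (intro continuous_intros w)
  show "edge_integral p q (%x. (w x)^2) = (L2_segment_norm p q w)^2 / dist p q"
    unfolding edge_integral_arclength[OF pq w2] L2_segment_norm_eq L2_norm_square_integral by simp
qed

text \<open>The approximating sequence in the definition of a trace, together with the gradients.\<close>

definition trace_sequence :: "plane set => (plane => real) => (plane => plane) => (plane => real)
    => (nat => plane => real) => (nat => plane => plane) => bool" where
  "trace_sequence D v G \<phi> w W \<longleftrightarrow>
     (\<forall>n. continuous_on (closure D) (w n)) \<and> (\<forall>n. H1_pair D (w n) (W n)) \<and>
     L2_lim D w v \<and> L2_lim D W G \<and>
     (\<forall>p q. closed_segment p q \<subseteq> frontier D -->
        (%n. L2_segment_norm p q (%x. w n x - \<phi> x)) ----> 0 \<and> L2_segment p q \<phi>)"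

lemma trace_sequenceD:
  assumes "trace_sequence D v G \<phi> w W"
  shows "!!n. continuous_on (closure D) (w n)" "!!n. H1_pair D (w n) (W n)"
    "L2_lim D w v" "L2_lim D W G"
    "!!p q. closed_segment p q \<subseteq> frontier D ==> (%n. L2_segment_norm p q (%x. w n x - \<phi> x)) ----> 0"
    "!!p q. closed_segment p q \<subseteq> frontier D ==> L2_segment p q \<phi>"
  using assms unfolding trace_sequence_def by simp_all

lemma has_traceE:
  assumes D: "open D" and t: "has_trace D v \<phi>" and G: "H1_pair D v G"
  obtains w W where "trace_sequence D v G \<phi> w W"
proof -
  obtain w :: "nat => plane => real" where w0: "\<forall>n. H1 D (w n) \<and> continuous_on (closure D) (w n)"
    "(%n. H1_norm D (%x. w n x - v x)) ----> 0"
    "\<forall>a b. closed_segment a b \<subseteq> frontier D --> (%n. L2_segment_norm a b (%x. w n x - \<phi> x)) ----> 0"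
    using t unfolding has_trace_def by (elim conjE exE) (rule that)
  then have w: "!!n. H1 D (w n)" "!!n. continuous_on (closure D) (w n)"
    "(%n. H1_norm D (%x. w n x - v x)) ----> 0"
    "!!a b. closed_segment a b \<subseteq> frontier D ==> (%n. L2_segment_norm a b (%x. w n x - \<phi> x)) ----> 0"
    by simp_all
  define W where "W n = weak_gradient D (w n)" for n
  have W: "H1_pair D (w n) (W n)" for n unfolding W_def by (rule H1_imp_pair[OF D w(1)])
  note d = H1_pair_diff[OF D W G]
  have 1: "L2_lim D w v"
    by (rule Lim_null_comparison[OF _ w(3)]) (simp add: L2_norm_nonneg H1_norm_bounds(1)[OF D d])
  have 2: "L2_lim D W G"
    by (rule Lim_null_comparison[OF _ w(3)]) (simp add: L2_norm_nonneg H1_norm_bounds(2)[OF D d])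
  have 3: "L2_segment a b \<phi>" if "closed_segment a b \<subseteq> frontier D" for a b
  proof -
    have "\<forall>a b. closed_segment a b \<subseteq> frontier D --> L2_segment a b \<phi>"
      using t unfolding has_trace_def by (elim conjE)
    then show ?thesis using that by simp
  qed
  show ?thesis
    by (rule that[of w W]) (unfold trace_sequence_def, use w(2) W 1 2 w(4) 3 in simp)
qed

lemma H1_norm_tendsto_0:
  assumes D: "open D" and w: "!!n. H1_pair D (w n) (W n)" and v: "H1_pair D v G"
    and lim: "L2_lim D w v" "L2_lim D W G"
  shows "(%n. H1_norm D (%x. w n x - v x)) ----> 0"
proof (rule Lim_null_comparison)
  note d = H1_pair_diff[OF D w v]
  have "0 \<le> H1_norm D (%x. w n x - v x)" for n
    using H1_norm_bounds(1)[OF D d, of n] L2_norm_nonneg order_trans by blast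
  then show "\<forall>\<^sub>F n in sequentially. norm (H1_norm D (%x. w n x - v x)) \<le> L2_norm D (%x. w n x - v x) + L2_norm D (%x. W n x - G x)"
    using H1_norm_bounds(3)[OF D d] by simp
  show "(%n. L2_norm D (%x. w n x - v x) + L2_norm D (%x. W n x - G x)) ----> 0"
    using tendsto_add[OF lim] by simp
qed

lemma has_traceI:
  assumes D: "open D" and v: "H1_pair D v G"
    and w: "!!n. continuous_on (closure D) (w n)" "!!n. H1_pair D (w n) (W n)"
    and lim: "L2_lim D w v" "L2_lim D W G"
    and "!!p q. closed_segment p q \<subseteq> frontier D ==> L2_segment p q \<phi>"
    and "!!p q. closed_segment p q \<subseteq> frontier D ==> (%n. L2_segment_norm p q (%x. w n x - \<phi> x)) ----> 0"
  shows "has_trace D v \<phi>"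
  unfolding has_trace_def
  by (intro conjI exI[of _ w] allI impI H1_pair_imp_H1[OF v] H1_pair_imp_H1[OF w(2)] w(1)
    H1_norm_tendsto_0[OF D w(2) v lim] assms)

context triangle
begin

lemma vertices_distinct: "a \<noteq> b" "b \<noteq> c" "c \<noteq> a"
  using nondegenerate by (auto simp: cr_def)

lemma edge_in_frontier: "closed_segment a b \<subseteq> frontier D"
proof
  fix x assume "x \<in> closed_segment a b"
  then obtain t where t: "0 \<le> t" "t \<le> 1" "x = (1 - t) *\<^sub>R a + t *\<^sub>R b" unfolding in_segment by blast
  then have "x = cone (1, t)" by (simp add: cone_1)
  then have "x \<in> T" "bary a b c x = 0" using t cone_in_T[of 1 t] by (simp_all add: bary_cone)
  then show "x \<in> frontier D" unfolding frontier_D by (simp add: mem_D)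
qed

lemma edges_in_frontier:
  "closed_segment a b \<subseteq> frontier D" "closed_segment b c \<subseteq> frontier D" "closed_segment c a \<subseteq> frontier D"
proof -
  interpret r1: triangle b c a by (rule rotate)
  interpret r2: triangle c a b by (rule r1.rotate)
  show "closed_segment a b \<subseteq> frontier D" "closed_segment b c \<subseteq> frontier D" "closed_segment c a \<subseteq> frontier D"
    using edge_in_frontier r1.edge_in_frontier r2.edge_in_frontier by (simp_all add: r1.D_rotate D_rotate)
qed

lemma frontier_subset_T: "frontier D \<subseteq> T" by (auto simp: frontier_D)

lemma boundary_integral_tendsto:
  assumes w: "!!n. continuous_on T (w n)"
    and s: "!!p q. closed_segment p q \<subseteq> frontier D ==> (%n. L2_segment_norm p q (w n)) ----> 0"
  shows "(%n. boundary_integral (w n)) ----> 0" "(%n. boundary_integral (%x. (w n x)^2)) ----> 0"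
proof -
  have 1: "(%n. edge_integral p q (w n)) ----> 0" "(%n. edge_integral p q (%x. (w n x)^2)) ----> 0"
    if pq: "p \<noteq> q" "closed_segment p q \<subseteq> frontier D" for p q
  proof -
    have c: "continuous_on (closed_segment p q) (w n)" for n
      by (rule continuous_on_subset[OF w]) (use pq(2) frontier_subset_T in blast)
    have "(%n. L2_segment_norm p q (w n) / sqrt (dist p q)) ----> 0"
      using tendsto_divide[OF s[OF pq(2)] tendsto_const, of "sqrt (dist p q)"] pq(1) by simp
    then show "(%n. edge_integral p q (w n)) ----> 0"
      by (rule Lim_null_comparison[rotated]) (simp add: edge_integral_nonneg edge_integral_L2(1)[OF pq(1) c])
    show "(%n. edge_integral p q (%x. (w n x)^2)) ----> 0"
      unfolding edge_integral_L2(2)[OF pq(1) c]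
      using tendsto_divide[OF tendsto_power[OF s[OF pq(2)], of 2] tendsto_const, of "dist p q"] pq(1) by simp
  qed
  note e = 1[OF vertices_distinct(1) edges_in_frontier(1)] 1[OF vertices_distinct(2) edges_in_frontier(2)]
    1[OF vertices_distinct(3) edges_in_frontier(3)]
  show "(%n. boundary_integral (w n)) ----> 0"
    unfolding boundary_integral_def using tendsto_add[OF tendsto_add[OF e(1,3)] e(5)] by simp
  show "(%n. boundary_integral (%x. (w n x)^2)) ----> 0"
    unfolding boundary_integral_def using tendsto_add[OF tendsto_add[OF e(2,4)] e(6)] by simp
qed

lemma smooth_bounded_T:
  assumes "smooth \<zeta>" obtains Z where "!!x. x \<in> T ==> \<bar>\<zeta> x\<bar> \<le> Z"
proof -
  obtain Z where Z: "\<forall>y\<in>\<zeta> ` T. norm y \<le> Z"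
    using compact_imp_bounded[OF compact_continuous_image[OF smooth_continuous[OF assms] T_compact]] bounded_iff by metis
  show ?thesis by (rule that[of Z]) (use Z in auto)
qed

lemma smooth_L2: "smooth \<zeta> ==> L2_on D \<zeta>"
  by (rule continuous_L2_on[OF D_open D_bounded smooth_continuous])

lemma smooth_L2_Basis: "smooth \<zeta> ==> L2_on D (%x. \<zeta> x *\<^sub>R i)"
  by (rule continuous_L2_on[OF D_open D_bounded]) (intro continuous_on_scaleR continuous_on_const smooth_continuous)

text \<open>\<open>green_inequality\<close> applies to the approximating sequence, whose boundary values tend to
  zero.\<close>

lemma H1_zero_green:
  assumes v: "H1_zero D v" "H1_pair D v G" and z: "smooth \<zeta>" and i: "i \<in> Basis"
  shows "(LINT x|lebesgue_on D. v x * partial i \<zeta> x) = - (LINT x|lebesgue_on D. (G x \<bullet> i) * \<zeta> x)"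
proof -
  obtain w W where "trace_sequence D v G (%x. 0) w W"
    by (rule has_traceE[OF D_open v(1)[unfolded H1_zero_def] v(2)]) (rule that)
  note w = trace_sequenceD[OF this]
  have wT: "continuous_on T (w n)" for n using w(1) by (simp add: closure_D)
  obtain Z where Z: "!!x. x \<in> T ==> \<bar>\<zeta> x\<bar> \<le> Z" using smooth_bounded_T[OF z] by metis
  have w2: "L2_on D (w n)" "L2_on D (W n)" "has_weak_gradient D (w n) (W n)" for n
    using w(2)[of n] by (simp_all add: H1_pair_def)
  have v2: "L2_on D v" "L2_on D G" using v(2) by (simp_all add: H1_pair_def)
  have ineq: "\<bar>L2_inner D (w n) (partial i \<zeta>) + L2_inner D (W n) (%x. \<zeta> x *\<^sub>R i)\<bar> \<le> Z * green_const * boundary_integral (w n)" for n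
    using green_inequality[OF wT w2(3) L2_bounded_integrable[OF D_open D_bounded w2(2)] z Z i, of n]
    by (simp add: L2_inner_def mult.commute[of "\<zeta> _"])
  have "(%n. L2_inner D (w n) (partial i \<zeta>) + L2_inner D (W n) (%x. \<zeta> x *\<^sub>R i)) ----> 0"
  proof (rule Lim_null_comparison)
    show "\<forall>\<^sub>F n in sequentially. norm (L2_inner D (w n) (partial i \<zeta>) + L2_inner D (W n) (%x. \<zeta> x *\<^sub>R i)) \<le> Z * green_const * boundary_integral (w n)"
      using ineq by simp
    have "(%n. boundary_integral (w n)) ----> 0"
      by (rule boundary_integral_tendsto(1)[OF wT]) (use w(5) in simp)
    then show "(%n. Z * green_const * boundary_integral (w n)) ----> 0" by (rule tendsto_mult_right_zero)
  qed
  moreover have "(%n. L2_inner D (w n) (partial i \<zeta>) + L2_inner D (W n) (%x. \<zeta> x *\<^sub>R i))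
      ----> L2_inner D v (partial i \<zeta>) + L2_inner D G (%x. \<zeta> x *\<^sub>R i)"
    by (rule tendsto_add[OF L2_norm_tendsto[OF w2(1) v2(1) w(3) smooth_L2[OF smooth_partial[OF z i]]]
        L2_norm_tendsto[OF w2(2) v2(2) w(4) smooth_L2_Basis[OF z]]])
  ultimately have "L2_inner D v (partial i \<zeta>) + L2_inner D G (%x. \<zeta> x *\<^sub>R i) = 0"
    using LIMSEQ_unique by blast
  then show ?thesis by (simp add: L2_inner_def mult.commute[of "\<zeta> _"])
qed

lemma diameter_T: "x \<in> T ==> y \<in> T ==> dist x y \<le> diameter T"
  by (rule diameter_bounded_bound[OF compact_imp_bounded[OF T_compact]])

lemma vertex_in_T: "a \<in> T" "b \<in> T" "c \<in> T"
  unfolding T_def by (auto intro: hull_inc)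

text \<open>The square of \<open>v\<close> is integrated against \<open>1 = \<partial>\<^sub>i \<zeta>\<close>
  for the affine function \<open>\<zeta> = x\<^sub>i - c\<^sub>i\<close>, which is bounded by the
  diameter. Integration by parts gives \<open>2 v (\<partial>\<^sub>i v) \<zeta>\<close>, and the
  Cauchy--Schwarz inequality finishes. The boundary terms are treated on the approximating sequence.\<close>

lemma Poincare:
  assumes v: "H1_zero D v" "H1_pair D v G"
  shows "L2_norm D v \<le> 2 * diameter T * L2_norm D G"
proof -
  obtain w W where "trace_sequence D v G (%x. 0) w W"
    by (rule has_traceE[OF D_open v(1)[unfolded H1_zero_def] v(2)]) (rule that)
  note w = trace_sequenceD[OF this]
  have wT: "continuous_on T (w n)" for n using w(1) by (simp add: closure_D)
  have w2: "L2_on D (w n)" "L2_on D (W n)" for n using w(2)[of n] by (simp_all add: H1_pair_def)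
  have v2: "L2_on D v" "L2_on D G" using v(2) by (simp_all add: H1_pair_def)
  obtain i :: plane where i: "i \<in> Basis" using nonempty_Basis by blast
  let ?h = "diameter T"
  define \<zeta> where "\<zeta> x = x \<bullet> i - c \<bullet> i" for x
  have z: "smooth \<zeta>" unfolding \<zeta>_def[abs_def] by (rule smooth_diff; rule smooth_intros(1,2))
  have zi: "partial i \<zeta> x = 1" for x
  proof -
    have "(\<zeta> has_derivative (%h. h \<bullet> i)) (at x)" unfolding \<zeta>_def by (auto intro!: derivative_eq_intros)
    from partial_eqI[OF this] show ?thesis using i by simp
  qed
  have Z: "\<bar>\<zeta> x\<bar> \<le> ?h" if "x \<in> T" for x
  proof -
    have "\<bar>\<zeta> x\<bar> \<le> norm (x - c)" using Basis_le_norm[OF i, of "x - c"] by (simp add: \<zeta>_def inner_diff_left)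
    also have "... \<le> ?h" using diameter_T[OF that vertex_in_T(3)] by (simp add: dist_norm)
    finally show ?thesis .
  qed
  have h: "0 \<le> ?h" using Z[OF vertex_in_T(1)] by linarith
  have key: "(L2_norm D (w n))^2 \<le> 2 * ?h * (L2_norm D (w n) * L2_norm D (W n)) + ?h * green_const * boundary_integral (%x. (w n x)^2)" for n
  proof -
    have d: "((%t::real. t^2) has_real_derivative 2 * t) (at t)" for t by (auto intro!: derivative_eq_intros)
    have P: "H1_pair D (%x. (w n x)^2) (%x. (2 * w n x) *\<^sub>R W n x)"
      by (rule H1_pair_chain_continuous[OF D_open D_bounded w(1,2) d]) (intro continuous_intros)
    have P2: "has_weak_gradient D (%x. (w n x)^2) (%x. (2 * w n x) *\<^sub>R W n x)"
      "integrable (lebesgue_on D) (%x. (2 * w n x) *\<^sub>R W n x)"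
      using P by (simp add: H1_pair_def)
        (rule L2_bounded_integrable[OF D_open D_bounded], use P in "simp add: H1_pair_def")
    have c2: "continuous_on T (%x. (w n x)^2)" by (intro continuous_intros wT)
    have g: "\<bar>(LINT x|lebesgue_on D. (w n x)^2 * partial i \<zeta> x) + (LINT x|lebesgue_on D. (((2 * w n x) *\<^sub>R W n x) \<bullet> i) * \<zeta> x)\<bar>
      \<le> ?h * green_const * boundary_integral (%x. (w n x)^2)"
      by (rule green_inequality[OF c2 P2 z Z i])
    have zW: "L2_on D (%x. (W n x \<bullet> i) * \<zeta> x)" "L2_norm D (%x. (W n x \<bullet> i) * \<zeta> x) \<le> ?h * L2_norm D (W n)"
    proof -
      have hW: "L2_on D (%x. ?h *\<^sub>R W n x)" using L2_on_add_scale[OF L2_on_const[OF D_open D_bounded] w2(2), of 0 ?h n] by simp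
      have m: "(%x. (W n x \<bullet> i) * \<zeta> x) \<in> borel_measurable (lebesgue_on D)"
        using L2_on_measurable[OF w2(2)] measurable_lebesgue_on_continuous[OF smooth_continuous[OF z]] by measurable
      have ae: "AE x in lebesgue_on D. norm ((W n x \<bullet> i) * \<zeta> x) \<le> norm (?h *\<^sub>R W n x)"
      proof (rule AE_I2)
        fix x assume "x \<in> space (lebesgue_on D)"
        then have "x \<in> T" using D_subset by auto
        have "\<bar>W n x \<bullet> i\<bar> * \<bar>\<zeta> x\<bar> \<le> norm (W n x) * ?h"
          by (intro mult_mono Z Basis_le_norm i \<open>x \<in> T\<close>) auto
        then show "norm ((W n x \<bullet> i) * \<zeta> x) \<le> norm (?h *\<^sub>R W n x)" using h by (simp add: abs_mult mult.commute)
      qed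
      show "L2_on D (%x. (W n x \<bullet> i) * \<zeta> x)" by (rule L2_norm_mono(1)[OF hW m ae])
      show "L2_norm D (%x. (W n x \<bullet> i) * \<zeta> x) \<le> ?h * L2_norm D (W n)"
        using L2_norm_mono(2)[OF hW m ae] h by (simp add: L2_norm_scale)
    qed
    have "\<bar>LINT x|lebesgue_on D. (((2 * w n x) *\<^sub>R W n x) \<bullet> i) * \<zeta> x\<bar> = 2 * \<bar>L2_inner D (w n) (%x. (W n x \<bullet> i) * \<zeta> x)\<bar>"
    proof -
      have "(LINT x|lebesgue_on D. (((2 * w n x) *\<^sub>R W n x) \<bullet> i) * \<zeta> x) = (LINT x|lebesgue_on D. 2 * (w n x * ((W n x \<bullet> i) * \<zeta> x)))"
        by (simp add: mult.assoc)
      then show ?thesis by (simp add: L2_inner_def abs_mult)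
    qed
    also have "... \<le> 2 * (L2_norm D (w n) * (?h * L2_norm D (W n)))"
      using L2_Cauchy_Schwarz[OF w2(1)[of n] zW(1)] mult_left_mono[OF zW(2) L2_norm_nonneg[of D "w n"]] by linarith
    finally show ?thesis using g by (simp add: zi L2_norm_square_integral algebra_simps)
  qed
  have lim1: "(%n. (L2_norm D (w n))^2) ----> (L2_norm D v)^2"
    by (intro tendsto_power L2_norm_tendsto_norm[OF w2(1) v2(1) w(3)])
  have lim2: "(%n. 2 * ?h * (L2_norm D (w n) * L2_norm D (W n)) + ?h * green_const * boundary_integral (%x. (w n x)^2))
     ----> 2 * ?h * (L2_norm D v * L2_norm D G) + ?h * green_const * 0"
  proof (intro tendsto_add tendsto_mult_left tendsto_mult)
    show "(%n. L2_norm D (w n)) ----> L2_norm D v" by (rule L2_norm_tendsto_norm[OF w2(1) v2(1) w(3)])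
    show "(%n. L2_norm D (W n)) ----> L2_norm D G" by (rule L2_norm_tendsto_norm[OF w2(2) v2(2) w(4)])
    show "(%n. boundary_integral (%x. (w n x)^2)) ----> 0"
      by (rule boundary_integral_tendsto(2)[OF wT]) (use w(5) in simp)
  qed
  have "(L2_norm D v)^2 \<le> 2 * ?h * (L2_norm D v * L2_norm D G) + ?h * green_const * 0"
    by (rule LIMSEQ_le[OF lim1 lim2]) (use key in blast)
  then have "L2_norm D v * L2_norm D v \<le> (2 * ?h * L2_norm D G) * L2_norm D v"
    by (simp add: power2_eq_square ac_simps)
  then show ?thesis
    using L2_norm_nonneg[of D v] L2_norm_nonneg[of D G] h by (cases "L2_norm D v = 0") (auto simp: mult_le_cancel_right)
qed

end

section \<open>The weak maximum principle\<close>

lemma kappa_le: "0 \<le> t ==> kappa t \<le> t"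
proof -
  assume t: "0 \<le> t"
  show "kappa t \<le> t"
  proof (cases "t = 0")
    case False
    then have t: "t > 0" using t by simp
    have "1 / t \<le> exp (1 / t)" using exp_ge_add_one_self[of "1 / t"] by linarith
    then have "exp (- (1 / t)) * (1 / t) \<le> exp (- (1 / t)) * exp (1 / t)" by (rule mult_left_mono) simp
    then have "exp (- (1 / t)) * (1 / t) \<le> 1" by (simp add: exp_add[symmetric])
    then show ?thesis using t by (simp add: kappa_eq field_simps)
  qed (simp add: kappa_eq)
qed

definition harmonic :: "(plane => real) => bool" where
  "harmonic \<psi> \<longleftrightarrow> smooth \<psi> \<and> (\<forall>x. laplacian \<psi> x = 0)"

lemma partial_affine:
  assumes "smooth b" shows "partial i (%x. k + C * b x) x = C * partial i b x"
proof -
  have "((%x. k + C * b x) has_derivative (%h. 0 + C * frechet_derivative b (at x) h)) (at x)"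
    by (intro has_derivative_add has_derivative_const has_derivative_mult_right smooth_has_derivative assms)
  from partial_eqI[OF this] show ?thesis by simp
qed

lemma smooth_affine_comb: "smooth b ==> smooth (%x. k + C * b x)"
  by (intro smooth_intros(3) smooth_intros(1) smooth_cmult)

lemma harmonic_affine:
  assumes "harmonic b" shows "harmonic (%x. k + C * b x)"
  unfolding harmonic_def
proof (intro conjI allI)
  have b: "smooth b" "!!x. laplacian b x = 0" using assms by (auto simp: harmonic_def)
  show "smooth (%x. k + C * b x)" by (rule smooth_affine_comb[OF b(1)])
  fix x :: plane
  have e: "partial i (%x. k + C * b x) = (%x. 0 + C * partial i b x)" for i
    by (rule ext) (simp add: partial_affine[OF b(1)])
  have "laplacian (%x. k + C * b x) x = (\<Sum>i\<in>Basis. C * partial i (partial i b) x)"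
    unfolding e by (intro sum.cong refl partial_affine smooth_partial b(1))
  also have "... = 0" by (simp add: sum_distrib_left[symmetric] b(2))
  finally show "laplacian (%x. k + C * b x) x = 0" .
qed

lemma harmonic_const: "harmonic (%x. k)"
proof -
  have z: "partial i (%x::plane. k::real) x = 0" for i x k
    by (rule partial_eqI[of _ "%h. 0"]) simp
  show ?thesis unfolding harmonic_def by (simp add: smooth_intros(1) z[abs_def])
qed

lemma L2_segment_const_0: "L2_segment p q (%x. 0)"
  unfolding L2_segment_def by (rule continuous_L2_on) (auto simp: o_def)

context triangle
begin

text \<open>Truncation commutes with the approximation by functions that are continuous up to the boundary
  (\<open>H1_chain_limit\<close>), and \<open>kappa (w - \<psi>)\<close> is bounded by \<open>\<bar>w
  - \<phi>\<bar>\<close> on the boundary, where \<open>\<phi> \<le> \<psi>\<close>.\<close>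

lemma truncation_H1_zero:
  assumes t: "has_trace D u \<phi>" and u: "H1_pair D u G" and psi: "smooth \<psi>"
    and le: "!!x. x \<in> frontier D ==> \<phi> x \<le> \<psi> x"
  shows "H1_zero D (%x. kappa (u x - \<psi> x))"
    "H1_pair D (%x. kappa (u x - \<psi> x)) (%x. kappa' (u x - \<psi> x) *\<^sub>R (G x - grad \<psi> x))"
proof -
  obtain w W where "trace_sequence D u G \<phi> w W"
    by (rule has_traceE[OF D_open t u]) (rule that)
  note w = trace_sequenceD[OF this]
  note P = H1_pair_smooth[OF D_open D_bounded psi]
  have c: "continuous_on (closure D) (%x. w n x - \<psi> x)" for n
    by (intro continuous_on_diff w(1) smooth_continuous psi)
  note wP = H1_pair_diff[OF D_open w(2) P] and uP = H1_pair_diff[OF D_open u P]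
  have l1: "(%n. L2_norm D (%x. (w n x - \<psi> x) - (u x - \<psi> x))) ----> 0" using w(3) by simp
  have l2: "(%n. L2_norm D (%x. (W n x - grad \<psi> x) - (G x - grad \<psi> x))) ----> 0" using w(4) by simp
  have kb: "\<bar>kappa' t\<bar> \<le> 1" for t using kappa'_bounds[of t] by simp
  obtain r :: "nat => nat" where r: "strict_mono r"
    "H1_pair D (%x. kappa (u x - \<psi> x)) (%x. kappa' (u x - \<psi> x) *\<^sub>R (G x - grad \<psi> x))"
    "!!n. H1_pair D (%x. kappa (w n x - \<psi> x)) (%x. kappa' (w n x - \<psi> x) *\<^sub>R (W n x - grad \<psi> x))"
    "(%n. L2_norm D (%x. kappa (w (r n) x - \<psi> x) - kappa (u x - \<psi> x))) ----> 0"
    "(%n. L2_norm D (%x. kappa' (w (r n) x - \<psi> x) *\<^sub>R (W (r n) x - grad \<psi> x) - kappa' (u x - \<psi> x) *\<^sub>R (G x - grad \<psi> x))) ----> 0"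
    by (rule H1_chain_limit[OF D_open D_bounded c wP uP l1 l2 kappa_deriv kappa'_isCont kb]) (rule that)
  show pair: "H1_pair D (%x. kappa (u x - \<psi> x)) (%x. kappa' (u x - \<psi> x) *\<^sub>R (G x - grad \<psi> x))" by (rule r(2))
  show "H1_zero D (%x. kappa (u x - \<psi> x))"
    unfolding H1_zero_def
  proof (rule has_traceI[OF D_open pair _ r(3) r(4,5)])
    show "L2_segment p q (%x. 0)" for p q by (rule L2_segment_const_0)
    have "continuous_on UNIV kappa" by (rule continuous_at_imp_continuous_on) (use kappa_deriv DERIV_isCont in blast)
    then show "continuous_on (closure D) (%x. kappa (w (r n) x - \<psi> x))" for n
      by (rule continuous_on_compose2[OF _ c]) simp
    fix p q assume pq: "closed_segment p q \<subseteq> frontier D"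
    show "(%n. L2_segment_norm p q (%x. kappa (w (r n) x - \<psi> x) - 0)) ----> 0"
    proof (cases "p = q")
      case True
      have "space (lebesgue_on {0<..<0::real}) = {}" by simp
      then have "L2_segment_norm p q f = 0" for f
        unfolding L2_segment_norm_def True L2_inner_def by (simp add: Bochner_Integration.integral_empty)
      then show ?thesis by simp
    next
      case False
      let ?I = "{0<..<dist p q}"
      have cs: "continuous_on (closed_segment p q) (w n)" for n
        by (rule continuous_on_subset[OF w(1)]) (use pq in "auto simp: frontier_def")
      have ps: "L2_on ?I (\<phi> \<circ> arclength_param p q)" using w(6)[OF pq] by (simp add: L2_segment_def)
      have d: "L2_on ?I (%s. (w n \<circ> arclength_param p q) s - (\<phi> \<circ> arclength_param p q) s)" for n
        by (rule L2_norm_diff(1)[OF segment_L2[OF False cs] ps])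
      have cn: "continuous_on (closed_segment p q) (%x. kappa (w n x - \<psi> x))" for n
        by (rule continuous_on_compose2[OF \<open>continuous_on UNIV kappa\<close>]) (intro continuous_on_diff cs smooth_continuous psi, simp)
      have "L2_segment_norm p q (%x. kappa (w n x - \<psi> x) - 0) \<le> L2_segment_norm p q (%x. w n x - \<phi> x)" for n
        unfolding L2_segment_norm_eq o_def
      proof (rule L2_norm_mono(2)[OF d[unfolded o_def]])
        show "(%s. kappa (w n (arclength_param p q s) - \<psi> (arclength_param p q s)) - 0) \<in> borel_measurable (lebesgue_on ?I)"
          using L2_on_measurable[OF segment_L2[OF False cn]] by (simp add: o_def)
        show "AE s in lebesgue_on ?I. norm (kappa (w n (arclength_param p q s) - \<psi> (arclength_param p q s)) - 0)
           \<le> norm (w n (arclength_param p q s) - \<phi> (arclength_param p q s))"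
        proof (rule AE_I2)
          fix s assume "s \<in> space (lebesgue_on ?I)"
          then have "arclength_param p q s \<in> frontier D"
            using arclength_param_segment[OF False, of s] pq by auto
          from le[OF this] show "norm (kappa (w n (arclength_param p q s) - \<psi> (arclength_param p q s)) - 0)
           \<le> norm (w n (arclength_param p q s) - \<phi> (arclength_param p q s))"
            using kappa_bounds(1)[of "w n (arclength_param p q s) - \<psi> (arclength_param p q s)"]
              kappa_le[of "w n (arclength_param p q s) - \<psi> (arclength_param p q s)"]
              kappa_nonpos(1)[of "w n (arclength_param p q s) - \<psi> (arclength_param p q s)"]
            by (cases "w n (arclength_param p q s) - \<psi> (arclength_param p q s) \<le> 0") auto
        qed
      qed
      then have "\<forall>\<^sub>F n in sequentially. norm (L2_segment_norm p q (%x. kappa (w (r n) x - \<psi> x) - 0)) \<le> L2_segment_norm p q (%x. w (r n) x - \<phi> x)"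
        by (simp add: L2_segment_norm_eq L2_norm_nonneg)
      then show ?thesis
        by (rule Lim_null_comparison) (use LIMSEQ_subseq_LIMSEQ[OF w(5)[OF pq] r(1)] in "simp add: o_def")
    qed
  qed
qed

text \<open>Testing with the truncation \<open>v\<close> of \<open>u - \<psi>\<close> gives \<open>\<integral>
  kappa'(u - \<psi>) \<bar>\<nabla>(u - \<psi>)\<bar>^2 = 0\<close>, so \<open>v\<close> has zero
  gradient and, by the Poincare inequality, vanishes. Since \<open>kappa\<close> is positive on
  positive numbers, \<open>u \<le> \<psi>\<close>.\<close>

lemma weak_maximum:
  assumes u: "harmonic_extension D \<phi> u" and psi: "harmonic \<psi>"
    and le: "!!x. x \<in> frontier D ==> \<phi> x \<le> \<psi> x"
  shows "AE x in lebesgue_on D. u x \<le> \<psi> x"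
proof -
  have t: "has_trace D u \<phi>" using u by (simp add: harmonic_extension_def)
  define G where "G = weak_gradient D u"
  have G: "H1_pair D u G" unfolding G_def
    by (rule H1_imp_pair[OF D_open]) (use t in "simp add: has_trace_def")
  have s: "smooth \<psi>" using psi by (simp add: harmonic_def)
  let ?v = "%x. kappa (u x - \<psi> x)"
  let ?H = "%x. kappa' (u x - \<psi> x) *\<^sub>R (G x - grad \<psi> x)"
  note v = truncation_H1_zero[OF t G s le]
  have v2: "L2_on D ?v" "L2_on D ?H" using v(2) by (simp_all add: H1_pair_def)
  have G2: "L2_on D G" "L2_on D (grad \<psi>)"
    using G H1_pair_smooth[OF D_open D_bounded s] by (simp_all add: H1_pair_def)
  have "dirichlet_form D u ?v = 0" using u v(1) by (simp add: harmonic_extension_def)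
  then have 1: "L2_inner D G ?H = 0" using dirichlet_form_eq[OF D_open G v(2)] by simp
  have 2: "L2_inner D (grad \<psi>) ?H = 0"
  proof -
    have i1: "integrable (lebesgue_on D) (%x. (?H x \<bullet> i) * partial i \<psi> x)" if "i \<in> Basis" for i
      using L2_inner_integrable[OF v2(2) smooth_L2_Basis[OF smooth_partial[OF s that], of i]] by (simp add: mult.commute)
    have i2: "integrable (lebesgue_on D) (%x. ?v x * partial i (partial i \<psi>) x)" if "i \<in> Basis" for i
      using L2_inner_integrable[OF v2(1) smooth_L2[OF smooth_partial[OF smooth_partial[OF s that] that]]] by simp
    have "L2_inner D (grad \<psi>) ?H = (LINT x|lebesgue_on D. (\<Sum>i\<in>Basis. (?H x \<bullet> i) * partial i \<psi> x))"
      unfolding L2_inner_def by (subst euclidean_inner) (simp add: grad_inner_Basis mult.commute)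
    also have "... = (\<Sum>i\<in>Basis. (LINT x|lebesgue_on D. (?H x \<bullet> i) * partial i \<psi> x))"
      by (rule Bochner_Integration.integral_sum) (rule i1)
    also have "... = (\<Sum>i\<in>Basis. - (LINT x|lebesgue_on D. ?v x * partial i (partial i \<psi>) x))"
    proof (rule sum.cong[OF refl])
      fix i :: plane assume i: "i \<in> Basis"
      show "(LINT x|lebesgue_on D. (?H x \<bullet> i) * partial i \<psi> x) = - (LINT x|lebesgue_on D. ?v x * partial i (partial i \<psi>) x)"
        using H1_zero_green[OF v smooth_partial[OF s i] i] by simp
    qed
    also have "... = - (LINT x|lebesgue_on D. (\<Sum>i\<in>Basis. ?v x * partial i (partial i \<psi>) x))"
      by (subst Bochner_Integration.integral_sum) (simp_all add: i2 sum_negf)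
    also have "... = 0"
      using psi by (simp add: sum_distrib_left[symmetric] harmonic_def)
    finally show ?thesis .
  qed
  have d2: "L2_on D (%x. G x - grad \<psi> x)" by (rule L2_norm_diff(1)[OF G2])
  have "L2_inner D (%x. G x + (-1) *\<^sub>R grad \<psi> x) ?H = L2_inner D G ?H + (-1) * L2_inner D (grad \<psi>) ?H"
    by (rule L2_inner_add_scale[OF G2 v2(2)])
  then have "L2_inner D (%x. G x - grad \<psi> x) ?H = 0" using 1 2 by simp
  then have z: "(LINT x|lebesgue_on D. (G x - grad \<psi> x) \<bullet> ?H x) = 0" by (simp add: L2_inner_def)
  have "AE x in lebesgue_on D. (G x - grad \<psi> x) \<bullet> ?H x = 0"
    by (rule integral_nonneg_eq_0_iff_AE[THEN iffD1, OF L2_inner_integrable[OF d2 v2(2)] _ z])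
      (simp add: kappa'_bounds)
  then have H0: "AE x in lebesgue_on D. ?H x = 0"
    by eventually_elim auto
  have "L2_norm D ?H = L2_norm D (%x. 0::plane)"
    by (rule L2_norm_cong_AE[OF v2(2) L2_on_const[OF D_open D_bounded] H0])
  then have "L2_norm D ?H = 0" by (simp add: L2_norm_def L2_inner_def)
  then have "L2_norm D ?v = 0" using Poincare[OF v] L2_norm_nonneg[of D ?v] by simp
  from L2_norm_zero_AE[OF v2(1) this] show ?thesis
  proof eventually_elim
    case (elim x)
    then show ?case using kappa_pos[of "u x - \<psi> x"] by linarith
  qed
qed

lemma harmonic_extension_uminus:
  assumes "harmonic_extension D \<phi> u"
  shows "harmonic_extension D (%x. - \<phi> x) (%x. - u x)"
proof -
  have t: "has_trace D u \<phi>" using assms by (simp add: harmonic_extension_def)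
  define G where "G = weak_gradient D u"
  have G: "H1_pair D u G" unfolding G_def
    by (rule H1_imp_pair[OF D_open]) (use t in "simp add: has_trace_def")
  have zero: "H1_pair D (%x. 0) (%x. 0)"
    using H1_pair_diff[OF D_open G G] by simp
  have neg: "H1_pair D (%x. - v x) (%x. - V x)" if "H1_pair D v V" for v V
    using H1_pair_diff[OF D_open zero that] by simp
  obtain w W where "trace_sequence D u G \<phi> w W"
    by (rule has_traceE[OF D_open t G]) (rule that)
  note w = trace_sequenceD[OF this]
  have n: "L2_norm A (%x. - f x) = L2_norm A f" for f :: "'x::euclidean_space => 'y::euclidean_space" and A
    by (simp add: L2_norm_def L2_inner_def)
  have nn: "L2_norm A (%x. - f x - - g x) = L2_norm A (%x. f x - g x)" for f g :: "'x::euclidean_space => 'y::euclidean_space" and A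
    using n[of A "%x. f x - g x"] by (simp add: algebra_simps)
  have tr: "has_trace D (%x. - u x) (%x. - \<phi> x)"
  proof (rule has_traceI[OF D_open neg[OF G] _ neg[OF w(2)]])
    show "L2_segment p q (%x. - \<phi> x)" if "closed_segment p q \<subseteq> frontier D" for p q
    proof -
      have "L2_on {0<..<dist p q} (\<phi> \<circ> arclength_param p q)" using w(6)[OF that] by (simp add: L2_segment_def)
      from L2_norm_diff(1)[OF L2_on_const[of "{0<..<dist p q}" 0] this] show ?thesis
        by (auto simp: L2_segment_def o_def)
    qed
    show "continuous_on (closure D) (%x. - w n x)" for n by (intro continuous_on_minus w(1))
    show "(%n. L2_norm D (%x. - w n x - - u x)) ----> 0" "(%n. L2_norm D (%x. - W n x - - G x)) ----> 0"
      by (simp_all only: nn w(3,4))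
    show "(%n. L2_segment_norm p q (%x. - w n x - - \<phi> x)) ----> 0" if "closed_segment p q \<subseteq> frontier D" for p q
      using w(5)[OF that] unfolding L2_segment_norm_eq o_def by (simp only: nn)
  qed
  show ?thesis unfolding harmonic_extension_def
  proof (intro conjI tr allI impI)
    fix z assume z: "H1_zero D z"
    then have zP: "H1_pair D z (weak_gradient D z)"
      by (intro H1_imp_pair[OF D_open]) (simp add: H1_zero_def has_trace_def)
    have "dirichlet_form D u z = 0" using assms z by (simp add: harmonic_extension_def)
    then have "L2_inner D G (weak_gradient D z) = 0" using dirichlet_form_eq[OF D_open G zP] by simp
    then have "L2_inner D (%x. - G x) (weak_gradient D z) = 0" by (simp add: L2_inner_def)
    then show "dirichlet_form D (%x. - u x) z = 0" using dirichlet_form_eq[OF D_open neg[OF G] zP] by simp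
  qed
qed

subsection \<open>Barriers\<close>

text \<open>At a boundary point with supporting normal \<open>\<nu>\<close>, let \<open>y\<close> be the distance to the supporting
  line. Then \<open>\<bar>x - x\<^sub>0\<bar>^2 - 2 y^2\<close> is harmonic in the plane, and a multiple of \<open>y\<close> makes it positive.\<close>

lemma barrier:
  assumes x0: "x0 \<in> frontier D"
  obtains B where "harmonic B" "!!x. x \<in> T ==> (dist x x0)^2 \<le> B x" "!!x. x \<in> T ==> B x \<le> 3 * diameter T * dist x x0"
proof -
  have x0T: "x0 \<in> T" using x0 frontier_subset_T by blast
  have rb: "x0 \<notin> rel_interior T"
  proof -
    have "rel_interior T = D" unfolding D_def
      by (rule rel_interior_nonempty_interior) (use centroid_in_D D_def in blast)
    then show ?thesis using x0 by (simp add: frontier_D)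
  qed
  obtain m where "m \<noteq> 0" and m: "!!y. y \<in> T ==> m \<bullet> x0 \<le> m \<bullet> y"
    by (rule supporting_hyperplane_rel_boundary[OF T_convex x0T rb]) (rule that)
  define \<nu> where "\<nu> = m /\<^sub>R norm m"
  have nu: "norm \<nu> = 1" using \<open>m \<noteq> 0\<close> by (simp add: \<nu>_def)
  have y0: "0 \<le> (x - x0) \<bullet> \<nu>" if "x \<in> T" for x
  proof -
    have "m \<bullet> x0 \<le> m \<bullet> x" by (rule m[OF that])
    then have "0 \<le> (x - x0) \<bullet> m" unfolding inner_commute[of _ m] inner_diff_right by linarith
    then show ?thesis by (simp add: \<nu>_def)
  qed
  let ?d = "diameter T"
  define B where "B x = 2 * ?d * ((x - x0) \<bullet> \<nu>) + (x - x0) \<bullet> (x - x0) - 2 * ((x - x0) \<bullet> \<nu>)^2" for x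
  have D1: "(B has_derivative (%h. 2 * ?d * (h \<bullet> \<nu>) + 2 * ((x - x0) \<bullet> h) - 4 * ((x - x0) \<bullet> \<nu>) * (h \<bullet> \<nu>))) (at x)" for x
    unfolding B_def[abs_def] power2_eq_square
    by (auto intro!: derivative_eq_intros simp: algebra_simps inner_commute)
  then have p1: "partial i B = (%x. 2 * ?d * (i \<bullet> \<nu>) + 2 * ((x - x0) \<bullet> i) - 4 * ((x - x0) \<bullet> \<nu>) * (i \<bullet> \<nu>))" for i
    using partial_eqI[OF D1] by auto
  have D2: "(partial i B has_derivative (%h. 2 * (h \<bullet> i) - 4 * (h \<bullet> \<nu>) * (i \<bullet> \<nu>))) (at x)" for x i
    unfolding p1 by (auto intro!: derivative_eq_intros simp: algebra_simps)
  then have p2: "partial i (partial i B) x = 2 * (i \<bullet> i) - 4 * (i \<bullet> \<nu>)^2" for i x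
    using partial_eqI[OF D2] by (simp add: power2_eq_square)
  have "smooth B"
  proof -
    have l: "smooth (%x. (x - x0) \<bullet> v)" for v
      unfolding inner_diff_left by (rule smooth_diff; rule smooth_intros(1,2))
    have q: "smooth (%x. (x - x0) \<bullet> (x - x0))"
    proof -
      have "smooth (%x. \<Sum>i\<in>Basis. ((x - x0) \<bullet> i) * ((x - x0) \<bullet> i))"
        by (rule smooth_intros(5), rule smooth_intros(4); rule l)
      then show ?thesis by (simp only: euclidean_inner[symmetric])
    qed
    show ?thesis unfolding B_def[abs_def] power2_eq_square
      by (rule smooth_diff, rule smooth_intros(3), rule smooth_cmult, rule l, rule q, rule smooth_cmult, rule smooth_intros(4); rule l)
  qed
  moreover have "laplacian B x = 0" for x
  proof -
    have "(\<Sum>i\<in>(Basis::plane set). (i \<bullet> \<nu>)^2) = \<nu> \<bullet> \<nu>"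
      by (subst (2) euclidean_inner) (simp add: power2_eq_square inner_commute)
    also have "... = 1" using nu by (simp add: dot_square_norm)
    finally have s: "(\<Sum>i\<in>(Basis::plane set). (i \<bullet> \<nu>)^2) = 1" .
    have "laplacian B x = (\<Sum>i\<in>(Basis::plane set). 2 - 4 * (i \<bullet> \<nu>)^2)"
      by (intro sum.cong) (auto simp: p2)
    also have "... = 2 * real (card (Basis::plane set)) - 4 * (\<Sum>i\<in>(Basis::plane set). (i \<bullet> \<nu>)^2)"
      by (simp add: sum_subtractf sum_distrib_left)
    finally show ?thesis using s by simp
  qed
  ultimately have "harmonic B" by (simp add: harmonic_def)
  moreover have "(dist x x0)^2 \<le> B x" "B x \<le> 3 * ?d * dist x x0" if x: "x \<in> T" for x
  proof -
    define y where "y = (x - x0) \<bullet> \<nu>"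
    have yd: "0 \<le> y" "y \<le> dist x x0" "dist x x0 \<le> ?d"
      using y0[OF x] norm_cauchy_schwarz[of "x - x0" \<nu>] nu diameter_T[OF x x0T] by (simp_all add: y_def dist_norm)
    have be: "B x = 2 * ?d * y + (dist x x0)^2 - 2 * y^2"
      by (simp add: B_def y_def dist_norm dot_square_norm)
    have "y * y \<le> ?d * y" using yd by (intro mult_right_mono) auto
    then show "(dist x x0)^2 \<le> B x" unfolding be by (simp add: power2_eq_square)
    have "?d * y \<le> ?d * dist x x0" "dist x x0 * dist x x0 \<le> ?d * dist x x0"
      using yd by (intro mult_left_mono mult_right_mono; linarith)+
    moreover have "0 \<le> y * y" by simp
    ultimately show "B x \<le> 3 * ?d * dist x x0" unfolding be power2_eq_square by linarith
  qed
  ultimately show ?thesis by (rule that)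
qed

text \<open>The barrier at \<open>x0\<close>, multiplied by a constant and shifted, lies above
  \<open>\<phi>\<close> on the whole boundary and is continuous at \<open>x0\<close>, with constants
  that do not depend on \<open>x0\<close>.\<close>

lemma boundary_upper_estimate:
  assumes u: "harmonic_extension D \<phi> u" and c: "continuous_on (frontier D) \<phi>" and e: "e > 0"
  shows "\<exists>r>0. \<forall>x0\<in>frontier D. AE x in lebesgue_on D. dist x x0 < r --> u x \<le> \<phi> x0 + e"
proof -
  have fc: "compact (frontier D)" by (rule compact_frontier_bounded[OF D_bounded])
  obtain M where M: "\<forall>y\<in>\<phi> ` frontier D. norm y \<le> M"
    using compact_imp_bounded[OF compact_continuous_image[OF c fc]] bounded_iff by metis
  obtain \<delta> where \<delta>: "\<delta> > 0" "!!x y. x \<in> frontier D ==> y \<in> frontier D ==> dist y x < \<delta> ==> dist (\<phi> y) (\<phi> x) < e / 2"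
    using compact_uniformly_continuous[OF c fc] half_gt_zero[OF e] unfolding uniformly_continuous_on_def by metis
  (* beyond distance \<delta> from x0 the barrier is at least \<delta>^2, so this factor makes it
     exceed the oscillation of \<phi> *)
  define C where "C = 2 * \<bar>M\<bar> / \<delta>^2"
  have C: "C \<ge> 0" using \<delta> by (simp add: C_def)
  have d: "0 \<le> diameter T" using diameter_T[OF vertex_in_T(1,1)] by simp
  define r where "r = (e / 2) / (C * (3 * diameter T) + 1)"
  have Cd: "0 \<le> C * (3 * diameter T)" using C d by simp
  have r: "r > 0" "C * (3 * diameter T) * r \<le> e / 2"
  proof -
    show "r > 0" unfolding r_def using e Cd by (intro divide_pos_pos) linarith+
    have mult_div: "K * (y / K) = y" if "K \<noteq> 0" for K y :: real using that by simp
    have "(C * (3 * diameter T) + 1) * r = e / 2" unfolding r_def by (rule mult_div) (use Cd in linarith)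
    then show "C * (3 * diameter T) * r \<le> e / 2" using \<open>r > 0\<close> by (simp add: distrib_right)
  qed
  show ?thesis
  proof (intro exI conjI ballI)
    show "r > 0" by (rule r(1))
    fix x0 assume x0: "x0 \<in> frontier D"
    obtain B where b: "harmonic B" "!!x. x \<in> T ==> (dist x x0)^2 \<le> B x" "!!x. x \<in> T ==> B x \<le> 3 * diameter T * dist x x0"
      by (rule barrier[OF x0]) (rule that)
    have "AE x in lebesgue_on D. u x \<le> (\<phi> x0 + e / 2) + C * B x"
    proof (rule weak_maximum[OF u harmonic_affine[OF b(1)]])
      fix x assume x: "x \<in> frontier D"
      have bx: "0 \<le> (dist x x0)^2" "(dist x x0)^2 \<le> B x" using b(2) x frontier_subset_T by auto
      show "\<phi> x \<le> \<phi> x0 + e / 2 + C * B x"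
      proof (cases "dist x x0 < \<delta>")
        case True
        then have "\<phi> x \<le> \<phi> x0 + e / 2" using \<delta>(2)[OF x0 x] unfolding dist_real_def by linarith
        moreover have "0 \<le> C * B x" using C bx by (intro mult_nonneg_nonneg) linarith+
        ultimately show ?thesis by linarith
      next
        case False
        then have "\<delta>^2 \<le> B x" using \<delta>(1) power_mono[of \<delta> "dist x x0" 2] bx by linarith
        then have "C * \<delta>^2 \<le> C * B x" using C by (rule mult_left_mono)
        moreover have "C * \<delta>^2 = 2 * \<bar>M\<bar>" using \<delta>(1) by (simp add: C_def)
        moreover have "\<bar>\<phi> x\<bar> \<le> M" "\<bar>\<phi> x0\<bar> \<le> M" using M x x0 by auto
        ultimately show ?thesis using e by linarith
      qed
    qed
    moreover have "AE x in lebesgue_on D. x \<in> T" by (rule AE_I2) (use D_subset in auto)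
    ultimately show "AE x in lebesgue_on D. dist x x0 < r --> u x \<le> \<phi> x0 + e"
    proof eventually_elim
      case (elim x)
      show ?case
      proof
        assume "dist x x0 < r"
        have "C * B x \<le> C * (3 * diameter T * dist x x0)" using b(3)[OF elim(2)] C by (rule mult_left_mono)
        also have "... = (C * (3 * diameter T)) * dist x x0" by simp
        also have "... \<le> (C * (3 * diameter T)) * r" using \<open>dist x x0 < r\<close> Cd by (intro mult_left_mono) auto
        also have "... \<le> e / 2" by (rule r(2))
        finally show "u x \<le> \<phi> x0 + e" using elim(1) by linarith
      qed
    qed
  qed
qed

lemma boundary_estimate:
  assumes u: "harmonic_extension D \<phi> u" and c: "continuous_on (frontier D) \<phi>" and e: "e > 0"
  shows "\<exists>r>0. \<forall>x0\<in>frontier D. AE x in lebesgue_on D. dist x x0 < r --> \<bar>u x - \<phi> x0\<bar> \<le> e"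
proof -
  obtain r1 where r1: "r1 > 0" "!!x0. x0 \<in> frontier D ==> AE x in lebesgue_on D. dist x x0 < r1 --> u x \<le> \<phi> x0 + e"
    using boundary_upper_estimate[OF u c e] by blast
  have c': "continuous_on (frontier D) (%x. - \<phi> x)" by (intro continuous_on_minus c)
  obtain r2 where r2: "r2 > 0" "!!x0. x0 \<in> frontier D ==> AE x in lebesgue_on D. dist x x0 < r2 --> - u x \<le> - \<phi> x0 + e"
    using boundary_upper_estimate[OF harmonic_extension_uminus[OF u] c' e] by blast
  show ?thesis
  proof (intro exI conjI ballI)
    show "min r1 r2 > 0" using r1 r2 by simp
    fix x0 assume x0: "x0 \<in> frontier D"
    show "AE x in lebesgue_on D. dist x x0 < min r1 r2 --> \<bar>u x - \<phi> x0\<bar> \<le> e"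
      using r1(2)[OF x0] r2(2)[OF x0] by eventually_elim auto
  qed
qed

end

section \<open>Interior regularity\<close>

lemma smooth_conv:
  assumes u: "integrable (lebesgue_on D) u" and k: "smooth k" and 0: "!!z. z \<notin> cball 0 R ==> k z = 0"
  shows "smooth (conv D u k)"
proof -
  have "Ck n (conv D u k)" if "smooth k" "!!z. z \<notin> cball 0 R ==> k z = 0" for n k
    using that
  proof (induction n arbitrary: k)
    case 0
    show ?case unfolding Ck.simps by (rule conv_continuous[OF u 0])
  next
    case (Suc n)
    show ?case
    proof (rule Ck_SucI)
      show "(conv D u k has_derivative frechet_derivative (conv D u k) (at x)) (at x)" for x
        unfolding frechet_derivative_works[symmetric] differentiable_def using conv_has_derivative[OF u Suc.prems] by blast
      fix i :: 'a assume i: "i \<in> Basis"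
      have "Ck n (conv D u (partial i k))"
        by (rule Suc.IH[OF smooth_partial[OF Suc.prems(1) i] partial_support[OF u Suc.prems]])
      moreover have "partial i (conv D u k) = conv D u (partial i k)"
        by (rule ext) (rule conv_partial[OF u Suc.prems i])
      ultimately show "Ck n (%x. partial i (conv D u k) x)" by simp
    qed
  qed
  from this[OF k 0] show ?thesis unfolding smooth_def by simp
qed

lemma second_derivative_nonpos:
  fixes g :: "real => real"
  assumes g: "!!t. (g has_real_derivative g' t) (at t)" and l: "(g' has_real_derivative l) (at 0)"
    and d: "d > 0" and m: "!!t. \<bar>t\<bar> < d ==> g t \<le> g 0"
  shows "l \<le> 0"
proof (rule ccontr)
  assume "\<not> l \<le> 0"
  then have lp: "0 < l" by simp
  have g0: "g' 0 = 0"
    by (rule DERIV_local_max[OF g d]) (use m in auto)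
  obtain s where s: "s > 0" "!!h. h > 0 ==> h < s ==> g' 0 < g' (0 + h)"
    using DERIV_pos_inc_right[OF l lp] by blast
  define h where "h = min s d / 2"
  have h: "0 < h" "h < s" "h < d" using s d by (auto simp: h_def)
  obtain z where z: "0 < z" "z < h" "g h - g 0 = (h - 0) * g' z"
    using MVT2[OF h(1) g] by blast
  have "0 < g' z" using s(2)[of z] z h g0 by simp
  then have "0 < h * g' z" using h by simp
  then show False using z(3) m[of h] h by simp
qed

lemma partial_along_line:
  assumes F: "smooth F"
  shows "((%t. F (y + t *\<^sub>R i)) has_real_derivative partial i F (y + t *\<^sub>R i)) (at t)"
proof -
  have 1: "((%t. y + t *\<^sub>R i) has_derivative (%h. h *\<^sub>R i)) (at t)"
    by (auto intro!: derivative_eq_intros)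
  have 2: "(F has_derivative frechet_derivative F (at (y + t *\<^sub>R i))) (at (y + t *\<^sub>R i))"
    by (rule smooth_has_derivative[OF F])
  have "linear (frechet_derivative F (at (y + t *\<^sub>R i)))"
    using 2 has_derivative_linear by blast
  then have e: "frechet_derivative F (at (y + t *\<^sub>R i)) (h *\<^sub>R i) = partial i F (y + t *\<^sub>R i) * h" for h
    by (simp add: linear_scale mult.commute)
  show ?thesis
    unfolding has_field_derivative_def using has_derivative_compose[OF 1 2] by (simp only: e)
qed

text \<open>Adding a small multiple of \<open>\<bar>x - p\<bar>^2\<close> to \<open>f\<close> makes the Laplacian positive, which is
  impossible at an interior maximum.\<close>

lemma classical_maximum:
  fixes f :: "plane => real"
  assumes f: "smooth f" and A: "compact A" and l: "!!x. x \<in> interior A ==> laplacian f x = 0"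
    and M: "!!x. x \<in> frontier A ==> f x \<le> M" and p: "p \<in> A"
  shows "f p \<le> M"
proof (rule ccontr)
  assume "\<not> f p \<le> M"
  then have gap: "M < f p" by simp
  obtain R' where R': "!!x. x \<in> A ==> dist p x \<le> R'"
    using compact_imp_bounded[OF A] unfolding bounded_any_center[where a = p] by blast
  define R where "R = max R' 1"
  have R: "R > 0" "!!x. x \<in> A ==> dist p x \<le> R" using R' by (force simp: R_def)+
  (* small enough for the gap between f p and M to survive the perturbation *)
  define c where "c = (f p - M) / (2 * R^2)"
  have c: "c > 0" "c * R^2 < f p - M" using gap R by (simp_all add: c_def)
  define F where "F x = f x + c * ((x - p) \<bullet> (x - p))" for x
  have q: "smooth (%x. (x - p) \<bullet> (x - p))"
  proof -
    have "smooth (%x. \<Sum>i\<in>Basis. ((x - p) \<bullet> i) * ((x - p) \<bullet> i))"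
      by (rule smooth_intros(5), rule smooth_intros(4); unfold inner_diff_left; rule smooth_diff; rule smooth_intros(1,2))
    then show ?thesis by (simp only: euclidean_inner[symmetric])
  qed
  have sF: "smooth F" unfolding F_def[abs_def] by (rule smooth_intros(3)[OF f smooth_cmult[OF q]])
  have "(F has_derivative (%h. frechet_derivative f (at x) h + c * (2 * ((x - p) \<bullet> h)))) (at x)" for x
    unfolding F_def[abs_def]
    by (auto intro!: derivative_eq_intros smooth_has_derivative[OF f] simp: inner_commute)
  then have p1: "partial i F = (%x. partial i f x + c * (2 * ((x - p) \<bullet> i)))" for i
    using partial_eqI by (intro ext) blast
  have p2: "partial i (partial i F) x = partial i (partial i f) x + 2 * c" if i: "i \<in> Basis" for i x
  proof -
    have "((%x. partial i f x + c * (2 * ((x - p) \<bullet> i))) has_derivative (%h. frechet_derivative (partial i f) (at x) h + c * (2 * (h \<bullet> i)))) (at x)"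
      by (auto intro!: derivative_eq_intros smooth_has_derivative[OF smooth_partial[OF f i]])
    from partial_eqI[OF this, of i] show ?thesis unfolding p1 using i by (simp add: inner_Basis)
  qed
  obtain y where y: "y \<in> A" "!!x. x \<in> A ==> F x \<le> F y"
    using continuous_attains_sup[OF A _ smooth_continuous[OF sF]] p by blast
  have "y \<in> interior A"
  proof (rule ccontr)
    assume "y \<notin> interior A"
    then have fr: "y \<in> frontier A" using y(1) closure_subset by (auto simp: frontier_def)
    have "(y - p) \<bullet> (y - p) \<le> R^2"
      using power_mono[OF R(2)[OF y(1)], of 2] unfolding dist_commute[of p] by (simp add: dist_norm power2_norm_eq_inner)
    then have "c * ((y - p) \<bullet> (y - p)) \<le> c * R^2" using c by (intro mult_left_mono) auto
    moreover have "F p \<le> F y" by (rule y(2)[OF p])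
    moreover have "F p = f p" by (simp add: F_def)
    ultimately show False using M[OF fr] c(2) unfolding F_def by linarith
  qed
  then obtain d where d: "d > 0" "ball y d \<subseteq> A" using mem_interior by blast
  have "partial i (partial i F) y \<le> 0" if i: "i \<in> Basis" for i
  proof (rule second_derivative_nonpos[OF partial_along_line[OF sF] _ d(1)])
    show "((%t. partial i F (y + t *\<^sub>R i)) has_real_derivative partial i (partial i F) y) (at 0)"
      using partial_along_line[OF smooth_partial[OF sF i], of y i 0] by simp
    fix t :: real assume "\<bar>t\<bar> < d"
    then have "y + t *\<^sub>R i \<in> ball y d" using i by (simp add: dist_norm)
    then show "F (y + t *\<^sub>R i) \<le> F (y + 0 *\<^sub>R i)" using y(2) d(2) by auto
  qed
  then have "laplacian F y \<le> 0" by (intro sum_nonpos)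
  moreover have "laplacian F y = laplacian f y + (\<Sum>i\<in>(Basis::plane set). 2 * c)"
    unfolding sum.distrib[symmetric] by (intro sum.cong refl p2)
  moreover have "(\<Sum>i\<in>(Basis::plane set). 2 * c) > 0" using c by (intro sum_pos) auto
  ultimately show False using l[OF \<open>y \<in> interior A\<close>] by linarith
qed

lemma conv_diff_laplacian:
  fixes u :: "plane => real"
  assumes "smooth f" "smooth g" "laplacian f x = 0" "laplacian g x = 0"
  shows "laplacian (%x. f x - g x) x = (0::real)"
proof -
  have d: "partial i (%x. f x - g x) x = partial i f x - partial i g x" if "smooth f" "smooth g" for f g :: "'b::euclidean_space => real" and i x
    by (rule partial_eqI[OF has_derivative_diff[OF smooth_has_derivative[OF that(1)] smooth_has_derivative[OF that(2)]]])
  have e: "partial i (%x. f x - g x) = (%x. partial i f x - partial i g x)" for i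
    by (rule ext) (rule d[OF assms(1,2)])
  have "laplacian (%x. f x - g x) x = (\<Sum>i\<in>Basis. partial i (partial i f) x - partial i (partial i g) x)"
    unfolding e by (intro sum.cong refl d smooth_partial assms)
  then show ?thesis by (simp add: sum_subtractf assms(3,4))
qed

context triangle
begin

text \<open>A constant sequence approximates.\<close>

lemma test_fun_H1_zero:
  assumes t: "test_fun D \<psi>"
  shows "H1_zero D \<psi>"
proof -
  note s = test_funD(1)[OF t] and P = H1_pair_smooth[OF D_open D_bounded test_funD(1)[OF t]]
  have z: "L2_norm D (%x. 0::'z::euclidean_space) = 0"
    by (simp add: L2_norm_def L2_inner_def)
  show ?thesis unfolding H1_zero_def
  proof (rule has_traceI[OF D_open P _ P])
    show "L2_segment p q (%x. 0)" for p q by (rule L2_segment_const_0)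
    show "continuous_on (closure D) \<psi>" by (rule smooth_continuous[OF s])
    show "(%n. L2_norm D (%x. \<psi> x - \<psi> x)) ----> 0" "(%n. L2_norm D (%x. grad \<psi> x - grad \<psi> x)) ----> 0"
      by (simp_all add: z)
    fix p q assume pq: "closed_segment p q \<subseteq> frontier D"
    have "L2_segment_norm p q (%x. \<psi> x - 0) = 0"
    proof -
      have "(LINT s|lebesgue_on {0<..<dist p q}. \<psi> (arclength_param p q s) * \<psi> (arclength_param p q s))
        = (LINT s|lebesgue_on {0<..<dist p q}. 0)"
      proof (rule lintegral_cong)
        fix s assume "s \<in> space (lebesgue_on {0<..<dist p q})"
        then have s: "0 < s" "s < dist p q" by auto
        then have "p \<noteq> q" by auto
        from arclength_param_segment[OF this, of s] s pq have "arclength_param p q s \<in> frontier D" by auto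
        then have "\<psi> (arclength_param p q s) = 0" by (intro test_funD(3)[OF t]) (simp add: frontier_D)
        then show "\<psi> (arclength_param p q s) * \<psi> (arclength_param p q s) = 0" by simp
      qed
      then show ?thesis by (simp add: L2_segment_norm_def L2_inner_real)
    qed
    then show "(%n. L2_segment_norm p q (%x. \<psi> x - 0)) ----> 0" by simp
  qed
qed

text \<open>The kernel centred at \<open>x\<close> is a test function, and the Laplacian may be moved onto it.\<close>

lemma conv_harmonic:
  assumes u: "harmonic_extension D \<phi> u" and d: "d > 0" and c: "cball x d \<subseteq> D"
  shows "laplacian (conv D u (eta d)) x = 0"
proof -
  define G where "G = weak_gradient D u"
  have G: "H1_pair D u G" unfolding G_def
    by (rule H1_imp_pair[OF D_open]) (use u in "simp add: harmonic_extension_def has_trace_def")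
  have uL: "L2_on D u" "L2_on D G" and wg: "has_weak_gradient D u G" using G by (auto simp: H1_pair_def)
  have ui: "integrable (lebesgue_on D) u" by (rule L2_bounded_integrable[OF D_open D_bounded uL(1)])
  define \<psi> where "\<psi> y = eta d (x - y)" for y :: plane
  have t: "test_fun D \<psi>" unfolding \<psi>_def[abs_def] by (rule test_fun_eta[OF c d])
  note s = test_funD(1)[OF t]
  note e = smooth_eta[OF d, where 'a=plane]
  have p1: "partial i \<psi> y = - partial i (eta d) (x - y)" for i y
    unfolding \<psi>_def[abs_def] by (rule has_derivative_affine_reflect[OF e])
  have p2: "partial i (partial i \<psi>) y = partial i (partial i (eta d)) (x - y)" if i: "i \<in> Basis" for i y
  proof -
    have D': "((%y. partial i (eta d) (x - y)) has_derivative frechet_derivative (%y. partial i (eta d) (x - y)) (at y)) (at y)"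
      by (rule smooth_has_derivative[OF smooth_reflect[OF smooth_partial[OF e i]]])
    have "((%y. - partial i (eta d) (x - y)) has_derivative (%h. - frechet_derivative (%y. partial i (eta d) (x - y)) (at y) h)) (at y)"
      by (rule has_derivative_minus[OF D'])
    then have "partial i (%y. - partial i (eta d) (x - y)) y = - partial i (%y. partial i (eta d) (x - y)) y"
      by (rule partial_eqI)
    also have "... = partial i (partial i (eta d)) (x - y)"
      by (simp only: has_derivative_affine_reflect[OF smooth_partial[OF e i]] minus_minus)
    finally show ?thesis by (simp only: p1[abs_def])
  qed
  have "partial i (partial i (conv D u (eta d))) x = - L2_inner D (%y. G y \<bullet> i) (partial i \<psi>)" if i: "i \<in> Basis" for i
  proof -
    have "partial i (conv D u (eta d)) = conv D u (partial i (eta d))"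
      by (rule ext) (rule conv_partial[OF ui e eta_support[OF d] i])
    then have "partial i (partial i (conv D u (eta d))) x = partial i (conv D u (partial i (eta d))) x" by simp
    also have "... = conv D u (partial i (partial i (eta d))) x"
      by (rule conv_partial[OF ui smooth_partial[OF e i] partial_support[OF ui e eta_support[OF d]] i])
    also have "... = (LINT y|lebesgue_on D. u y * partial i (partial i \<psi>) y)"
      unfolding conv_def by (simp only: p2[OF i])
    also have "... = - (LINT y|lebesgue_on D. (G y \<bullet> i) * partial i \<psi> y)"
      using wg test_fun_partial[OF t i] i unfolding has_weak_gradient_iff by blast
    finally show ?thesis by (simp add: L2_inner_real)
  qed
  then have "laplacian (conv D u (eta d)) x = - (\<Sum>i\<in>Basis. L2_inner D (%y. G y \<bullet> i) (partial i \<psi>))"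
    by (simp add: sum_negf)
  also have "(\<Sum>i\<in>Basis. L2_inner D (%y. G y \<bullet> i) (partial i \<psi>)) = L2_inner D G (grad \<psi>)"
  proof -
    have i1: "integrable (lebesgue_on D) (%y. (G y \<bullet> i) * partial i \<psi> y)" if "i \<in> Basis" for i
      using L2_inner_integrable[OF uL(2) smooth_L2_Basis[OF smooth_partial[OF s that], of i]] by (simp add: mult.commute)
    have "L2_inner D G (grad \<psi>) = (LINT y|lebesgue_on D. (\<Sum>i\<in>Basis. (G y \<bullet> i) * partial i \<psi> y))"
      unfolding L2_inner_def by (subst euclidean_inner) (simp add: grad_inner_Basis)
    also have "... = (\<Sum>i\<in>Basis. (LINT y|lebesgue_on D. (G y \<bullet> i) * partial i \<psi> y))"
      by (rule Bochner_Integration.integral_sum) (rule i1)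
    finally show ?thesis by (simp add: L2_inner_real)
  qed
  also have "... = dirichlet_form D u \<psi>"
    by (rule dirichlet_form_eq[OF D_open G H1_pair_smooth[OF D_open D_bounded s], symmetric])
  also have "... = 0" using u test_fun_H1_zero[OF t] by (simp add: harmonic_extension_def)
  finally show ?thesis by simp
qed

text \<open>The points at distance at least \<open>r\<close> from the boundary; there mollification with a
  radius below \<open>r\<close> makes sense.\<close>

definition core :: "real => plane set" where
  "core r = {x \<in> T. r \<le> infdist x (frontier D)}"

lemma frontier_nonempty: "frontier D \<noteq> {}"
  using edge_in_frontier by auto

lemma core_compact: "compact (core r)"
proof -
  have "closed {x. r \<le> infdist x (frontier D)}"
    by (intro closed_Collect_le continuous_on_const continuous_on_infdist continuous_on_id)
  then have "compact (T \<inter> {x. r \<le> infdist x (frontier D)})" by (rule compact_Int_closed[OF T_compact])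
  moreover have "core r = T \<inter> {x. r \<le> infdist x (frontier D)}" by (auto simp: core_def)
  ultimately show ?thesis by simp
qed

text \<open>The ball is connected, so it would have to meet the boundary in order to leave the triangle.\<close>

lemma core_cball:
  assumes x: "x \<in> core r" and d: "d < r" "0 < d" shows "cball x d \<subseteq> D"
proof (rule ccontr)
  assume n: "\<not> cball x d \<subseteq> D"
  have le: "r \<le> infdist x (frontier D)" using x by (simp add: core_def)
  have "x \<notin> frontier D"
  proof
    assume "x \<in> frontier D"
    then have "infdist x (frontier D) = 0" by simp
    then show False using le d by simp
  qed
  then have "x \<in> D" using x frontier_D by (auto simp: core_def)
  then have "cball x d \<inter> D \<noteq> {}" using d by force
  moreover have "cball x d - D \<noteq> {}" using n by blast
  ultimately have "cball x d \<inter> frontier D \<noteq> {}" by (intro connected_Int_frontier connected_cball)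
  then obtain z where z: "z \<in> frontier D" "dist x z \<le> d" by auto
  have "infdist x (frontier D) \<le> dist x z" by (rule infdist_le[OF z(1)])
  then show False using le z d by simp
qed

lemma core_frontier:
  assumes y: "y \<in> frontier (core r)" and r: "r > 0"
  shows "y \<in> core r" "\<exists>z\<in>frontier D. dist y z \<le> r"
proof -
  show yc: "y \<in> core r"
    using frontier_subset_closed[OF compact_imp_closed[OF core_compact]] y by blast
  obtain z where z: "z \<in> frontier D" "infdist y (frontier D) = dist y z"
    using infdist_attains_inf[OF frontier_closed frontier_nonempty] by blast
  have "infdist y (frontier D) \<le> r"
  proof (rule ccontr)
    assume "\<not> infdist y (frontier D) \<le> r"
    then have g: "r < infdist y (frontier D)" by simp
    have o: "open (D \<inter> {x. r < infdist x (frontier D)})"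
      by (intro open_Int D_open open_Collect_less continuous_on_const continuous_on_infdist continuous_on_id)
    have "y \<in> D" using core_cball[OF yc, of "r / 2"] r by auto
    then have "y \<in> interior (core r)"
      by (intro interiorI[OF o]) (use g D_subset in "auto simp: core_def")
    then show False using y by (simp add: frontier_def)
  qed
  then show "\<exists>z\<in>frontier D. dist y z \<le> r" using z by auto
qed

lemma D_core: "x \<in> D ==> 0 < infdist x (frontier D)" "x \<in> D ==> x \<in> core (infdist x (frontier D))"
proof -
  assume x: "x \<in> D"
  then have "x \<notin> frontier D" by (simp add: frontier_D)
  then show "0 < infdist x (frontier D)"
    using in_closed_iff_infdist_zero[OF frontier_closed frontier_nonempty, of x] infdist_nonneg[of x "frontier D"] by linarith
  show "x \<in> core (infdist x (frontier D))" using x D_subset by (auto simp: core_def)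
qed

lemma core_mono: "x \<in> core r ==> s \<le> r ==> x \<in> core s"
  by (simp add: core_def)

lemma harmonic_extension_integrable:
  assumes "harmonic_extension D \<phi> u" shows "integrable (lebesgue_on D) u"
  by (rule L2_bounded_integrable[OF D_open D_bounded])
    (use assms in "simp add: harmonic_extension_def has_trace_def H1_def")

lemma conv_near_boundary:
  assumes u: "harmonic_extension D \<phi> u" and c: "continuous_on (frontier D) \<phi>" and e: "e > 0"
  obtains r where "r > 0" "!!z y d. z \<in> frontier D ==> d > 0 ==> cball y d \<subseteq> D ==> dist y z + d \<le> r
    ==> \<bar>conv D u (eta d) y - \<phi> z\<bar> \<le> e"
proof -
  obtain r where r: "r > 0" "!!z. z \<in> frontier D ==> AE x in lebesgue_on D. dist x z < r --> \<bar>u x - \<phi> z\<bar> \<le> e"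
    using boundary_estimate[OF u c e] by blast
  have "\<bar>conv D u (eta d) y - \<phi> z\<bar> \<le> e"
    if z: "z \<in> frontier D" and d: "d > 0" "cball y d \<subseteq> D" "dist y z + d \<le> r" for z y d
  proof (rule conv_close[OF D_open d(1) harmonic_extension_integrable[OF u] d(2)])
    show "AE x in lebesgue_on D. dist y x < d --> \<bar>u x - \<phi> z\<bar> \<le> e"
      using r(2)[OF z]
    proof eventually_elim
      case (elim x)
      show ?case
      proof
        assume "dist y x < d"
        then have "dist x z < r" using dist_triangle[of x z y] d(3) by (simp add: dist_commute)
        then show "\<bar>u x - \<phi> z\<bar> \<le> e" using elim by blast
      qed
    qed
  qed
  with r(1) show ?thesis by (rule that)
qed

text \<open>Two mollifications are harmonic on the core and close to \<open>\<phi>\<close>, hence to each other, on its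
  boundary; the classical maximum principle then makes them close on the whole core.\<close>

lemma conv_Cauchy:
  assumes u: "harmonic_extension D \<phi> u" and c: "continuous_on (frontier D) \<phi>" and e: "e > 0"
  obtains r where "r > 0" "!!s d d' x. s \<le> r ==> 0 < d ==> d < s ==> 0 < d' ==> d' < s ==> x \<in> core s
    ==> \<bar>conv D u (eta d) x - conv D u (eta d') x\<bar> \<le> e"
proof -
  have e2: "e / 2 > 0" using e by simp
  obtain r where r: "r > 0" "!!z y d. z \<in> frontier D ==> d > 0 ==> cball y d \<subseteq> D ==> dist y z + d \<le> r
    ==> \<bar>conv D u (eta d) y - \<phi> z\<bar> \<le> e / 2"
    by (rule conv_near_boundary[OF u c e2]) (rule that)
  note ui = harmonic_extension_integrable[OF u]
  have sm: "smooth (conv D u (eta d))" if "d > 0" for d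
    by (rule smooth_conv[OF ui smooth_eta[OF that] eta_support[OF that]])
  have main: "conv D u (eta d) x - conv D u (eta d') x \<le> e"
    if s: "s \<le> r / 2" "0 < d" "d < s" "0 < d'" "d' < s" "x \<in> core s" for s d d' x
  proof (rule classical_maximum[OF smooth_diff[OF sm[OF s(2)] sm[OF s(4)]] core_compact _ _ s(6)])
    fix y assume "y \<in> interior (core s)"
    then have y: "y \<in> core s" using interior_subset by blast
    show "laplacian (%x. conv D u (eta d) x - conv D u (eta d') x) y = 0"
      by (rule conv_diff_laplacian[OF sm[OF s(2)] sm[OF s(4)]])
        (rule conv_harmonic[OF u] s core_cball[OF y])+
  next
    fix y assume yf: "y \<in> frontier (core s)"
    have s0: "s > 0" using s by simp
    note y = core_frontier[OF yf s0]
    obtain z where z: "z \<in> frontier D" "dist y z \<le> s" using y(2) by blast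
    have "\<bar>conv D u (eta d) y - \<phi> z\<bar> \<le> e / 2"
      by (rule r(2)[OF z(1) s(2) core_cball[OF y(1) s(3,2)]]) (use z s in linarith)
    moreover have "\<bar>conv D u (eta d') y - \<phi> z\<bar> \<le> e / 2"
      by (rule r(2)[OF z(1) s(4) core_cball[OF y(1) s(5,4)]]) (use z s in linarith)
    ultimately show "conv D u (eta d) y - conv D u (eta d') y \<le> e" by linarith
  qed
  have "\<bar>conv D u (eta d) x - conv D u (eta d') x\<bar> \<le> e"
    if s: "s \<le> r / 2" "0 < d" "d < s" "0 < d'" "d' < s" "x \<in> core s" for s d d' x
    using main[OF s] main[OF s(1,4,5,2,3,6)] by linarith
  moreover have "r / 2 > 0" using r by simp
  ultimately show ?thesis by (rule that[rotated])
qed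

text \<open>The limit of the mollifications is approached uniformly on every core.\<close>

lemma mollification_limit:
  assumes u: "harmonic_extension D \<phi> u" and c: "continuous_on (frontier D) \<phi>"
  obtains U where
    "!!e. e > 0 ==> \<exists>r>0. \<forall>s d x. s \<le> r \<and> 0 < d \<and> d < s \<and> x \<in> core s --> \<bar>conv D u (eta d) x - U x\<bar> \<le> e"
proof -
  define v where "v n x = conv D u (eta (1 / real (Suc n))) x" for n x
  have conv: "convergent (%n. v n x)" if x: "x \<in> D" for x
    unfolding Cauchy_convergent_iff[symmetric]
  proof (rule metric_CauchyI)
    fix e :: real assume "e > 0"
    then have e2: "e / 2 > 0" by simp
    obtain r where r: "r > 0" "!!s d d' x. s \<le> r ==> 0 < d ==> d < s ==> 0 < d' ==> d' < s ==> x \<in> core s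
        ==> \<bar>conv D u (eta d) x - conv D u (eta d') x\<bar> \<le> e / 2"
      by (rule conv_Cauchy[OF u c e2]) (rule that)
    define s where "s = min r (infdist x (frontier D))"
    have s: "s > 0" "s \<le> r" "x \<in> core s"
      using r D_core[OF x] core_mono[of x "infdist x (frontier D)" s] by (auto simp: s_def)
    obtain N where N: "1 / real (Suc N) < s" using nat_approx_posE[OF s(1)] by blast
    have small: "1 / real (Suc n) < s" if "n \<ge> N" for n
    proof -
      have "1 / real (Suc n) \<le> 1 / real (Suc N)" using that by (intro divide_left_mono) auto
      then show ?thesis using N by simp
    qed
    have "\<bar>v m x - v n x\<bar> \<le> e / 2" if "m \<ge> N" "n \<ge> N" for m n
      unfolding v_def by (rule r(2)[OF s(2) _ small[OF that(1)] _ small[OF that(2)] s(3)]) auto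
    then have "\<forall>m\<ge>N. \<forall>n\<ge>N. dist (v m x) (v n x) < e"
      using e2 unfolding dist_real_def by force
    then show "\<exists>M. \<forall>m\<ge>M. \<forall>n\<ge>M. dist (v m x) (v n x) < e" by blast
  qed
  define U where "U x = lim (%n. v n x)" for x
  have lim: "(%n. v n x) ----> U x" if "x \<in> D" for x
    using conv[OF that] unfolding U_def convergent_LIMSEQ_iff .
  have "\<exists>r>0. \<forall>s d x. s \<le> r \<and> 0 < d \<and> d < s \<and> x \<in> core s --> \<bar>conv D u (eta d) x - U x\<bar> \<le> e" if e: "e > 0" for e
  proof -
    obtain r where r: "r > 0" "!!s d d' x. s \<le> r ==> 0 < d ==> d < s ==> 0 < d' ==> d' < s ==> x \<in> core s
        ==> \<bar>conv D u (eta d) x - conv D u (eta d') x\<bar> \<le> e"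
      by (rule conv_Cauchy[OF u c e]) (rule that)
    have "\<bar>conv D u (eta d) x - U x\<bar> \<le> e" if s: "s \<le> r" "0 < d" "d < s" "x \<in> core s" for s d x
    proof -
      have xD: "x \<in> D" using core_cball[OF s(4,3,2)] s(2) by auto
      have "\<forall>\<^sub>F n in sequentially. 1 / real (Suc n) < s"
        by (rule order_tendstoD(2)[OF LIMSEQ_Suc[OF lim_1_over_n]]) (use s in simp)
      then have ev: "\<forall>\<^sub>F n in sequentially. \<bar>conv D u (eta d) x - v n x\<bar> \<le> e"
      proof eventually_elim
        case (elim n)
        show ?case unfolding v_def by (rule r(2)[OF s(1,2,3) _ elim s(4)]) simp
      qed
      have "(%n. \<bar>conv D u (eta d) x - v n x\<bar>) ----> \<bar>conv D u (eta d) x - U x\<bar>"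
        by (intro tendsto_rabs tendsto_diff tendsto_const lim[OF xD])
      from tendsto_upperbound[OF this ev] show ?thesis by simp
    qed
    then show ?thesis using r(1) by blast
  qed
  then show ?thesis by (rule that)
qed

text \<open>On the cores the limit is uniform, so it is continuous there; near the boundary it inherits from the
  mollifications the closeness to \<open>\<phi>\<close>. It agrees with \<open>u\<close> almost
  everywhere because mollifications also converge weakly to \<open>u\<close>.\<close>

lemma continuous_representative:
  assumes u: "harmonic_extension D \<phi> u" and c: "continuous_on (frontier D) \<phi>"
  obtains U where "continuous_on T U" "!!x. x \<in> frontier D ==> U x = \<phi> x" "AE x in lebesgue_on D. U x = u x"
proof -
  note ui = harmonic_extension_integrable[OF u]
  obtain V where V: "!!e. e > 0 ==> \<exists>r>0. \<forall>s d x. s \<le> r \<and> 0 < d \<and> d < s \<and> x \<in> core s --> \<bar>conv D u (eta d) x - V x\<bar> \<le> e"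
    by (rule mollification_limit[OF u c]) (rule that)
  have Vr: thesis if "e > 0" "!!r. r > 0 ==> (!!s d x. s \<le> r ==> 0 < d ==> d < s ==> x \<in> core s ==> \<bar>conv D u (eta d) x - V x\<bar> \<le> e) ==> thesis" for e thesis
    using V[OF that(1)] that(2) by blast
  define U where "U x = (if x \<in> D then V x else \<phi> x)" for x
  have inner: "\<exists>t>0. \<forall>y. dist y x < t --> y \<in> D \<and> \<bar>V y - V x\<bar> < e" if x: "x \<in> D" and e: "e > 0" for x e
  proof -
    have e4: "e / 4 > 0" using e by simp
    obtain r where r: "r > 0" "!!s d x. s \<le> r ==> 0 < d ==> d < s ==> x \<in> core s ==> \<bar>conv D u (eta d) x - V x\<bar> \<le> e / 4"
      by (rule Vr[OF e4]) (rule that)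
    define s where "s = min r (infdist x (frontier D) / 2)"
    have s: "s > 0" "s \<le> r" "s < infdist x (frontier D)" using r D_core(1)[OF x] by (auto simp: s_def)
    have o: "open (D \<inter> {y. s < infdist y (frontier D)})"
      by (intro open_Int D_open open_Collect_less continuous_on_const continuous_on_infdist continuous_on_id)
    obtain t1 where t1: "t1 > 0" "!!y. dist y x < t1 ==> y \<in> D \<inter> {y. s < infdist y (frontier D)}"
      using o[unfolded open_dist] x s(3) by blast
    have d: "s / 2 > 0" "s / 2 < s" using s by auto
    have "continuous_on UNIV (conv D u (eta (s / 2)))"
      by (rule conv_continuous[OF ui smooth_eta[OF d(1)] eta_support[OF d(1)]])
    then obtain t2 where t2: "t2 > 0" "!!y. dist y x < t2 ==> dist (conv D u (eta (s / 2)) y) (conv D u (eta (s / 2)) x) < e / 4"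
      unfolding continuous_on_iff using e4 by blast
    have "y \<in> D \<and> \<bar>V y - V x\<bar> < e" if y: "dist y x < min t1 t2" for y
    proof -
      have yD: "y \<in> D" "s < infdist y (frontier D)" using t1(2)[of y] y by auto
      have cy: "y \<in> core s" "x \<in> core s" using yD s x D_subset by (auto simp: core_def)
      have "\<bar>conv D u (eta (s / 2)) y - conv D u (eta (s / 2)) x\<bar> < e / 4"
        using t2(2)[of y] y by (simp add: dist_real_def)
      then show ?thesis using r(2)[OF s(2) d cy(1)] r(2)[OF s(2) d cy(2)] yD(1) by linarith
    qed
    then show ?thesis using t1(1) t2(1) by (intro exI[of _ "min t1 t2"]) auto
  qed
  have bdry: "\<exists>t>0. \<forall>y\<in>D. \<forall>x\<in>frontier D. dist y x < t --> \<bar>V y - \<phi> x\<bar> \<le> e" if e: "e > 0" for e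
  proof -
    have e2: "e / 2 > 0" using e by simp
    obtain r where r: "r > 0" "!!z y d. z \<in> frontier D ==> d > 0 ==> cball y d \<subseteq> D ==> dist y z + d \<le> r
      ==> \<bar>conv D u (eta d) y - \<phi> z\<bar> \<le> e / 2"
      by (rule conv_near_boundary[OF u c e2]) (rule that)
    obtain q where q: "q > 0" "!!s d x. s \<le> q ==> 0 < d ==> d < s ==> x \<in> core s ==> \<bar>conv D u (eta d) x - V x\<bar> \<le> e / 2"
      by (rule Vr[OF e2]) (rule that)
    have "\<bar>V y - \<phi> x\<bar> \<le> e" if y: "y \<in> D" and x: "x \<in> frontier D" and yx: "dist y x < r" for y x
    proof -
      define s where "s = min (min q (infdist y (frontier D))) (r - dist y x)"
      have s: "s > 0" "s \<le> q" "y \<in> core s" "s \<le> r - dist y x"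
        using q D_core[OF y] yx core_mono[of y "infdist y (frontier D)" s] by (auto simp: s_def)
      have d: "0 < s / 2" "s / 2 < s" using s by auto
      have "\<bar>conv D u (eta (s / 2)) y - \<phi> x\<bar> \<le> e / 2"
        by (rule r(2)[OF x d(1) core_cball[OF s(3) d(2,1)]]) (use s d in linarith)
      then show ?thesis using q(2)[OF s(2) d s(3)] by linarith
    qed
    then show ?thesis using r(1) by blast
  qed
  have cU: "continuous_on T U"
    unfolding continuous_on_iff
  proof (intro ballI allI impI)
    fix x e assume x: "x \<in> T" and e: "(e::real) > 0"
    show "\<exists>t>0. \<forall>y\<in>T. dist y x < t --> dist (U y) (U x) < e"
    proof (cases "x \<in> D")
      case True
      then show ?thesis using inner[OF True e] by (auto simp: U_def dist_real_def)
    next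
      case False
      then have xf: "x \<in> frontier D" using x by (simp add: frontier_D)
      have e2: "e / 2 > 0" using e by simp
      obtain t1 where t1: "t1 > 0" "\<forall>y\<in>D. \<forall>x\<in>frontier D. dist y x < t1 --> \<bar>V y - \<phi> x\<bar> \<le> e / 2"
        using bdry[OF e2] by blast
      obtain t2 where t2: "t2 > 0" "\<forall>y\<in>frontier D. dist y x < t2 --> dist (\<phi> y) (\<phi> x) < e"
        using c[unfolded continuous_on_iff] xf e by blast
      have "dist (U y) (U x) < e" if y: "y \<in> T" "dist y x < min t1 t2" for y
      proof (cases "y \<in> D")
        case True
        then have "\<bar>V y - \<phi> x\<bar> \<le> e / 2" using t1 xf y by auto
        then show ?thesis using True False e by (simp add: U_def dist_real_def)
      next
        case n: False
        then have "y \<in> frontier D" using y by (simp add: frontier_D)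
        then show ?thesis using t2 y n False by (simp add: U_def)
      qed
      then show ?thesis using t1(1) t2(1) by (intro exI[of _ "min t1 t2"]) auto
    qed
  qed
  have Ui: "integrable (lebesgue_on D) U" by (rule continuous_T_integrable[OF cU])
  have Dl: "D \<in> sets lebesgue" using D_open by (intro sets_completionI_sets) (simp add: borel_open)
  have "AE x in lebesgue_on D. u x - U x = 0"
  proof (rule fundamental_lemma[OF D_open])
    show "locally_integrable D (%x. u x - U x)"
      by (rule integrable_imp_locally_integrable[OF Dl Bochner_Integration.integrable_diff[OF ui Ui]])
    fix \<psi> assume t: "test_fun D \<psi>"
    have tc: "continuous_on UNIV \<psi>" by (rule test_funD(2)[OF t])
    obtain Z where Z: "!!x. x \<in> T ==> \<bar>\<psi> x\<bar> \<le> Z" by (rule smooth_bounded_T[OF test_funD(1)[OF t]]) (rule that)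
    define d where "d n = 1 / real (Suc n)" for n
    have d: "!!n. d n > 0" "d ----> 0"
      unfolding d_def[abs_def] using LIMSEQ_Suc[OF lim_1_over_n] by auto
    have l1: "(%n. LINT x|lebesgue_on D. \<psi> x * conv D u (eta (d n)) x) ----> (LINT y|lebesgue_on D. u y * \<psi> y)"
    proof (rule mollification_weak_limit[OF D_open D_bounded ui d])
      show "\<psi> \<in> borel_measurable (lebesgue_on D)" by (rule measurable_lebesgue_on_continuous[OF tc])
      show "\<bar>\<psi> x\<bar> \<le> Z" if "x \<in> D" for x using Z D_subset that by blast
      fix y e assume "y \<in> D" and e: "(e::real) > 0"
      obtain r where "r > 0" "!!x. dist x y < r ==> dist (\<psi> x) (\<psi> y) < e"
        using tc[unfolded continuous_on_iff] e by blast
      then show "\<exists>r>0. \<forall>\<^sub>F n in sequentially. \<forall>x\<in>D. dist y x < r --> \<bar>\<psi> x - \<psi> y\<bar> \<le> e"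
        by (intro exI[of _ r]) (force simp: dist_commute dist_real_def less_imp_le)
    qed
    have psi_i: "integrable (lebesgue_on D) \<psi>"
      by (rule continuous_T_integrable[OF continuous_on_subset[OF tc subset_UNIV]])
    have vi: "integrable (lebesgue_on D) (%x. \<psi> x * conv D u (eta (d n)) x)" for n
      by (intro continuous_T_integrable continuous_on_mult continuous_on_subset[OF tc subset_UNIV]
        continuous_on_subset[OF conv_continuous[OF ui smooth_eta[OF d(1)] eta_support[OF d(1)]] subset_UNIV])
    have pUi: "integrable (lebesgue_on D) (%x. \<psi> x * U x)"
      by (intro continuous_T_integrable continuous_on_mult continuous_on_subset[OF tc subset_UNIV] cU)
    have l2: "(%n. LINT x|lebesgue_on D. \<psi> x * conv D u (eta (d n)) x) ----> (LINT x|lebesgue_on D. \<psi> x * U x)"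
    proof (rule metric_LIMSEQ_I)
      fix e :: real assume e: "e > 0"
      define I where "I = (LINT x|lebesgue_on D. \<bar>\<psi> x\<bar>)"
      have I: "0 \<le> I" unfolding I_def by simp
      define e' where "e' = e / (I + 1)"
      have e': "e' > 0" "e' * I < e"
      proof -
        show "e' > 0" using e I by (simp add: e'_def)
        have "e' * (I + 1) = e" using I by (simp add: e'_def)
        then show "e' * I < e" using \<open>e' > 0\<close> by (simp add: distrib_left)
      qed
      obtain r where r: "r > 0" "!!s d x. s \<le> r ==> 0 < d ==> d < s ==> x \<in> core s ==> \<bar>conv D u (eta d) x - V x\<bar> \<le> e'"
        by (rule Vr[OF e'(1)]) (rule that)
      (* on the compact support of the test function the convergence is uniform *)
      obtain K where K: "compact K" "K \<subseteq> D" "!!x. x \<notin> K ==> \<psi> x = 0"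
      proof (rule that)
        show "compact (closure {x. \<psi> x \<noteq> 0})" "closure {x. \<psi> x \<noteq> 0} \<subseteq> D" using t by (simp_all add: test_fun_def)
      qed (rule test_funD(5)[OF t])
      obtain q where q: "q > 0" "!!x. x \<in> K ==> q \<le> infdist x (frontier D)"
      proof (cases "K = {}")
        case True
        then show ?thesis using that[of 1] by simp
      next
        case False
        obtain x0 where x0: "x0 \<in> K" "!!x. x \<in> K ==> infdist x0 (frontier D) \<le> infdist x (frontier D)"
          using continuous_attains_inf[OF K(1) False continuous_on_infdist[OF continuous_on_id]] by blast
        have "0 < infdist x0 (frontier D)" by (rule D_core(1)) (use x0 K in blast)
        then show ?thesis using x0(2) by (rule that)
      qed
      define s where "s = min r q"
      have s: "s > 0" "s \<le> r" using r q by (auto simp: s_def)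
      have Ks: "x \<in> core s" if "x \<in> K" for x
        using q(2)[OF that] that K(2) D_subset by (auto simp: core_def s_def)
      have "\<forall>\<^sub>F n in sequentially. d n < s" by (rule order_tendstoD(2)[OF d(2) s(1)])
      then obtain N where N: "!!n. n \<ge> N ==> d n < s" unfolding eventually_sequentially by blast
      have "dist (LINT x|lebesgue_on D. \<psi> x * conv D u (eta (d n)) x) (LINT x|lebesgue_on D. \<psi> x * U x) < e" if n: "n \<ge> N" for n
      proof -
        have le: "\<bar>\<psi> x * conv D u (eta (d n)) x - \<psi> x * U x\<bar> \<le> e' * \<bar>\<psi> x\<bar>" for x
        proof (cases "x \<in> K")
          case True
          then have "U x = V x" using K(2) by (auto simp: U_def)
          have "\<bar>conv D u (eta (d n)) x - U x\<bar> \<le> e'" unfolding \<open>U x = V x\<close>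
            by (rule r(2)[OF s(2) d(1) N[OF n] Ks[OF True]])
          then have "\<bar>\<psi> x\<bar> * \<bar>conv D u (eta (d n)) x - U x\<bar> \<le> \<bar>\<psi> x\<bar> * e'" by (rule mult_left_mono) simp
          then show ?thesis by (simp add: abs_mult[symmetric] right_diff_distrib mult.commute)
        next
          case False
          then show ?thesis using K(3) e' by simp
        qed
        have "dist (LINT x|lebesgue_on D. \<psi> x * conv D u (eta (d n)) x) (LINT x|lebesgue_on D. \<psi> x * U x)
          = \<bar>LINT x|lebesgue_on D. \<psi> x * conv D u (eta (d n)) x - \<psi> x * U x\<bar>"
          unfolding dist_real_def lintegral_diff[OF vi pUi] ..
        moreover have "\<bar>LINT x|lebesgue_on D. \<psi> x * conv D u (eta (d n)) x - \<psi> x * U x\<bar>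
          \<le> (LINT x|lebesgue_on D. \<bar>\<psi> x * conv D u (eta (d n)) x - \<psi> x * U x\<bar>)" by (rule integral_abs_bound)
        moreover have "(LINT x|lebesgue_on D. \<bar>\<psi> x * conv D u (eta (d n)) x - \<psi> x * U x\<bar>) \<le> (LINT x|lebesgue_on D. e' * \<bar>\<psi> x\<bar>)"
          by (intro integral_mono integrable_abs integrable_mult_right Bochner_Integration.integrable_diff vi pUi psi_i le)
        moreover have "(LINT x|lebesgue_on D. e' * \<bar>\<psi> x\<bar>) = e' * I" by (simp add: I_def)
        ultimately show ?thesis using e'(2) by linarith
      qed
      then show "\<exists>no. \<forall>n\<ge>no. dist (LINT x|lebesgue_on D. \<psi> x * conv D u (eta (d n)) x) (LINT x|lebesgue_on D. \<psi> x * U x) < e" by blast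
    qed
    have eq: "(LINT y|lebesgue_on D. u y * \<psi> y) = (LINT x|lebesgue_on D. \<psi> x * U x)" by (rule LIMSEQ_unique[OF l1 l2])
    have upi: "integrable (lebesgue_on D) (%y. u y * \<psi> y)"
      by (rule locally_integrable_mult_test[OF D_open integrable_imp_locally_integrable[OF Dl ui] t])
    have "(LINT x|lebesgue_on D. (u x - U x) * \<psi> x) = (LINT x|lebesgue_on D. u x * \<psi> x - \<psi> x * U x)"
      by (simp add: algebra_simps)
    also have "... = 0" unfolding lintegral_diff[OF upi pUi] eq by simp
    finally show "(LINT x|lebesgue_on D. (u x - U x) * \<psi> x) = 0" .
  qed
  then have "AE x in lebesgue_on D. U x = u x" by eventually_elim simp
  moreover have "!!x. x \<in> frontier D ==> U x = \<phi> x" by (simp add: U_def frontier_D)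
  ultimately show ?thesis using cU by (intro that) 
qed

lemma frontier_T_eq: "frontier T = frontier D"
  by (simp add: frontier_T frontier_D)

text \<open>The weak maximum principle for \<open>-u\<close> and a constant bounds the representative below
  almost everywhere, hence everywhere by continuity.\<close>

lemma minimum_principle:
  assumes u: "harmonic_extension D \<phi> u" and c: "continuous_on (frontier D) \<phi>"
  shows "\<exists>U. continuous_on T U \<and> (AE x in lebesgue_on T. U x = u x) \<and> (\<forall>x\<in>frontier T. U x = \<phi> x) \<and>
    (\<exists>m. has_min_on T U m \<and> has_min_on (frontier T) \<phi> m)"
proof -
  obtain U where U: "continuous_on T U" "!!x. x \<in> frontier D ==> U x = \<phi> x" "AE x in lebesgue_on D. U x = u x"
    by (rule continuous_representative[OF u c]) (rule that)
  have fc: "compact (frontier D)" by (rule compact_frontier_bounded[OF D_bounded])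
  obtain z where z: "z \<in> frontier D" "!!x. x \<in> frontier D ==> \<phi> z \<le> \<phi> x"
    using continuous_attains_inf[OF fc frontier_nonempty c] by blast
  have "AE x in lebesgue_on D. - u x \<le> - \<phi> z"
    by (rule weak_maximum[OF harmonic_extension_uminus[OF u] harmonic_const]) (use z in simp)
  with U(3) have ae: "AE x in lebesgue_on D. \<phi> z \<le> U x" by eventually_elim simp
  have Dl: "D \<in> sets lebesgue" using D_open by (intro sets_completionI_sets) (simp add: borel_open)
  have ge: "\<phi> z \<le> U x" if x: "x \<in> D" for x
  proof -
    have o: "open (D \<inter> U -` {..<\<phi> z})"
      by (rule continuous_open_preimage[OF continuous_on_subset[OF U(1) D_subset] D_open open_lessThan])
    have "AE y in lebesgue. y \<in> D --> \<phi> z \<le> U y"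
      using ae AE_restrict_space_iff[of D lebesgue "%x. \<phi> z \<le> U x"] Dl by simp
    then have "AE y\<in>D \<inter> U -` {..<\<phi> z} in lebesgue. y \<in> {}"
      by eventually_elim auto
    from mem_closed_if_AE_lebesgue_open[OF o closed_empty this, of x] x show ?thesis by force
  qed
  have m: "has_min_on T U (\<phi> z)" "has_min_on (frontier T) \<phi> (\<phi> z)"
  proof -
    have "U x \<ge> \<phi> z" if "x \<in> T" for x
      using ge[of x] U(2)[of x] z(2)[of x] that by (cases "x \<in> D") (auto simp: frontier_D)
    moreover have "z \<in> T" using z(1) frontier_subset_T by blast
    ultimately show "has_min_on T U (\<phi> z)" using U(2)[OF z(1)] unfolding has_min_on_def by force
    show "has_min_on (frontier T) \<phi> (\<phi> z)" using z unfolding has_min_on_def frontier_T_eq by blast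
  qed
  have Tl: "T \<in> sets lebesgue" using T_compact by (intro sets_completionI_sets) (simp add: borel_compact)
  have "AE x in lebesgue_on T. U x = u x"
  proof -
    have n: "frontier T \<in> null_sets lebesgue"
      using negligible_convex_frontier[OF T_convex] negligible_iff_null_sets by blast
    have "AE x in lebesgue. x \<in> D --> U x = u x"
      using U(3) AE_restrict_space_iff[of D lebesgue "%x. U x = u x"] Dl by simp
    moreover have "AE x in lebesgue. x \<notin> frontier T" by (rule AE_not_in[OF n])
    ultimately have "AE x in lebesgue. x \<in> T --> U x = u x"
      by eventually_elim (auto simp: frontier_T)
    then show ?thesis using AE_restrict_space_iff[of T lebesgue "%x. U x = u x"] Tl by simp
  qed
  then show ?thesis using U(1,2) m unfolding frontier_T_eq[symmetric] by blast
qed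

end

section \<open>Functions on an edge\<close>

text \<open>Extension by zero outside of the unit interval makes the function continuous on the whole line when
  \<open>\<phi>\<close> vanishes at both endpoints.\<close>

definition edge_fun :: "plane => plane => (plane => real) => real => real" where
  "edge_fun p q \<phi> t = (if t \<in> {0..1} then \<phi> ((1 - t) *\<^sub>R p + t *\<^sub>R q) else 0)"

lemma segment_param: "0 \<le> t ==> t \<le> 1 ==> (1 - t) *\<^sub>R p + t *\<^sub>R q \<in> closed_segment p (q::plane)"
  by (auto simp: in_segment)

lemma edge_fun_continuous:
  assumes c: "continuous_on (closed_segment p q) \<phi>" and z: "\<phi> p = 0" "\<phi> q = 0"
  shows "continuous_on UNIV (edge_fun p q \<phi>)"
proof -
  define r :: "real => real" where "r t = max 0 (min 1 t)" for t
  have r: "0 \<le> r t" "r t \<le> 1" for t by (auto simp: r_def)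
  have rc: "continuous_on UNIV r" unfolding r_def[abs_def] by (intro continuous_intros)
  have "edge_fun p q \<phi> t = \<phi> ((1 - r t) *\<^sub>R p + r t *\<^sub>R q)" for t
  proof -
    consider "t < 0" | "0 \<le> t \<and> t \<le> 1" | "t > 1" by linarith
    then show ?thesis by cases (simp_all add: edge_fun_def r_def z)
  qed
  then have e: "edge_fun p q \<phi> = (%t. \<phi> ((1 - r t) *\<^sub>R p + r t *\<^sub>R q))" by (rule ext)
  have k: "continuous_on UNIV (%t. (1 - r t) *\<^sub>R p + r t *\<^sub>R q)" by (intro continuous_intros rc)
  show ?thesis unfolding e
    by (rule continuous_on_compose2[OF c k]) (use segment_param[OF r] in blast)
qed

lemma partial_real_scale:
  fixes \<eta> :: "real => real"
  assumes "smooth \<eta>" shows "partial 1 (%x. \<eta> (x / L)) x = partial 1 \<eta> (x / L) / L"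
proof -
  have 1: "((%x. x / L) has_derivative (%h. h / L)) (at x)"
    by (rule bounded_linear_imp_has_derivative[OF bounded_linear_divide])
  have d: "(\<eta> has_derivative frechet_derivative \<eta> (at (x / L))) (at (x / L))" by (rule smooth_has_derivative[OF assms])
  have "frechet_derivative \<eta> (at (x / L)) ((1 / L) *\<^sub>R 1) = (1 / L) *\<^sub>R frechet_derivative \<eta> (at (x / L)) 1"
    by (rule linear_scale) (rule has_derivative_linear[OF d])
  then show ?thesis using partial_eqI[OF has_derivative_compose[OF 1 d], of 1] by simp
qed

text \<open>A function in \<open>H\<^sup>1\<^sub>0(0,1)\<close> and its weak derivative, both extended by zero
  to the real line, where the derivative is a Borel function so that it may be inserted into Borel
  maps.\<close>

definition H10_pair :: "(real => real) => (real => real) => bool" where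
  "H10_pair f g \<longleftrightarrow> continuous_on UNIV f \<and> (\<forall>t. t \<notin> {0<..<1} --> f t = 0) \<and>
     g \<in> borel_measurable borel \<and> (\<forall>t. t \<notin> {0<..<1} --> g t = 0) \<and> integrable lborel (%t. (g t)^2) \<and>
     (\<forall>\<eta>. test_fun {0<..<1} \<eta> --> (LINT t|lborel. f t * partial 1 \<eta> t) = - (LINT t|lborel. g t * \<eta> t))"

lemma H10_pair_elim:
  assumes "H10_pair f g"
  shows "continuous_on UNIV f" "!!t. t \<notin> {0<..<1} ==> f t = 0"
    "g \<in> borel_measurable borel" "!!t. t \<notin> {0<..<1} ==> g t = 0" "integrable lborel (%t. (g t)^2)"
    "!!\<eta>. test_fun {0<..<1} \<eta> ==> (LINT t|lborel. f t * partial 1 \<eta> t) = - (LINT t|lborel. g t * \<eta> t)"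
  using assms unfolding H10_pair_def by blast+

text \<open>The derivative with respect to arc length is transported to the unit interval. The scaling \<open>t
  = s / dist p q\<close> multiplies it by the length of the segment and \<open>dt\<close> by the
  inverse of that length, which leaves one factor \<open>dist p q\<close> in the squared norm.\<close>

lemma edge_H10_pair:
  assumes pq: "p \<noteq> q" and c: "continuous_on (closed_segment p q) \<phi>" and z: "\<phi> p = 0" "\<phi> q = 0"
    and h: "H1_segment p q \<phi>"
  obtains g where "H10_pair (edge_fun p q \<phi>) g"
    "(LINT t|lborel. (g t)^2) = dist p q * (H1_segment_seminorm p q \<phi>)^2"
proof -
  define L where "L = dist p q"
  have L: "L > 0" using pq by (simp add: L_def)
  define I where "I = {0<..<L}"
  have I: "open I" "bounded I" "I \<in> sets borel" "I \<in> sets lebesgue" by (simp_all add: I_def)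
  define v where "v = \<phi> \<circ> arclength_param p q"
  define G where "G = weak_gradient I v"
  have P: "H1_pair I v G" unfolding G_def
    by (rule H1_imp_pair[OF I(1)]) (use h in "simp add: H1_segment_def I_def L_def v_def")
  then have GL: "L2_on I G" and wg: "has_weak_gradient I v G" by (simp_all add: H1_pair_def)
  have "(%x. if x \<in> I then G x else 0) \<in> borel_measurable (completion lborel)"
    using L2_on_measurable[OF GL] borel_measurable_if[OF I(4)] by blast
  from completion_ex_borel_measurable_real[OF this] obtain G1 where
    G1[measurable]: "G1 \<in> borel_measurable borel" and "AE x in lborel. (if x \<in> I then G x else 0) = G1 x" by auto
  then have "AE x in lebesgue. x \<in> I --> G x = G1 x"
    by (intro AE_completion) (auto elim: eventually_mono)
  then have ae: "AE x in lebesgue_on I. G x = G1 x"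
    using AE_restrict_space_iff[of I lebesgue "%x. G x = G1 x"] I(4) by simp
  have G1L: "L2_on I G1" by (rule L2_on_AE_cong[OF I(4) GL ae])
  define g where "g t = indicator {0<..<1} t * (L * G1 (L * t))" for t
  have ind: "indicator I (L * t) = (indicator {0<..<1} t :: real)" for t
    using L by (auto simp: I_def indicator_def zero_less_mult_iff)
  have sub: "(LINT x|lebesgue_on I. H x) = L * (LINT t|lborel. indicator {0<..<1} t * H (L * t))"
    "integrable (lebesgue_on I) H \<longleftrightarrow> integrable lborel (%t. indicator {0<..<1} t * H (L * t))"
    if H: "(%x. indicator I x * H x) \<in> borel_measurable borel" for H :: "real => real"
  proof -
    let ?H = "%x. indicator I x * H x"
    have "(LINT x|lebesgue_on I. H x) = (LINT x|lebesgue_on I. ?H x)"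
      by (rule lintegral_cong) (simp add: indicator_def)
    also have "... = (LINT x|lborel. ?H x)" by (rule lebesgue_on_eq_lborel(1)[OF H I(3)]) simp
    also have "... = L * (LINT t|lborel. ?H (0 + L * t))"
      using lborel_integral_real_affine[of L ?H 0] L by simp
    finally show "(LINT x|lebesgue_on I. H x) = L * (LINT t|lborel. indicator {0<..<1} t * H (L * t))"
      by (simp only: ind add_0)
    have "integrable (lebesgue_on I) H \<longleftrightarrow> integrable (lebesgue_on I) ?H"
      by (rule Bochner_Integration.integrable_cong[OF refl]) (simp add: indicator_def)
    also have "... \<longleftrightarrow> integrable lborel ?H" by (rule lebesgue_on_eq_lborel(2)[OF H I(3)]) simp
    also have "... \<longleftrightarrow> integrable lborel (%t. ?H (0 + L * t))"
      using lborel_integrable_real_affine_iff[of L ?H 0] L by simp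
    finally show "integrable (lebesgue_on I) H \<longleftrightarrow> integrable lborel (%t. indicator {0<..<1} t * H (L * t))"
      by (simp only: ind add_0)
  qed
  have m1: "(%x. indicator I x * (G1 x)^2) \<in> borel_measurable borel" using I(3) by measurable
  have gsq: "(g t)^2 = L^2 * (indicator {0<..<1} t * (G1 (L * t))^2)" for t
    by (simp add: g_def power_mult_distrib indicator_def)
    have g1: "g \<in> borel_measurable borel" unfolding g_def[abs_def] by measurable
    have g2: "g t = 0" if "t \<notin> {0<..<1}" for t using that by (simp add: g_def)
    have "integrable (lebesgue_on I) (%x. (G1 x)^2)" using L2_on_square[OF G1L] by simp
    then have "integrable lborel (%t. indicator {0<..<1} t * (G1 (L * t))^2)" using sub(2)[OF m1] by blast
    then have g3: "integrable lborel (%t. (g t)^2)" unfolding gsq by (rule integrable_mult_right)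
    have "(H1_segment_seminorm p q \<phi>)^2 = L2_inner I G G"
      unfolding H1_segment_seminorm_def H1_seminorm_def
      using dirichlet_form_eq[OF I(1) P P] L2_inner_nonneg[of I G] by (simp add: I_def L_def v_def)
    also have "... = L2_inner I G1 G1" by (rule L2_inner_cong_AE[OF GL G1L GL G1L ae ae])
    also have "... = (LINT x|lebesgue_on I. (G1 x)^2)" by (simp add: L2_inner_def power2_eq_square)
    also have "... = L * (LINT t|lborel. indicator {0<..<1} t * (G1 (L * t))^2)" by (rule sub(1)[OF m1])
    finally have s: "(H1_segment_seminorm p q \<phi>)^2 = L * (LINT t|lborel. indicator {0<..<1} t * (G1 (L * t))^2)" .
    have "(LINT t|lborel. (g t)^2) = L^2 * (LINT t|lborel. indicator {0<..<1} t * (G1 (L * t))^2)"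
      unfolding gsq by simp
    then have g4: "(LINT t|lborel. (g t)^2) = dist p q * (H1_segment_seminorm p q \<phi>)^2"
      unfolding s L_def[symmetric] by (simp add: power2_eq_square)
  have g5: "(LINT t|lborel. edge_fun p q \<phi> t * partial 1 \<eta> t) = - (LINT t|lborel. g t * \<eta> t)"
    if t: "test_fun {0<..<1} \<eta>" for \<eta>
  proof -
    note se = test_funD(1)[OF t]
    have l: "linear (%x::real. x / L)" by (rule linearI) (simp_all add: add_divide_distrib)
    have sL: "smooth (%x. \<eta> (x / L))" using smooth_affine[OF l se, of 0] by simp
    have tL: "test_fun I (%x. \<eta> (x / L))"
    proof (rule test_funI[OF sL])
      let ?K = "closure {x. \<eta> x \<noteq> 0}"
      have K: "compact ?K" "?K \<subseteq> {0<..<1}" using t by (simp_all add: test_fun_def)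
      show "compact ((%x. L * x) ` ?K)" by (intro compact_continuous_image continuous_intros K)
      show "(%x. L * x) ` ?K \<subseteq> I" using K(2) L by (auto simp: I_def subset_iff)
      fix x assume x: "x \<notin> (%x. L * x) ` ?K"
      have "x / L \<notin> ?K"
      proof
        assume "x / L \<in> ?K"
        then have "L * (x / L) \<in> (%x. L * x) ` ?K" by blast
        then show False using x L by simp
      qed
      then show "\<eta> (x / L) = 0" by (rule test_funD(5)[OF t])
    qed
    have ec: "\<eta> \<in> borel_measurable borel" "partial 1 \<eta> \<in> borel_measurable borel"
      using smooth_continuous[OF se, of UNIV] smooth_continuous[OF smooth_partial[OF se, of 1], of UNIV]
      by (simp_all add: borel_measurable_continuous_onI)
    have fc: "edge_fun p q \<phi> \<in> borel_measurable borel"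
      using edge_fun_continuous[OF c z] by (rule borel_measurable_continuous_onI)
    note [measurable] = ec fc
    have vf: "v x = edge_fun p q \<phi> (x / L)" if "x \<in> I" for x
      using that L by (simp add: v_def edge_fun_def I_def arclength_param_eq L_def[symmetric] field_simps)
    have m2: "(%x. indicator I x * (edge_fun p q \<phi> (x / L) * (partial 1 \<eta> (x / L) / L))) \<in> borel_measurable borel"
      using I(3) by measurable
    have m3: "(%x. indicator I x * (G1 x * \<eta> (x / L))) \<in> borel_measurable borel" using I(3) by measurable
    have f0: "edge_fun p q \<phi> t = indicator {0<..<1} t * edge_fun p q \<phi> t" for t
      using z by (cases "t = 0 \<or> t = 1") (auto simp: edge_fun_def indicator_def)
    have "(LINT x|lebesgue_on I. v x * partial 1 (%x. \<eta> (x / L)) x) = (LINT x|lebesgue_on I. edge_fun p q \<phi> (x / L) * (partial 1 \<eta> (x / L) / L))"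
      by (rule lintegral_cong) (simp add: vf partial_real_scale[OF se])
    also have "... = L * (LINT t|lborel. indicator {0<..<1} t * (edge_fun p q \<phi> (L * t / L) * (partial 1 \<eta> (L * t / L) / L)))"
      by (rule sub(1)[OF m2])
    also have "... = L * (LINT t|lborel. (1 / L) * (edge_fun p q \<phi> t * partial 1 \<eta> t))"
      using L by (subst (2) f0) (simp add: mult_ac)
    also have "... = (LINT t|lborel. edge_fun p q \<phi> t * partial 1 \<eta> t)" using L by simp
    finally have e1: "(LINT x|lebesgue_on I. v x * partial 1 (%x. \<eta> (x / L)) x) = (LINT t|lborel. edge_fun p q \<phi> t * partial 1 \<eta> t)" .
    have "(LINT x|lebesgue_on I. G x * \<eta> (x / L)) = L2_inner I G (%x. \<eta> (x / L))" by (simp add: L2_inner_real)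
    also have "... = L2_inner I G1 (%x. \<eta> (x / L))"
    proof (rule L2_inner_cong_AE[OF GL G1L _ _ ae])
      show "L2_on I (%x. \<eta> (x / L))" "L2_on I (%x. \<eta> (x / L))" by (rule test_fun_L2(1)[OF I(1,2) tL])+
    qed simp
    also have "... = (LINT x|lebesgue_on I. G1 x * \<eta> (x / L))" by (simp add: L2_inner_real)
    also have "... = L * (LINT t|lborel. indicator {0<..<1} t * (G1 (L * t) * \<eta> (L * t / L)))" by (rule sub(1)[OF m3])
    also have "... = (LINT t|lborel. L * (indicator {0<..<1} t * (G1 (L * t) * \<eta> (L * t / L))))" by simp
    also have "... = (LINT t|lborel. g t * \<eta> t)"
      by (rule lintegral_cong) (use L in "simp add: g_def")
    finally have e2: "(LINT x|lebesgue_on I. G x * \<eta> (x / L)) = (LINT t|lborel. g t * \<eta> t)" .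
    have "(LINT x|lebesgue_on I. v x * partial 1 (%x. \<eta> (x / L)) x) = - (LINT x|lebesgue_on I. (G x \<bullet> 1) * \<eta> (x / L))"
      using wg tL unfolding has_weak_gradient_iff by simp
    then show ?thesis unfolding e1 by (simp add: e2)
  qed
  have "edge_fun p q \<phi> t = 0" if "t \<notin> {0<..<1}" for t
    using that z by (cases "t = 0 \<or> t = 1") (auto simp: edge_fun_def)
  then have "H10_pair (edge_fun p q \<phi>) g"
    unfolding H10_pair_def using edge_fun_continuous[OF c z] g1 g2 g3 g5 by blast
  then show ?thesis using g4 by (rule that)
qed

text \<open>Testing a weak derivative with this function compares the mollified values at
  \<open>\<alpha>\<close> and \<open>\<beta>\<close>. It is the mollification of the indicator
  function of the interval.\<close>

lemma smooth_step:
  fixes \<alpha> \<beta> d :: real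
  assumes d: "d > 0" and ab: "\<alpha> \<le> \<beta>"
  obtains \<eta> where "smooth \<eta>" "!!x. 0 \<le> \<eta> x \<and> \<eta> x \<le> 1" "!!x. x \<notin> {\<alpha> - d..\<beta> + d} ==> \<eta> x = 0"
    "!!x. partial 1 \<eta> x = eta d (x - \<alpha>) - eta d (x - \<beta>)"
proof -
  let ?I = "{\<alpha><..<\<beta>}"
  have i1: "integrable (lebesgue_on ?I) (%x. 1::real)"
    by (rule bounded_integrable_lebesgue_on[where B = 1]) auto
  note e = smooth_eta[OF d, where 'a = real]
  define \<eta> where "\<eta> = conv ?I (%x. 1) (eta d)"
  show ?thesis
  proof (rule that)
    show "smooth \<eta>" unfolding \<eta>_def by (rule smooth_conv[OF i1 e eta_support[OF d]])
    have "\<eta> x \<le> 1" for x using conv_bound[OF _ d i1, of 1 x] by (simp add: \<eta>_def)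
    moreover have "0 \<le> \<eta> x" for x unfolding \<eta>_def conv_def
      by (rule Bochner_Integration.integral_nonneg) (simp add: eta_nonneg[OF d])
    ultimately show "0 \<le> \<eta> x \<and> \<eta> x \<le> 1" for x by blast
    show "\<eta> x = 0" if x: "x \<notin> {\<alpha> - d..\<beta> + d}" for x
    proof -
      have "\<eta> x = (LINT y|lebesgue_on ?I. 0)" unfolding \<eta>_def conv_def
      proof (rule lintegral_cong)
        fix y assume "y \<in> space (lebesgue_on ?I)"
        then have "d \<le> norm (x - y)" using x by auto
        then show "1 * eta d (x - y) = 0" by (simp add: eta_outside[OF d])
      qed
      then show ?thesis by simp
    qed
    show "partial 1 \<eta> x = eta d (x - \<alpha>) - eta d (x - \<beta>)" for x
    proof -
      let ?k = "%y. partial 1 (eta d) (x - y)"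
      have kc: "continuous_on UNIV (partial 1 (eta d :: real => real))"
        by (rule smooth_continuous[OF smooth_partial[OF e, of 1]]) simp
      have kc2: "continuous_on S ?k" for S
        by (rule continuous_on_compose2[OF kc]) (auto intro!: continuous_intros)
      have "partial 1 \<eta> x = conv ?I (%x. 1) (partial 1 (eta d)) x"
        unfolding \<eta>_def by (rule conv_partial[OF i1 e eta_support[OF d], of _ "1::real"]) (auto simp: Basis_real_def)
      also have "... = integral\<^sup>L (lebesgue_on ?I) ?k" by (simp add: conv_def)
      also have "... = integral ?I ?k"
      proof (rule lebesgue_integral_eq_integral)
        have "?k absolutely_integrable_on {\<alpha>..\<beta>}" by (rule absolutely_integrable_continuous_real[OF kc2])
        then have "?k absolutely_integrable_on ?I"
          by (rule set_integrable_subset) auto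
        then show "integrable (lebesgue_on ?I) ?k" by (simp add: integrable_lebesgue_on_iff)
      qed simp
      also have "... = integral {\<alpha>..\<beta>} ?k" by (simp add: integral_open_interval_real)
      also have "... = - eta d (x - \<beta>) - - eta d (x - \<alpha>)"
      proof (rule integral_unique[OF fundamental_theorem_of_calculus[OF ab]])
        fix y assume "y \<in> {\<alpha>..\<beta>}"
        have "((%y. eta d (x - y)) has_derivative frechet_derivative (%y. eta d (x - y)) (at y)) (at y)"
          by (rule smooth_has_derivative[OF smooth_reflect[OF e]])
        then have D: "((%y. - eta d (x - y)) has_derivative (%h. - frechet_derivative (%y. eta d (x - y)) (at y) h)) (at y)"
          by (rule has_derivative_minus)
        have "- frechet_derivative (%y. eta d (x - y)) (at y) h = h * ?k y" for h
        proof -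
          have "linear (frechet_derivative (%y. eta d (x - y)) (at y))"
            by (rule has_derivative_linear[OF smooth_has_derivative[OF smooth_reflect[OF e]]])
          from linear_scale[OF this, of h 1] show ?thesis
            by (simp add: has_derivative_affine_reflect[OF e])
        qed
        then have "((%y. - eta d (x - y)) has_vector_derivative ?k y) (at y)"
          unfolding has_vector_derivative_def using D by simp
        then show "((%y. - eta d (x - y)) has_vector_derivative ?k y) (at y within {\<alpha>..\<beta>})"
          by (rule has_vector_derivative_at_within)
      qed
      finally show ?thesis by simp
    qed
  qed
qed

text \<open>The fundamental theorem of calculus, in mollified form, on the interval from a point near the
  endpoint \<open>0\<close> to \<open>t\<close>; the Cauchy--Schwarz inequality turns the integral of
  \<open>\<bar>g\<bar>\<close> into that of \<open>g^2\<close>.\<close>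

lemma weak_derivative_bound:
  assumes "H10_pair f g"
  shows "integrable lborel g" "(f t)^2 \<le> (LINT t|lborel. (g t)^2)"
proof -
  note f = H10_pair_elim(1,2)[OF assms] and g = H10_pair_elim(3-5)[OF assms] and fg = H10_pair_elim(6)[OF assms]
  let ?I = "{0<..<1::real}"
  have I: "open ?I" "bounded ?I" "?I \<in> sets borel" by simp_all
  have gm: "g \<in> borel_measurable (lebesgue_on ?I)"
    using g(1) by (intro measurable_restrict_space1 measurable_completion) simp
  have "integrable (lebesgue_on ?I) (%t. (g t)^2)"
    using lebesgue_on_eq_lborel(2)[of "%t. (g t)^2" ?I] g by (simp add: borel_measurable_power)
  then have gL: "L2_on ?I g" using gm by (simp add: L2_on_def)
  have gi': "integrable (lebesgue_on ?I) g" by (rule L2_bounded_integrable[OF I(1,2) gL])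
  then show gi: "integrable lborel g" using lebesgue_on_eq_lborel(2)[OF g(1) I(3) g(2)] by blast
  define N where "N = (LINT t|lborel. \<bar>g t\<bar>)"
  have N0: "0 \<le> N" by (simp add: N_def)
  have N2: "N^2 \<le> (LINT t|lborel. (g t)^2)"
  proof -
    have aL: "L2_on ?I (%t. \<bar>g t\<bar>)" by (rule L2_norm_mono(1)[OF gL]) (use gm in auto)
    have oL: "L2_on ?I (%t. 1::real)" by (rule L2_on_const[OF I(1,2)])
    have "L2_inner ?I (%t. \<bar>g t\<bar>) (%t. 1) = N"
      unfolding L2_inner_real N_def using lebesgue_on_eq_lborel(1)[of "%t. \<bar>g t\<bar>" ?I] g(1,2) by simp
    moreover have "L2_norm ?I (%t. 1::real) = 1" by (simp add: L2_norm_def L2_inner_real measure_restrict_space)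
    ultimately have "N \<le> L2_norm ?I (%t. \<bar>g t\<bar>)" using L2_Cauchy_Schwarz[OF aL oL] by simp
    then have "N^2 \<le> (L2_norm ?I (%t. \<bar>g t\<bar>))^2" using N0 by (intro power_mono)
    also have "... = (LINT t|lborel. (g t)^2)"
      unfolding L2_norm_square_integral using lebesgue_on_eq_lborel(1)[of "%t. (g t)^2" ?I] g(1,2) by simp
    finally show ?thesis .
  qed
  have fi: "integrable (lebesgue_on ?I) f"
    by (rule L2_bounded_integrable[OF I(1,2) continuous_L2_on[OF I(1,2) continuous_on_subset[OF f(1) subset_UNIV]]])
  have "\<bar>f t\<bar> \<le> N"
  proof (cases "t \<in> ?I")
    case False
    then show ?thesis using f(2) N0 by simp
  next
    case True
    show ?thesis
    proof (rule field_le_epsilon)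
      fix e :: real assume "e > 0"
      then have e3: "e / 3 > 0" by simp
      obtain r1 where r1: "r1 > 0" "!!y. dist y t < r1 ==> dist (f y) (f t) < e / 3"
        using f(1)[unfolded continuous_on_iff] e3 by blast
      obtain r0 where r0: "r0 > 0" "!!y. dist y 0 < r0 ==> dist (f y) (f 0) < e / 3"
        using f(1)[unfolded continuous_on_iff] e3 by blast
      (* the supports of the kernels at 2 d and t stay inside the unit interval *)
      define d where "d = Min {r1, r0, t, 1 - t} / 4"
      have m: "Min {r1, r0, t, 1 - t} \<le> r1" "Min {r1, r0, t, 1 - t} \<le> r0" "Min {r1, r0, t, 1 - t} \<le> t" "Min {r1, r0, t, 1 - t} \<le> 1 - t"
        by (intro Min_le; simp)+
      have "Min {r1, r0, t, 1 - t} > 0" using r1 r0 True by (subst Min_gr_iff) auto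
      then have d: "d > 0" "4 * d \<le> r1" "4 * d \<le> r0" "4 * d \<le> t" "4 * d \<le> 1 - t"
        using m by (simp_all add: d_def)
      have ab: "2 * d \<le> t" using d by simp
      obtain \<eta> where \<eta>: "smooth \<eta>" "!!x. 0 \<le> \<eta> x \<and> \<eta> x \<le> 1" "!!x. x \<notin> {2 * d - d..t + d} ==> \<eta> x = 0"
        "!!x. partial 1 \<eta> x = eta d (x - 2 * d) - eta d (x - t)"
        by (rule smooth_step[OF d(1) ab]) (rule that)
      have tf: "test_fun ?I \<eta>" by (rule test_funI[OF \<eta>(1) _ _ \<eta>(3)]) (use d in auto)
      have cv: "integrable lborel (%x. f x * eta d (x - y))" "(LINT x|lborel. f x * eta d (x - y)) = conv ?I f (eta d) y" for y
      proof -
        have b: "(%x. f x * eta d (x - y)) \<in> borel_measurable borel"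
          by (intro borel_measurable_continuous_onI continuous_on_mult f(1) continuous_on_compose2[OF eta_continuous[OF d(1), of UNIV]] continuous_intros) auto
        have s: "eta d (x - y) = eta d (y - x)" for x using eta_minus[OF d(1), of "x - y"] by simp
        note q = lebesgue_on_eq_lborel[OF b I(3)]
        show "integrable lborel (%x. f x * eta d (x - y))"
          using q(2) f(2) conv_eta_integrable[OF fi d(1), of y] by (simp add: s)
        show "(LINT x|lborel. f x * eta d (x - y)) = conv ?I f (eta d) y"
          using q(1) f(2) by (simp add: conv_def s)
      qed
      have "(LINT x|lborel. f x * partial 1 \<eta> x) = (LINT x|lborel. f x * eta d (x - 2 * d) - f x * eta d (x - t))"
        unfolding \<eta>(4) by (simp add: right_diff_distrib)
      also have "... = conv ?I f (eta d) (2 * d) - conv ?I f (eta d) t"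
        unfolding lintegral_diff[OF cv(1) cv(1)] by (simp only: cv(2))
      finally have e1: "conv ?I f (eta d) (2 * d) - conv ?I f (eta d) t = - (LINT x|lborel. g x * \<eta> x)" using fg[OF tf] by simp
      have c1: "\<bar>conv ?I f (eta d) t - f t\<bar> \<le> e / 3"
      proof (rule conv_close[OF I(1) d(1) fi])
        show "cball t d \<subseteq> ?I" using d by (auto simp: dist_real_def)
        have "\<bar>f x - f t\<bar> \<le> e / 3" if "dist t x < d" for x
        proof -
          have "dist x t < r1" using that d by (simp add: dist_commute)
          then show ?thesis using r1(2)[of x] by (simp add: dist_real_def)
        qed
        then show "AE x in lebesgue_on ?I. dist t x < d --> \<bar>f x - f t\<bar> \<le> e / 3" by auto
      qed
      have c0: "\<bar>conv ?I f (eta d) (2 * d) - 0\<bar> \<le> e / 3"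
      proof (rule conv_close[OF I(1) d(1) fi])
        show "cball (2 * d) d \<subseteq> ?I" using d by (auto simp: dist_real_def)
        have "\<bar>f x - 0\<bar> \<le> e / 3" if "dist (2 * d) x < d" for x
        proof -
          have "dist x 0 < r0" using that d unfolding dist_real_def by linarith
          then show ?thesis using r0(2)[of x] f(2)[of 0] by (simp add: dist_real_def)
        qed
        then show "AE x in lebesgue_on ?I. dist (2 * d) x < d --> \<bar>f x - 0\<bar> \<le> e / 3" by auto
      qed
      have gei: "integrable lborel (%x. g x * \<eta> x)"
      proof (rule lintegrable_bound[OF gi])
        show "(%x. g x * \<eta> x) \<in> borel_measurable lborel"
          using g(1) borel_measurable_continuous_onI[OF smooth_continuous[OF \<eta>(1)]] by simp
        show "AE x in lborel. norm (g x * \<eta> x) \<le> norm (g x)"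
          using \<eta>(2) by (auto simp: abs_mult intro!: AE_I2 mult_right_le_one_le)
      qed
      have "\<bar>LINT x|lborel. g x * \<eta> x\<bar> \<le> (LINT x|lborel. \<bar>g x * \<eta> x\<bar>)" by (rule integral_abs_bound)
      moreover have "(LINT x|lborel. \<bar>g x * \<eta> x\<bar>) \<le> N" unfolding N_def
        by (intro integral_mono integrable_abs gei gi) (use \<eta>(2) in "simp add: abs_mult mult_right_le_one_le")
      ultimately have "\<bar>LINT x|lborel. g x * \<eta> x\<bar> \<le> N" by linarith
      then show "\<bar>f t\<bar> \<le> N + e" using e1 c1 c0 \<open>e > 0\<close> by linarith
    qed
  qed
  then have "\<bar>f t\<bar>^2 \<le> N^2" by (intro power_mono) auto
  then show "(f t)^2 \<le> (LINT t|lborel. (g t)^2)" using N2 by simp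
qed

lemma H10_pair_integrable:
  assumes "H10_pair f g"
  shows "f \<in> borel_measurable borel" "integrable lborel f"
proof -
  note F = H10_pair_elim[OF assms]
  show "f \<in> borel_measurable borel" by (rule borel_measurable_continuous_onI[OF F(1)])
  show "integrable lborel f" by (rule continuous_integrable_lborel[OF F(1), of 1]) (auto intro!: F(2))
qed

lemmas H10_pairD = H10_pair_elim H10_pair_integrable weak_derivative_bound

section \<open>Conical extension of an edge function\<close>

lemma iterated_integrals:
  fixes h :: "real \<times> real => real"
  assumes "integrable lborel h"
  shows "integral\<^sup>L lborel h = (LINT s|lborel. (LINT t|lborel. h (s, t)))"
    "integral\<^sup>L lborel h = (LINT t|lborel. (LINT s|lborel. h (s, t)))"
proof -
  have i: "integrable (lborel \<Otimes>\<^sub>M lborel) (%(s, t). h (s, t))" using assms by (simp add: lborel_prod)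
  show "integral\<^sup>L lborel h = (LINT s|lborel. (LINT t|lborel. h (s, t)))"
    using lborel_pair.integral_fst[OF i] by (simp add: lborel_prod)
  show "integral\<^sup>L lborel h = (LINT t|lborel. (LINT s|lborel. h (s, t)))"
    using lborel_pair.integral_snd[OF i] by (simp add: lborel_prod)
qed

lemma strip_integrable:
  fixes k :: "real => real" and H :: "real \<times> real => real"
  assumes k: "integrable lborel k" "!!t. t \<notin> {0<..<1} ==> k t = 0" and H: "continuous_on UNIV H"
  shows "integrable lborel (%p. indicator {0<..<1} (fst p) * (k (snd p) * H p) :: real)"
proof -
  have "compact ({0..1::real} \<times> {0..1::real})" by (intro compact_Times) auto
  then have "bounded (H ` ({0..1} \<times> {0..1}))"
    by (intro compact_imp_bounded compact_continuous_image continuous_on_subset[OF H]) auto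
  then obtain B where B: "!!p. p \<in> {0..1} \<times> {0..1} ==> \<bar>H p\<bar> \<le> B" by (auto simp: bounded_iff)
  have [measurable]: "k \<in> borel_measurable borel" using k(1) by auto
  have [measurable]: "H \<in> borel_measurable borel" by (rule borel_measurable_continuous_onI[OF H])
  have ii: "integrable lborel (indicator {0<..<1::real} :: real => real)" by simp
  show ?thesis
  proof (rule lintegrable_bound)
    show "integrable lborel (%p::real \<times> real. B * (indicator {0<..<1} (fst p) * k (snd p)))"
      by (rule integrable_mult_right[OF lborel_product_integral(1)[OF ii k(1)]])
    have "(%p. (indicator {0<..<1} (fst p) * k (snd p)) * H p) \<in> borel_measurable lborel"
      by (rule borel_measurable_times[OF borel_measurable_integrable[OF lborel_product_integral(1)[OF ii k(1)]]]) simp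
    then show "(%p. indicator {0<..<1} (fst p) * (k (snd p) * H p) :: real) \<in> borel_measurable lborel"
      by (simp only: mult.assoc)
    have "norm (indicator {0<..<1} (fst p) * (k (snd p) * H p)) \<le> norm (B * (indicator {0<..<1} (fst p) * k (snd p)))" for p
    proof (cases "fst p \<in> {0<..<1} \<and> snd p \<in> {0<..<1}")
      case True
      then have "\<bar>H p\<bar> \<le> \<bar>B\<bar>" using B[of p] by (cases p) auto
      then have "\<bar>k (snd p)\<bar> * \<bar>H p\<bar> \<le> \<bar>k (snd p)\<bar> * \<bar>B\<bar>" by (rule mult_left_mono) simp
      then show ?thesis using True by (simp add: abs_mult mult.commute)
    next
      case False
      then show ?thesis using k(2)[of "snd p"] by (auto simp: indicator_def)
    qed
    then show "AE p in lborel. norm (indicator {0<..<1} (fst p) * (k (snd p) * H p)) \<le> norm (B * (indicator {0<..<1} (fst p) * k (snd p)))"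
      by simp
  qed
qed

lemma derivative_inner_grad:
  assumes "smooth \<psi>" shows "frechet_derivative \<psi> (at x) h = h \<bullet> grad \<psi> x"
proof -
  have l: "linear (frechet_derivative \<psi> (at x))" by (rule has_derivative_linear[OF smooth_has_derivative[OF assms]])
  have "frechet_derivative \<psi> (at x) h = frechet_derivative \<psi> (at x) (\<Sum>i\<in>Basis. (h \<bullet> i) *\<^sub>R i)"
    by (simp only: euclidean_representation)
  also have "... = (\<Sum>i\<in>Basis. (h \<bullet> i) * partial i \<psi> x)"
    by (simp add: linear_sum[OF l] linear_scale[OF l])
  also have "... = h \<bullet> grad \<psi> x"
    by (subst (2) euclidean_inner) (simp add: grad_inner_Basis)
  finally show ?thesis .
qed

lemma grad_zero_outside:
  assumes "test_fun D \<psi>" "x \<notin> D" shows "grad \<psi> x = 0"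
  unfolding grad_def
  by (intro sum.neutral ballI) (use test_funD(3)[OF test_fun_partial[OF assms(1)]] assms(2) in simp)

context triangle
begin

text \<open>The gradients of the barycentric coordinates that belong to \<open>b\<close> and \<open>c\<close>.
  They form the basis dual to \<open>b - a\<close>, \<open>c - a\<close>.\<close>

definition \<beta> :: plane where "\<beta> = bary_grad c a b"
definition \<gamma> :: plane where "\<gamma> = bary_grad a b c"

lemma dual_basis: "v = (v \<bullet> \<beta>) *\<^sub>R (b - a) + (v \<bullet> \<gamma>) *\<^sub>R (c - a)"
proof -
  have 1: "J * (v \<bullet> \<beta>) = cr (a - c) v" "J * (v \<bullet> \<gamma>) = cr (b - a) v"
    using J_nonzero J_rotate
    by (simp_all add: \<beta>_def \<gamma>_def bary_grad_def J_def[symmetric] plane_inner cr_def algebra_simps)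
  have "J *\<^sub>R v = (cr (a - c) v) *\<^sub>R (b - a) + (cr (b - a) v) *\<^sub>R (c - a)"
    by (rule plane_eqI) (simp_all add: J_def cr_def algebra_simps)
  also have "... = J *\<^sub>R ((v \<bullet> \<beta>) *\<^sub>R (b - a) + (v \<bullet> \<gamma>) *\<^sub>R (c - a))"
    unfolding 1[symmetric] by (simp add: scaleR_add_right)
  finally show ?thesis using J_nonzero by simp
qed

definition ray :: "real => plane" where "ray t = (1 - t) *\<^sub>R a + t *\<^sub>R b - c"

lemma cone_ray: "cone (s, t) = c + s *\<^sub>R ray t"
  by (simp add: cone_def ray_def)

text \<open>Constant directions are expressed by the two directions in which the cone coordinates vary.\<close>

lemma ray_combination: "v = - (v \<bullet> \<gamma>) *\<^sub>R ray t + (v \<bullet> \<beta> + t * (v \<bullet> \<gamma>)) *\<^sub>R (b - a)"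
proof -
  have "ray t = t *\<^sub>R (b - a) - (c - a)" by (simp add: ray_def algebra_simps)
  then have "- (v \<bullet> \<gamma>) *\<^sub>R ray t + (v \<bullet> \<beta> + t * (v \<bullet> \<gamma>)) *\<^sub>R (b - a) = (v \<bullet> \<beta>) *\<^sub>R (b - a) + (v \<bullet> \<gamma>) *\<^sub>R (c - a)"
    by (simp only: scaleR_diff_right scaleR_left_distrib scaleR_scaleR) (simp add: algebra_simps)
  then show ?thesis using dual_basis[of v] by simp
qed

lemma cone_edge_notin_D: "cone (1, t) \<notin> D"
  by (simp add: mem_D bary_cone)

lemma continuous_cone: "continuous_on S cone"
  unfolding cone_def[abs_def] by (intro continuous_intros)

text \<open>Integration by parts along a ray. The boundary terms vanish: the factor \<open>s^2\<close> at the
  vertex, and \<open>\<psi>\<close> on the edge.\<close>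

lemma radial_parts:
  assumes t: "test_fun D \<psi>"
  shows "(LINT s|lborel. indicator {0<..<1} s * (s^2 * (ray \<tau> \<bullet> grad \<psi> (cone (s, \<tau>)))))
    = - 2 * (LINT s|lborel. indicator {0<..<1} s * (s * \<psi> (cone (s, \<tau>))))"
proof -
  note sm = test_funD(1)[OF t]
  have cc: "continuous_on UNIV (%s. cone (s, \<tau>))"
    by (rule continuous_on_compose2[OF continuous_cone[of UNIV]]) (auto intro!: continuous_intros)
  have c1: "continuous_on UNIV (%s. grad \<psi> (cone (s, \<tau>)))" "continuous_on UNIV (%s. \<psi> (cone (s, \<tau>)))"
    by (rule continuous_on_compose2[OF continuous_grad[OF sm, of UNIV] cc] continuous_on_compose2[OF smooth_continuous[OF sm, of UNIV] cc]; simp)+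
  let ?X = "%s. s^2 * (ray \<tau> \<bullet> grad \<psi> (cone (s, \<tau>)))" and ?Y = "%s. 2 * (s * \<psi> (cone (s, \<tau>)))"
  have c2: "continuous_on UNIV ?X" "continuous_on UNIV ?Y" by (intro continuous_intros c1)+
  have d: "((%s. s^2 * \<psi> (cone (s, \<tau>))) has_vector_derivative ?Y s + ?X s) (at s within {0..1})" for s
  proof -
    have 1: "((%s. cone (s, \<tau>)) has_derivative (%h. h *\<^sub>R ray \<tau>)) (at s)"
      unfolding cone_ray by (auto intro!: derivative_eq_intros)
    have "((%s. \<psi> (cone (s, \<tau>))) has_derivative (%h. frechet_derivative \<psi> (at (cone (s, \<tau>))) (h *\<^sub>R ray \<tau>))) (at s)"
      by (rule has_derivative_compose[OF 1 smooth_has_derivative[OF sm]])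
    then have 2: "((%s. \<psi> (cone (s, \<tau>))) has_real_derivative (ray \<tau> \<bullet> grad \<psi> (cone (s, \<tau>)))) (at s)"
      unfolding derivative_inner_grad[OF sm] has_field_derivative_def by (simp add: mult.commute[of _ "_ \<bullet> _"])
    have "((%s. s^2 * \<psi> (cone (s, \<tau>))) has_real_derivative ?Y s + ?X s) (at s)"
      by (auto intro!: derivative_eq_intros 2)
    then show ?thesis
      by (rule has_vector_derivative_at_within[OF has_real_derivative_iff_has_vector_derivative[THEN iffD1]])
  qed
  have z: "\<psi> (cone (1, \<tau>)) = 0" "grad \<psi> (cone (1, \<tau>)) = 0"
    using test_funD(3)[OF t cone_edge_notin_D] grad_zero_outside[OF t cone_edge_notin_D] by auto
  have "has_bochner_integral lborel (%s. indicator {0..1} s *\<^sub>R (?Y s + ?X s)) (1^2 * \<psi> (cone (1, \<tau>)) - 0^2 * \<psi> (cone (0, \<tau>)))"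
    by (rule has_bochner_integral_FTC_Icc) (use d in "auto intro!: continuous_on_add continuous_on_subset[OF c2(1)] continuous_on_subset[OF c2(2)]")
  then have i0: "(LINT s|lborel. indicator {0..1} s *\<^sub>R (?Y s + ?X s)) = 0"
    using z by (simp add: has_bochner_integral_integral_eq)
  have e: "indicator {0<..<1} s * ?X s = indicator {0..1} s *\<^sub>R ?X s" "indicator {0<..<1} s * ?Y s = indicator {0..1} s *\<^sub>R ?Y s" for s
    using z by (cases "s = 0 \<or> s = 1"; auto simp: indicator_def)+
  have i: "integrable lborel (%s. indicator {0..1} s *\<^sub>R ?X s)" "integrable lborel (%s. indicator {0..1} s *\<^sub>R ?Y s)"
    by (rule borel_integrable_compact[OF compact_Icc continuous_on_subset[OF c2(1) subset_UNIV]]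
      borel_integrable_compact[OF compact_Icc continuous_on_subset[OF c2(2) subset_UNIV]])+
  have "(LINT s|lborel. indicator {0..1} s *\<^sub>R ?Y s) + (LINT s|lborel. indicator {0..1} s *\<^sub>R ?X s) = 0"
    unfolding lintegral_add[OF i(2,1), symmetric] using i0 by (simp add: distrib_left)
  then have "(LINT s|lborel. indicator {0<..<1} s * ?X s) = - (LINT s|lborel. indicator {0<..<1} s * ?Y s)"
    unfolding e by linarith
  also have "(LINT s|lborel. indicator {0<..<1} s * ?Y s) = 2 * (LINT s|lborel. indicator {0<..<1} s * (s * \<psi> (cone (s, \<tau>))))"
    unfolding integral_mult_right_zero[symmetric] by (rule lintegral_cong) simp
  finally show ?thesis by simp
qed

text \<open>Integration by parts along a segment parallel to the edge, on which \<open>\<psi>\<close> times an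
  affine function of \<open>\<tau>\<close> is a test function of one variable.\<close>

lemma angular_parts:
  assumes t: "test_fun D \<psi>" and s: "0 < s" "s < 1" and fg: "H10_pair f g"
  shows "(LINT \<tau>|lborel. f \<tau> * ((k + \<tau> * l) * (s * ((b - a) \<bullet> grad \<psi> (cone (s, \<tau>))))))
    = - (LINT \<tau>|lborel. g \<tau> * ((k + \<tau> * l) * \<psi> (cone (s, \<tau>)))) - l * (LINT \<tau>|lborel. f \<tau> * \<psi> (cone (s, \<tau>)))"
proof -
  note sm = test_funD(1)[OF t] and F = H10_pairD[OF fg]
  have cc: "continuous_on UNIV (%\<tau>. cone (s, \<tau>))"
    by (rule continuous_on_compose2[OF continuous_cone[of UNIV]]) (auto intro!: continuous_intros)
  have c1: "continuous_on UNIV (%\<tau>. grad \<psi> (cone (s, \<tau>)))" "continuous_on UNIV (%\<tau>. \<psi> (cone (s, \<tau>)))"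
    by (rule continuous_on_compose2[OF continuous_grad[OF sm, of UNIV] cc] continuous_on_compose2[OF smooth_continuous[OF sm, of UNIV] cc]; simp)+
  define \<eta> where "\<eta> \<tau> = (k + \<tau> * l) * \<psi> (cone (s, \<tau>))" for \<tau>
  have cn: "cone (s, \<tau>) = (c + s *\<^sub>R (a - c)) + \<tau> *\<^sub>R (s *\<^sub>R (b - a))" for \<tau>
    by (simp add: cone_ray ray_def algebra_simps)
  have "linear (%\<tau>::real. \<tau> *\<^sub>R (s *\<^sub>R (b - a)))" by (rule linearI) (simp_all add: algebra_simps)
  from smooth_affine[OF this sm, of "c + s *\<^sub>R (a - c)"] have sc: "smooth (%\<tau>. \<psi> (cone (s, \<tau>)))" by (simp only: cn)
  have "smooth (%\<tau>::real. k + (\<tau> \<bullet> 1) * l)" by (intro smooth_intros)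
  then have sl: "smooth (%\<tau>::real. k + \<tau> * l)" by simp
  have se: "smooth \<eta>" unfolding \<eta>_def[abs_def] by (rule smooth_intros(4)[OF sl sc])
  have pe: "partial 1 \<eta> \<tau> = l * \<psi> (cone (s, \<tau>)) + (k + \<tau> * l) * (s * ((b - a) \<bullet> grad \<psi> (cone (s, \<tau>))))" for \<tau>
  proof -
    have 1: "((%\<tau>. cone (s, \<tau>)) has_derivative (%h. h *\<^sub>R (s *\<^sub>R (b - a)))) (at \<tau>)"
      unfolding cn by (auto intro!: derivative_eq_intros)
    have 2: "((%\<tau>. \<psi> (cone (s, \<tau>))) has_derivative (%h. frechet_derivative \<psi> (at (cone (s, \<tau>))) (h *\<^sub>R (s *\<^sub>R (b - a))))) (at \<tau>)"
      by (rule has_derivative_compose[OF 1 smooth_has_derivative[OF sm]])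
    have "((%\<tau>. k + \<tau> * l) has_derivative (%h. h * l)) (at \<tau>)" by (auto intro!: derivative_eq_intros)
    from partial_eqI[OF has_derivative_mult[OF this 2], of 1] show ?thesis
      unfolding \<eta>_def[abs_def] derivative_inner_grad[OF sm] by simp
  qed
  have te: "test_fun {0<..<1} \<eta>"
  proof (rule test_funI[OF se])
    let ?K = "closure {x. \<psi> x \<noteq> 0}"
    have K: "compact ?K" "?K \<subseteq> D" using t by (simp_all add: test_fun_def)
    have sub: "{\<tau>. cone (s, \<tau>) \<in> ?K} \<subseteq> {0<..<1}"
    proof
      fix \<tau> assume "\<tau> \<in> {\<tau>. cone (s, \<tau>) \<in> ?K}"
      then have "0 < s * (1 - \<tau>)" "0 < s * \<tau>" using K(2) by (auto simp: mem_D bary_cone subset_iff)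
      then show "\<tau> \<in> {0<..<1}" using s by (simp add: zero_less_mult_iff)
    qed
    have "closed {\<tau>. cone (s, \<tau>) \<in> ?K}"
      using continuous_closed_vimage[of ?K "%\<tau>. cone (s, \<tau>)"] cc by (simp add: vimage_def continuous_on_eq_continuous_at)
    moreover have "bounded {\<tau>. cone (s, \<tau>) \<in> ?K}" by (rule bounded_subset[OF _ sub]) simp
    ultimately show "compact {\<tau>. cone (s, \<tau>) \<in> ?K}" by (simp add: compact_eq_bounded_closed)
    show "{\<tau>. cone (s, \<tau>) \<in> ?K} \<subseteq> {0<..<1}" by (rule sub)
    show "\<eta> \<tau> = 0" if "\<tau> \<notin> {\<tau>. cone (s, \<tau>) \<in> ?K}" for \<tau>
    proof -
      have "cone (s, \<tau>) \<notin> ?K" using that by blast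
      from test_funD(5)[OF t this] show ?thesis unfolding \<eta>_def by simp
    qed
  qed
  have f0: "f \<tau> = 0" if "\<tau> \<notin> cball 0 1" for \<tau> using that by (intro F(2)) auto
  have i: "integrable lborel (%\<tau>. f \<tau> * h \<tau>)" if "continuous_on UNIV h" for h
    by (rule continuous_integrable_lborel[of _ 1, OF continuous_on_mult[OF F(1) that]]) (drule f0, simp)
  let ?Y = "%\<tau>. (k + \<tau> * l) * (s * ((b - a) \<bullet> grad \<psi> (cone (s, \<tau>))))"
  have cY: "continuous_on UNIV ?Y" by (intro continuous_intros c1)
  have "- (LINT \<tau>|lborel. g \<tau> * \<eta> \<tau>) = (LINT \<tau>|lborel. f \<tau> * partial 1 \<eta> \<tau>)" using F(6)[OF te] by simp
  also have "... = (LINT \<tau>|lborel. l * (f \<tau> * \<psi> (cone (s, \<tau>))) + f \<tau> * ?Y \<tau>)"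
    unfolding pe by (rule lintegral_cong) (simp add: algebra_simps)
  also have "... = (LINT \<tau>|lborel. l * (f \<tau> * \<psi> (cone (s, \<tau>)))) + (LINT \<tau>|lborel. f \<tau> * ?Y \<tau>)"
    by (rule lintegral_add[OF integrable_mult_right[OF i[OF c1(2)]] i[OF cY]])
  finally show ?thesis unfolding \<eta>_def by simp
qed

definition cone_ext :: "(real => real) => plane => real" where
  "cone_ext f x = (1 - bary a b c x) * f (bary c a b x / (1 - bary a b c x))"

text \<open>The gradient of the conical extension. On a ray it is constant, as the extension is homogeneous of
  degree one.\<close>

definition cone_grad :: "(real => real) => (real => real) => plane => plane" where
  "cone_grad f g x = (let \<tau> = bary c a b x / (1 - bary a b c x) in
     g \<tau> *\<^sub>R (\<beta> + \<tau> *\<^sub>R \<gamma>) - f \<tau> *\<^sub>R \<gamma>)"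

lemma cone_ext_cone: "s \<noteq> 0 ==> cone_ext f (cone (s, \<tau>)) = s * f \<tau>"
  by (simp add: cone_ext_def bary_cone)

lemma cone_grad_cone: "s \<noteq> 0 ==> cone_grad f g (cone (s, \<tau>)) = g \<tau> *\<^sub>R (\<beta> + \<tau> *\<^sub>R \<gamma>) - f \<tau> *\<^sub>R \<gamma>"
  by (simp add: cone_grad_def bary_cone)

lemma borel_bary[measurable]: "bary p q r \<in> borel_measurable borel"
  by (rule borel_measurable_continuous_onI[OF continuous_bary])

lemma cone_ext_borel:
  assumes "H10_pair f g"
  shows "cone_ext f \<in> borel_measurable borel" "cone_grad f g \<in> borel_measurable borel"
proof -
  note [measurable] = H10_pairD(3,7)[OF assms]
  show "cone_ext f \<in> borel_measurable borel" unfolding cone_ext_def[abs_def] by measurable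
  show "cone_grad f g \<in> borel_measurable borel" unfolding cone_grad_def[abs_def] Let_def by measurable
qed

text \<open>In cone coordinates the derivative of \<open>\<psi>\<close> in a fixed direction is a combination of
  the derivatives with respect to \<open>s\<close> and \<open>\<tau>\<close>. The first is integrated
  by parts on the rays, the second on the segments, with Fubini's theorem in both orders.\<close>

lemma cone_ext_parts:
  assumes t: "test_fun D \<psi>" and fg: "H10_pair f g" and i: "i \<in> Basis"
  shows "(LINT x|lebesgue_on D. cone_ext f x * partial i \<psi> x) = - (LINT x|lebesgue_on D. (cone_grad f g x \<bullet> i) * \<psi> x)"
proof -
  note sm = test_funD(1)[OF t] and F = H10_pairD[OF fg]
  let ?I = "indicator {0<..<1} :: real => real"
  have cp: "continuous_on UNIV (%p. grad \<psi> (cone p))" "continuous_on UNIV (%p. \<psi> (cone p))"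
    by (rule continuous_on_compose2[OF continuous_grad[OF sm, of UNIV] continuous_cone] continuous_on_compose2[OF smooth_continuous[OF sm, of UNIV] continuous_cone]; simp)+
  have rc: "continuous_on UNIV (%p::real \<times> real. ray (snd p))" unfolding ray_def by (intro continuous_intros)
  define k l where "k = i \<bullet> \<beta>" and "l = i \<bullet> \<gamma>"
  (* radial and angular parts before (A, B) and after (C, E) integration by parts *)
  define A where "A p = ?I (fst p) * (f (snd p) * ((fst p)^2 * (ray (snd p) \<bullet> grad \<psi> (cone p))))" for p
  define B where "B p = ?I (fst p) * (f (snd p) * (fst p * ((k + snd p * l) * (fst p * ((b - a) \<bullet> grad \<psi> (cone p))))))" for p
  define C where "C p = ?I (fst p) * (f (snd p) * (fst p * \<psi> (cone p)))" for p
  define E where "E p = ?I (fst p) * (g (snd p) * (fst p * ((k + snd p * l) * \<psi> (cone p))))" for p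
  have Ai: "integrable lborel A" unfolding A_def
    by (rule strip_integrable[OF F(8) F(2)]) (assumption, intro continuous_intros cp rc)
  have Bi: "integrable lborel B" unfolding B_def
    by (rule strip_integrable[OF F(8) F(2)]) (assumption, intro continuous_intros cp)
  have Ci: "integrable lborel C" unfolding C_def
    by (rule strip_integrable[OF F(8) F(2)]) (assumption, intro continuous_intros cp)
  have Ei: "integrable lborel E" unfolding E_def
    by (rule strip_integrable[OF F(9) F(4)]) (assumption, intro continuous_intros cp)
  have f0: "f \<tau> = 0" if "\<tau> \<notin> cball 0 1" for \<tau> using that by (intro F(2)) auto
  have fQ: "indicator Q p * f (snd p) = ?I (fst p) * f (snd p)" "indicator Q p * g (snd p) = ?I (fst p) * g (snd p)" for p
    using F(2,4)[of "snd p"] by (cases p; auto simp: Q_def indicator_def)+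
  have vec: "i \<bullet> w = - l * (ray \<tau> \<bullet> w) + (k + \<tau> * l) * ((b - a) \<bullet> w)" for w \<tau>
    using arg_cong[OF ray_combination[of i \<tau>], of "%v. v \<bullet> w"]
    unfolding inner_add_left inner_scaleR_left k_def l_def .
  have psi_b: "\<psi> \<in> borel_measurable borel" "partial i \<psi> \<in> borel_measurable borel"
    by (rule borel_measurable_continuous_onI[OF smooth_continuous[OF sm]]
      borel_measurable_continuous_onI[OF smooth_continuous[OF smooth_partial[OF sm i]]])+
  note [measurable] = psi_b cone_ext_borel[OF fg]
  have "(LINT x|lebesgue_on D. cone_ext f x * partial i \<psi> x) = (LINT p|lborel. wt p * (cone_ext f (cone p) * partial i \<psi> (cone p)))"
    by (rule cone_integral(1)) measurable
  also have "... = (LINT p|lborel. \<bar>J\<bar> * ((- l) * A p + B p))"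
  proof (rule lintegral_cong)
    fix p :: "real \<times> real"
    obtain s \<tau> where p: "p = (s, \<tau>)" by (cases p)
    have pi: "partial i \<psi> (cone p) = i \<bullet> grad \<psi> (cone p)" by (rule derivative_inner_grad[OF sm])
    show "wt p * (cone_ext f (cone p) * partial i \<psi> (cone p)) = \<bar>J\<bar> * ((- l) * A p + B p)"
    proof (cases "s = 0")
      case True
      then show ?thesis by (simp add: wt_def A_def B_def p)
    next
      case False
      have "wt p * (cone_ext f (cone p) * partial i \<psi> (cone p)) = \<bar>J\<bar> * (s * (s * ((indicator Q p * f \<tau>) * (i \<bullet> grad \<psi> (cone p)))))"
        unfolding pi using False by (simp add: wt_def cone_ext_cone p)
      also have "indicator Q p * f \<tau> = ?I s * f \<tau>" using fQ(1)[of p] p by simp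
      also have "i \<bullet> grad \<psi> (cone p) = - l * (ray \<tau> \<bullet> grad \<psi> (cone p)) + (k + \<tau> * l) * ((b - a) \<bullet> grad \<psi> (cone p))" by (rule vec)
      finally show ?thesis
        by (simp only: A_def B_def p fst_conv snd_conv) (simp add: algebra_simps power2_eq_square)
    qed
  qed
  also have "... = \<bar>J\<bar> * ((- l) * integral\<^sup>L lborel A + integral\<^sup>L lborel B)"
    unfolding integral_mult_right_zero lintegral_add[OF integrable_mult_right[OF Ai] Bi] ..
  also have "integral\<^sup>L lborel A = - 2 * integral\<^sup>L lborel C"
  proof -
    have "integral\<^sup>L lborel A = (LINT \<tau>|lborel. (LINT s|lborel. A (s, \<tau>)))" by (rule iterated_integrals(2)[OF Ai])
    also have "... = (LINT \<tau>|lborel. - 2 * (LINT s|lborel. C (s, \<tau>)))"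
    proof (rule lintegral_cong)
      fix \<tau> :: real
      have "(LINT s|lborel. A (s, \<tau>)) = (LINT s|lborel. f \<tau> * (?I s * (s^2 * (ray \<tau> \<bullet> grad \<psi> (cone (s, \<tau>))))))"
        by (rule lintegral_cong) (simp add: A_def)
      also have "... = f \<tau> * (- 2 * (LINT s|lborel. ?I s * (s * \<psi> (cone (s, \<tau>)))))"
        unfolding integral_mult_right_zero radial_parts[OF t] ..
      also have "... = - 2 * (LINT s|lborel. f \<tau> * (?I s * (s * \<psi> (cone (s, \<tau>)))))" by simp
      also have "(LINT s|lborel. f \<tau> * (?I s * (s * \<psi> (cone (s, \<tau>))))) = (LINT s|lborel. C (s, \<tau>))"
        by (rule lintegral_cong) (simp add: C_def)
      finally show "(LINT s|lborel. A (s, \<tau>)) = - 2 * (LINT s|lborel. C (s, \<tau>))" .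
    qed
    also have "... = - 2 * integral\<^sup>L lborel C" unfolding iterated_integrals(2)[OF Ci] by simp
    finally show ?thesis .
  qed
  also have "integral\<^sup>L lborel B = - integral\<^sup>L lborel E - l * integral\<^sup>L lborel C"
  proof -
    have "integral\<^sup>L lborel B = (LINT s|lborel. (LINT \<tau>|lborel. B (s, \<tau>)))" by (rule iterated_integrals(1)[OF Bi])
    also have "... = (LINT s|lborel. (LINT \<tau>|lborel. - E (s, \<tau>) - l * C (s, \<tau>)))"
    proof (rule lintegral_cong)
      fix s :: real
      show "(LINT \<tau>|lborel. B (s, \<tau>)) = (LINT \<tau>|lborel. - E (s, \<tau>) - l * C (s, \<tau>))"
      proof (cases "0 < s \<and> s < 1")
        case False
        then show ?thesis by (simp add: B_def E_def C_def)
      next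
        case True
        then have s: "0 < s" "s < 1" by auto
        have cs: "continuous_on UNIV (%\<tau>. \<psi> (cone (s, \<tau>)))"
          by (rule continuous_on_compose2[OF cp(2)]) (auto intro!: continuous_intros)
        have fi: "integrable lborel (%\<tau>. f \<tau> * \<psi> (cone (s, \<tau>)))"
          by (rule continuous_integrable_lborel[of _ 1, OF continuous_on_mult[OF F(1) cs]]) (drule f0, simp)
        have gi: "integrable lborel (%\<tau>. g \<tau> * ((k + \<tau> * l) * \<psi> (cone (s, \<tau>))))"
        proof -
          let ?h = "%\<tau>. (k + \<tau> * l) * \<psi> (cone (s, \<tau>))"
          have hc: "continuous_on UNIV ?h" by (intro continuous_intros cs)
          have "bounded (?h ` {0..1})"
            by (intro compact_imp_bounded compact_continuous_image continuous_on_subset[OF hc]) auto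
          then obtain M where "\<forall>\<tau>\<in>{0..1}. \<bar>?h \<tau>\<bar> \<le> M" unfolding bounded_iff by auto
          then have M: "\<bar>?h \<tau>\<bar> \<le> M" if "\<tau> \<in> {0..1}" for \<tau> using that by blast
          show ?thesis
          proof (rule lintegrable_bound[OF integrable_mult_right[OF F(9), of M]])
            show "(%\<tau>. g \<tau> * ?h \<tau>) \<in> borel_measurable lborel"
              using F(3) borel_measurable_continuous_onI[OF hc] by simp
            have "norm (g \<tau> * ?h \<tau>) \<le> norm (M * g \<tau>)" for \<tau>
            proof (cases "\<tau> \<in> {0<..<1}")
              case True
              then have "\<bar>?h \<tau>\<bar> \<le> \<bar>M\<bar>" using M[of \<tau>] by force
              then have "\<bar>g \<tau>\<bar> * \<bar>?h \<tau>\<bar> \<le> \<bar>g \<tau>\<bar> * \<bar>M\<bar>" by (rule mult_left_mono) simp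
              then show ?thesis by (simp only: real_norm_def abs_mult[symmetric] mult.commute)
            qed (simp add: F(4))
            then show "AE \<tau> in lborel. norm (g \<tau> * ?h \<tau>) \<le> norm (M * g \<tau>)" by simp
          qed
        qed
        have "(LINT \<tau>|lborel. B (s, \<tau>)) = (LINT \<tau>|lborel. s * (f \<tau> * ((k + \<tau> * l) * (s * ((b - a) \<bullet> grad \<psi> (cone (s, \<tau>)))))))"
          by (rule lintegral_cong) (use s in "simp add: B_def")
        also have "... = s * (- (LINT \<tau>|lborel. g \<tau> * ((k + \<tau> * l) * \<psi> (cone (s, \<tau>)))) - l * (LINT \<tau>|lborel. f \<tau> * \<psi> (cone (s, \<tau>))))"
          unfolding integral_mult_right_zero angular_parts[OF t s fg] ..
        also have "... = (LINT \<tau>|lborel. (- s) * (g \<tau> * ((k + \<tau> * l) * \<psi> (cone (s, \<tau>))))) - (LINT \<tau>|lborel. (s * l) * (f \<tau> * \<psi> (cone (s, \<tau>))))"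
          unfolding integral_mult_right_zero by (simp add: algebra_simps)
        also have "... = (LINT \<tau>|lborel. (- s) * (g \<tau> * ((k + \<tau> * l) * \<psi> (cone (s, \<tau>)))) - (s * l) * (f \<tau> * \<psi> (cone (s, \<tau>))))"
          by (rule lintegral_diff[OF integrable_mult_right[OF gi] integrable_mult_right[OF fi], symmetric])
        also have "... = (LINT \<tau>|lborel. - E (s, \<tau>) - l * C (s, \<tau>))"
          by (rule lintegral_cong) (use s in "simp add: E_def C_def")
        finally show ?thesis .
      qed
    qed
    also have "... = (LINT p|lborel. - E p - l * C p)"
      by (rule iterated_integrals(1)[symmetric]) (intro Bochner_Integration.integrable_diff integrable_minus integrable_mult_right Ei Ci)
    also have "... = - integral\<^sup>L lborel E - l * integral\<^sup>L lborel C"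
      by (simp add: lintegral_diff[OF Bochner_Integration.integrable_minus[OF Ei] integrable_mult_right[OF Ci]])
    finally show ?thesis .
  qed
  finally have lhs: "(LINT x|lebesgue_on D. cone_ext f x * partial i \<psi> x) = \<bar>J\<bar> * (l * integral\<^sup>L lborel C - integral\<^sup>L lborel E)"
    by (simp add: algebra_simps)
  have "(LINT x|lebesgue_on D. (cone_grad f g x \<bullet> i) * \<psi> x) = (LINT p|lborel. wt p * ((cone_grad f g (cone p) \<bullet> i) * \<psi> (cone p)))"
    by (rule cone_integral(1)) measurable
  also have "... = (LINT p|lborel. \<bar>J\<bar> * (E p - l * C p))"
  proof (rule lintegral_cong)
    fix p :: "real \<times> real"
    obtain s \<tau> where p: "p = (s, \<tau>)" by (cases p)
    show "wt p * ((cone_grad f g (cone p) \<bullet> i) * \<psi> (cone p)) = \<bar>J\<bar> * (E p - l * C p)"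
    proof (cases "s = 0")
      case True
      then show ?thesis by (simp add: wt_def E_def C_def p)
    next
      case False
      have "cone_grad f g (cone p) \<bullet> i = g \<tau> * (k + \<tau> * l) - f \<tau> * l"
        using False unfolding inner_commute[of _ i] by (simp add: cone_grad_cone p inner_diff_right inner_add_right k_def l_def)
      then have "wt p * ((cone_grad f g (cone p) \<bullet> i) * \<psi> (cone p))
        = \<bar>J\<bar> * (s * (((indicator Q p * g \<tau>) * (k + \<tau> * l) - (indicator Q p * f \<tau>) * l) * \<psi> (cone p)))"
        by (simp only: wt_def p fst_conv snd_conv) (simp add: algebra_simps)
      also have "indicator Q p * g \<tau> = ?I s * g \<tau>" using fQ(2)[of p] p by simp
      also have "indicator Q p * f \<tau> = ?I s * f \<tau>" using fQ(1)[of p] p by simp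
      finally show ?thesis by (simp only: E_def C_def p fst_conv snd_conv) (simp add: algebra_simps)
    qed
  qed
  also have "... = \<bar>J\<bar> * (integral\<^sup>L lborel E - l * integral\<^sup>L lborel C)"
    by (simp add: lintegral_diff[OF Ei integrable_mult_right[OF Ci]])
  finally show ?thesis unfolding lhs by (simp add: algebra_simps)
qed

text \<open>The integrands are at most a function of \<open>\<tau>\<close> alone, and the area element is at
  most \<open>\<bar>J\<bar> ds d\<tau>\<close>.\<close>

lemma cone_ext_bounds:
  assumes fg: "H10_pair f g" and K: "norm \<beta> \<le> K" "norm \<gamma> \<le> K"
  defines "E \<equiv> LINT t|lborel. (g t)^2"
  shows "L2_on D (cone_ext f)" "(L2_norm D (cone_ext f))^2 \<le> \<bar>J\<bar> * E"
    "L2_on D (cone_grad f g)" "(L2_norm D (cone_grad f g))^2 \<le> 10 * \<bar>J\<bar> * K^2 * E"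
proof -
  note F = H10_pairD[OF fg]
  note [measurable] = cone_ext_borel[OF fg]
  let ?I = "indicator {0<..<1} :: real => real"
  have E0: "0 \<le> E" by (simp add: E_def)
  have ii: "integrable lborel ?I" by simp
  have II: "integral\<^sup>L lborel ?I = 1" by simp
  have lb: "h \<in> borel_measurable (lebesgue_on D)" if "h \<in> borel_measurable borel" for h :: "plane => 'z::euclidean_space"
    using that by (intro measurable_restrict_space1 measurable_completion) simp
  have bound: "integrable (lebesgue_on D) h" "(LINT x|lebesgue_on D. h x) \<le> \<bar>J\<bar> * integral\<^sup>L lborel m"
    if h[measurable]: "h \<in> borel_measurable borel" and m: "integrable lborel m" "!!t. 0 \<le> m t"
      and le: "!!s \<tau>. 0 < s ==> s < 1 ==> 0 < \<tau> ==> \<tau> < 1 ==> h (cone (s, \<tau>)) \<le> m \<tau>"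
      and h0: "!!x. 0 \<le> h x"
    for h and m :: "real => real"
  proof -
    have pi: "integrable lborel (%p. \<bar>J\<bar> * (?I (fst p) * m (snd p)))"
      by (intro integrable_mult_right lborel_product_integral(1)[OF ii m(1)])
    have le': "wt p * h (cone p) \<le> \<bar>J\<bar> * (?I (fst p) * m (snd p))" for p
    proof -
      obtain s \<tau> where p: "p = (s, \<tau>)" by (cases p)
      show ?thesis
      proof (cases "p \<in> Q")
        case True
        then have s: "0 < s" "s < 1" "0 < \<tau>" "\<tau> < 1" by (auto simp: Q_def p)
        have "s * h (cone p) \<le> 1 * m \<tau>" unfolding p by (rule mult_mono) (use le[OF s] s h0 in auto)
        then have "\<bar>J\<bar> * (s * h (cone p)) \<le> \<bar>J\<bar> * (1 * m \<tau>)" by (rule mult_left_mono) simp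
        then show ?thesis using True s by (simp add: wt_def p)
      next
        case False
        then show ?thesis using m(2) by (simp add: wt_def)
      qed
    qed
    have w0: "0 \<le> wt p * h (cone p)" for p by (intro mult_nonneg_nonneg wt_nonneg h0)
    have wi: "integrable lborel (%p. wt p * h (cone p))"
    proof (rule lintegrable_bound[OF pi])
      show "(%p. wt p * h (cone p)) \<in> borel_measurable lborel" by measurable
      have "norm (wt p * h (cone p)) \<le> norm (\<bar>J\<bar> * (?I (fst p) * m (snd p)))" for p
        using le'[of p] w0[of p] unfolding real_norm_def by linarith
      then show "AE p in lborel. norm (wt p * h (cone p)) \<le> norm (\<bar>J\<bar> * (?I (fst p) * m (snd p)))" by simp
    qed
    then show "integrable (lebesgue_on D) h" using cone_integral(2)[OF h] by blast
    have "(LINT x|lebesgue_on D. h x) = (LINT p|lborel. wt p * h (cone p))" by (rule cone_integral(1)[OF h])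
    also have "... \<le> (LINT p|lborel. \<bar>J\<bar> * (?I (fst p) * m (snd p)))" by (rule integral_mono[OF wi pi le'])
    also have "... = \<bar>J\<bar> * integral\<^sup>L lborel m"
      using lborel_product_integral(2)[OF ii m(1)] by (simp add: II)
    finally show "(LINT x|lebesgue_on D. h x) \<le> \<bar>J\<bar> * integral\<^sup>L lborel m" .
  qed
  have b1: "(norm (cone_ext f (cone (s, \<tau>))))^2 \<le> E * ?I \<tau>" if s: "0 < s" "s < 1" "0 < \<tau>" "\<tau> < 1" for s \<tau>
  proof -
    have "s^2 * (f \<tau>)^2 \<le> 1 * E" unfolding E_def
      by (rule mult_mono[OF _ F(10)]) (use s in "auto simp: power_le_one")
    then show ?thesis using s by (simp add: cone_ext_cone power_mult_distrib)
  qed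
  have m1: "integrable lborel (%\<tau>. E * ?I \<tau>)" by (intro integrable_mult_right ii)
  have h1: "(%x. (norm (cone_ext f x))^2) \<in> borel_measurable borel" by measurable
  note B1 = bound[OF h1 m1 _ b1 zero_le_power2]
  show "L2_on D (cone_ext f)" unfolding L2_on_def using lb[OF cone_ext_borel(1)[OF fg]] B1(1) E0 by simp
  show "(L2_norm D (cone_ext f))^2 \<le> \<bar>J\<bar> * E"
    unfolding L2_norm_square_integral using B1(2) E0 II by simp
  have K0: "0 \<le> K" using K(1) norm_ge_zero order_trans by blast
  have b2: "(norm (cone_grad f g (cone (s, \<tau>))))^2 \<le> 8 * K^2 * (g \<tau>)^2 + 2 * K^2 * E * ?I \<tau>" if s: "0 < s" "s < 1" "0 < \<tau>" "\<tau> < 1" for s \<tau>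
  proof -
    have n1: "norm (\<beta> + \<tau> *\<^sub>R \<gamma>) \<le> 2 * K"
    proof -
      have "norm (\<tau> *\<^sub>R \<gamma>) \<le> 1 * K" using s K(2) by (simp only: norm_scaleR) (intro mult_mono, auto)
      then show ?thesis using norm_triangle_ineq[of \<beta> "\<tau> *\<^sub>R \<gamma>"] K(1) by linarith
    qed
    have "(norm (cone_grad f g (cone (s, \<tau>))))^2 = (norm (g \<tau> *\<^sub>R (\<beta> + \<tau> *\<^sub>R \<gamma>) + (- 1) *\<^sub>R (f \<tau> *\<^sub>R \<gamma>)))^2"
      using s by (simp add: cone_grad_cone)
    also have "... \<le> 2 * (norm (g \<tau> *\<^sub>R (\<beta> + \<tau> *\<^sub>R \<gamma>)))^2 + 2 * (- 1)^2 * (norm (f \<tau> *\<^sub>R \<gamma>))^2"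
      by (rule norm_add_scale_square)
    also have "... = 2 * ((g \<tau>)^2 * (norm (\<beta> + \<tau> *\<^sub>R \<gamma>))^2) + 2 * ((f \<tau>)^2 * (norm \<gamma>)^2)"
      by (simp add: power_mult_distrib)
    also have "... \<le> 2 * ((g \<tau>)^2 * (2 * K)^2) + 2 * (E * K^2)"
    proof -
      have "(g \<tau>)^2 * (norm (\<beta> + \<tau> *\<^sub>R \<gamma>))^2 \<le> (g \<tau>)^2 * (2 * K)^2"
        by (intro mult_left_mono power_mono n1) auto
      moreover have "(f \<tau>)^2 * (norm \<gamma>)^2 \<le> E * K^2"
        by (rule mult_mono) (use F(10) E0 K(2) in "auto simp: E_def intro!: power_mono")
      ultimately show ?thesis by linarith
    qed
    finally show ?thesis using s by (simp add: power_mult_distrib algebra_simps)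
  qed
  have m2: "integrable lborel (%\<tau>. 8 * K^2 * (g \<tau>)^2 + 2 * K^2 * E * ?I \<tau>)"
    by (intro Bochner_Integration.integrable_add integrable_mult_right ii F(5))
  have h2: "(%x. (norm (cone_grad f g x))^2) \<in> borel_measurable borel" by measurable
  have m0: "0 \<le> 8 * K^2 * (g \<tau>)^2 + 2 * K^2 * E * ?I \<tau>" for \<tau> using E0 by simp
  note B2 = bound[OF h2 m2 m0 b2 zero_le_power2]
  show "L2_on D (cone_grad f g)" unfolding L2_on_def using lb[OF cone_ext_borel(2)[OF fg]] B2(1) by simp
  have "(LINT \<tau>|lborel. 8 * K^2 * (g \<tau>)^2 + 2 * K^2 * E * ?I \<tau>) = 8 * K^2 * E + 2 * K^2 * E * 1"
    unfolding lintegral_add[OF integrable_mult_right[OF F(5)] integrable_mult_right[OF ii]] integral_mult_right_zero II E_def ..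
  then show "(L2_norm D (cone_grad f g))^2 \<le> 10 * \<bar>J\<bar> * K^2 * E"
    unfolding L2_norm_square_integral using B2(2) by (simp add: algebra_simps)
qed

lemma cone_ext_H1_pair:
  assumes fg: "H10_pair f g"
  shows "H1_pair D (cone_ext f) (cone_grad f g)"
proof -
  have K: "norm \<beta> \<le> norm \<beta> + norm \<gamma>" "norm \<gamma> \<le> norm \<beta> + norm \<gamma>" by simp_all
  note L = cone_ext_bounds(1,3)[OF fg K]
  have Dl: "D \<in> sets lebesgue" using D_open by (intro sets_completionI_sets) (simp add: borel_open)
  show ?thesis unfolding H1_pair_def has_weak_gradient_iff
    using L cone_ext_parts[OF _ fg] by (auto intro!: integrable_imp_locally_integrable[OF Dl] L2_bounded_integrable[OF D_open D_bounded])
qed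

text \<open>Away from \<open>c\<close> this is a composition; at \<open>c\<close> the factor \<open>s\<close>
  tends to zero and \<open>f\<close> is bounded.\<close>

lemma cone_ext_continuous:
  assumes fg: "H10_pair f g" shows "continuous_on T (cone_ext f)"
  unfolding continuous_on_eq_continuous_within
proof
  note F = H10_pairD[OF fg]
  fix x assume x: "x \<in> T"
  have cb: "continuous (at x within T) (bary p q r)" for p q r
    using continuous_bary[of T p q r] x by (simp add: continuous_on_eq_continuous_within)
  show "continuous (at x within T) (cone_ext f)"
  proof (cases "bary a b c x = 1")
    case False
    have 1: "continuous (at x within T) (%y. bary c a b y / (1 - bary a b c y))"
      by (intro continuous_intros cb) (use False in simp)
    have "isCont f (bary c a b x / (1 - bary a b c x))" using F(1) by (simp add: continuous_on_eq_continuous_at)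
    then have "continuous (at x within T) (%y. f (bary c a b y / (1 - bary a b c y)))"
      by (rule continuous_within_compose3[OF _ 1])
    then show ?thesis unfolding cone_ext_def[abs_def] by (intro continuous_intros cb)
  next
    case True
    define M where "M = sqrt (LINT t|lborel. (g t)^2)"
    have M: "\<bar>f t\<bar> \<le> M" for t using real_sqrt_le_mono[OF F(10)[of t]] by (simp add: M_def)
    have "((%y. (1 - bary a b c y) * M) \<longlongrightarrow> (1 - bary a b c x) * M) (at x within T)"
      by (intro tendsto_intros) (use cb[of a b c] in "simp add: continuous_within")
    then have l: "((%y. (1 - bary a b c y) * M) \<longlongrightarrow> 0) (at x within T)" using True by simp
    have "\<forall>\<^sub>F y in at x within T. norm (cone_ext f y) \<le> (1 - bary a b c y) * M"
      unfolding eventually_at_filter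
    proof (intro always_eventually allI impI)
      fix y assume "y \<in> T"
      then have "0 \<le> 1 - bary a b c y" using mem_T bary_sum[of y] by smt
      then show "norm (cone_ext f y) \<le> (1 - bary a b c y) * M"
        using M by (simp add: cone_ext_def abs_mult mult_left_mono)
    qed
    then have "(cone_ext f \<longlongrightarrow> 0) (at x within T)" by (rule Lim_null_comparison[OF _ l])
    moreover have "cone_ext f x = 0" using True by (simp add: cone_ext_def)
    ultimately show ?thesis by (simp add: continuous_within)
  qed
qed

lemma edge_mem:
  assumes "x \<in> closed_segment a b"
  obtains t where "0 \<le> t" "t \<le> 1" "x = cone (1, t)"
  using assms unfolding cone_1 by (auto simp: in_segment)

lemma cone_ext_boundary:
  assumes z: "\<phi> a = 0" "\<phi> b = 0"
  shows "x \<in> closed_segment a b ==> cone_ext (edge_fun a b \<phi>) x = \<phi> x"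
    "x \<in> frontier D ==> x \<notin> closed_segment a b ==> cone_ext (edge_fun a b \<phi>) x = 0"
proof -
  assume "x \<in> closed_segment a b"
  then obtain t where t: "0 \<le> t" "t \<le> 1" "x = cone (1, t)" by (rule edge_mem)
  have "cone_ext (edge_fun a b \<phi>) x = edge_fun a b \<phi> t" unfolding t(3) by (simp add: cone_ext_cone)
  also have "... = \<phi> x" using t by (simp add: edge_fun_def cone_1)
  finally show "cone_ext (edge_fun a b \<phi>) x = \<phi> x" .
next
  assume x: "x \<in> frontier D" and n: "x \<notin> closed_segment a b"
  have nn: "0 \<le> bary a b c x" "0 \<le> bary b c a x" "0 \<le> bary c a b x" using x by (auto simp: frontier_D mem_T)
  have "bary a b c x \<noteq> 0"
  proof
    assume 0: "bary a b c x = 0"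
    have s: "bary b c a x = 1 - bary c a b x" using bary_sum[of x] 0 by simp
    have "x = (1 - bary c a b x) *\<^sub>R a + bary c a b x *\<^sub>R b" using bary_representation[of x] 0 s by simp
    then have "x \<in> closed_segment a b" using nn s unfolding in_segment by (intro exI[of _ "bary c a b x"]) auto
    then show False using n by simp
  qed
  then have "bary b c a x = 0 \<or> bary c a b x = 0" using x nn by (auto simp: frontier_D mem_D)
  then show "cone_ext (edge_fun a b \<phi>) x = 0"
  proof
    assume "bary c a b x = 0"
    then show ?thesis using z by (simp add: cone_ext_def edge_fun_def)
  next
    assume "bary b c a x = 0"
    then have "bary c a b x = 1 - bary a b c x" using bary_sum[of x] by simp
    then show ?thesis using z by (cases "1 - bary a b c x = 0") (simp_all add: cone_ext_def edge_fun_def)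
  qed
qed

end

section \<open>The energy estimate\<close>

lemma L2_segment_norm_cong:
  assumes "!!x. x \<in> closed_segment p q ==> v x = w x"
  shows "L2_segment_norm p q v = L2_segment_norm p q w"
proof -
  have "(LINT s|lebesgue_on {0<..<dist p q}. v (arclength_param p q s) * v (arclength_param p q s))
    = (LINT s|lebesgue_on {0<..<dist p q}. w (arclength_param p q s) * w (arclength_param p q s))"
  proof (rule lintegral_cong)
    fix s assume "s \<in> space (lebesgue_on {0<..<dist p q})"
    then have s: "0 < s" "s < dist p q" by auto
    then have "p \<noteq> q" by auto
    then have "arclength_param p q s \<in> closed_segment p q" using arclength_param_segment[of p q s] s by simp
    then show "v (arclength_param p q s) * v (arclength_param p q s) = w (arclength_param p q s) * w (arclength_param p q s)"
      by (simp add: assms)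
  qed
  then show ?thesis by (simp add: L2_segment_norm_def L2_inner_real)
qed

lemma smooth_affine_fun: "smooth (%x. p \<bullet> x + k)"
  using smooth_intros(3)[OF smooth_intros(2) smooth_intros(1), of p k] by (simp only: inner_commute)

lemma grad_affine_fun: "grad (%x. p \<bullet> x + k) x = p"
proof -
  have "partial i (%x. p \<bullet> x + k) x = p \<bullet> i" for i
    by (rule partial_eqI[of _ "%h. p \<bullet> h"]) (auto intro!: derivative_eq_intros)
  then show ?thesis unfolding grad_def by (simp add: euclidean_representation)
qed

lemma cr_Lagrange: "(cr u v)^2 + (u \<bullet> v)^2 = (norm u)^2 * (norm v)^2"
  unfolding power2_norm_eq_inner plane_inner cr_def by (simp add: power2_eq_square algebra_simps)

lemma cr_bound: "\<bar>cr u v\<bar> \<le> norm u * norm v"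
proof (rule power2_le_imp_le)
  show "\<bar>cr u v\<bar>^2 \<le> (norm u * norm v)^2"
    using cr_Lagrange[of u v] zero_le_power2[of "u \<bullet> v"] unfolding power_mult_distrib power2_abs by linarith
qed simp

lemma norm_bary_grad: "norm (bary_grad p q r) = norm (q - p) / \<bar>cr (q - p) (r - p)\<bar>"
proof -
  have "norm (vector [- (q - p)$2, (q - p)$1] :: plane) = norm (q - p)"
    by (simp add: norm_eq_sqrt_inner plane_inner algebra_simps)
  then show ?thesis by (simp add: bary_grad_def)
qed

context triangle
begin

text \<open>Green's formula against a constant function.\<close>

lemma H1_zero_integral_gradient:
  assumes v: "H1_zero D v" "H1_pair D v G"
  shows "L2_inner D (%x. p) G = 0"
proof -
  have GL: "L2_on D G" using v(2) by (simp add: H1_pair_def)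
  have Gi: "integrable (lebesgue_on D) G" by (rule L2_bounded_integrable[OF D_open D_bounded GL])
  have "(LINT x|lebesgue_on D. G x) \<bullet> i = 0" if i: "i \<in> Basis" for i
  proof -
    have z: "partial i (%x::plane. 1::real) x = 0" for x
      by (rule partial_eqI[of _ "%h. 0"]) simp
    have "(LINT x|lebesgue_on D. G x \<bullet> i) = 0"
      using H1_zero_green[OF v smooth_intros(1)[of 1] i] by (simp add: z)
    moreover have "(LINT x|lebesgue_on D. G x \<bullet> i) = (LINT x|lebesgue_on D. G x) \<bullet> i"
      by (rule integral_inner_left) (rule Gi)
    ultimately show ?thesis by simp
  qed
  then have 0: "(LINT x|lebesgue_on D. G x) = 0"
    unfolding euclidean_eq_iff[of _ "0::plane"] inner_zero_left by blast
  have "L2_inner D (%x. p) G = p \<bullet> (LINT x|lebesgue_on D. G x)"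
    unfolding L2_inner_def by (rule integral_inner_right) (rule Gi)
  then show ?thesis unfolding 0 by simp
qed

text \<open>The difference \<open>y\<close> of \<open>u - v\<close> and \<open>w\<close> has zero trace. Its
  gradient is orthogonal to that of \<open>u\<close>, by harmonicity, and to constants, hence to that
  of \<open>u - v\<close>; so its norm is at most that of \<open>W\<close>.\<close>

lemma energy_comparison:
  assumes u: "harmonic_extension D \<Phi> u"
    and aff: "!!x. x \<in> T ==> v x = p \<bullet> x + k"
    and w: "H1_pair D w W" "continuous_on T w"
    and tr: "!!x. x \<in> frontier D ==> w x = \<Phi> x - v x"
  shows "H1_norm D (%x. u x - v x) \<le> 2 * (1 + diameter T) * L2_norm D W + L2_norm D w"
proof -
  have t: "has_trace D u \<Phi>" using u by (simp add: harmonic_extension_def)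
  define G where "G = weak_gradient D u"
  have G: "H1_pair D u G" unfolding G_def
    by (rule H1_imp_pair[OF D_open]) (use t in "simp add: has_trace_def")
  have "H1_pair D (%x. p \<bullet> x + k) (%x. p)"
    using H1_pair_smooth[OF D_open D_bounded smooth_affine_fun[of p k]] by (simp add: grad_affine_fun[abs_def])
  then have vP: "H1_pair D v (%x. p)"
    by (rule H1_pair_cong[OF D_open, rotated 2]) (use aff D_subset in auto)
  have vc: "continuous_on T v"
    using continuous_on_cong[of T T v "%x. p \<bullet> x + k"] aff by (simp add: continuous_intros)
  let ?z = "%x. u x - v x" and ?Z = "%x. G x - p"
  let ?y = "%x. (u x - v x) - w x" and ?Y = "%x. (G x - p) - W x"
  note zP = H1_pair_diff[OF D_open G vP]
  note yP = H1_pair_diff[OF D_open zP w(1)]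
  have Ls: "L2_on D G" "L2_on D ?Z" "L2_on D ?Y" "L2_on D W" "L2_on D ?y" "L2_on D w" "L2_on D (%x. p)"
    using G zP yP w(1) vP by (simp_all add: H1_pair_def)
  have y0: "H1_zero D ?y"
  proof -
    obtain f F where "trace_sequence D u G \<Phi> f F"
    by (rule has_traceE[OF D_open t G]) (rule that)
  note f = trace_sequenceD[OF this]
    note fP = H1_pair_diff[OF D_open H1_pair_diff[OF D_open f(2) vP] w(1)]
    show ?thesis unfolding H1_zero_def
    proof (rule has_traceI[OF D_open yP _ fP])
      show "L2_segment p q (%x. 0)" for p q by (rule L2_segment_const_0)
      show "continuous_on (closure D) (%x. (f n x - v x) - w x)" for n
        using f(1)[of n] vc w(2) unfolding closure_D by (intro continuous_on_diff)
      show "(%n. L2_norm D (%x. ((f n x - v x) - w x) - ((u x - v x) - w x))) ----> 0"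
        "(%n. L2_norm D (%x. ((F n x - p) - W x) - ((G x - p) - W x))) ----> 0" using f(3,4) by simp_all
      fix q r assume qr: "closed_segment q r \<subseteq> frontier D"
      have "L2_segment_norm q r (%x. (f n x - v x) - w x - 0) = L2_segment_norm q r (%x. f n x - \<Phi> x)" for n
        by (rule L2_segment_norm_cong) (use tr qr in auto)
      then show "(%n. L2_segment_norm q r (%x. (f n x - v x) - w x - 0)) ----> 0" using f(5)[OF qr] by simp
    qed
  qed
  have "dirichlet_form D u ?y = 0" using u y0 by (simp add: harmonic_extension_def)
  then have 1: "L2_inner D G ?Y = 0" using dirichlet_form_eq[OF D_open G yP] by simp
  have 2: "L2_inner D (%x. p) ?Y = 0" by (rule H1_zero_integral_gradient[OF y0 yP])
  have "L2_inner D (%x. G x + (-1) *\<^sub>R p) ?Y = L2_inner D G ?Y + (-1) * L2_inner D (%x. p) ?Y"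
    by (rule L2_inner_add_scale[OF Ls(1,7,3)])
  then have 3: "L2_inner D ?Z ?Y = 0" using 1 2 by simp
  have "L2_inner D (%x. ?Z x + (-1) *\<^sub>R W x) ?Y = L2_inner D ?Z ?Y + (-1) * L2_inner D W ?Y"
    by (rule L2_inner_add_scale[OF Ls(2,4,3)])
  (* orthogonality leaves only the contribution of W *)
  then have "L2_inner D ?Y ?Y = - L2_inner D W ?Y" using 3 by simp
  then have "(L2_norm D ?Y)^2 \<le> L2_norm D W * L2_norm D ?Y"
    using L2_Cauchy_Schwarz[OF Ls(4,3)] by (simp add: L2_norm_square)
  then have Yn: "L2_norm D ?Y \<le> L2_norm D W"
    using L2_norm_nonneg[of D ?Y] L2_norm_nonneg[of D W]
    by (cases "L2_norm D ?Y = 0") (simp_all add: power2_eq_square)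
  have dT: "0 \<le> diameter T" using diameter_T[OF vertex_in_T(1,1)] by simp
  have "L2_norm D ?y \<le> 2 * diameter T * L2_norm D ?Y" by (rule Poincare[OF y0 yP])
  also have "... \<le> 2 * diameter T * L2_norm D W" using Yn dT by (intro mult_left_mono) auto
  finally have yn: "L2_norm D ?y \<le> 2 * diameter T * L2_norm D W" .
  have "L2_norm D (%x. ?y x + 1 *\<^sub>R w x) \<le> L2_norm D ?y + \<bar>1\<bar> * L2_norm D w" by (rule L2_norm_triangle[OF Ls(5,6)])
  then have zn: "L2_norm D ?z \<le> 2 * diameter T * L2_norm D W + L2_norm D w" using yn by simp
  have "L2_norm D (%x. ?Y x + 1 *\<^sub>R W x) \<le> L2_norm D ?Y + \<bar>1\<bar> * L2_norm D W" by (rule L2_norm_triangle[OF Ls(3,4)])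
  then have Zn: "L2_norm D ?Z \<le> 2 * L2_norm D W" using Yn by simp
  have "H1_norm D ?z \<le> L2_norm D ?z + L2_norm D ?Z" by (rule H1_norm_bounds(3)[OF D_open zP])
  then show ?thesis using zn Zn by (simp add: algebra_simps)
qed

lemma diameter_positive: "0 < diameter T"
proof -
  have "0 < dist a b" using vertices_distinct by simp
  then show ?thesis using diameter_T[OF vertex_in_T(1,2)] by linarith
qed

text \<open>The gradients of the barycentric coordinates have norm at most \<open>h / \<bar>J\<bar>\<close>, so
  the squared norm of the gradient of the conical extension is of order \<open>h^2 /
  \<bar>J\<bar>\<close> times the squared norm of the scaled derivative on the edge; the latter
  contributes the factor \<open>h\<close>.\<close>

lemma energy_estimate:
  assumes u: "harmonic_extension D \<Phi> u"
    and aff: "!!x. x \<in> T ==> v x = p \<bullet> x + k"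
    and z: "!!x. x \<in> frontier D ==> x \<notin> closed_segment a b ==> \<Phi> x = v x" "\<Phi> a = v a" "\<Phi> b = v b"
    and c: "continuous_on (closed_segment a b) (%x. \<Phi> x - v x)"
    and h: "H1_segment a b (%x. \<Phi> x - v x)"
    and shape: "\<kappa> > 0" "\<kappa> * (diameter T)^2 \<le> \<bar>J\<bar>"
  shows "H1_norm D (%x. u x - v x) \<le>
    (2 * (1 + diameter T) * sqrt (10 / \<kappa>) + diameter T) * sqrt (diameter T) * H1_segment_seminorm a b (%x. \<Phi> x - v x)"
proof -
  define \<phi> where "\<phi> x = \<Phi> x - v x" for x
  have z': "\<phi> a = 0" "\<phi> b = 0" using z(2,3) by (simp_all add: \<phi>_def)
  define S where "S = H1_segment_seminorm a b \<phi>"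
  obtain g where g: "H10_pair (edge_fun a b \<phi>) g"
    "(LINT t|lborel. (g t)^2) = dist a b * (H1_segment_seminorm a b \<phi>)^2"
    by (rule edge_H10_pair[OF vertices_distinct(1) c[folded \<phi>_def] z' h[folded \<phi>_def]]) (rule that)
  have S0: "0 \<le> S"
  proof -
    have "H1_pair {0<..<dist a b} (\<phi> \<circ> arclength_param a b) (weak_gradient {0<..<dist a b} (\<phi> \<circ> arclength_param a b))"
      by (rule H1_imp_pair) (use h in "simp_all add: H1_segment_def \<phi>_def o_def")
    from dirichlet_form_eq[OF _ this this] show ?thesis
      unfolding S_def H1_segment_seminorm_def H1_seminorm_def by (simp add: L2_inner_nonneg)
  qed
  let ?h = "diameter T"
  have h0: "0 < ?h" by (rule diameter_positive)
  let ?w = "cone_ext (edge_fun a b \<phi>)" and ?W = "cone_grad (edge_fun a b \<phi>) g"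
  have side: "norm (a - c) \<le> ?h" "norm (b - c) \<le> ?h" "norm (b - a) \<le> ?h" "dist a b \<le> ?h"
    using diameter_T[OF vertex_in_T(1,3)] diameter_T[OF vertex_in_T(2,3)] diameter_T[OF vertex_in_T(2,1)] diameter_T[OF vertex_in_T(1,2)]
    by (simp_all add: dist_norm)
  have J0: "0 < \<bar>J\<bar>" using J_nonzero by simp
  have Jh: "\<bar>J\<bar> \<le> ?h * ?h"
    using cr_bound[of "a - c" "b - c"] mult_mono[OF side(1,2)] h0 by (simp add: J_def)
  have K: "norm \<beta> \<le> ?h / \<bar>J\<bar>" "norm \<gamma> \<le> ?h / \<bar>J\<bar>"
  proof -
    have "norm \<beta> = norm (a - c) / \<bar>J\<bar>" unfolding \<beta>_def norm_bary_grad J_def ..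
    then show "norm \<beta> \<le> ?h / \<bar>J\<bar>" using side J0 by (simp add: divide_right_mono)
    have "norm \<gamma> = norm (b - a) / \<bar>J\<bar>" unfolding \<gamma>_def norm_bary_grad J_rotate ..
    then show "norm \<gamma> \<le> ?h / \<bar>J\<bar>" using side J0 by (simp add: divide_right_mono)
  qed
  define E where "E = dist a b * S^2"
  have E: "(LINT t|lborel. (g t)^2) = E" using g(2) by (simp add: E_def S_def)
  have E0: "0 \<le> E" by (simp add: E_def)
  have Eh: "E \<le> ?h * S^2" unfolding E_def using side by (intro mult_right_mono) auto
  note B = cone_ext_bounds[OF g(1) K, unfolded E]
  have wn: "L2_norm D ?w \<le> ?h * (sqrt ?h * S)"
  proof (rule power2_le_imp_le)
    have "(L2_norm D ?w)^2 \<le> \<bar>J\<bar> * E" by (rule B(2))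
    also have "... \<le> (?h * ?h) * (?h * S^2)" by (rule mult_mono[OF Jh Eh]) (use E0 h0 in auto)
    also have "... = (?h * (sqrt ?h * S))^2" using h0 by (simp add: power_mult_distrib power2_eq_square[of ?h])
    finally show "(L2_norm D ?w)^2 \<le> (?h * (sqrt ?h * S))^2" .
  qed (use h0 S0 in simp)
  have Wn: "L2_norm D ?W \<le> sqrt (10 / \<kappa>) * (sqrt ?h * S)"
  proof (rule power2_le_imp_le)
    have "(L2_norm D ?W)^2 \<le> 10 * \<bar>J\<bar> * (?h / \<bar>J\<bar>)^2 * E" by (rule B(4))
    also have "... = 10 * (?h^2 / \<bar>J\<bar>) * E" using J0 by (simp add: power2_eq_square field_simps)
    also have "... \<le> 10 * (1 / \<kappa>) * (?h * S^2)"
    proof -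
      have "?h^2 / \<bar>J\<bar> \<le> 1 / \<kappa>" using shape J0 by (simp add: field_simps)
      then show ?thesis by (intro mult_mono Eh mult_left_mono) (use E0 shape in auto)
    qed
    also have "... = (sqrt (10 / \<kappa>) * (sqrt ?h * S))^2" using h0 shape by (simp add: power_mult_distrib)
    finally show "(L2_norm D ?W)^2 \<le> (sqrt (10 / \<kappa>) * (sqrt ?h * S))^2" .
  qed (use h0 S0 shape in simp)
  have tr: "?w x = \<Phi> x - v x" if x: "x \<in> frontier D" for x
  proof (cases "x \<in> closed_segment a b")
    case True
    have "?w x = \<phi> x" by (rule cone_ext_boundary(1)[OF z' True])
    then show ?thesis unfolding \<phi>_def[of x] .
  next
    case False
    then show ?thesis using cone_ext_boundary(2)[OF z' x False] z(1)[OF x False] by simp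
  qed
  have "H1_norm D (%x. u x - v x) \<le> 2 * (1 + ?h) * L2_norm D ?W + L2_norm D ?w"
    by (rule energy_comparison[OF u aff cone_ext_H1_pair[OF g(1)] cone_ext_continuous[OF g(1)] tr])
  also have "... \<le> 2 * (1 + ?h) * (sqrt (10 / \<kappa>) * (sqrt ?h * S)) + ?h * (sqrt ?h * S)"
    using h0 by (intro add_mono wn mult_left_mono Wn) auto
  finally show ?thesis unfolding S_def \<phi>_def[abs_def] by (simp add: algebra_simps)
qed

end

section \<open>Shape regularity\<close>

lemma cr_angle:
  assumes uv: "u \<noteq> 0" "v \<noteq> 0" "0 \<le> u \<bullet> v" and t: "0 \<le> t" "t \<le> arccos ((u \<bullet> v) / (norm u * norm v))" "t \<le> pi / 2"
  shows "norm u * norm v * sin t \<le> \<bar>cr u v\<bar>"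
proof (rule power2_le_imp_le)
  let ?n = "norm u * norm v"
  have n: "0 < ?n" using uv(1,2) by simp
  define y where "y = (u \<bullet> v) / ?n"
  have y: "0 \<le> y" "y \<le> 1" "u \<bullet> v = ?n * y"
    using uv n norm_cauchy_schwarz[of u v] by (simp_all add: y_def)
  have "cos (arccos y) \<le> cos t"
  proof (rule cos_monotone_0_pi_le)
    show "0 \<le> t" by (rule t(1))
    show "t \<le> arccos y" using t(2) unfolding y_def .
    show "arccos y \<le> pi" using y by (intro arccos_ubound) auto
  qed
  then have "y \<le> cos t" using y by (simp add: cos_arccos)
  then have "y^2 \<le> (cos t)^2" using y by (intro power_mono) auto
  then have "(sin t)^2 \<le> 1 - y^2" using sin_cos_squared_add[of t] by linarith
  then have "?n^2 * (sin t)^2 \<le> ?n^2 * (1 - y^2)" by (rule mult_left_mono) simp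
  moreover have "(cr u v)^2 = ?n^2 * (1 - y^2)"
    using cr_Lagrange[of u v] y(3) by (simp add: power_mult_distrib algebra_simps)
  ultimately show "(?n * sin t)^2 \<le> \<bar>cr u v\<bar>^2" by (simp add: power_mult_distrib)
qed simp

text \<open>The angle at an endpoint of the longest side is acute, so the lower bound for the angle is a lower
  bound for its sine.\<close>

lemma longest_side_angle:
  assumes len: "norm (q - r) \<le> norm (q - p)" "norm (q - p) / 2 \<le> norm (r - p)" "q \<noteq> p"
    and t: "0 < \<theta>" "\<theta> \<le> angle_at p q r"
  shows "sin (min \<theta> (pi / 2)) / 2 * (norm (q - p))^2 \<le> \<bar>cr (q - p) (r - p)\<bar>"
proof -
  let ?u = "q - p" and ?v = "r - p" and ?t = "min \<theta> (pi / 2)"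
  have n: "0 < norm ?u" using len(3) by simp
  then have v: "0 < norm ?v" using len(2) by linarith
  have "(norm (q - r))^2 \<le> (norm ?u)^2" using len(1) by (rule power_mono) simp
  moreover have "(norm (q - r))^2 = (norm ?u)^2 - 2 * (?u \<bullet> ?v) + (norm ?v)^2"
    unfolding power2_norm_eq_inner by (simp add: inner_diff_left inner_diff_right inner_commute)
  ultimately have uv: "0 \<le> ?u \<bullet> ?v" using zero_le_power2[of "norm ?v"] by linarith
  have s: "norm ?u * norm ?v * sin ?t \<le> \<bar>cr ?u ?v\<bar>"
  proof (rule cr_angle)
    show "?t \<le> arccos (?u \<bullet> ?v / (norm ?u * norm ?v))" using t(2) unfolding angle_at_def by linarith
  qed (use n v uv t in auto)
  have sp: "0 \<le> sin ?t" using t(1) pi_gt_zero by (intro sin_ge_zero) linarith+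
  have "sin ?t * (norm ?u * (norm ?u / 2)) \<le> sin ?t * (norm ?u * norm ?v)"
    using len sp by (intro mult_left_mono) auto
  then show ?thesis using s by (simp add: power2_eq_square algebra_simps)
qed

context triangle
begin

text \<open>The diameter is the length of the longest side. At one of its endpoints the second side is at least
  half as long, and the angle there is used.\<close>

lemma shape_regular:
  assumes t: "0 < \<theta>" and ang: "!!p q r. T = convex hull {p, q, r} ==> \<theta> \<le> angle_at p q r"
  shows "sin (min \<theta> (pi / 2)) / 2 * (diameter T)^2 \<le> \<bar>J\<bar>"
proof -
  let ?h = "diameter T"
  have Tne: "T \<noteq> {}" using vertex_in_T by blast
  obtain x y where xy: "x \<in> T" "y \<in> T" "dist x y = ?h"
    using diameter_compact_attained[OF T_compact Tne] by blast
  have fin: "finite {a, b, c}" by simp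
  obtain q p where qp: "q \<in> {a, b, c}" "p \<in> {a, b, c}" "norm (x - y) \<le> norm (q - p)"
    using simplex_extremal_le_exists[OF fin] xy(1,2) unfolding T_def by blast
  have vT: "z \<in> T" if "z \<in> {a, b, c}" for z using that vertex_in_T by auto
  have le: "norm (z - z') \<le> ?h" if "z \<in> {a, b, c}" "z' \<in> {a, b, c}" for z z'
    using diameter_T[OF vT[OF that(1)] vT[OF that(2)]] by (simp add: dist_norm)
  have h: "norm (q - p) = ?h" using qp xy(3) le[OF qp(1,2)] by (simp add: dist_norm)
  have "q \<noteq> p" using h diameter_positive by auto
  obtain r where r: "r \<in> {a, b, c}" "r \<noteq> q" "r \<noteq> p"
    using qp \<open>q \<noteq> p\<close> vertices_distinct by auto
  have main: "sin (min \<theta> (pi / 2)) / 2 * ?h^2 \<le> \<bar>J\<bar>"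
    if P: "p \<in> {a, b, c}" "q \<in> {a, b, c}" "r \<in> {a, b, c}" "q \<noteq> p" "r \<noteq> q" "r \<noteq> p"
      and hh: "norm (q - p) = ?h" "?h / 2 \<le> norm (r - p)" for p q r
  proof -
    have J6: "cr (b - a) (c - a) = J" "cr (c - b) (a - b) = J" "cr (a - c) (b - c) = J"
      "cr (c - a) (b - a) = - J" "cr (a - b) (c - b) = - J" "cr (b - c) (a - c) = - J"
      using J_rotate unfolding J_def cr_def by (simp_all add: algebra_simps)
    have S: "T = convex hull {p, q, r}" unfolding T_def
      by (rule arg_cong[where f = "%S. convex hull S"]) (use P in auto)
    have "\<bar>cr (q - p) (r - p)\<bar> = \<bar>J\<bar>" using P J6 by (elim insertE emptyE) auto
    moreover have "sin (min \<theta> (pi / 2)) / 2 * (norm (q - p))^2 \<le> \<bar>cr (q - p) (r - p)\<bar>"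
      by (rule longest_side_angle[OF _ _ P(4) t ang[OF S]]) (use le[OF P(2,3)] hh in auto)
    ultimately show ?thesis using hh by simp
  qed
  show ?thesis
  proof (cases "?h / 2 \<le> norm (r - p)")
    case True
    then show ?thesis by (rule main[OF qp(2,1) r(1) \<open>q \<noteq> p\<close> r(2,3) h])
  next
    case False
    have "norm (p - q) \<le> norm (r - q) + norm (r - p)"
      using norm_triangle_ineq4[of "r - q" "r - p"] by simp
    then have "?h / 2 \<le> norm (r - q)" using False h by (simp add: norm_minus_commute)
    then show ?thesis
      by (intro main[OF qp(1,2) r(1) _ r(3,2)]) (use \<open>q \<noteq> p\<close> h in "auto simp: norm_minus_commute")
  qed
qed

end

section \<open>Triangles of a mesh\<close>

lemma cr_collinear: "cr (p - r) (q - r) = 0 \<longleftrightarrow> collinear {p, r, q}"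
proof -
  let ?u = "p - r" and ?v = "q - r"
  have "cr ?u ?v = 0 \<longleftrightarrow> (cr ?u ?v)^2 = 0" by simp
  also have "... \<longleftrightarrow> (?u \<bullet> ?v)^2 = (norm ?u * norm ?v)^2"
    using cr_Lagrange[of ?u ?v] unfolding power_mult_distrib by linarith
  also have "... \<longleftrightarrow> \<bar>?u \<bullet> ?v\<bar> = \<bar>norm ?u * norm ?v\<bar>" by (simp only: power2_eq_iff abs_eq_iff)
  also have "... \<longleftrightarrow> collinear {0, ?u, ?v}" using norm_cauchy_schwarz_equal[of ?u ?v] by simp
  also have "... \<longleftrightarrow> collinear {p, r, q}"
    by (rule collinear_3[unfolded NO_MATCH_def, OF TrueI, symmetric])
  finally show ?thesis .
qed

lemma triangle_iff:
  "triangle p q r \<longleftrightarrow> \<not> affine_dependent {p, q, r} \<and> card {p, q, r} = 3"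
proof -
  have c3: "card {p, q, r} = 3 \<longleftrightarrow> p \<noteq> q \<and> p \<noteq> r \<and> q \<noteq> r"
    by (auto simp: card_insert_if)
  have "{p, r, q} = {p, q, r}" by auto
  then have "triangle p q r \<longleftrightarrow> \<not> collinear {p, q, r}"
    using cr_collinear[of p r q] by (simp add: triangle_def)
  then show ?thesis unfolding c3 collinear_3_eq_affine_dependent by auto
qed

text \<open>The endpoints of an edge are vertices.\<close>

lemma triangle_of_simplex_edge:
  assumes T: "2 simplex T" and e: "closed_segment p q edge_of T"
  obtains r where "triangle p q r" "T = convex hull {p, q, r}"
proof -
  obtain C where C: "\<not> affine_dependent C" "int (card C) = 2 + 1" "T = convex hull C"
    using T unfolding simplex_def by blast
  have fC: "finite C" by (rule aff_independent_finite[OF C(1)])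
  have "closed_segment p q face_of convex hull C" "aff_dim (closed_segment p q) = 1"
    using e C(3) by (simp_all add: edge_of_def)
  then obtain C' where C': "C' \<subseteq> C" "closed_segment p q = convex hull C'"
    using face_of_convex_hull_affine_independent[OF C(1)] by blast
  have i': "\<not> affine_dependent C'" by (rule affine_independent_subset[OF C(1) C'(1)])
  have "aff_dim C' = 1" using \<open>aff_dim (closed_segment p q) = 1\<close> C'(2) by (simp add: aff_dim_convex_hull)
  then have "card C' = 2" using aff_dim_affine_independent[OF i'] by simp
  then obtain x y where xy: "C' = {x, y}" "x \<noteq> y" by (auto simp: card_2_iff)
  then have "closed_segment p q = closed_segment x y" using C'(2) by (simp add: segment_convex_hull)
  then have pq: "C' = {p, q}" using xy by simp
  have "card (C - C') = 1" using C(2) \<open>card C' = 2\<close> card_Diff_subset[OF finite_subset[OF C'(1) fC] C'(1)] by simp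
  then obtain r where r: "C - C' = {r}" by (auto simp: card_1_singleton_iff)
  then have "C = {p, q, r}" using C'(1) pq by blast
  then show ?thesis using C that[of r] by (simp add: triangle_iff)
qed

context triangle
begin

lemma affine_independent: "\<not> affine_dependent {a, b, c}" and card_vertices: "card {a, b, c} = 3"
  using triangle_iff[of a b c] triangle_axioms by auto

lemma simplex_T: "2 simplex T"
  unfolding simplex_def T_def using affine_independent card_vertices by (intro exI[of _ "{a, b, c}"]) simp

lemma edge_T: "closed_segment a b edge_of T"
  unfolding edge_of_def T_def
proof
  show "closed_segment a b face_of convex hull {a, b, c}"
    unfolding face_of_convex_hull_affine_independent[OF affine_independent] segment_convex_hull
    by (intro exI[of _ "{a, b}"]) auto
  show "aff_dim (closed_segment a b) = 1"
    using vertices_distinct by (simp add: segment_convex_hull aff_dim_convex_hull)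
qed

lemma extreme_T: "x extreme_point_of T \<longleftrightarrow> x \<in> {a, b, c}"
  unfolding T_def by (rule extreme_point_of_convex_hull_affine_independent[OF affine_independent])

lemma on_edge:
  assumes "x \<in> T" "bary a b c x = 0" shows "x \<in> closed_segment a b"
proof -
  have nn: "0 \<le> bary b c a x" "0 \<le> bary c a b x" using assms(1) by (auto simp: mem_T)
  have s: "bary b c a x = 1 - bary c a b x" using bary_sum[of x] assms(2) by simp
  have "x = (1 - bary c a b x) *\<^sub>R a + bary c a b x *\<^sub>R b" using bary_representation[of x] assms(2) s by simp
  then show ?thesis using nn s unfolding in_segment by (intro exI[of _ "bary c a b x"]) auto
qed

lemma open_edge_bary:
  assumes "x \<in> open_segment a b"
  shows "0 < bary b c a x" "0 < bary c a b x"
proof -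
  obtain t where t: "0 < t" "t < 1" "x = (1 - t) *\<^sub>R a + t *\<^sub>R b" using assms by (auto simp: in_segment)
  then have "x = cone (1, t)" by (simp add: cone_1)
  then show "0 < bary b c a x" "0 < bary c a b x" using t by (simp_all add: bary_cone)
qed

text \<open>Near a relative interior point of the edge the constraints from the other two edges are inactive.\<close>

lemma half_neighbourhood:
  assumes x: "x \<in> open_segment a b"
  obtains r where "r > 0" "!!y. dist y x < r ==> y \<in> T \<longleftrightarrow> 0 \<le> bary a b c y"
proof -
  have o: "open ({y. 0 < bary b c a y} \<inter> {y. 0 < bary c a b y})"
    by (intro open_Int open_Collect_less continuous_on_const continuous_bary)
  have "x \<in> {y. 0 < bary b c a y} \<inter> {y. 0 < bary c a b y}" using open_edge_bary[OF x] by simp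
  then obtain r where r: "r > 0" "!!y. dist y x < r ==> y \<in> {y. 0 < bary b c a y} \<inter> {y. 0 < bary c a b y}"
    using o unfolding open_dist by blast
  show ?thesis
  proof (rule that[OF r(1)])
    fix y assume "dist y x < r"
    then have "0 < bary b c a y" "0 < bary c a b y" using r(2)[of y] by auto
    then show "y \<in> T \<longleftrightarrow> 0 \<le> bary a b c y" by (simp add: mem_T)
  qed
qed

text \<open>If both triangles were on the same side of the edge, they would share interior points close to
  \<open>x\<close>. On opposite sides they fill a neighbourhood of \<open>x\<close>.\<close>

lemma adjacent_triangles:
  assumes d: "triangle a b d" and x: "x \<in> open_segment a b"
    and disj: "T \<inter> convex hull {a, b, d} \<subseteq> closed_segment a b"
  shows "x \<in> interior (T \<union> convex hull {a, b, d})"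
proof -
  interpret d: triangle a b d by (rule d)
  have Td: "d.T = convex hull {a, b, d}" by (rule d.T_def)
  obtain r1 where r1: "r1 > 0" "!!y. dist y x < r1 ==> y \<in> T \<longleftrightarrow> 0 \<le> bary a b c y"
    by (rule half_neighbourhood[OF x]) (rule that)
  obtain r2 where r2: "r2 > 0" "!!y. dist y x < r2 ==> y \<in> d.T \<longleftrightarrow> 0 \<le> bary a b d y"
    by (rule d.half_neighbourhood[OF x]) (rule that)
  let ?p = "cr (b - a) (c - a)" and ?q = "cr (b - a) (d - a)"
  have nz: "?p \<noteq> 0" "?q \<noteq> 0" using J_nonzero d.J_nonzero J_rotate d.J_rotate by simp_all
  (* the signs of the two areas tell on which side of the edge the third vertices lie *)
  have opp: "\<not> (0 < ?p \<and> 0 < ?q \<or> ?p < 0 \<and> ?q < 0)"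
  proof
    assume s: "0 < ?p \<and> 0 < ?q \<or> ?p < 0 \<and> ?q < 0"
    have "x \<in> closed_segment a b" using x by (simp add: open_segment_def)
    then have "x \<in> closure D" using edge_in_frontier by (auto simp: frontier_def)
    then obtain y where y: "y \<in> D" "dist y x < min r1 r2"
      using r1(1) r2(1) unfolding closure_approachable by (metis min_less_iff_conj)
    have "0 < bary a b c y" using y(1) by (simp add: mem_D)
    then have "0 \<le> bary a b d y" using s unfolding bary_def by (auto simp: zero_less_divide_iff zero_le_divide_iff)
    then have "y \<in> d.T" using r2(2)[of y] y(2) by simp
    then have "y \<in> closed_segment a b" using disj y(1) D_subset Td by blast
    then have "y \<in> frontier D" using edge_in_frontier by blast
    then show False using y(1) by (simp add: frontier_D)
  qed
  have "ball x (min r1 r2) \<subseteq> T \<union> d.T"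
  proof
    fix y assume "y \<in> ball x (min r1 r2)"
    then have y: "dist y x < r1" "dist y x < r2" by (auto simp: dist_commute)
    have "0 \<le> bary a b c y \<or> 0 \<le> bary a b d y"
      using opp nz unfolding bary_def zero_le_divide_iff by linarith
    then show "y \<in> T \<union> d.T" using r1(2)[OF y(1)] r2(2)[OF y(2)] by blast
  qed
  moreover have "x \<in> ball x (min r1 r2)" using r1(1) r2(1) by simp
  ultimately show ?thesis unfolding Td by (intro interiorI[OF open_ball])
qed

lemma neighbour_intersection:
  assumes T': "2 simplex T'" "T' \<noteq> T" "T \<inter> T' face_of T" "T \<inter> T' face_of T'" "a \<in> T'" "b \<in> T'"
  shows "T \<inter> T' = closed_segment a b"
proof -
  obtain C where C: "C \<subseteq> {a, b, c}" "T \<inter> T' = convex hull C"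
    using T'(3) unfolding T_def face_of_convex_hull_affine_independent[OF affine_independent] by blast
  have "a extreme_point_of (T \<inter> T')" "b extreme_point_of (T \<inter> T')"
    using extreme_point_of_face[OF T'(3)] extreme_T T'(5,6) vertex_in_T by auto
  then have ab: "{a, b} \<subseteq> C" unfolding C(2) using extreme_point_of_convex_hull by blast
  have "c \<notin> C"
  proof
    assume "c \<in> C"
    then have "C = {a, b, c}" using C(1) ab by blast
    then have TT: "T \<inter> T' = T" using C(2) by (simp add: T_def)
    have cv: "convex T'" using T'(1) convex_convex_hull by (auto simp: simplex_def)
    have "aff_dim T < aff_dim T'"
      by (rule face_of_aff_dim_lt[OF cv]) (use T'(2,4) TT in auto)
    then show False using aff_dim_simplex[OF T'(1)] aff_dim_simplex[OF simplex_T] by simp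
  qed
  then have "C = {a, b}" using C(1) ab by blast
  then show ?thesis using C(2) by (simp add: segment_convex_hull)
qed

text \<open>If \<open>T\<close> were the only triangle on the edge, all points of the edge would be boundary
  points of the domain. So there is an adjacent triangle, and \<open>x\<close> is interior to the
  closure of the domain, which has no slits.\<close>

lemma interior_edge:
  assumes tri: "triangulation \<T>" "!!T'. T' \<in> \<T> ==> 2 simplex T'" "\<Union>\<T> = closure \<Omega>"
    and Om: "open \<Omega>" "interior (closure \<Omega>) = \<Omega>" and T: "T \<in> \<T>"
    and nb: "\<not> closed_segment a b \<subseteq> frontier \<Omega>" and x: "x \<in> open_segment a b"
  shows "x \<notin> frontier \<Omega>"
proof -
  have face: "T1 \<inter> T2 face_of T1" if "T1 \<in> \<T>" "T2 \<in> \<T>" for T1 T2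
    using tri(1) that unfolding triangulation_def by blast
  have fo: "frontier \<Omega> = closure \<Omega> - \<Omega>" using Om by (simp add: frontier_def interior_open)
  have "\<exists>T'\<in>\<T>. T' \<noteq> T \<and> a \<in> T' \<and> b \<in> T'"
  proof (rule ccontr)
    assume n: "\<not> (\<exists>T'\<in>\<T>. T' \<noteq> T \<and> a \<in> T' \<and> b \<in> T')"
    have "y \<in> frontier \<Omega>" if y: "y \<in> open_segment a b" for y
    proof (rule ccontr)
      assume "y \<notin> frontier \<Omega>"
      have yf: "y \<in> frontier D" using y edge_in_frontier by (auto simp: open_segment_def)
      then have yT: "y \<in> T" using frontier_subset_T by blast
      then have yO: "y \<in> \<Omega>" using \<open>y \<notin> frontier \<Omega>\<close> T tri(3) fo by blast
      have yn: "y \<notin> T'" if T': "T' \<in> \<T> - {T}" for T'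
      proof
        assume "y \<in> T'"
        have "T \<inter> T' face_of T" using face T T' by blast
        then have "a \<in> T \<inter> T' \<and> b \<in> T \<inter> T'"
          using yT \<open>y \<in> T'\<close> y vertex_in_T unfolding face_of_def by blast
        then show False using n T' by blast
      qed
      have cl: "closed (\<Union>(\<T> - {T}))"
      proof (rule closed_Union)
        show "finite (\<T> - {T})" using tri(1) by (simp add: triangulation_def)
        show "\<forall>T'\<in>\<T> - {T}. closed T'"
        proof
          fix T' assume "T' \<in> \<T> - {T}"
          then obtain C where "\<not> affine_dependent C" "T' = convex hull C" using tri(2) unfolding simplex_def by blast
          then show "closed T'"
            using compact_imp_closed[OF finite_imp_compact_convex_hull] aff_independent_finite by blast
        qed
      qed
      have "\<Omega> - \<Union>(\<T> - {T}) \<subseteq> T"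
        using tri(3) closure_subset[of \<Omega>] by blast
      then have "y \<in> interior T"
        by (intro interiorI[OF open_Diff[OF Om(1) cl]]) (use yO yn in auto)
      then show False using yf frontier_D D_def by blast
    qed
    then have "open_segment a b \<subseteq> frontier \<Omega>" by blast
    then have "closure (open_segment a b) \<subseteq> frontier \<Omega>" by (rule closure_minimal) simp
    then show False using nb vertices_distinct by simp
  qed
  then obtain T' where T': "T' \<in> \<T>" "T' \<noteq> T" "a \<in> T'" "b \<in> T'" by blast
  have f: "T \<inter> T' face_of T" "T \<inter> T' face_of T'"
    using face[OF T T'(1)] face[OF T'(1) T] by (simp_all add: Int_commute)
  have I: "T \<inter> T' = closed_segment a b" by (rule neighbour_intersection[OF tri(2)[OF T'(1)] T'(2) f T'(3,4)])
  have "closed_segment a b edge_of T'"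
    using f(2) edge_T unfolding I edge_of_def by blast
  then obtain d where d: "triangle a b d" "T' = convex hull {a, b, d}"
    by (rule triangle_of_simplex_edge[OF tri(2)[OF T'(1)]])
  have "x \<in> interior (T \<union> T')"
    unfolding d(2) by (rule adjacent_triangles[OF d(1) x]) (use I d(2) in simp)
  moreover have "T \<union> T' \<subseteq> closure \<Omega>" using T T'(1) tri(3) by blast
  ultimately have "x \<in> interior (closure \<Omega>)" using interior_mono by blast
  then show ?thesis using Om(2) fo by simp
qed

end

lemma (in triangle) frontier_edges:
  assumes "x \<in> frontier D"
  shows "x \<in> closed_segment a b \<or> x \<in> closed_segment b c \<or> x \<in> closed_segment c a"
proof -
  interpret r1: triangle b c a by (rule rotate)
  interpret r2: triangle c a b by (rule r1.rotate)
  have T: "r1.T = T" "r2.T = T" using T_rotate r1.T_rotate by simp_all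
  have "x \<in> T" "bary a b c x = 0 \<or> bary b c a x = 0 \<or> bary c a b x = 0"
    using assms by (force simp: frontier_D mem_T mem_D)+
  then show ?thesis using on_edge r1.on_edge r2.on_edge unfolding T by blast
qed

section \<open>The discrete boundary values\<close>

lemma H1_segment_pair:
  assumes "H1_segment p q v"
  obtains G where "H1_pair {0<..<dist p q} (v \<circ> arclength_param p q) G" "H1_segment_seminorm p q v = L2_norm {0<..<dist p q} G"
proof -
  let ?I = "{0<..<dist p q}"
  have P: "H1_pair ?I (v \<circ> arclength_param p q) (weak_gradient ?I (v \<circ> arclength_param p q))"
    by (rule H1_imp_pair) (use assms in "simp_all add: H1_segment_def")
  have "H1_segment_seminorm p q v = L2_norm ?I (weak_gradient ?I (v \<circ> arclength_param p q))"
    unfolding H1_segment_seminorm_def H1_seminorm_def L2_norm_def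
    by (subst dirichlet_form_eq[OF _ P P]) simp_all
  with P show ?thesis by (rule that)
qed

lemma H1_segment_cong:
  assumes pq: "p \<noteq> q" and e: "!!x. x \<in> closed_segment p q ==> v x = w x" and v: "H1_segment p q v"
  shows "H1_segment p q w" "H1_segment_seminorm p q w = H1_segment_seminorm p q v"
proof -
  let ?I = "{0<..<dist p q}"
  obtain G where G: "H1_pair ?I (v \<circ> arclength_param p q) G" "H1_segment_seminorm p q v = L2_norm ?I G"
    by (rule H1_segment_pair[OF v]) (rule that)
  have W: "H1_pair ?I (w \<circ> arclength_param p q) G"
  proof (rule H1_pair_cong[OF _ _ _ G(1)])
    fix s assume "s \<in> ?I"
    then show "(v \<circ> arclength_param p q) s = (w \<circ> arclength_param p q) s"
      using e[OF arclength_param_segment[OF pq, of s]] by simp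
  qed simp_all
  then show "H1_segment p q w" unfolding H1_segment_def by (rule H1_pair_imp_H1)
  show "H1_segment_seminorm p q w = H1_segment_seminorm p q v"
    unfolding G(2) unfolding H1_segment_seminorm_def H1_seminorm_def L2_norm_def
    by (subst dirichlet_form_eq[OF _ W W]) simp_all
qed

lemma H1_segment_diff_affine:
  assumes g: "H1_segment p q g" and v: "affine_fun_on (closed_segment p q) v" and pq: "p \<noteq> q"
  shows "H1_segment p q (%x. g x - v x)"
proof -
  let ?I = "{0<..<dist p q}"
  obtain G where G: "H1_pair ?I (g \<circ> arclength_param p q) G"
    by (rule H1_segment_pair[OF g]) (rule that)
  obtain m k where mk: "!!x. x \<in> closed_segment p q ==> v x = m \<bullet> x + k"
    using v unfolding affine_fun_on_def by blast
  define l where "l s = s \<bullet> ((m \<bullet> (q - p)) / dist p q) + (m \<bullet> p + k)" for s :: real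
  have "smooth l" unfolding l_def[abs_def] by (rule smooth_intros(3)[OF smooth_intros(2) smooth_intros(1)])
  then have L: "H1_pair ?I l (grad l)" by (intro H1_pair_smooth) simp_all
  have "H1_pair ?I (%s. (g \<circ> arclength_param p q) s - l s) (%s. G s - grad l s)"
    by (rule H1_pair_diff[OF _ G L]) simp
  then have "H1_pair ?I ((%x. g x - v x) \<circ> arclength_param p q) (%s. G s - grad l s)"
  proof (rule H1_pair_cong[rotated 3])
    fix s assume "s \<in> ?I"
    then have "v (arclength_param p q s) = m \<bullet> arclength_param p q s + k"
      by (intro mk arclength_param_segment[OF pq]) auto
    also have "... = l s" by (simp add: arclength_param_def l_def inner_add_right)
    finally show "(g \<circ> arclength_param p q) s - l s = ((%x. g x - v x) \<circ> arclength_param p q) s" by simp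
  qed simp_all
  then show ?thesis unfolding H1_segment_def by (rule H1_pair_imp_H1)
qed

lemma (in triangle) discrete_boundary_values:
  assumes mesh: "admissible_mesh \<Omega> \<theta> \<T>" and Om: "open \<Omega>" "interior (closure \<Omega>) = \<Omega>"
    and g: "continuous_on (frontier \<Omega>) g" and gh: "nodal_boundary_interpolant \<Omega> \<T> g g\<^sub>h"
    and v: "v \<in> fe_space \<Omega> \<T>" "\<forall>x\<in>frontier \<Omega>. v x = g\<^sub>h x"
    and T: "T \<in> \<T>" and e: "closed_segment a b \<in> boundary_edges \<Omega> \<T>"
  shows "!!x. x \<in> frontier D ==> x \<notin> closed_segment a b ==> u_star \<Omega> g v x = v x"
    "u_star \<Omega> g v a = v a" "u_star \<Omega> g v b = v b"
    "!!x. x \<in> closed_segment a b ==> u_star \<Omega> g v x - v x = g x - g\<^sub>h x"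
    "continuous_on (frontier D) (u_star \<Omega> g v)"
proof -
  have eO: "closed_segment a b \<subseteq> frontier \<Omega>" using e by (simp add: boundary_edges_def)
  have vert: "u_star \<Omega> g v z = v z" if "z \<in> {a, b, c}" for z
  proof (cases "z \<in> frontier \<Omega>")
    case True
    have "z \<in> vertices \<T>" using that T extreme_T unfolding vertices_def by blast
    then have "g\<^sub>h z = g z" using gh True unfolding nodal_boundary_interpolant_def by blast
    then show ?thesis using v(2) True by (simp add: u_star_def)
  qed (simp add: u_star_def)
  show "u_star \<Omega> g v a = v a" "u_star \<Omega> g v b = v b" by (simp_all add: vert)
  interpret r1: triangle b c a by (rule rotate)
  interpret r2: triangle c a b by (rule r1.rotate)
  have Tr: "r1.T = T" "r2.T = T" using T_rotate r1.T_rotate by simp_all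
  have tri: "triangulation \<T>" "!!T'. T' \<in> \<T> ==> 2 simplex T'" "\<Union>\<T> = closure \<Omega>"
    using mesh by (auto simp: admissible_mesh_def)
  have one: "closed_segment a b = e'" if "e' \<in> boundary_edges \<Omega> \<T>" "e' edge_of T" for e'
    using mesh T e edge_T that unfolding admissible_mesh_def by blast
  have nb: "\<not> closed_segment b c \<subseteq> frontier \<Omega>" "\<not> closed_segment c a \<subseteq> frontier \<Omega>"
  proof -
    show "\<not> closed_segment b c \<subseteq> frontier \<Omega>"
    proof
      assume "closed_segment b c \<subseteq> frontier \<Omega>"
      then have "closed_segment b c \<in> boundary_edges \<Omega> \<T>"
        using r1.edge_T T unfolding Tr boundary_edges_def by blast
      from one[OF this r1.edge_T[unfolded Tr]] show False using vertices_distinct by (auto simp: doubleton_eq_iff)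
    qed
    show "\<not> closed_segment c a \<subseteq> frontier \<Omega>"
    proof
      assume "closed_segment c a \<subseteq> frontier \<Omega>"
      then have "closed_segment c a \<in> boundary_edges \<Omega> \<T>"
        using r2.edge_T T unfolding Tr boundary_edges_def by blast
      from one[OF this r2.edge_T[unfolded Tr]] show False using vertices_distinct by (auto simp: doubleton_eq_iff)
    qed
  qed
  have in1: "x \<notin> frontier \<Omega>" if "x \<in> open_segment b c" for x
    by (rule r1.interior_edge[OF tri Om T[folded Tr(1)] nb(1) that])
  have in2: "x \<notin> frontier \<Omega>" if "x \<in> open_segment c a" for x
    by (rule r2.interior_edge[OF tri Om T[folded Tr(2)] nb(2) that])
  have e1: "u_star \<Omega> g v x = v x" if "x \<in> closed_segment b c" for x
    using that in1[of x] vert[of x] unfolding closed_segment_eq_open by (auto simp: u_star_def)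
  have e2: "u_star \<Omega> g v x = v x" if "x \<in> closed_segment c a" for x
    using that in2[of x] vert[of x] unfolding closed_segment_eq_open by (auto simp: u_star_def)
  show "u_star \<Omega> g v x = v x" if "x \<in> frontier D" "x \<notin> closed_segment a b" for x
    using frontier_edges[OF that(1)] that(2) e1 e2 by blast
  show "u_star \<Omega> g v x - v x = g x - g\<^sub>h x" if "x \<in> closed_segment a b" for x
    using that eO v(2) by (auto simp: u_star_def)
  obtain p k where pk: "!!x. x \<in> T ==> v x = p \<bullet> x + k"
    using v(1) T unfolding fe_space_def affine_fun_on_def by blast
  have vc: "continuous_on T v"
    using continuous_on_cong[of T T v "%x. p \<bullet> x + k"] pk by (simp add: continuous_intros)
  have sT: "closed_segment a b \<subseteq> T" "closed_segment b c \<subseteq> T" "closed_segment c a \<subseteq> T"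
    using edges_in_frontier frontier_subset_T by blast+
  have c0: "continuous_on (closed_segment a b) (u_star \<Omega> g v)"
  proof (rule continuous_on_eq[OF continuous_on_subset[OF g eO]])
    show "g x = u_star \<Omega> g v x" if "x \<in> closed_segment a b" for x
      using that eO by (auto simp: u_star_def)
  qed
  have c1: "continuous_on (closed_segment b c) (u_star \<Omega> g v)"
    by (rule continuous_on_eq[OF continuous_on_subset[OF vc sT(2)]]) (simp add: e1)
  have c2: "continuous_on (closed_segment c a) (u_star \<Omega> g v)"
    by (rule continuous_on_eq[OF continuous_on_subset[OF vc sT(3)]]) (simp add: e2)
  have "continuous_on (closed_segment a b \<union> (closed_segment b c \<union> closed_segment c a)) (u_star \<Omega> g v)"
    by (intro continuous_on_closed_Un closed_Un closed_segment c0 c1 c2)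
  then show "continuous_on (frontier D) (u_star \<Omega> g v)"
    by (rule continuous_on_subset) (use frontier_edges in blast)
qed

theorem proposition3p1:
  fixes \<Omega> :: "plane set" and \<theta> :: real
  assumes "polygonal_domain \<Omega>" and "\<theta> > 0"
  shows "\<exists>C>0. \<forall>\<T> f g \<psi> g\<^sub>h u\<^sub>h T e a b u\<^sub>t.
    admissible_mesh \<Omega> \<theta> \<T> \<and>
    L2_on \<Omega> f \<and>
    continuous_on (frontier \<Omega>) g \<and> (\<exists>G. has_trace \<Omega> G g) \<and>
    continuous_on (closure \<Omega>) \<psi> \<and> H1 \<Omega> \<psi> \<and> (\<forall>x\<in>frontier \<Omega>. \<psi> x \<le> g x) \<and>
    nodal_boundary_interpolant \<Omega> \<T> g g\<^sub>h \<and>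
    discrete_solution \<Omega> \<T> f \<psi> g\<^sub>h u\<^sub>h \<and>
    T \<in> boundary_triangles \<Omega> \<T> \<and>
    e \<in> boundary_edges \<Omega> \<T> \<and> e edge_of T \<and> e = closed_segment a b \<and>
    harmonic_extension (interior T) (u_star \<Omega> g u\<^sub>h) u\<^sub>t \<and>
    H1_segment a b g
    \<longrightarrow>
    H1_norm (interior T) (\<lambda>x. u\<^sub>t x - u\<^sub>h x)
      \<le> C * sqrt (diameter T) * H1_segment_seminorm a b (\<lambda>x. g x - g\<^sub>h x) \<and>
    (\<exists>U. continuous_on T U \<and> (AE x in lebesgue_on T. U x = u\<^sub>t x) \<and>
       (\<forall>x\<in>frontier T. U x = u_star \<Omega> g u\<^sub>h x) \<and>
       (\<exists>m. has_min_on T U m \<and> has_min_on (frontier T) (u_star \<Omega> g u\<^sub>h) m))"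
proof -
  have Om: "open \<Omega>" "interior (closure \<Omega>) = \<Omega>" "bounded \<Omega>"
    using assms(1) by (simp_all add: polygonal_domain_def)
  define M where "M = diameter \<Omega>"
  have M: "0 \<le> M" unfolding M_def by (rule diameter_ge_0[OF Om(3)])
  (* the constant in the lower bound for the area in terms of the diameter *)
  define \<kappa> where "\<kappa> = sin (min \<theta> (pi / 2)) / 2"
  have \<kappa>: "\<kappa> > 0"
  proof -
    have "0 < sin (min \<theta> (pi / 2))"
      by (rule sin_gt_zero) (use assms(2) pi_gt_zero in "simp, linarith")
    then show ?thesis by (simp add: \<kappa>_def)
  qed
  define K where "K h = 2 * (1 + h) * sqrt (10 / \<kappa>) + h" for h
  have K_mono: "K h \<le> K M + 1" if "h \<le> M" for h
  proof -
    have "(1 + h) * sqrt (10 / \<kappa>) \<le> (1 + M) * sqrt (10 / \<kappa>)" using that \<kappa> by (intro mult_right_mono) auto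
    then show ?thesis using that unfolding K_def by linarith
  qed
  have K0: "0 < K M + 1" using M \<kappa> by (simp add: K_def add_nonneg_pos)
  show ?thesis
  proof (intro exI[of _ "K M + 1"] conjI[OF K0] allI impI, elim conjE)
    fix \<T> f g \<psi> g\<^sub>h u\<^sub>h T e a b u\<^sub>t
    assume mesh: "admissible_mesh \<Omega> \<theta> \<T>" and g: "continuous_on (frontier \<Omega>) g"
      and gh: "nodal_boundary_interpolant \<Omega> \<T> g g\<^sub>h" and uh: "discrete_solution \<Omega> \<T> f \<psi> g\<^sub>h u\<^sub>h"
      and T: "T \<in> boundary_triangles \<Omega> \<T>" and e: "e \<in> boundary_edges \<Omega> \<T>" "e edge_of T" "e = closed_segment a b"
      and ut: "harmonic_extension (interior T) (u_star \<Omega> g u\<^sub>h) u\<^sub>t" and gH: "H1_segment a b g"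
    have TT: "T \<in> \<T>" using T by (simp add: boundary_triangles_def)
    have uh': "u\<^sub>h \<in> fe_space \<Omega> \<T>" "\<forall>x\<in>frontier \<Omega>. u\<^sub>h x = g\<^sub>h x"
      using uh by (auto simp: discrete_solution_def discrete_convex_set_def)
    have "2 simplex T" using mesh TT by (simp add: admissible_mesh_def)
    then obtain c where c: "triangle a b c" "T = convex hull {a, b, c}"
      by (rule triangle_of_simplex_edge[OF _ e(2)[unfolded e(3)]])
    interpret t: triangle a b c by (rule c(1))
    have tT: "t.T = T" using c(2) by (simp add: t.T_def)
    have tD: "t.D = interior T" by (simp add: t.D_def tT)
    note bv = t.discrete_boundary_values[OF mesh Om(1,2) g gh uh' TT[folded tT] e(1)[unfolded e(3)]]
    note u = ut[folded tD]
    obtain p k where pk: "!!x. x \<in> T ==> u\<^sub>h x = p \<bullet> x + k"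
      using uh'(1) TT unfolding fe_space_def affine_fun_on_def by blast
    have ab: "a \<noteq> b" by (rule t.vertices_distinct(1))
    have seg: "closed_segment a b \<subseteq> T" using e by (auto dest: edge_of_imp_subset)
    let ?\<Phi> = "u_star \<Omega> g u\<^sub>h"
    have "affine_fun_on (closed_segment a b) g\<^sub>h"
      using gh e unfolding nodal_boundary_interpolant_def by blast
    from H1_segment_diff_affine[OF gH this ab] have d: "H1_segment a b (%x. g x - g\<^sub>h x)" .
    have cong: "H1_segment a b (%x. ?\<Phi> x - u\<^sub>h x)"
      "H1_segment_seminorm a b (%x. ?\<Phi> x - u\<^sub>h x) = H1_segment_seminorm a b (%x. g x - g\<^sub>h x)"
      by (rule H1_segment_cong[OF ab _ d], rule bv(4)[symmetric], assumption)+
    have ang: "\<theta> \<le> angle_at q r s" if "T = convex hull {q, r, s}" for q r s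
      using mesh TT that unfolding admissible_mesh_def by blast
    have shape: "\<kappa> * (diameter T)^2 \<le> \<bar>t.J\<bar>"
      using t.shape_regular[OF assms(2)] ang unfolding tT \<kappa>_def by blast
    have cont: "continuous_on (closed_segment a b) (%x. ?\<Phi> x - u\<^sub>h x)"
    proof (rule continuous_on_diff)
      show "continuous_on (closed_segment a b) ?\<Phi>"
        by (rule continuous_on_subset[OF bv(5) t.edge_in_frontier])
      show "continuous_on (closed_segment a b) u\<^sub>h"
        by (rule continuous_on_eq[of _ "%x. p \<bullet> x + k"]) (use pk seg in "auto intro!: continuous_intros")
    qed
    define S where "S = H1_segment_seminorm a b (%x. g x - g\<^sub>h x)"
    have S0: "0 \<le> S" unfolding S_def
      by (rule H1_segment_pair[OF d]) (simp add: L2_norm_nonneg)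
    have "H1_norm t.D (%x. u\<^sub>t x - u\<^sub>h x) \<le>
      (2 * (1 + diameter t.T) * sqrt (10 / \<kappa>) + diameter t.T) * sqrt (diameter t.T) * H1_segment_seminorm a b (%x. ?\<Phi> x - u\<^sub>h x)"
    proof (rule t.energy_estimate[OF u _ _ bv(2,3) cont cong(1) \<kappa> shape[folded tT]])
      show "u\<^sub>h x = p \<bullet> x + k" if "x \<in> t.T" for x using pk that by (simp add: tT)
      show "?\<Phi> x = u\<^sub>h x" if "x \<in> frontier t.D" "x \<notin> closed_segment a b" for x by (rule bv(1)[OF that])
    qed
    then have "H1_norm t.D (%x. u\<^sub>t x - u\<^sub>h x) \<le> K (diameter T) * sqrt (diameter T) * S"
      unfolding tT cong(2) K_def S_def .
    also have "... \<le> (K M + 1) * sqrt (diameter T) * S"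
    proof -
      have "\<Union>\<T> = closure \<Omega>" using mesh by (simp add: admissible_mesh_def)
      then have "T \<subseteq> closure \<Omega>" using TT by blast
      then have "diameter T \<le> diameter (closure \<Omega>)" by (rule diameter_subset[OF _ bounded_closure[OF Om(3)]])
      then have "diameter T \<le> M" unfolding M_def diameter_closure[OF Om(3)] .
      from K_mono[OF this] show ?thesis
        using S0 t.diameter_positive unfolding tT by (intro mult_right_mono) auto
    qed
    finally show "H1_norm (interior T) (%x. u\<^sub>t x - u\<^sub>h x)
      \<le> (K M + 1) * sqrt (diameter T) * H1_segment_seminorm a b (%x. g x - g\<^sub>h x) \<and>
      (\<exists>U. continuous_on T U \<and> (AE x in lebesgue_on T. U x = u\<^sub>t x) \<and>
       (\<forall>x\<in>frontier T. U x = u_star \<Omega> g u\<^sub>h x) \<and>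
       (\<exists>m. has_min_on T U m \<and> has_min_on (frontier T) (u_star \<Omega> g u\<^sub>h) m))"
      using t.minimum_principle[OF u bv(5)] unfolding tT tD S_def by blast
  qed
qed

end
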